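(* Let $\kappa\ge2$ be an integer, $\mathcal X$ a set with $|\mathcal X|=2$, $\nu=\mathsf{Unif}(\mathcal X)$, $h:\mathcal X\times\mathcal X\to\mathbb R$ symmetric, $h_{\min}=\min h$, $h_{\max}=\max h$, $c_{h,\mathrm{ref}}=\kappa\sum_{x,y\in\mathcal X}h(x,y)\nu(x)\nu(y)$, and let $c\in(\kappa h_{\min},\kappa h_{\max})$ with $c\neq c_{h,\mathrm{ref}}$. Then $U_n$ given $\mathrm{Con}_n(h,c)$ lies asymptotically in $$\mathcal G^{\mathrm{nondeg}}(c):=\bigcup_{\beta\in\mathbb R}\mathrm{TISGM}_{T^\kappa}^{\exp(\beta h),\nu}\ \cap\ \big\{\rho\in\mathcal P(\mathcal T^\kappa_*[\mathcal X]):\ \kappa\,\mathbb E_{\pi_{\rho_1}}[h(X_o,X_1)]=c\big\};$$ that is, for every open set $\mathcal O\subset\mathcal P(\mathcal G_*[\mathcal X])$ containing $\mathcal G^{\mathrm{nondeg}}(c)$, $$\lim_{\delta\downarrow0}\limsup_{n\to\infty}\frac1n\log\mathbb P\big(U_n\notin\mathcal O\mid\mathrm{Con}_n(h,c_\delta)\big)<0 .$$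
   Context: Graph model. For each $n$ (with $n\kappa$ even), $G_n$ is uniform on the set of $\kappa$-regular graphs on $\{1,\dots,n\}$, and $X^n=(X_v)_{v\in G_n}$ are i.i.d. with law $\nu$, independent of $G_n$. $\mathcal G_*[\mathcal X]$ is the Polish space of (isomorphism classes of) connected locally finite rooted graphs with $\mathcal X$-valued vertex marks, with the local topology; $\mathcal P(\cdot)$ denotes probability measures with the weak topology. $U_n=\frac1n\sum_{v\in G_n}\delta_{\mathsf C_v(G_n,X^n)}\in\mathcal P(\mathcal G_*[\mathcal X])$, where $\mathsf C_v(G_n,X^n)$ is the marked connected component of $v$, rooted at $v$. Rare events. Let $M_n^h=\frac1n\sum_{v\in G_n}\sum_{u\sim v}h(X_v,X_u)$, which converges in probability to $c_{h,\mathrm{ref}}$. For $c\ne c_{h,\mathrm{ref}}$: $\mathrm{Con}_n(h,c)=\{M^h_n\ge c\}$ and $c_\delta=c+\delta$ if $c>c_{h,\mathrm{ref}}$; $\mathrm{Con}_n(h,c)=\{M^h_n\le c\}$ and $c_\delta=c-\delta$ if $c<c_{h,\mathrm{ref}}$. Translation-invariant splitting (TIS) Gibbs measures. $T^\kappa$ is the infinite $\kappa$-regular tree with root $o$; $T_r$ is its subtree of vertices at distance at most $r$ from $o$ ($T_0=\{o\}$). For a symmetric $\psi:\mathcal X^2\to(0,\infty)$ and $\bar\psi:\mathcal X\to(0,\infty)$, $\mathrm{TISGM}^{\psi,\bar\psi}_{T^\kappa}$ is the set of $\rho\in\mathcal P(\mathcal X^{T^\kappa})$ for which there is $\ell\in\mathcal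 P(\mathcal X)$ such that for all $r\ge1$ and $x\in\mathcal X^{T_r}$ the marginal of $\rho$ on $T_r$ is $$\rho_{T_r}(x)=\frac1{Z_{T_r}}\prod_{\{u,v\}\in E(T_r)}\psi(x_u,x_v)\prod_{v\in T_{r-1}}\bar\psi(x_v)\prod_{v\in T_r\setminus T_{r-1}}\ell(x_v).$$ Such measures are viewed as elements of $\mathcal P(\mathcal T^\kappa_*[\mathcal X])\subset\mathcal P(\mathcal G_*[\mathcal X])$, where $\mathcal T_*^\kappa[\mathcal X]$ is the set of $\mathcal X$-marked versions of the rooted tree $T^\kappa$. For $\rho\in\mathcal P(\mathcal T^\kappa_*[\mathcal X])$, $\pi_{\rho_1}\in\mathcal P(\mathcal X^2)$ is the edge marginal: the law of $(X_o,X_1)$, the marks of the root and of a uniformly chosen neighbor of the root. *)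

theory Defs
  imports "HOL-Probability.Probability"
begin

section \<open>Marked rooted graphs and the local topology\<close>

text \<open>
  Graphs are simple and undirected: an edge \<open>{u, v}\<close> is stored as both pairs \<open>(u, v)\<close> and \<open>(v, u)\<close>.
  The values of \<open>mark\<close> outside \<open>verts\<close> are irrelevant.
\<close>

record ('v, 'x) rmgraph =
  verts :: "'v set"
  edges :: "('v \<times> 'v) set"
  root :: 'v
  mark :: "'v \<Rightarrow> 'x"

definition wf_rmgraph :: "('v, 'x) rmgraph \<Rightarrow> bool" where
  "wf_rmgraph G \<longleftrightarrow>
     edges G \<subseteq> verts G \<times> verts G \<and> sym (edges G) \<and> irrefl (edges G) \<and>
     root G \<in> verts G \<and>
     (\<forall>v\<in>verts G. finite (edges G `` {v})) \<and>
     (\<forall>v\<in>verts G. (root G, v) \<in> (edges G)\<^sup>*)"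

definition rmiso :: "('v, 'x) rmgraph \<Rightarrow> ('w, 'x) rmgraph \<Rightarrow> bool" where
  "rmiso G H \<longleftrightarrow> (\<exists>\<phi>. bij_betw \<phi> (verts G) (verts H) \<and> \<phi> (root G) = root H \<and>
     (\<forall>u\<in>verts G. \<forall>v\<in>verts G. (u, v) \<in> edges G \<longleftrightarrow> (\<phi> u, \<phi> v) \<in> edges H) \<and>
     (\<forall>v\<in>verts G. mark H (\<phi> v) = mark G v))"

lemma rmiso_refl: "rmiso G G"
  unfolding rmiso_def by (rule exI[of _ id]) auto

lemma rmiso_sym: assumes "rmiso G H" "root G \<in> verts G" shows "rmiso H G"
proof -
  obtain \<phi> where p: "bij_betw \<phi> (verts G) (verts H)" "\<phi> (root G) = root H"
    "\<And>u v. u \<in> verts G \<Longrightarrow> v \<in> verts G \<Longrightarrow> (u, v) \<in> edges G \<longleftrightarrow> (\<phi> u, \<phi> v) \<in> edges H"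
    "\<And>v. v \<in> verts G \<Longrightarrow> mark H (\<phi> v) = mark G v"
    using assms(1) unfolding rmiso_def by blast
  define \<psi> where "\<psi> = inv_into (verts G) \<phi>"
  have b: "bij_betw \<psi> (verts H) (verts G)"
    unfolding \<psi>_def by (rule bij_betw_inv_into[OF p(1)])
  have i: "\<phi> (\<psi> w) = w" "\<psi> w \<in> verts G" if "w \<in> verts H" for w
    using that p(1) b unfolding \<psi>_def by (auto simp: bij_betw_inv_into_right bij_betwE)
  have r: "\<psi> (root H) = root G"
    unfolding \<psi>_def using p(1,2) assms(2) by (metis bij_betw_inv_into_left)
  show ?thesis
    unfolding rmiso_def
    by (rule exI[of _ \<psi>]) (use b i r p(3,4) in \<open>auto, metis+\<close>)
qed

lemma rmiso_trans: assumes "rmiso G H" "rmiso H K" shows "rmiso G K"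
proof -
  obtain \<phi> where p: "bij_betw \<phi> (verts G) (verts H)" "\<phi> (root G) = root H"
    "\<And>u v. u \<in> verts G \<Longrightarrow> v \<in> verts G \<Longrightarrow> (u, v) \<in> edges G \<longleftrightarrow> (\<phi> u, \<phi> v) \<in> edges H"
    "\<And>v. v \<in> verts G \<Longrightarrow> mark H (\<phi> v) = mark G v"
    using assms(1) unfolding rmiso_def by blast
  obtain \<psi> where q: "bij_betw \<psi> (verts H) (verts K)" "\<psi> (root H) = root K"
    "\<And>u v. u \<in> verts H \<Longrightarrow> v \<in> verts H \<Longrightarrow> (u, v) \<in> edges H \<longleftrightarrow> (\<psi> u, \<psi> v) \<in> edges K"
    "\<And>v. v \<in> verts H \<Longrightarrow> mark K (\<psi> v) = mark H v"
    using assms(2) unfolding rmiso_def by blast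
  have m: "\<phi> v \<in> verts H" if "v \<in> verts G" for v
    using that p(1) by (auto dest: bij_betwE)
  show ?thesis
    unfolding rmiso_def
    by (rule exI[of _ "\<psi> \<circ> \<phi>"]) (use p q m in \<open>auto intro: bij_betw_trans\<close>)
qed

text \<open>
  The space of isomorphism classes. A connected locally finite graph is countable, so every class has
  a representative whose vertex set is a set of natural numbers.
\<close>

quotient_type 'x gstar = "(nat, 'x) rmgraph" /
  partial: "\<lambda>G H. wf_rmgraph G \<and> wf_rmgraph H \<and> rmiso G H"
proof (rule part_equivpI)
  show "\<exists>G :: (nat, 'x) rmgraph. wf_rmgraph G \<and> wf_rmgraph G \<and> rmiso G G"
    by (rule exI[of _ "\<lparr>verts = {0}, edges = {}, root = 0, mark = undefined\<rparr>"])
       (auto simp: wf_rmgraph_def rmiso_refl sym_def irrefl_def)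
  show "symp (\<lambda>G H :: (nat, 'x) rmgraph. wf_rmgraph G \<and> wf_rmgraph H \<and> rmiso G H)"
    by (auto simp: wf_rmgraph_def intro!: sympI rmiso_sym)
  show "transp (\<lambda>G H :: (nat, 'x) rmgraph. wf_rmgraph G \<and> wf_rmgraph H \<and> rmiso G H)"
    by (auto intro!: transpI intro: rmiso_trans)
qed

definition relabel :: "('v \<Rightarrow> 'w) \<Rightarrow> ('v, 'x) rmgraph \<Rightarrow> ('w, 'x) rmgraph" where
  "relabel f G = \<lparr>verts = f ` verts G, edges = map_prod f f ` edges G, root = f (root G),
                  mark = mark G \<circ> inv_into (verts G) f\<rparr>"

definition iso_class :: "('v::countable, 'x) rmgraph \<Rightarrow> 'x gstar" where
  "iso_class G = abs_gstar (relabel to_nat G)"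

lemma rmiso_relabel:
  assumes "inj f" shows "rmiso G (relabel f G)"
  unfolding rmiso_def relabel_def
  by (rule exI[of _ f])
     (use assms in \<open>auto simp: bij_betw_def inj_on_def dest: injD\<close>)

lemma wf_relabel:
  assumes f: "inj f" and G: "wf_rmgraph G" shows "wf_rmgraph (relabel f G)"
proof -
  have path: "(f u, f v) \<in> (map_prod f f ` edges G)\<^sup>*" if "(u, v) \<in> (edges G)\<^sup>*" for u v
    using that by (induction rule: rtrancl_induct) (auto intro: rtrancl_into_rtrancl rev_image_eqI)
  have nb: "(map_prod f f ` edges G) `` {f v} = f ` (edges G `` {v})" for v
    using f by (force dest: injD)
  show ?thesis
    using G path f unfolding wf_rmgraph_def relabel_def
    by (auto simp: nb sym_def irrefl_def dest: injD)
qed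

text \<open>The subgraph induced by the vertices at graph distance at most \<open>r\<close> from the root.\<close>

definition rball :: "nat \<Rightarrow> ('v, 'x) rmgraph \<Rightarrow> ('v, 'x) rmgraph" where
  "rball r G = (let B = {v \<in> verts G. \<exists>k\<le>r. (root G, v) \<in> edges G ^^ k} in
     G\<lparr>verts := B, edges := edges G \<inter> B \<times> B\<rparr>)"

text \<open>
  Local topology: two classes are close if large balls around their roots are isomorphic as marked
  graphs. Exact agreement of marks is the right notion because a finite mark space is discrete.
\<close>

definition local_nbhd :: "nat \<Rightarrow> 'x gstar \<Rightarrow> 'x gstar set" where
  "local_nbhd r g = {g'. rmiso (rball r (rep_gstar g')) (rball r (rep_gstar g))}"

instantiation gstar :: (finite) topological_space
begin

definition open_gstar :: "'a gstar set \<Rightarrow> bool" where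
  "open_gstar = generate_topology {local_nbhd r g |r g. True}"

instance
  by standard (auto simp: open_gstar_def intro: generate_topology.intros)

end

section \<open>Probability measures with the weak topology\<close>

definition prob_measures :: "'a::topological_space measure set" where
  "prob_measures = {\<mu>. prob_space \<mu> \<and> sets \<mu> = sets borel}"

definition weak_topology :: "'a::topological_space measure topology" where
  "weak_topology = topology_generated_by
     {{\<mu> \<in> prob_measures. (\<integral>x. f x \<partial>\<mu>) \<in> V} |(f :: 'a \<Rightarrow> real) V.
        continuous_on UNIV f \<and> bounded (range f) \<and> open V}"

section \<open>The random graph model\<close>

definition regular_graphs :: "nat \<Rightarrow> nat \<Rightarrow> (nat \<times> nat) set set" where
  "regular_graphs \<kappa> n = {E. E \<subseteq> {1..n} \<times> {1..n} \<and> sym E \<and> irrefl E \<and>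
     (\<forall>v\<in>{1..n}. card (E `` {v}) = \<kappa>)}"

text \<open>The joint law of the pair \<open>(G\<^sub>n, X\<^sup>n)\<close>.\<close>

definition graph_marks_law :: "nat \<Rightarrow> 'x pmf \<Rightarrow> nat \<Rightarrow> ((nat \<times> nat) set \<times> (nat \<Rightarrow> 'x)) pmf" where
  "graph_marks_law \<kappa> \<nu> n =
     pair_pmf (pmf_of_set (regular_graphs \<kappa> n)) (Pi_pmf {1..n} undefined (\<lambda>_. \<nu>))"

definition component :: "(nat \<times> nat) set \<Rightarrow> (nat \<Rightarrow> 'x) \<Rightarrow> nat \<Rightarrow> (nat, 'x) rmgraph" where
  "component E X v = \<lparr>verts = E\<^sup>* `` {v}, edges = E \<inter> (E\<^sup>* `` {v}) \<times> (E\<^sup>* `` {v}), root = v, mark = X\<rparr>"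

lemma wf_component:
  assumes "E \<in> regular_graphs \<kappa> n" shows "wf_rmgraph (component E X v)"
proof -
  define B where "B = E\<^sup>* `` {v}"
  have E: "finite E" "sym E" "irrefl E"
    using assms finite_subset[of E "{1..n} \<times> {1..n}"] by (auto simp: regular_graphs_def)
  have path: "(v, u) \<in> (E \<inter> B \<times> B)\<^sup>*" if "(v, u) \<in> E\<^sup>*" for u
    using that
  proof (induction rule: rtrancl_induct)
    case (step y z)
    then have "(y, z) \<in> E \<inter> B \<times> B"
      by (auto simp: B_def intro: rtrancl_into_rtrancl)
    then show ?case using step.IH by (rule rtrancl_into_rtrancl[rotated])
  qed simp
  have "finite (E `` {u})" for u using E(1) by (rule finite_Image)
  then have "finite ((E \<inter> B \<times> B) `` {u})" for u
    by (rule rev_finite_subset) auto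
  then show ?thesis
    using E(2,3) path unfolding wf_rmgraph_def component_def B_def[symmetric]
    by (simp add: sym_def irrefl_def) (simp add: B_def)
qed

definition component_empirical ::
    "nat \<Rightarrow> (nat \<times> nat) set \<times> (nat \<Rightarrow> 'x::finite) \<Rightarrow> 'x gstar measure" where
  "component_empirical n = (\<lambda>(E, X).
     distr (uniform_count_measure {1..n}) borel (\<lambda>v. iso_class (component E X v)))"

definition edge_average ::
    "('x \<Rightarrow> 'x \<Rightarrow> real) \<Rightarrow> nat \<Rightarrow> (nat \<times> nat) set \<times> (nat \<Rightarrow> 'x) \<Rightarrow> real" where
  "edge_average h n = (\<lambda>(E, X). (\<Sum>v\<in>{1..n}. \<Sum>u\<in>E `` {v}. h (X v) (X u)) / real n)"

definition c_ref :: "nat \<Rightarrow> 'x::finite pmf \<Rightarrow> ('x \<Rightarrow> 'x \<Rightarrow> real) \<Rightarrow> real" where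
  "c_ref \<kappa> \<nu> h = real \<kappa> * (\<Sum>x\<in>UNIV. \<Sum>y\<in>UNIV. h x y * pmf \<nu> x * pmf \<nu> y)"

definition Con ::
    "nat \<Rightarrow> 'x::finite pmf \<Rightarrow> ('x \<Rightarrow> 'x \<Rightarrow> real) \<Rightarrow> nat \<Rightarrow> real \<Rightarrow>
     ((nat \<times> nat) set \<times> (nat \<Rightarrow> 'x)) set" where
  "Con \<kappa> \<nu> h n c = {\<omega>. if c > c_ref \<kappa> \<nu> h then edge_average h n \<omega> \<ge> c else edge_average h n \<omega> \<le> c}"

definition c_shift :: "nat \<Rightarrow> 'x::finite pmf \<Rightarrow> ('x \<Rightarrow> 'x \<Rightarrow> real) \<Rightarrow> real \<Rightarrow> real \<Rightarrow> real" where
  "c_shift \<kappa> \<nu> h c \<delta> = (if c > c_ref \<kappa> \<nu> h then c + \<delta> else c - \<delta>)"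

section \<open>The regular tree and translation-invariant splitting Gibbs measures\<close>

text \<open>
  Vertices of the \<open>\<kappa>\<close>-regular tree are words: the root \<open>[]\<close> has \<open>\<kappa>\<close> children, every other vertex has
  \<open>\<kappa> - 1\<close> children, and \<open>w @ [a]\<close> is the \<open>a\<close>-th child of \<open>w\<close>. The length of a word is its distance
  from the root.
\<close>

definition tree_verts :: "nat \<Rightarrow> nat list set" where
  "tree_verts \<kappa> = {w. \<forall>i<length w. w ! i < (if i = 0 then \<kappa> else \<kappa> - 1)}"

definition tree_ball :: "nat \<Rightarrow> nat \<Rightarrow> nat list set" where
  "tree_ball \<kappa> r = {w \<in> tree_verts \<kappa>. length w \<le> r}"

text \<open>Each edge of \<open>T\<^sub>r\<close> occurs exactly once, as a pair (parent, child).\<close>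

definition tree_arcs :: "nat \<Rightarrow> nat \<Rightarrow> (nat list \<times> nat list) set" where
  "tree_arcs \<kappa> r = {(u, u @ [a]) |u a. u @ [a] \<in> tree_ball \<kappa> r}"

definition marked_tree :: "nat \<Rightarrow> (nat list \<Rightarrow> 'x) \<Rightarrow> (nat list, 'x) rmgraph" where
  "marked_tree \<kappa> x = (let A = (\<Union>r. tree_arcs \<kappa> r) in
     \<lparr>verts = tree_verts \<kappa>, edges = A \<union> A\<inverse>, root = [], mark = x\<rparr>)"

lemma wf_marked_tree: "wf_rmgraph (marked_tree \<kappa> x)"
proof -
  define A where "A = (\<Union>r. tree_arcs \<kappa> r)"
  have A: "(u, v) \<in> A \<longleftrightarrow> v \<in> tree_verts \<kappa> \<and> (\<exists>a. v = u @ [a])" for u v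
    by (auto simp: A_def tree_arcs_def tree_ball_def)
  have pre: "u \<in> tree_verts \<kappa>" if "u @ [a] \<in> tree_verts \<kappa>" for u a
    unfolding tree_verts_def
  proof (intro CollectI allI impI)
    fix i assume i: "i < length u"
    then have "(u @ [a]) ! i < (if i = 0 then \<kappa> else \<kappa> - 1)"
      using that by (simp only: tree_verts_def mem_Collect_eq length_append)
    then show "u ! i < (if i = 0 then \<kappa> else \<kappa> - 1)" using i by (simp only: nth_append if_True)
  qed
  have le: "a < Suc \<kappa>" if "u @ [a] \<in> tree_verts \<kappa>" for u a
  proof -
    have "(u @ [a]) ! length u < (if length u = 0 then \<kappa> else \<kappa> - 1)"
      using that[unfolded tree_verts_def mem_Collect_eq, rule_format, of "length u"] by (simp only: length_append_singleton lessI)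
    then have "a < (if length u = 0 then \<kappa> else \<kappa> - 1)" by (simp only: nth_append_length)
    then show ?thesis by (cases "length u = 0") simp_all
  qed
  have fin: "finite ((A \<union> A\<inverse>) `` {u})" for u
  proof (rule finite_subset)
    show "(A \<union> A\<inverse>) `` {u} \<subseteq> insert (butlast u) ((\<lambda>a. u @ [a]) ` {..<Suc \<kappa>})"
    proof
      fix v assume "v \<in> (A \<union> A\<inverse>) `` {u}"
      then consider a where "v = u @ [a]" "u @ [a] \<in> tree_verts \<kappa>" | a where "u = v @ [a]"
        by (auto simp: A)
      then show "v \<in> insert (butlast u) ((\<lambda>a. u @ [a]) ` {..<Suc \<kappa>})"
        by cases (use le in \<open>blast, simp\<close>)
    qed
  qed simp
  have path: "([], v) \<in> (A \<union> A\<inverse>)\<^sup>*" if "v \<in> tree_verts \<kappa>" for v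
    using that
  proof (induction v rule: rev_induct)
    case (snoc a v)
    then have "([], v) \<in> (A \<union> A\<inverse>)\<^sup>*" "(v, v @ [a]) \<in> A \<union> A\<inverse>" using pre A by auto
    then show ?case by (rule rtrancl_into_rtrancl)
  qed simp
  have "[] \<in> tree_verts \<kappa>" by (simp add: tree_verts_def)
  then show ?thesis
    using fin path unfolding wf_rmgraph_def marked_tree_def Let_def A_def[symmetric]
    by (simp add: sym_def irrefl_def) (force simp: A intro: pre)
qed

definition gibbs_weight ::
    "nat \<Rightarrow> ('x \<Rightarrow> 'x \<Rightarrow> real) \<Rightarrow> ('x \<Rightarrow> real) \<Rightarrow> 'x pmf \<Rightarrow> nat \<Rightarrow> (nat list \<Rightarrow> 'x) \<Rightarrow> real" where
  "gibbs_weight \<kappa> \<psi> \<psi>' l r x =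
     (\<Prod>(u, v)\<in>tree_arcs \<kappa> r. \<psi> (x u) (x v)) *
     (\<Prod>v\<in>tree_ball \<kappa> (r - 1). \<psi>' (x v)) *
     (\<Prod>v\<in>tree_ball \<kappa> r - tree_ball \<kappa> (r - 1). pmf l (x v))"

definition partition_function ::
    "nat \<Rightarrow> ('x::finite \<Rightarrow> 'x \<Rightarrow> real) \<Rightarrow> ('x \<Rightarrow> real) \<Rightarrow> 'x pmf \<Rightarrow> nat \<Rightarrow> real" where
  "partition_function \<kappa> \<psi> \<psi>' l r =
     (\<Sum>x\<in>tree_ball \<kappa> r \<rightarrow>\<^sub>E UNIV. gibbs_weight \<kappa> \<psi> \<psi>' l r x)"

definition TISGM ::
    "nat \<Rightarrow> ('x::finite \<Rightarrow> 'x \<Rightarrow> real) \<Rightarrow> ('x \<Rightarrow> real) \<Rightarrow> (nat list \<Rightarrow> 'x) measure set" where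
  "TISGM \<kappa> \<psi> \<psi>' = {\<rho>. prob_space \<rho> \<and>
     sets \<rho> = sets (Pi\<^sub>M (tree_verts \<kappa>) (\<lambda>_. count_space UNIV)) \<and>
     (\<exists>l :: 'x pmf. \<forall>r\<ge>1. \<forall>x \<in> tree_ball \<kappa> r \<rightarrow>\<^sub>E UNIV.
        measure (distr \<rho> (Pi\<^sub>M (tree_ball \<kappa> r) (\<lambda>_. count_space UNIV)) (\<lambda>y. restrict y (tree_ball \<kappa> r))) {x}
          = gibbs_weight \<kappa> \<psi> \<psi>' l r x / partition_function \<kappa> \<psi> \<psi>' l r)}"

text \<open>A law of a mark configuration on the tree, viewed as a law on isomorphism classes.\<close>

definition tree_law :: "nat \<Rightarrow> (nat list \<Rightarrow> 'x::finite) measure \<Rightarrow> 'x gstar measure" where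
  "tree_law \<kappa> \<rho> = distr \<rho> borel (\<lambda>x. iso_class (marked_tree \<kappa> x))"

definition tree_classes :: "nat \<Rightarrow> 'x gstar set" where
  "tree_classes \<kappa> = range (\<lambda>x. iso_class (marked_tree \<kappa> x))"

definition tree_prob_measures :: "nat \<Rightarrow> 'x::finite gstar measure set" where
  "tree_prob_measures \<kappa> = {\<rho> \<in> prob_measures. AE g in \<rho>. g \<in> tree_classes \<kappa>}"

text \<open>
  Given a class, the law of the marks of the root and of a uniformly chosen neighbour of the root;
  meaningful only if the root is not isolated, which is so on the regular tree.
\<close>

definition root_edge_pmf :: "'x gstar \<Rightarrow> ('x \<times> 'x) pmf" where
  "root_edge_pmf g = (let G = rep_gstar g in
     map_pmf (\<lambda>u. (mark G (root G), mark G u)) (pmf_of_set (edges G `` {root G})))"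

definition edge_marginal :: "'x::finite gstar measure \<Rightarrow> ('x \<times> 'x) measure" where
  "edge_marginal \<rho> = \<rho> \<bind> (\<lambda>g. measure_pmf (root_edge_pmf g))"

definition G_nondeg ::
    "nat \<Rightarrow> 'x::finite pmf \<Rightarrow> ('x \<Rightarrow> 'x \<Rightarrow> real) \<Rightarrow> real \<Rightarrow> 'x gstar measure set" where
  "G_nondeg \<kappa> \<nu> h c =
     (\<Union>\<beta>::real. tree_law \<kappa> ` TISGM \<kappa> (\<lambda>x y. exp (\<beta> * h x y)) (pmf \<nu>)) \<inter>
     {\<rho> \<in> tree_prob_measures \<kappa>. real \<kappa> * (\<integral>(x, y). h x y \<partial>edge_marginal \<rho>) = c}"

text \<open>The logarithm of a probability, with \<open>log 0 = - \<infinity>\<close> (whereas \<open>ln 0 = 0\<close>).\<close>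

definition log_prob :: "real \<Rightarrow> ereal" where
  "log_prob p = (if p = 0 then - \<infinity> else ereal (ln p))"

end

theory Submission
  imports Defs
begin

text \<open>
  In the configuration model a \<open>K\<close>-regular graph is a perfect matching \<open>M\<close> of the half-edges \<open>(v, i)\<close>,
  \<open>i < K\<close>. Every simple graph comes from the same number of matchings, so conditional probabilities are
  ratios of numbers of pairs of a simple matching and a mark vector. The number of pairs with a given
  edge law (the frequencies of the mark pairs along the edges) is \<open>exp\<close> of \<open>n\<close> times an explicit entropy,
  and by switchings the restriction to simple graphs does not change this rate.

  Given the constraint, the edge law therefore concentrates on the maximisers of the entropy. By the
  Lagrange conditions these have energy exactly \<open>c\<close> and split as \<open>C \<alpha>(x)\<^sup>g \<alpha>(y)\<^sup>g exp (\<beta> h(x, y))\<close> with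
  \<open>g = (K - 1) / K\<close>, which makes the Markov chain on the tree with this edge law a splitting Gibbs
  measure. Given its edge law the matching is uniform, and bounds for \<open>k\<close>-th moments, \<open>k\<close> proportional
  to \<open>n\<close>, show that the frequencies of marked balls differ from those of the Markov chain only with
  exponentially small probability. A finite cover of the compact set of feasible edge laws concludes.
  The case \<open>c < c_ref\<close> follows by passing to \<open>- h\<close>.
\<close>

section \<open>Matchings with a prescribed edge type\<close>

text \<open>A second moment gives no exponential decay, so all tails use moments of order
  proportional to \<open>n\<close>. Disjoint footprints turn a \<open>k\<close>-tuple of occurrences
  into one large partial matching; disjointness costs only \<open>k\<close> times a constant, and
  the half-edges used up shift the frequencies slightly. Only upper tails are proved: the limiting
  weights of the balls sum to 1 and collisions are rare, so no ball can be seen too seldom.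
  Simplicity enters asymmetrically. Upper bounds are inherited from all matchings; only the lower
  bound for the conditioning event needs repairs, and a polynomial loss there is harmless. On the
  boundary of the simplex an infinite slope excludes maximisers, except at the two laws with a
  single mark: there two singular terms compete, and an explicit nearby law of positive entropy is
  used instead. The limit as the shift of \<open>c\<close> tends to 0 is claimed to exist although
  the bad counts have no known rate: their limsup is monotone in the shift, and the rate of the
  conditioning event is right continuous.\<close>

definition matchings :: "'h set \<Rightarrow> ('h \<Rightarrow> 'h) set" where
  "matchings S = {M. (\<forall>x\<in>S. M x \<in> S \<and> M x \<noteq> x \<and> M (M x) = x) \<and> (\<forall>x. x \<notin> S \<longrightarrow> M x = x)}"

text \<open>\<open>E a b\<close> counts half-edges, not edges: an edge between two half-edges of
  colour \<open>a\<close> contributes 2 to \<open>E a a\<close>, an edge between different colours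
  contributes 1 to each of two off-diagonal entries.\<close>

definition typed_matchings :: "'h set \<Rightarrow> ('h \<Rightarrow> 'x) \<Rightarrow> ('x \<Rightarrow> 'x \<Rightarrow> nat) \<Rightarrow> ('h \<Rightarrow> 'h) set" where
  "typed_matchings S col E =
     {M \<in> matchings S. \<forall>a b. card {h\<in>S. col h = a \<and> col (M h) = b} = E a b}"

text \<open>Conjugation with a transposition lets \<open>y\<close> and \<open>z\<close> trade
  partners. For equal colours this is a symmetry of \<open>typed_matchings\<close>; this
  exchangeability is the only probabilistic input of the bounds on partial matchings.\<close>

definition swap_conj :: "'h \<Rightarrow> 'h \<Rightarrow> ('h \<Rightarrow> 'h) \<Rightarrow> 'h \<Rightarrow> 'h" where
  "swap_conj y z M = Transposition.transpose y z \<circ> M \<circ> Transposition.transpose y z"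

lemma matchingsD:
  assumes "M \<in> matchings S"
  shows "x \<in> S \<Longrightarrow> M x \<in> S" "x \<in> S \<Longrightarrow> M x \<noteq> x" "M (M x) = x" "x \<notin> S \<Longrightarrow> M x = x"
  using assms unfolding matchings_def by auto

lemma inj_matching: "M \<in> matchings S \<Longrightarrow> inj M"
  by (rule injI) (metis matchingsD(3))

lemma finite_matchings:
  assumes "finite S" shows "finite (matchings S)"
proof (rule finite_subset)
  show "matchings S \<subseteq> {f. \<forall>x. (x \<in> S \<longrightarrow> f x \<in> S) \<and> (x \<notin> S \<longrightarrow> f x = x)}"
    by (auto simp: matchings_def)
  have "{f. \<forall>x. (x \<in> S \<longrightarrow> f x \<in> S) \<and> (x \<notin> S \<longrightarrow> f x = x)} \<subseteq>
      (\<lambda>g x. if x \<in> S then g x else x) ` (S \<rightarrow>\<^sub>E S)"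
  proof
    fix f assume f: "f \<in> {f. \<forall>x. (x \<in> S \<longrightarrow> f x \<in> S) \<and> (x \<notin> S \<longrightarrow> f x = x)}"
    hence "f = (\<lambda>x. if x \<in> S then restrict f S x else x)" by auto
    moreover have "restrict f S \<in> S \<rightarrow>\<^sub>E S" using f by auto
    ultimately show "f \<in> (\<lambda>g x. if x \<in> S then g x else x) ` (S \<rightarrow>\<^sub>E S)" by blast
  qed
  thus "finite {f. \<forall>x. (x \<in> S \<longrightarrow> f x \<in> S) \<and> (x \<notin> S \<longrightarrow> f x = x)}"
    by (rule finite_subset) (simp add: assms finite_PiE)
qed

lemma finite_typed: "finite S \<Longrightarrow> finite (typed_matchings S col E)"
  by (rule finite_subset[OF _ finite_matchings]) (auto simp: typed_matchings_def)

lemma swap_conj_inv: "swap_conj y z (swap_conj y z M) = M"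
  by (simp add: swap_conj_def fun_eq_iff)

lemma inj_swap_conj: "inj_on (swap_conj y z) A"
  by (rule inj_onI) (metis swap_conj_inv)

lemma swap_conj_matching:
  assumes "M \<in> matchings S" "y \<in> S" "z \<in> S"
  shows "swap_conj y z M \<in> matchings S"
proof -
  have t: "Transposition.transpose y z x \<in> S \<longleftrightarrow> x \<in> S" for x
    using assms(2,3) by (auto simp: Transposition.transpose_def)
  show ?thesis
    unfolding matchings_def
  proof (intro CollectI conjI ballI allI impI)
    fix x assume "x \<in> S"
    thus "swap_conj y z M x \<in> S" "swap_conj y z M (swap_conj y z M x) = x"
      using matchingsD[OF assms(1)] by (auto simp: swap_conj_def t)
    show "swap_conj y z M x \<noteq> x"
    proof
      assume "swap_conj y z M x = x"
      hence "M (Transposition.transpose y z x) = Transposition.transpose y z x"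
        by (metis swap_conj_def comp_apply transpose_involutory)
      thus False using matchingsD(2)[OF assms(1)] t \<open>x \<in> S\<close> by blast
    qed
  next
    fix x assume "x \<notin> S"
    thus "swap_conj y z M x = x"
      using matchingsD(4)[OF assms(1)] by (simp add: swap_conj_def t)
  qed
qed

lemma swap_conj_typed:
  assumes "M \<in> typed_matchings S col E" "y \<in> S" "z \<in> S" "col y = col z"
  shows "swap_conj y z M \<in> typed_matchings S col E"
proof -
  have s: "M \<in> matchings S" using assms(1) by (simp add: typed_matchings_def)
  have c: "col (Transposition.transpose y z x) = col x" for x using assms(4) by (auto simp: Transposition.transpose_def)
  have t: "Transposition.transpose y z x \<in> S \<longleftrightarrow> x \<in> S" for x
    using assms(2,3) by (auto simp: Transposition.transpose_def)
  have "card {h\<in>S. col h = a \<and> col (swap_conj y z M h) = b} = E a b" for a b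
  proof -
    have "{h\<in>S. col h = a \<and> col (swap_conj y z M h) = b}
        = Transposition.transpose y z ` {h\<in>S. col h = a \<and> col (M h) = b}"
    proof (intro equalityI subsetI)
      fix x assume "x \<in> {h\<in>S. col h = a \<and> col (swap_conj y z M h) = b}"
      thus "x \<in> Transposition.transpose y z ` {h\<in>S. col h = a \<and> col (M h) = b}"
        by (intro image_eqI[of _ _ "Transposition.transpose y z x"]) (auto simp: swap_conj_def c t)
    qed (auto simp: swap_conj_def c t)
    thus ?thesis
      using assms(1) by (simp add: card_image typed_matchings_def)
  qed
  thus ?thesis
    using swap_conj_matching[OF s assms(2,3)] by (simp add: typed_matchings_def)
qed

text \<open>Two averagings. The free half-edges of the colour of \<open>h\<close> are exchangeable,
  and the total number of matches from this colour into that of \<open>k\<close> is fixed by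
  \<open>E\<close>. Once \<open>h\<close> is matched into the colour of \<open>k\<close>, the free
  half-edges of that colour are exchangeable as partners.\<close>

lemma typed_extension_bound:
  fixes f g :: "'i \<Rightarrow> 'h" and col :: "'h \<Rightarrow> 'x" and E :: "'x \<Rightarrow> 'x \<Rightarrow> nat"
  assumes S: "finite S" and U: "U = f ` A \<union> g ` A"
    and hk: "h \<in> S - U" "k \<in> S - U" "h \<noteq> k"
  defines "C \<equiv> {M \<in> typed_matchings S col E. \<forall>i\<in>A. M (f i) = g i}"
  shows "card {M\<in>C. M h = k} * (card ({x\<in>S. col x = col h} - U) * (card ({x\<in>S. col x = col k} - U) - 1))
      \<le> card C * E (col h) (col k)"
proof -
  have finC: "finite C" unfolding C_def by (rule finite_subset[OF _ finite_typed[OF S]]) auto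
  have tr: "Transposition.transpose y z u = u" if "u \<in> U" "y \<notin> U" "z \<notin> U" for y z u
    using that by (metis transpose_apply_other)
  have swapC: "swap_conj y z M \<in> C" if "M \<in> C" "y \<in> S - U" "z \<in> S - U" "col y = col z" for M y z
    using that swap_conj_typed[of M S col E y z] tr U
    by (auto simp: C_def swap_conj_def)
  \<comment> \<open>Only the colour of the partner is recorded, so that the swap of \<open>h\<close>
    and \<open>h'\<close> preserves the condition even if it moves \<open>k\<close>.\<close>
  define V where "V h' = {M\<in>C. col (M h') = col k}" for h'
  have finV: "finite (V h')" for h' using finC by (simp add: V_def)
  have Vle: "card (V h) \<le> card (V h')" if "h' \<in> {x\<in>S. col x = col h} - U" for h'
  proof (rule card_inj_on_le[OF inj_swap_conj _ finV])
    show "swap_conj h h' ` V h \<subseteq> V h'"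
    proof safe
      fix M assume s: "M \<in> V h"
      have "col (Transposition.transpose h h' x) = col x" for x using that by (auto simp: Transposition.transpose_def)
      thus "swap_conj h h' M \<in> V h'"
        using s swapC[of M h h'] that hk by (auto simp: V_def swap_conj_def)
    qed
  qed
  have "card (V h) * card ({x\<in>S. col x = col h} - U) \<le> (\<Sum>h'\<in>{x\<in>S. col x = col h} - U. card (V h'))"
    using sum_mono[of "{x\<in>S. col x = col h} - U" "\<lambda>_. card (V h)" "\<lambda>h'. card (V h')", OF Vle]
    by (simp add: mult.commute)
  also have "\<dots> \<le> (\<Sum>h'\<in>{x\<in>S. col x = col h}. card (V h'))"
    by (rule sum_mono2) (use S in auto)
  also have "\<dots> = (\<Sum>h'\<in>{x\<in>S. col x = col h}. \<Sum>M\<in>C. if col (M h') = col k then 1 else 0)"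
    using finC by (auto simp: V_def sum.If_cases Int_def intro!: sum.cong arg_cong[of _ _ card])
  also have "\<dots> = (\<Sum>M\<in>C. \<Sum>h'\<in>{x\<in>S. col x = col h}. if col (M h') = col k then 1 else 0)"
    by (rule sum.swap)
  also have "\<dots> = (\<Sum>M\<in>C. E (col h) (col k))"
  proof (rule sum.cong)
    fix M assume "M \<in> C"
    hence "card {x\<in>S. col x = col h \<and> col (M x) = col k} = E (col h) (col k)"
      by (auto simp: C_def typed_matchings_def)
    thus "(\<Sum>h'\<in>{x\<in>S. col x = col h}. if col (M h') = col k then 1 else 0) = E (col h) (col k)"
      using S by (simp add: sum.If_cases Int_def)
  qed simp
  finally have 1: "card (V h) * card ({x\<in>S. col x = col h} - U) \<le> card C * E (col h) (col k)"
    by simp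
  \<comment> \<open>\<open>h\<close> is removed because it may have the colour of \<open>k\<close>;
    this is the \<open>- 1\<close> of the claim.\<close>
  define K where "K = {x\<in>S. col x = col k} - U - {h}"
  have finK: "finite K" using S by (simp add: K_def)
  have Kle: "card {M\<in>C. M h = k} \<le> card {M\<in>C. M h = k'}" if "k' \<in> K" for k'
  proof (rule card_inj_on_le[OF inj_swap_conj])
    show "swap_conj k k' ` {M\<in>C. M h = k} \<subseteq> {M\<in>C. M h = k'}"
      using swapC[of _ k k'] that hk by (auto simp: K_def swap_conj_def)
    show "finite {M\<in>C. M h = k'}" using finC by simp
  qed
  have "card {M\<in>C. M h = k} * card K \<le> (\<Sum>k'\<in>K. card {M\<in>C. M h = k'})"
    using sum_mono[of K "\<lambda>_. card {M\<in>C. M h = k}" "\<lambda>k'. card {M\<in>C. M h = k'}", OF Kle]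
    by (simp add: mult.commute)
  also have "\<dots> = card (\<Union>k'\<in>K. {M\<in>C. M h = k'})"
    by (rule card_UN_disjoint[symmetric]) (use finK finC in auto)
  also have "\<dots> \<le> card (V h)"
    by (rule card_mono[OF finV]) (auto simp: V_def K_def)
  finally have 2: "card {M\<in>C. M h = k} * card K \<le> card (V h)" .
  have "card ({x\<in>S. col x = col k} - U) - 1 \<le> card K"
    unfolding K_def using diff_card_le_card_Diff[of "{h}" "{x\<in>S. col x = col k} - U"] by simp
  hence "card {M\<in>C. M h = k} * (card ({x\<in>S. col x = col k} - U) - 1) \<le> card (V h)"
    using 2 by (meson le_trans mult_le_mono2)
  hence "card {M\<in>C. M h = k} * (card ({x\<in>S. col x = col k} - U) - 1) * card ({x\<in>S. col x = col h} - U)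
     \<le> card C * E (col h) (col k)"
    using 1 by (meson le_trans mult_le_mono1)
  thus ?thesis by (simp add: ac_simps)
qed

text \<open>The pairs are revealed one at a time, each costing one factor of
  \<open>typed_extension_bound\<close>. \<open>MM\<close> bounds the number of half-edges in use at
  any time, so that all denominators have the same form and the bound is a product.\<close>

lemma typed_partial_bound:
  fixes f g :: "'i \<Rightarrow> 'h" and col :: "'h \<Rightarrow> 'x" and E :: "'x \<Rightarrow> 'x \<Rightarrow> nat"
  assumes S: "finite S" and A: "finite A" "2 * card A \<le> MM"
    and fg: "inj_on f A" "inj_on g A" "f ` A \<inter> g ` A = {}" "f ` A \<subseteq> S" "g ` A \<subseteq> S"
    and N: "\<And>a. N a = card {x\<in>S. col x = a}"
    and MM: "\<And>i. i \<in> A \<Longrightarrow> MM < N (col (f i)) \<and> MM < N (col (g i))"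
  shows "real (card {M \<in> typed_matchings S col E. \<forall>i\<in>A. M (f i) = g i})
     \<le> real (card (typed_matchings S col E)) *
        (\<Prod>i\<in>A. real (E (col (f i)) (col (g i))) /
            ((real (N (col (f i))) - real MM) * (real (N (col (g i))) - real MM)))"
  using A fg MM
proof (induction A rule: finite_induct)
  case empty thus ?case by simp
next
  case (insert j A)
  define U where "U = f ` A \<union> g ` A"
  define C where "C = {M \<in> typed_matchings S col E. \<forall>i\<in>A. M (f i) = g i}"
  have IH: "real (card C)
     \<le> real (card (typed_matchings S col E)) *
        (\<Prod>i\<in>A. real (E (col (f i)) (col (g i))) /
            ((real (N (col (f i))) - real MM) * (real (N (col (g i))) - real MM)))"
    unfolding C_def by (rule insert.IH) (use insert in auto)
  have cU: "card U \<le> 2 * card A"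
    unfolding U_def using card_Un_le[of "f ` A" "g ` A"] card_image_le[OF insert(1), of f] card_image_le[OF insert(1), of g]
    by linarith
  have finU: "finite U" using insert(1) by (simp add: U_def)
  have hk: "f j \<in> S - U" "g j \<in> S - U" "f j \<noteq> g j"
    using insert.prems insert.hyps by (auto simp: U_def)
  have "card {M\<in>C. M (f j) = g j} * (card ({x\<in>S. col x = col (f j)} - U) * (card ({x\<in>S. col x = col (g j)} - U) - 1))
      \<le> card C * E (col (f j)) (col (g j))"
    using typed_extension_bound[OF S U_def hk, of col E] unfolding C_def .
  hence b: "real (card {M\<in>C. M (f j) = g j}) * (real (card ({x\<in>S. col x = col (f j)} - U)) * real (card ({x\<in>S. col x = col (g j)} - U) - 1))
      \<le> real (card C) * real (E (col (f j)) (col (g j)))"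
    by (simp only: of_nat_mult[symmetric] of_nat_le_iff)
  have lo: "N a - 2 * card A \<le> card ({x\<in>S. col x = a} - U)" for a
  proof -
    have "N a - card U \<le> card ({x\<in>S. col x = a} - U)"
      unfolding N by (rule diff_card_le_card_Diff[OF finU])
    thus ?thesis using cU by linarith
  qed
  define x where "x = real (N (col (f j))) - real MM"
  define y where "y = real (N (col (g j))) - real MM"
  have xy: "x > 0" "y > 0" using insert.prems(7)[of j] by (auto simp: x_def y_def)
  \<comment> \<open>The new pair counts towards \<open>MM\<close> as well; the spare 2 absorbs the
    \<open>- 1\<close> of \<open>typed_extension_bound\<close>.\<close>
  have MM': "2 * card A + 2 \<le> MM" using insert.prems(1) insert.hyps by simp
  have x1: "x \<le> real (card ({x\<in>S. col x = col (f j)} - U))"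
    using lo[of "col (f j)"] MM' xy(1) unfolding x_def by linarith
  have y1: "y \<le> real (card ({x\<in>S. col x = col (g j)} - U) - 1)"
    using lo[of "col (g j)"] MM' xy(2) unfolding y_def by linarith
  have "real (card {M\<in>C. M (f j) = g j}) * (x * y) \<le> real (card C) * real (E (col (f j)) (col (g j)))"
  proof (rule order_trans[OF _ b])
    show "real (card {M\<in>C. M (f j) = g j}) * (x * y) \<le> real (card {M\<in>C. M (f j) = g j}) *
        (real (card ({x\<in>S. col x = col (f j)} - U)) * real (card ({x\<in>S. col x = col (g j)} - U) - 1))"
      by (intro mult_left_mono mult_mono x1 y1) (use xy in auto)
  qed
  hence "real (card {M\<in>C. M (f j) = g j}) \<le> real (card C) * (real (E (col (f j)) (col (g j))) / (x * y))"
    using xy by (simp add: field_simps)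
  also have "\<dots> \<le> (real (card (typed_matchings S col E)) *
        (\<Prod>i\<in>A. real (E (col (f i)) (col (g i))) /
            ((real (N (col (f i))) - real MM) * (real (N (col (g i))) - real MM)))) * (real (E (col (f j)) (col (g j))) / (x * y))"
    by (rule mult_right_mono[OF IH]) (use xy in auto)
  finally have fin: "real (card {M\<in>C. M (f j) = g j}) \<le> \<dots>" .
  have "{M \<in> typed_matchings S col E. \<forall>i\<in>insert j A. M (f i) = g i} = {M\<in>C. M (f j) = g j}"
    by (auto simp: C_def)
  thus ?case using fin insert.hyps by (simp add: x_def y_def ac_simps)
qed

section \<open>High moments through tuples with disjoint footprints\<close>

definition disjoint_lists :: "('t \<Rightarrow> 'v set) \<Rightarrow> 't set \<Rightarrow> nat \<Rightarrow> 't list set" where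
  "disjoint_lists fp X k =
     {l. length l = k \<and> set l \<subseteq> X \<and> sorted_wrt (\<lambda>a b. fp a \<inter> fp b = {}) l}"

lemma finite_disjoint_lists: "finite X \<Longrightarrow> finite (disjoint_lists fp X k)"
  by (rule finite_subset[OF _ finite_lists_length_eq[of X k]]) (auto simp: disjoint_lists_def)

text \<open>Greedy choice: each entry already chosen blocks at most \<open>Q\<close> elements, so at
  each of at most \<open>K\<close> steps at least \<open>b - K * Q\<close> elements remain.\<close>

lemma card_disjoint_lists_ge:
  fixes fp :: "'t \<Rightarrow> 'v set"
  assumes X: "finite X" "\<And>\<theta>. \<theta> \<in> X \<Longrightarrow> card {\<theta>'\<in>X. fp \<theta> \<inter> fp \<theta>' \<noteq> {}} \<le> Q"
    and b: "real K * real Q \<le> b" "b \<le> real (card X)" and j: "j \<le> K"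
  shows "(b - real K * real Q) ^ j \<le> real (card (disjoint_lists fp X j))"
  using j
proof (induction j)
  case 0
  have "disjoint_lists fp X 0 = {[]}" by (auto simp: disjoint_lists_def)
  thus ?case by simp
next
  case (Suc j)
  define Fr where "Fr l = {\<theta>\<in>X. \<forall>\<theta>'\<in>set l. fp \<theta> \<inter> fp \<theta>' = {}}" for l
  have eq: "disjoint_lists fp X (Suc j) = (\<lambda>(l, \<theta>). \<theta> # l) ` (SIGMA l:disjoint_lists fp X j. Fr l)"
  proof (intro equalityI subsetI)
    fix m assume "m \<in> disjoint_lists fp X (Suc j)"
    then obtain \<theta> l where "m = \<theta> # l" "l \<in> disjoint_lists fp X j" "\<theta> \<in> Fr l"
      by (cases m) (auto simp: disjoint_lists_def Fr_def)
    thus "m \<in> (\<lambda>(l, \<theta>). \<theta> # l) ` (SIGMA l:disjoint_lists fp X j. Fr l)"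
      by auto
  qed (auto simp: disjoint_lists_def Fr_def)
  have fin: "finite (disjoint_lists fp X j)" by (rule finite_disjoint_lists[OF X(1)])
  have inj: "inj_on (\<lambda>(l, \<theta>). \<theta> # l) (SIGMA l:disjoint_lists fp X j. Fr l)"
    by (auto simp: inj_on_def)
  have "card (disjoint_lists fp X (Suc j)) = (\<Sum>l\<in>disjoint_lists fp X j. card (Fr l))"
    unfolding eq card_image[OF inj] using X(1) fin by (intro card_SigmaI) (auto simp: Fr_def)
  moreover have "b - real K * real Q \<le> real (card (Fr l))" if l: "l \<in> disjoint_lists fp X j" for l
  proof -
    define Cf where "Cf = (\<Union>\<theta>'\<in>set l. {\<theta>\<in>X. fp \<theta>' \<inter> fp \<theta> \<noteq> {}})"
    have "card Cf \<le> (\<Sum>\<theta>'\<in>set l. card {\<theta>\<in>X. fp \<theta>' \<inter> fp \<theta> \<noteq> {}})"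
      unfolding Cf_def by (rule card_UN_le) simp
    also have "\<dots> \<le> (\<Sum>\<theta>'\<in>set l. Q)"
      by (rule sum_mono) (use l X(2) in \<open>auto simp: disjoint_lists_def\<close>)
    also have "\<dots> \<le> K * Q"
      using l Suc.prems card_length[of l] by (auto simp: disjoint_lists_def intro!: mult_le_mono1)
    finally have 1: "card Cf \<le> K * Q" .
    have "card X - card Cf \<le> card (X - Cf)"
      by (rule diff_card_le_card_Diff) (use X(1) in \<open>auto simp: Cf_def\<close>)
    moreover have e: "X - Cf = Fr l" by (auto simp: Cf_def Fr_def)
    ultimately have "card X \<le> card (Fr l) + K * Q" using 1 unfolding e by linarith
    hence "real (card X) \<le> real (card (Fr l)) + real K * real Q"
      by (metis of_nat_add of_nat_le_iff of_nat_mult)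
    thus ?thesis using b by linarith
  qed
  ultimately have "real (card (disjoint_lists fp X (Suc j))) \<ge> (\<Sum>l\<in>disjoint_lists fp X j. b - real K * real Q)"
    by (simp only: of_nat_sum) (rule sum_mono)
  moreover have "(b - real K * real Q) ^ j * (b - real K * real Q)
      \<le> real (card (disjoint_lists fp X j)) * (b - real K * real Q)"
    by (rule mult_right_mono) (use Suc b in auto)
  ultimately show ?case by (simp add: mult.commute)
qed

text \<open>
  A high-moment bound: many occurrences of a pattern force many \<open>k\<close>-tuples of occurrences with disjoint
  footprints, and such tuples are counted by \<open>typed_partial_bound\<close>.
\<close>

lemma pattern_tail:
  fixes f g :: "'t \<Rightarrow> 'i \<Rightarrow> 'h" and col :: "'h \<Rightarrow> 'x" and E :: "'x \<Rightarrow> 'x \<Rightarrow> nat"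
    and Occ :: "('h \<Rightarrow> 'h) \<Rightarrow> 't set" and fp :: "'t \<Rightarrow> 'v set" and vtx :: "'h \<Rightarrow> 'v"
  defines "\<Omega> \<equiv> \<lambda>S col E. typed_matchings S col E"
  assumes S: "finite S" and A: "finite A" and Th: "finite \<Theta>"
    and N: "\<And>a. N a = card {x\<in>S. col x = a}"
    and Occ: "\<And>M. M \<in> \<Omega> S col E \<Longrightarrow> Occ M \<subseteq> \<Theta>"
      "\<And>M \<theta> i. M \<in> \<Omega> S col E \<Longrightarrow> \<theta> \<in> Occ M \<Longrightarrow> i \<in> A \<Longrightarrow> M (f \<theta> i) = g \<theta> i"
    and fg: "\<And>\<theta>. \<theta> \<in> \<Theta> \<Longrightarrow> inj_on (f \<theta>) A \<and> inj_on (g \<theta>) A \<and> f \<theta> ` A \<inter> g \<theta> ` A = {} \<and>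
        f \<theta> ` A \<subseteq> S \<and> g \<theta> ` A \<subseteq> S"
      "\<And>\<theta> i. \<theta> \<in> \<Theta> \<Longrightarrow> i \<in> A \<Longrightarrow> vtx (f \<theta> i) \<in> fp \<theta> \<and> vtx (g \<theta> i) \<in> fp \<theta>"
    and MM: "2 * (k * card A) \<le> MM" "\<And>h. h \<in> S \<Longrightarrow> MM < N (col h)"
    and q: "\<And>\<theta>. \<theta> \<in> \<Theta> \<Longrightarrow> (\<Prod>i\<in>A. real (E (col (f \<theta> i)) (col (g \<theta> i))) /
            ((real (N (col (f \<theta> i))) - real MM) * (real (N (col (g \<theta> i))) - real MM))) \<le> q"
    and Q: "\<And>M \<theta>. M \<in> \<Omega> S col E \<Longrightarrow> \<theta> \<in> Occ M \<Longrightarrow> card {\<theta>'\<in>Occ M. fp \<theta> \<inter> fp \<theta>' \<noteq> {}} \<le> Q"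
    and b: "real k * real Q \<le> b"
  shows "real (card {M\<in>\<Omega> S col E. b \<le> real (card (Occ M))}) * (b - real k * real Q) ^ k
       \<le> real (card (\<Omega> S col E)) * (real (card \<Theta>) * q) ^ k"
proof -
  define O1 where "O1 = \<Omega> S col E"
  have finO: "finite O1" unfolding O1_def \<Omega>_def by (rule finite_typed[OF S])
  have finOcc: "finite (Occ M)" if "M \<in> O1" for M
    using Occ(1)[of M] that Th finite_subset unfolding O1_def by blast
  define P where "P \<theta> = (\<Prod>i\<in>A. real (E (col (f \<theta> i)) (col (g \<theta> i))) /
            ((real (N (col (f \<theta> i))) - real MM) * (real (N (col (g \<theta> i))) - real MM)))" for \<theta>
  have P0: "0 \<le> P \<theta>" if "\<theta> \<in> \<Theta>" for \<theta>
    unfolding P_def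
  proof (rule prod_nonneg)
    fix i assume "i \<in> A"
    hence "f \<theta> i \<in> S" "g \<theta> i \<in> S" using fg(1)[OF that] by auto
    thus "0 \<le> real (E (col (f \<theta> i)) (col (g \<theta> i))) /
            ((real (N (col (f \<theta> i))) - real MM) * (real (N (col (g \<theta> i))) - real MM))"
      using MM(2) by (auto intro!: divide_nonneg_nonneg mult_nonneg_nonneg simp: less_imp_le)
  qed
  have "real (card {M\<in>O1. b \<le> real (card (Occ M))}) * (b - real k * real Q) ^ k
      = (\<Sum>M\<in>{M\<in>O1. b \<le> real (card (Occ M))}. (b - real k * real Q) ^ k)" by simp
  also have "\<dots> \<le> (\<Sum>M\<in>{M\<in>O1. b \<le> real (card (Occ M))}. real (card (disjoint_lists fp (Occ M) k)))"
    by (intro sum_mono card_disjoint_lists_ge[where Q = Q])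
       (use finOcc Q b in \<open>auto simp: O1_def\<close>)
  also have "\<dots> \<le> (\<Sum>M\<in>O1. real (card (disjoint_lists fp (Occ M) k)))"
    by (rule sum_mono2) (use finO in auto)
  also have "\<dots> = real (card (SIGMA M:O1. disjoint_lists fp (Occ M) k))"
    by (subst card_SigmaI) (auto intro: finite_disjoint_lists finOcc finO)
  \<comment> \<open>The pairs of a matching and a tuple of its occurrences are regrouped by the
    tuple.\<close>
  also have "\<dots> \<le> real (card (SIGMA l:disjoint_lists fp \<Theta> k. {M\<in>O1. set l \<subseteq> Occ M}))"
  proof -
    have "card ((\<lambda>(M, l). (l, M)) ` (SIGMA M:O1. disjoint_lists fp (Occ M) k))
      \<le> card (SIGMA l:disjoint_lists fp \<Theta> k. {M\<in>O1. set l \<subseteq> Occ M})"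
    proof (rule card_mono)
      show "finite (SIGMA l:disjoint_lists fp \<Theta> k. {M\<in>O1. set l \<subseteq> Occ M})"
        using finO by (intro finite_SigmaI finite_disjoint_lists[OF Th]) auto
      show "(\<lambda>(M, l). (l, M)) ` (SIGMA M:O1. disjoint_lists fp (Occ M) k) \<subseteq>
          (SIGMA l:disjoint_lists fp \<Theta> k. {M\<in>O1. set l \<subseteq> Occ M})"
      proof
        fix p assume "p \<in> (\<lambda>(M, l). (l, M)) ` (SIGMA M:O1. disjoint_lists fp (Occ M) k)"
        then obtain M l where p: "p = (l, M)" "M \<in> O1" "l \<in> disjoint_lists fp (Occ M) k" by auto
        have "Occ M \<subseteq> \<Theta>" using Occ(1) p(2) by (simp add: O1_def)
        thus "p \<in> (SIGMA l:disjoint_lists fp \<Theta> k. {M\<in>O1. set l \<subseteq> Occ M})"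
          using p by (auto simp: disjoint_lists_def)
      qed
    qed
    moreover have "inj_on (\<lambda>(M, l). (l, M)) (SIGMA M:O1. disjoint_lists fp (Occ M) k)"
      by (auto simp: inj_on_def)
    ultimately show ?thesis by (simp add: card_image)
  qed
  also have "\<dots> = (\<Sum>l\<in>disjoint_lists fp \<Theta> k. real (card {M\<in>O1. set l \<subseteq> Occ M}))"
    by (subst card_SigmaI) (auto intro: finite_disjoint_lists[OF Th] finite_subset[OF _ finO])
  also have "\<dots> \<le> (\<Sum>l\<in>disjoint_lists fp \<Theta> k. real (card O1) * q ^ k)"
  proof (rule sum_mono)
    fix l assume l: "l \<in> disjoint_lists fp \<Theta> k"
    hence len: "length l = k" and sub: "set l \<subseteq> \<Theta>" and dj: "sorted_wrt (\<lambda>a b. fp a \<inter> fp b = {}) l"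
      by (auto simp: disjoint_lists_def)
    have mem: "l ! j \<in> \<Theta>" if "j < k" for j using that len sub by auto
    have dj': "fp (l ! i) \<inter> fp (l ! j) = {}" if "i < k" "j < k" "i \<noteq> j" for i j
      using that dj len unfolding sorted_wrt_iff_nth_less by (metis Int_commute nat_neq_iff)
    \<comment> \<open>The \<open>k\<close> occurrences together prescribe \<open>k * card A\<close>
      pairs. Disjoint footprints keep the half-edges of different occurrences apart, the hypotheses
      \<open>fg\<close> those of the same occurrence, so this is a single partial matching.\<close>
    define I where "I = {..<k} \<times> A"
    define F where "F p = f (l ! fst p) (snd p)" for p
    define G where "G p = g (l ! fst p) (snd p)" for p
    have ne: "F p \<noteq> F p'" "G p \<noteq> G p'" "F p \<noteq> G p'" if "p \<in> I" "p' \<in> I" "fst p \<noteq> fst p'" for p p'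
    proof -
      have "vtx (F p) \<in> fp (l ! fst p)" "vtx (G p) \<in> fp (l ! fst p)"
           "vtx (F p') \<in> fp (l ! fst p')" "vtx (G p') \<in> fp (l ! fst p')"
        using fg(2) mem that by (auto simp: I_def F_def G_def)
      thus "F p \<noteq> F p'" "G p \<noteq> G p'" "F p \<noteq> G p'"
        using dj'[of "fst p" "fst p'"] that by (auto simp: I_def)
    qed
    have same: "F p = F p' \<Longrightarrow> p = p'" "G p = G p' \<Longrightarrow> p = p'" "F p \<noteq> G p'"
      if "p \<in> I" "p' \<in> I" "fst p = fst p'" for p p'
    proof -
      have t: "l ! fst p \<in> \<Theta>" "snd p \<in> A" "snd p' \<in> A" using that mem by (auto simp: I_def)
      note * = fg(1)[OF t(1)]
      show "F p = F p' \<Longrightarrow> p = p'" "G p = G p' \<Longrightarrow> p = p'" "F p \<noteq> G p'"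
        using * t that unfolding F_def G_def prod_eq_iff inj_on_def
        by auto
    qed
    have *: "inj_on F I" "inj_on G I" "F ` I \<inter> G ` I = {}"
    proof -
      show "inj_on F I" "inj_on G I" unfolding inj_on_def using ne same by metis+
      show "F ` I \<inter> G ` I = {}" unfolding disjoint_iff using ne same by (metis imageE)
    qed
    have FS: "F ` I \<subseteq> S" "G ` I \<subseteq> S" unfolding F_def G_def I_def using fg(1)[OF mem] by (fastforce simp: image_subset_iff)+
    have MF: "MM < N (col (F p)) \<and> MM < N (col (G p))" if "p \<in> I" for p
      using MM(2) FS that by auto
    have "real (card {M\<in>O1. set l \<subseteq> Occ M}) \<le> real (card {M\<in>O1. \<forall>p\<in>I. M (F p) = G p})"
    proof -
      have "{M\<in>O1. set l \<subseteq> Occ M} \<subseteq> {M\<in>O1. \<forall>p\<in>I. M (F p) = G p}"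
      proof safe
        fix M j i assume s: "M \<in> O1" "set l \<subseteq> Occ M" and p: "(j, i) \<in> I"
        hence "l ! j \<in> Occ M" "i \<in> A" using len by (auto simp: I_def)
        thus "M (F (j, i)) = G (j, i)" using Occ(2) s by (simp add: F_def G_def O1_def)
      qed
      thus ?thesis using finO by (intro of_nat_mono card_mono) auto
    qed
    also have "\<dots> \<le> real (card O1) * (\<Prod>p\<in>I. real (E (col (F p)) (col (G p))) /
            ((real (N (col (F p))) - real MM) * (real (N (col (G p))) - real MM)))"
      unfolding O1_def \<Omega>_def
      by (rule typed_partial_bound[OF S _ _ * FS N])
         (use A MM(1) MF in \<open>auto simp: I_def card_cartesian_product\<close>)
    also have "(\<Prod>p\<in>I. real (E (col (F p)) (col (G p))) /
            ((real (N (col (F p))) - real MM) * (real (N (col (G p))) - real MM))) = (\<Prod>j<k. P (l ! j))"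
      unfolding P_def I_def F_def G_def by (subst prod.cartesian_product) (simp add: case_prod_beta)
    also have "real (card O1) * \<dots> \<le> real (card O1) * q ^ k"
    proof (rule mult_left_mono)
      have "(\<Prod>j<k. P (l ! j)) \<le> (\<Prod>j<k. q)"
        by (rule prod_mono) (use P0 q mem in \<open>auto simp: P_def\<close>)
      thus "(\<Prod>j<k. P (l ! j)) \<le> q ^ k" by simp
    qed simp
    finally show "real (card {M\<in>O1. set l \<subseteq> Occ M}) \<le> real (card O1) * q ^ k" .
  qed
  also have "\<dots> = real (card (disjoint_lists fp \<Theta> k)) * (real (card O1) * q ^ k)" by simp
  also have "\<dots> \<le> real (card \<Theta> ^ k) * (real (card O1) * q ^ k)"
  \<comment> \<open>The hypothesis on \<open>q\<close> speaks about elements of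
    \<open>\<Theta>\<close>, so without any of them \<open>q\<close> may be negative; then there is
    no list of positive length and both sides are 0.\<close>
  proof (cases "\<Theta> = {} \<and> k > 0")
    case True
    hence "disjoint_lists fp \<Theta> k = {}" by (auto simp: disjoint_lists_def)
    thus ?thesis using True by (auto simp: power_0_left)
  next
    case False
    have "card (disjoint_lists fp \<Theta> k) \<le> card {l. set l \<subseteq> \<Theta> \<and> length l = k}"
      by (rule card_mono[OF finite_lists_length_eq[OF Th]]) (auto simp: disjoint_lists_def)
    also have "\<dots> = card \<Theta> ^ k" by (rule card_lists_length_eq[OF Th])
    finally have c: "card (disjoint_lists fp \<Theta> k) \<le> card \<Theta> ^ k" .
    have "0 \<le> q ^ k"
    proof (cases "k = 0")
      case False
      then obtain \<theta> where "\<theta> \<in> \<Theta>" using \<open>\<not> (\<Theta> = {} \<and> k > 0)\<close> by auto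
      hence "0 \<le> q" using P0[of \<theta>] q[of \<theta>] by (auto simp: P_def)
      thus ?thesis by simp
    qed simp
    thus ?thesis using c by (intro mult_right_mono) auto
  qed
  finally show ?thesis by (simp add: O1_def power_mult_distrib ac_simps)
qed

section \<open>Exploration of the configuration model\<close>

definition half_edges :: "nat \<Rightarrow> nat \<Rightarrow> (nat \<times> nat) set" where
  "half_edges K n = {1..n} \<times> {..<K}"

text \<open>Increasing enumeration of the numbers other than \<open>j\<close>: it maps
  \<open>{..<K - 1}\<close> onto the ports other than a given \<open>j < K\<close>, and for
  \<open>j = K\<close> it is the identity below \<open>K\<close>.\<close>

definition skip :: "nat \<Rightarrow> nat \<Rightarrow> nat" where
  "skip j i = (if i < j then i else Suc i)"

text \<open>
  \<open>pos K M v w\<close> follows the word \<open>w\<close> from the vertex \<open>v\<close>. It returns the half-edge through which the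
  last vertex is entered; the port of that half-edge is skipped in the next step, so that the walk
  does not backtrack. The fictitious entry port \<open>K\<close> of the start skips nothing.
\<close>

definition pos :: "nat \<Rightarrow> (nat \<times> nat \<Rightarrow> nat \<times> nat) \<Rightarrow> nat \<Rightarrow> nat list \<Rightarrow> nat \<times> nat" where
  "pos K M v w = foldl (\<lambda>he i. M (fst he, skip (snd he) i)) (v, K) w"

lemma pos_Nil [simp]: "pos K M v [] = (v, K)"
  by (simp add: pos_def)

lemma pos_snoc: "pos K M v (w @ [i]) = M (fst (pos K M v w), skip (snd (pos K M v w)) i)"
  by (simp add: pos_def)

lemma skip_neq: "skip j i \<noteq> j" by (auto simp: skip_def)

lemma skip_inj: "skip j i = skip j i' \<longleftrightarrow> i = i'" by (auto simp: skip_def)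

lemma Nil_tree_verts [simp]: "[] \<in> tree_verts K" by (simp add: tree_verts_def)

lemma tree_verts_snoc:
  "w @ [i] \<in> tree_verts K \<longleftrightarrow> w \<in> tree_verts K \<and> i < (if w = [] then K else K - 1)"
proof
  assume a: "w @ [i] \<in> tree_verts K"
  have "w ! j < (if j = 0 then K else K - 1)" if "j < length w" for j
  proof -
    have "(w @ [i]) ! j < (if j = 0 then K else K - 1)"
      using a that unfolding tree_verts_def by simp
    thus ?thesis using that by (simp only: nth_append if_True)
  qed
  moreover have "(w @ [i]) ! length w < (if length w = 0 then K else K - 1)"
    using a unfolding tree_verts_def mem_Collect_eq by auto
  ultimately show "w \<in> tree_verts K \<and> i < (if w = [] then K else K - 1)"
    by (simp add: tree_verts_def)
next
  assume a: "w \<in> tree_verts K \<and> i < (if w = [] then K else K - 1)"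
  show "w @ [i] \<in> tree_verts K"
    unfolding tree_verts_def
  proof (intro CollectI allI impI)
    fix j assume "j < length (w @ [i])"
    then consider "j < length w" | "j = length w" by fastforce
    thus "(w @ [i]) ! j < (if j = 0 then K else K - 1)"
      using a by cases (auto simp: tree_verts_def nth_append split: if_splits)
  qed
qed

lemma pos_range:
  assumes M: "M \<in> matchings (half_edges K n)" and v: "v \<in> {1..n}" and w: "w \<in> tree_verts K"
  shows "fst (pos K M v w) \<in> {1..n} \<and> snd (pos K M v w) \<in> (if w = [] then {K} else {..<K})"
  using w
proof (induction w rule: rev_induct)
  case (snoc i w)
  hence "(fst (pos K M v w), skip (snd (pos K M v w)) i) \<in> half_edges K n"
    by (auto simp: tree_verts_snoc half_edges_def skip_def split: if_splits)
  from matchingsD(1)[OF M this] show ?case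
    by (auto simp: pos_snoc half_edges_def)
qed (use v in auto)

lemma pos_port:
  assumes M: "M \<in> matchings (half_edges K n)" and v: "v \<in> {1..n}" and w: "w @ [i] \<in> tree_verts K"
  shows "(fst (pos K M v w), skip (snd (pos K M v w)) i) \<in> half_edges K n"
  using pos_range[OF M v, of w] w
  by (auto simp: tree_verts_snoc half_edges_def skip_def split: if_splits)

text \<open>Backwards the walk has at most \<open>K\<close> choices per step: the port through which
  the present vertex is entered determines the vertex before it.\<close>

lemma card_pos_preimage:
  assumes M: "M \<in> matchings (half_edges K n)" and w: "w \<in> tree_verts K" and U: "finite U"
  shows "card {v\<in>{1..n}. fst (pos K M v w) \<in> U} \<le> card U * K ^ length w"
  using w U
proof (induction w arbitrary: U rule: rev_induct)
  case Nil
  thus ?case by (auto intro!: card_mono)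
next
  case (snoc i w)
  define U' where "U' = (\<lambda>h. fst (M h)) ` (U \<times> {..<K})"
  have sub: "{v\<in>{1..n}. fst (pos K M v (w @ [i])) \<in> U} \<subseteq> {v\<in>{1..n}. fst (pos K M v w) \<in> U'}"
  proof safe
    fix v assume v: "v \<in> {1..n}" and u: "fst (pos K M v (w @ [i])) \<in> U"
    define h where "h = (fst (pos K M v w), skip (snd (pos K M v w)) i)"
    have h: "h \<in> half_edges K n" unfolding h_def by (rule pos_port[OF M v snoc.prems(1)])
    have "M h \<in> half_edges K n" using matchingsD(1)[OF M h] .
    moreover have "fst (M h) \<in> U" using u by (simp add: pos_snoc h_def)
    ultimately have "M h \<in> U \<times> {..<K}" by (auto simp: half_edges_def)
    hence "fst (M (M h)) \<in> U'" unfolding U'_def by simp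
    thus "fst (pos K M v w) \<in> U'" using matchingsD(3)[OF M] by (simp add: h_def)
  qed
  have "card U' \<le> card U * K"
    unfolding U'_def using snoc.prems(2) card_image_le[of "U \<times> {..<K}" "\<lambda>h. fst (M h)"]
    by simp
  hence "card U' * K ^ length w \<le> card U * K ^ length (w @ [i])"
    by simp
  moreover have "card {v\<in>{1..n}. fst (pos K M v (w @ [i])) \<in> U} \<le> card {v\<in>{1..n}. fst (pos K M v w) \<in> U'}"
    by (rule card_mono[OF _ sub]) simp
  moreover have "card {v\<in>{1..n}. fst (pos K M v w) \<in> U'} \<le> card U' * K ^ length w"
    by (rule snoc.IH) (use snoc.prems in \<open>auto simp: tree_verts_snoc U'_def\<close>)
  ultimately show ?case by linarith
qed

text \<open>\<open>\<theta>\<close> stands for a map that sends each word of \<open>T\<close> to the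
  half-edge through which its vertex is entered. The edge of a word \<open>w\<close> then joins
  \<open>from_port \<theta> w\<close> at the parent to \<open>to_port T u j \<theta> w\<close>; a
  word outside \<open>T\<close> is one that closes a cycle at port \<open>j\<close> of
  \<open>u\<close>.\<close>

definition from_port :: "(nat list \<Rightarrow> nat \<times> nat) \<Rightarrow> nat list \<Rightarrow> nat \<times> nat" where
  "from_port \<theta> w = (fst (\<theta> (butlast w)), skip (snd (\<theta> (butlast w))) (last w))"

definition to_port :: "nat list set \<Rightarrow> nat list \<Rightarrow> nat \<Rightarrow> (nat list \<Rightarrow> nat \<times> nat) \<Rightarrow> nat list \<Rightarrow> nat \<times> nat" where
  "to_port T u j \<theta> w = (if w \<in> T then \<theta> w else (fst (\<theta> u), j))"

text \<open>
  The vertices at which the exploration along \<open>T\<close> sees distinct vertices with marks \<open>x\<close> and, for the words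
  in \<open>A - T\<close>, then runs back into the vertex at \<open>u\<close> through its port \<open>j\<close>.
\<close>

definition pattern_verts where
  "pattern_verts K n X T A x u j M = {v\<in>{1..n}.
     (\<forall>w\<in>T. X (fst (pos K M v w)) = x w) \<and> inj_on (\<lambda>w. fst (pos K M v w)) T \<and>
     (\<forall>w\<in>A - T. pos K M v w = (fst (pos K M v u), j))}"

text \<open>\<open>pattern_tail\<close> with one pattern for each choice of vertices and entry ports
  along \<open>T\<close>: \<open>Nv (x w)\<close> vertices for each word and \<open>K\<close> ports
  for each word but the root. A footprint has at most \<open>card T\<close> vertices, and each of
  the \<open>card T\<close> words reaches such a vertex from at most \<open>K ^ L\<close> starts;
  this is \<open>Q\<close>.\<close>

lemma pattern_verts_tail:
  fixes X :: "nat \<Rightarrow> 'x" and E :: "'x \<Rightarrow> 'x \<Rightarrow> nat" and n K k MM :: nat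
  assumes K: "K \<ge> 1"
    and T: "finite T" "T \<subseteq> tree_verts K" "[] \<in> T" "\<And>w. w \<in> T \<Longrightarrow> length w \<le> L"
    and A: "finite A" "A \<subseteq> tree_verts K - {[]}" "\<And>w. w \<in> A \<Longrightarrow> butlast w \<in> T" "A - T \<subseteq> {ws}"
    and u: "u \<in> T"
    and Nv: "\<And>a. Nv a = card {v\<in>{1..n}. X v = a}"
    and MM: "2 * (k * card A) \<le> MM" "\<And>v. v \<in> {1..n} \<Longrightarrow> MM < K * Nv (X v)"
    and Q: "Q = card T * card T * K ^ L" "real k * real Q \<le> b"
  defines "\<Omega> \<equiv> typed_matchings (half_edges K n) (\<lambda>h. X (fst h)) E"
  shows "real (card {M\<in>\<Omega>. b \<le> real (card (pattern_verts K n X T A x u j M))}) * (b - real k * real Q) ^ k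
     \<le> real (card \<Omega>) * ((\<Prod>w\<in>T. real (Nv (x w)) * (if w = [] then 1 else real K)) *
        (\<Prod>w\<in>A. real (E (x (butlast w)) (x (if w \<in> T then w else u))) /
          ((real (K * Nv (x (butlast w))) - real MM) * (real (K * Nv (x (if w \<in> T then w else u))) - real MM)))) ^ k"
proof -
  define S where "S = half_edges K n"
  define col where "col h = X (fst h)" for h :: "nat \<times> nat"
  have colE: "col = (\<lambda>h. X (fst h))" by (rule ext) (rule col_def)
  have finS: "finite S" by (simp add: S_def half_edges_def)
  have N: "K * Nv a = card {h\<in>S. col h = a}" for a
  proof -
    have "{h\<in>S. col h = a} = {v\<in>{1..n}. X v = a} \<times> {..<K}"
      by (auto simp: S_def half_edges_def col_def)
    thus ?thesis by (simp add: Nv)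
  qed
  define D where "D w = {v\<in>{1..n}. X v = x w} \<times> (if w = [] then {K} else {..<K})" for w :: "nat list"
  define f where "f = from_port"
  define g where "g = to_port T u j"
  define \<Theta> where "\<Theta> = {\<theta> \<in> PiE T D. inj_on (f \<theta>) A \<and> inj_on (g \<theta>) A \<and> f \<theta> ` A \<inter> g \<theta> ` A = {} \<and>
        f \<theta> ` A \<subseteq> S \<and> g \<theta> ` A \<subseteq> S}"
  have finD: "finite (D w)" for w by (simp add: D_def)
  have finPi: "finite (PiE T D)" using T(1) finD by (intro finite_PiE) auto
  have Th: "finite \<Theta>" unfolding \<Theta>_def using finPi by simp
  define PV where "PV = pattern_verts K n X T A x u j"
  define emb where "emb M v = restrict (pos K M v) T" for M v
  define Oc where "Oc M = emb M ` PV M" for M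
  define fp where "fp \<theta> = (\<lambda>w. fst (\<theta> w)) ` T" for \<theta> :: "nat list \<Rightarrow> nat \<times> nat"
  have om: "M \<in> matchings (half_edges K n)" if "M \<in> \<Omega>" for M
    using that by (simp add: \<Omega>_def typed_matchings_def)
  \<comment> \<open>The root entry of the embedding is \<open>(v, K)\<close>, so the start can be
    read off.\<close>
  have inj_emb: "inj_on (emb M) (PV M)" for M
  proof (rule inj_onI)
    fix v v' assume "emb M v = emb M v'"
    hence "emb M v [] = emb M v' []" by simp
    thus "v = v'" using T(3) by (simp add: emb_def)
  qed
  have cOc: "card (Oc M) = card (PV M)" for M
    unfolding Oc_def by (rule card_image[OF inj_emb])
  have fg_emb: "f (emb M v) w = (fst (pos K M v (butlast w)), skip (snd (pos K M v (butlast w))) (last w))"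
       "g (emb M v) w = M (f (emb M v) w)" "f (emb M v) w \<in> S" "w = butlast w @ [last w]"
    if "M \<in> \<Omega>" "v \<in> PV M" "w \<in> A" for M v w
  proof -
    have w: "w = butlast w @ [last w]" using A(2) that(3) by (metis Diff_iff append_butlast_last_id insertI1 subsetD)
    show "w = butlast w @ [last w]" by (rule w)
    show 1: "f (emb M v) w = (fst (pos K M v (butlast w)), skip (snd (pos K M v (butlast w))) (last w))"
      using A(3)[OF that(3)] by (simp add: f_def from_port_def emb_def)
    have p: "pos K M v w = M (f (emb M v) w)"
      unfolding 1 by (subst w) (rule pos_snoc)
    show "g (emb M v) w = M (f (emb M v) w)"
      using that u unfolding p[symmetric]
      by (auto simp: g_def to_port_def emb_def PV_def pattern_verts_def)
    have "butlast w @ [last w] \<in> tree_verts K" using w A(2) that(3) by auto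
    thus "f (emb M v) w \<in> S"
      unfolding 1 S_def using that(2) by (intro pos_port[OF om[OF that(1)]]) (auto simp: PV_def pattern_verts_def)
  qed
  have OcT: "Oc M \<subseteq> \<Theta>" if s: "M \<in> \<Omega>" for M
  proof
    fix \<theta> assume "\<theta> \<in> Oc M"
    then obtain v where v: "v \<in> PV M" and th: "\<theta> = emb M v" by (auto simp: Oc_def)
    have v1: "v \<in> {1..n}" using v by (simp add: PV_def pattern_verts_def)
    note F = fg_emb[OF s v]
    have thPi: "\<theta> \<in> PiE T D"
    proof -
      have "pos K M v w \<in> D w" if "w \<in> T" for w
        using pos_range[OF om[OF s] v1, of w] that T(2) v
        by (auto simp: D_def PV_def pattern_verts_def mem_Times_iff split: if_splits)
      thus ?thesis by (simp add: th emb_def)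
    qed
    have finj: "inj_on (f \<theta>) A"
    proof (rule inj_onI)
      fix w w' assume w: "w \<in> A" "w' \<in> A" "f \<theta> w = f \<theta> w'"
      hence e: "fst (pos K M v (butlast w)) = fst (pos K M v (butlast w'))"
        "skip (snd (pos K M v (butlast w))) (last w) = skip (snd (pos K M v (butlast w'))) (last w')"
        using F(1) by (auto simp: th)
      have "butlast w = butlast w'"
        using e(1) v A(3) w(1,2) by (auto simp: PV_def pattern_verts_def dest: inj_onD)
      moreover hence "last w = last w'" using e(2) by (simp add: skip_inj)
      ultimately show "w = w'" using F(4) w(1,2) by metis
    qed
    have ginj: "inj_on (g \<theta>) A"
    proof (rule inj_onI)
      fix w w' assume w: "w \<in> A" "w' \<in> A" "g \<theta> w = g \<theta> w'"
      hence "f \<theta> w = f \<theta> w'" using F(2) inj_matching[OF om[OF s]] by (simp add: th inj_eq)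
      thus "w = w'" using finj w by (auto dest: inj_onD)
    qed
    have ne: "f \<theta> w \<noteq> \<theta> w'" if w: "w \<in> A" "w' \<in> T" for w w'
    proof
      assume e: "f \<theta> w = \<theta> w'"
      have "\<theta> w' = pos K M v w'" using w by (simp add: th emb_def)
      hence e2: "fst (pos K M v (butlast w)) = fst (pos K M v w')"
        "skip (snd (pos K M v (butlast w))) (last w) = snd (pos K M v w')"
        using F(1)[OF w(1)] e by (auto simp: th prod_eq_iff)
      have "butlast w = w'"
        using e2(1) v A(3) w by (auto simp: PV_def pattern_verts_def dest: inj_onD)
      thus False using e2(2) skip_neq by simp
    qed
    \<comment> \<open>If a departing half-edge is also an arriving one, both words lie outside
      \<open>T\<close>. There is at most one such word, so the half-edge would be its own
      partner.\<close>
    have "f \<theta> w \<noteq> g \<theta> w'" if w: "w \<in> A" "w' \<in> A" for w w'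
    proof
      assume e: "f \<theta> w = g \<theta> w'"
      have wT': "w' \<notin> T" using ne[OF w(1), of w'] e by (auto simp: g_def to_port_def)
      have e2: "g \<theta> w = f \<theta> w'"
        using e F(2)[OF w(1)] F(2)[OF w(2)] matchingsD(3)[OF om[OF s]] by (simp add: th)
      hence "w \<notin> T" using ne[OF w(2), of w] by (auto simp: g_def to_port_def)
      hence "w = w'" using A(4) w wT' by auto
      hence "M (f \<theta> w) = f \<theta> w" using e F(2)[OF w(1)] by (simp add: th)
      thus False using matchingsD(2)[OF om[OF s]] F(3)[OF w(1)] by (simp add: th S_def)
    qed
    hence dj: "f \<theta> ` A \<inter> g \<theta> ` A = {}" by blast
    have fS: "f \<theta> ` A \<subseteq> S" using F(3) unfolding th by auto
    have "g \<theta> w \<in> S" if "w \<in> A" for w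
      using F(2,3)[OF that] matchingsD(1)[OF om[OF s], of "f \<theta> w"] by (simp add: th S_def)
    hence gS: "g \<theta> ` A \<subseteq> S" by auto
    show "\<theta> \<in> \<Theta>" unfolding \<Theta>_def using thPi finj ginj dj fS gS by blast
  qed
  have thT: "fst (\<theta> w) \<in> {1..n}" "X (fst (\<theta> w)) = x w" if "\<theta> \<in> \<Theta>" "w \<in> T" for \<theta> w
  proof -
    have "\<theta> w \<in> D w" using that by (auto simp: \<Theta>_def)
    thus "fst (\<theta> w) \<in> {1..n}" "X (fst (\<theta> w)) = x w" by (auto simp: D_def)
  qed
  define tg where "tg w = (if w \<in> T then w else u)" for w
  have tgT: "tg w \<in> T" for w using u by (simp add: tg_def)
  have fstf: "fst (f \<theta> w) = fst (\<theta> (butlast w))" "fst (g \<theta> w) = fst (\<theta> (tg w))" for \<theta> w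
    by (auto simp: f_def g_def from_port_def to_port_def tg_def)
  define q where "q = (\<Prod>w\<in>A. real (E (x (butlast w)) (x (tg w))) /
          ((real (K * Nv (x (butlast w))) - real MM) * (real (K * Nv (x (tg w))) - real MM)))"
  have q_nonneg: "0 \<le> q" if lt: "\<And>w. w \<in> T \<Longrightarrow> real MM \<le> real (K * Nv (x w))"
    unfolding q_def
  proof (intro prod_nonneg divide_nonneg_nonneg mult_nonneg_nonneg)
    fix w assume "w \<in> A"
    show "0 \<le> real (K * Nv (x (butlast w))) - real MM" using lt[OF A(3)[OF \<open>w \<in> A\<close>]] by linarith
    show "0 \<le> real (K * Nv (x (tg w))) - real MM" using lt[OF tgT[of w]] by linarith
  qed (rule of_nat_0_le_iff)
  have conf: "card {\<theta>'\<in>Oc M. fp \<theta> \<inter> fp \<theta>' \<noteq> {}} \<le> Q" if s: "M \<in> \<Omega>" for M \<theta>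
  proof -
    have "{\<theta>'\<in>Oc M. fp \<theta> \<inter> fp \<theta>' \<noteq> {}} \<subseteq> emb M ` (\<Union>w\<in>T. {v\<in>{1..n}. fst (pos K M v w) \<in> fp \<theta>})"
    proof
      fix \<theta>' assume "\<theta>' \<in> {\<theta>'\<in>Oc M. fp \<theta> \<inter> fp \<theta>' \<noteq> {}}"
      then obtain y where "\<theta>' \<in> Oc M" and y: "y \<in> fp \<theta>" "y \<in> fp \<theta>'" by blast
      then obtain v where v: "v \<in> PV M" "\<theta>' = emb M v" by (auto simp: Oc_def)
      obtain w where "w \<in> T" "y = fst (\<theta>' w)" using y(2) by (auto simp: fp_def)
      hence "w \<in> T" "fst (pos K M v w) \<in> fp \<theta>" using v(2) y(1) by (auto simp: emb_def)
      moreover have "v \<in> {1..n}" using v(1) by (simp add: PV_def pattern_verts_def)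
      ultimately show "\<theta>' \<in> emb M ` (\<Union>w\<in>T. {v\<in>{1..n}. fst (pos K M v w) \<in> fp \<theta>})"
        using v(2) by blast
    qed
    hence "card {\<theta>'\<in>Oc M. fp \<theta> \<inter> fp \<theta>' \<noteq> {}} \<le> card (\<Union>w\<in>T. {v\<in>{1..n}. fst (pos K M v w) \<in> fp \<theta>})"
      using T(1) by (intro surj_card_le) auto
    also have "\<dots> \<le> (\<Sum>w\<in>T. card {v\<in>{1..n}. fst (pos K M v w) \<in> fp \<theta>})"
      by (rule card_UN_le[OF T(1)])
    also have "\<dots> \<le> (\<Sum>w\<in>T. card T * K ^ L)"
    proof (rule sum_mono)
      fix w assume w: "w \<in> T"
      have "card {v\<in>{1..n}. fst (pos K M v w) \<in> fp \<theta>} \<le> card (fp \<theta>) * K ^ length w"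
        by (rule card_pos_preimage[OF om[OF s]]) (use w T in \<open>auto simp: fp_def\<close>)
      also have "\<dots> \<le> card T * K ^ L"
        by (intro mult_le_mono power_increasing T(4) w K) (simp add: fp_def card_image_le T(1))
      finally show "card {v\<in>{1..n}. fst (pos K M v w) \<in> fp \<theta>} \<le> card T * K ^ L" .
    qed
    also have "\<dots> = Q" by (simp add: Q)
    finally show ?thesis .
  qed
  let ?R = "\<Prod>w\<in>T. real (Nv (x w)) * (if w = [] then 1 else real K)"
  have "real (card {M\<in>typed_matchings S col E. b \<le> real (card (Oc M))}) * (b - real k * real Q) ^ k
     \<le> real (card (typed_matchings S col E)) * (real (card \<Theta>) * q) ^ k"
  proof (rule pattern_tail[where f = f and g = g and A = A and N = "\<lambda>a. K * Nv a" and vtx = fst and fp = fp and MM = MM])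
    have "col = (\<lambda>h. X (fst h))" by (rule ext) (rule col_def)
    hence OmS: "typed_matchings S col E = \<Omega>" by (simp add: \<Omega>_def S_def)
    show "Oc M \<subseteq> \<Theta>" if "M \<in> typed_matchings S col E" for M using OcT that OmS by simp
    show "M (f \<theta> i) = g \<theta> i" if "M \<in> typed_matchings S col E" "\<theta> \<in> Oc M" "i \<in> A" for M \<theta> i
      using that fg_emb(2) OmS by (auto simp: Oc_def)
    show "inj_on (f \<theta>) A \<and> inj_on (g \<theta>) A \<and> f \<theta> ` A \<inter> g \<theta> ` A = {} \<and> f \<theta> ` A \<subseteq> S \<and> g \<theta> ` A \<subseteq> S"
      if "\<theta> \<in> \<Theta>" for \<theta> using that by (simp add: \<Theta>_def)
    show "fst (f \<theta> i) \<in> fp \<theta> \<and> fst (g \<theta> i) \<in> fp \<theta>" if "i \<in> A" for \<theta> i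
      using A(3)[OF that] tgT by (auto simp: fstf fp_def)
    show "MM < K * Nv (col h)" if "h \<in> S" for h
      using MM(2) that by (auto simp: S_def half_edges_def col_def)
    show "(\<Prod>i\<in>A. real (E (col (f \<theta> i)) (col (g \<theta> i))) /
            ((real (K * Nv (col (f \<theta> i))) - real MM) * (real (K * Nv (col (g \<theta> i))) - real MM))) \<le> q"
      if "\<theta> \<in> \<Theta>" for \<theta>
      unfolding q_def
    proof (rule eq_refl, rule prod.cong)
      fix i assume i: "i \<in> A"
      have "col (f \<theta> i) = x (butlast i)" "col (g \<theta> i) = x (tg i)"
        unfolding col_def fstf by (rule thT(2)[OF that A(3)[OF i]], rule thT(2)[OF that tgT])
      thus "real (E (col (f \<theta> i)) (col (g \<theta> i))) /
            ((real (K * Nv (col (f \<theta> i))) - real MM) * (real (K * Nv (col (g \<theta> i))) - real MM)) =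
          real (E (x (butlast i)) (x (tg i))) /
          ((real (K * Nv (x (butlast i))) - real MM) * (real (K * Nv (x (tg i))) - real MM))" by simp
    qed simp
    show "card {\<theta>'\<in>Oc M. fp \<theta> \<inter> fp \<theta>' \<noteq> {}} \<le> Q" if "M \<in> typed_matchings S col E" for M \<theta>
      using conf that OmS by simp
  qed (use finS A(1) Th N MM(1) Q in auto)
  also have "\<dots> \<le> real (card (typed_matchings S col E)) *
     (?R * q) ^ k"
  proof (cases "\<Theta> = {}")
    case True
    \<comment> \<open>Without embeddings the right-hand side must still be nonnegative: either all
      marks of the pattern occur, and the denominators in \<open>q\<close> are nonnegative, or the
      first product has a factor 0.\<close>
    have q0: "0 \<le> ?R * q"
    proof (cases "\<forall>w\<in>T. Nv (x w) \<noteq> 0")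
      case True
      have lt: "real MM \<le> real (K * Nv (x w))" if w: "w \<in> T" for w
      proof -
        have "{v\<in>{1..n}. X v = x w} \<noteq> {}" using True w unfolding Nv by simp
        then obtain v where "v \<in> {1..n}" "X v = x w" by auto
        thus ?thesis using MM(2)[of v] by (metis less_imp_le of_nat_le_iff)
      qed
      show ?thesis by (intro mult_nonneg_nonneg prod_nonneg q_nonneg[OF lt]) simp_all
    next
      case False
      then obtain w where "w \<in> T" "Nv (x w) = 0" by blast
      hence "?R = 0"
        using T(1) by (intro prod_zero bexI[of _ w]) simp_all
      thus ?thesis by simp
    qed
    have "(real (card \<Theta>) * q) ^ k \<le> (?R * q) ^ k"
    proof (rule power_mono)
      show "real (card \<Theta>) * q \<le> ?R * q"
        using q0 unfolding True by simp
      show "0 \<le> real (card \<Theta>) * q" unfolding True by simp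
    qed
    thus ?thesis by (rule mult_left_mono) simp
  next
    case False
    then obtain \<theta> where \<theta>: "\<theta> \<in> \<Theta>" by auto
    have q0: "0 \<le> q"
    proof (rule q_nonneg)
      fix w assume w: "w \<in> T"
      show "real MM \<le> real (K * Nv (x w))"
        using MM(2)[OF thT(1)[OF \<theta> w]] thT(2)[OF \<theta> w] by (metis less_imp_le of_nat_le_iff)
    qed
    have "card \<Theta> \<le> card (PiE T D)" by (rule card_mono[OF finPi]) (auto simp: \<Theta>_def)
    also have "\<dots> = (\<Prod>w\<in>T. card (D w))" by (rule card_PiE[OF T(1)])
    also have "\<dots> = (\<Prod>w\<in>T. Nv (x w) * (if w = [] then 1 else K))"
      by (rule prod.cong) (auto simp: D_def card_cartesian_product Nv)
    finally have "real (card \<Theta>) \<le> real (\<Prod>w\<in>T. Nv (x w) * (if w = [] then 1 else K))" by (simp only: of_nat_le_iff)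
    also have "\<dots> = ?R"
      unfolding of_nat_prod by (rule prod.cong) simp_all
    finally have "real (card \<Theta>) * q \<le> ?R * q"
      by (rule mult_right_mono[OF _ q0])
    thus ?thesis
      by (rule mult_left_mono[OF power_mono[OF _ mult_nonneg_nonneg[OF of_nat_0_le_iff q0]] of_nat_0_le_iff])
  qed
  finally show ?thesis
    unfolding cOc q_def tg_def colE S_def \<Omega>_def PV_def .
qed

section \<open>Counting matchings between two marks\<close>

definition cross_matchings :: "'h set \<Rightarrow> 'h set \<Rightarrow> nat \<Rightarrow> ('h \<Rightarrow> 'h) set" where
  "cross_matchings P Q s = {M \<in> matchings (P \<union> Q). card {h\<in>P. M h \<in> Q} = s}"

lemma matchings_fix_pair:
  assumes "h \<in> S" "k \<in> S" "h \<noteq> k"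
  shows "bij_betw (\<lambda>M. M(h := h, k := k)) {M\<in>matchings S. M h = k} (matchings (S - {h, k}))"
proof (rule bij_betwI[where g = "\<lambda>\<tau>. \<tau>(h := k, k := h)"])
  show "(\<lambda>M. M(h := h, k := k)) \<in> {M\<in>matchings S. M h = k} \<rightarrow> matchings (S - {h, k})"
  proof
    fix M assume s: "M \<in> {M\<in>matchings S. M h = k}"
    hence m: "M \<in> matchings S" and hk: "M h = k" "M k = h" using matchingsD(3)[of M S h] by auto
    have ne: "M x \<noteq> h" "M x \<noteq> k" if "x \<noteq> h" "x \<noteq> k" for x
      using hk matchingsD(3)[OF m, of x] that by metis+
    show "M(h := h, k := k) \<in> matchings (S - {h, k})"
      using matchingsD[OF m] ne by (auto simp: matchings_def)
  qed
  show "(\<lambda>\<tau>. \<tau>(h := k, k := h)) \<in> matchings (S - {h, k}) \<rightarrow> {M\<in>matchings S. M h = k}"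
  proof
    fix \<tau> assume m: "\<tau> \<in> matchings (S - {h, k})"
    have ne: "\<tau> x \<noteq> h" "\<tau> x \<noteq> k" if "x \<noteq> h" "x \<noteq> k" for x
      using matchingsD(1,4)[OF m, of x] that by (cases "x \<in> S"; auto)+
    show "\<tau>(h := k, k := h) \<in> {M\<in>matchings S. M h = k}"
      using matchingsD[OF m] assms by (auto simp: matchings_def)
  qed
  show "(M(h := h, k := k))(h := k, k := h) = M" if "M \<in> {M\<in>matchings S. M h = k}" for M
    using that matchingsD(3)[of M S h] by auto
  show "(\<tau>(h := k, k := h))(h := h, k := k) = \<tau>" if "\<tau> \<in> matchings (S - {h, k})" for \<tau>
    using matchingsD(4)[OF that, of h] matchingsD(4)[OF that, of k] by auto
qed

lemma matchings_empty: "matchings {} = {\<lambda>x. x}"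
  by (auto simp: matchings_def)

lemma cross_matchings_swap:
  assumes "finite P" "finite Q"
  shows "cross_matchings P Q s = cross_matchings Q P s"
proof -
  have "card {h\<in>P. M h \<in> Q} = card {h\<in>Q. M h \<in> P}" if "M \<in> matchings (P \<union> Q)" for M
  proof -
    have "bij_betw M {h\<in>P. M h \<in> Q} {h\<in>Q. M h \<in> P}"
      by (rule bij_betwI[where g = M]) (auto simp: matchingsD(3)[OF that])
    thus ?thesis by (rule bij_betw_same_card)
  qed
  thus ?thesis by (auto simp: cross_matchings_def Un_commute)
qed

text \<open>Distinction by the partner \<open>k\<close> of \<open>h\<close>: a partner in
  \<open>P\<close> leaves the number \<open>s\<close> of crossing pairs unchanged, a partner in
  \<open>Q\<close> uses up one of them.\<close>

lemma card_cross_matchings_step: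
  assumes fin: "finite P" "finite Q" "P \<inter> Q = {}" and h: "h \<in> P"
  shows "card (cross_matchings P Q s) = (\<Sum>k\<in>P - {h}. card (cross_matchings (P - {h, k}) Q s)) +
     (if s = 0 then 0 else (\<Sum>k\<in>Q. card (cross_matchings (P - {h}) (Q - {k}) (s - 1))))"
proof -
  define C where "C = cross_matchings P Q s"
  have finC: "finite C" unfolding C_def cross_matchings_def
    using finite_matchings[of "P \<union> Q"] fin by simp
  have sub: "M h \<in> (P - {h}) \<union> Q" if "M \<in> C" for M
    using that h matchingsD(1,2)[of M "P \<union> Q" h] by (auto simp: C_def cross_matchings_def)
  have "C = (\<Union>k\<in>(P - {h}) \<union> Q. {M\<in>C. M h = k})" using sub by auto
  hence "card C = (\<Sum>k\<in>(P - {h}) \<union> Q. card {M\<in>C. M h = k})"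
    using card_UN_disjoint[of "(P - {h}) \<union> Q" "\<lambda>k. {M\<in>C. M h = k}"] fin finC by auto
  also have "\<dots> = (\<Sum>k\<in>P - {h}. card {M\<in>C. M h = k}) + (\<Sum>k\<in>Q. card {M\<in>C. M h = k})"
    by (rule sum.union_disjoint) (use fin in auto)
  also have "(\<Sum>k\<in>P - {h}. card {M\<in>C. M h = k}) = (\<Sum>k\<in>P - {h}. card (cross_matchings (P - {h, k}) Q s))"
  proof (rule sum.cong)
    fix k assume k: "k \<in> P - {h}"
    have kQ: "k \<notin> Q" "h \<notin> Q" using k h fin(3) by auto
    have S: "P \<union> Q - {h, k} = P - {h, k} \<union> Q" using kQ by auto
    have b: "bij_betw (\<lambda>M. M(h := h, k := k)) {M\<in>matchings (P \<union> Q). M h = k} (matchings (P - {h, k} \<union> Q))"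
      using matchings_fix_pair[of h "P \<union> Q" k] h k S by auto
    have "bij_betw (\<lambda>M. M(h := h, k := k)) {M\<in>C. M h = k} (cross_matchings (P - {h, k}) Q s)"
    proof (rule bij_betw_imageI)
      show "inj_on (\<lambda>M. M(h := h, k := k)) {M\<in>C. M h = k}"
        by (rule inj_on_subset[OF bij_betw_imp_inj_on[OF b]]) (auto simp: C_def cross_matchings_def)
      have eq: "{x\<in>P - {h, k}. (M(h := h, k := k)) x \<in> Q} = {x\<in>P. M x \<in> Q}"
        if "M \<in> matchings (P \<union> Q)" "M h = k" for M
        using that kQ matchingsD(3)[OF that(1), of h] by auto
      show "(\<lambda>M. M(h := h, k := k)) ` {M\<in>C. M h = k} = cross_matchings (P - {h, k}) Q s"
      proof (intro equalityI subsetI)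
        fix \<tau> assume "\<tau> \<in> (\<lambda>M. M(h := h, k := k)) ` {M\<in>C. M h = k}"
        then obtain M where s: "M \<in> matchings (P \<union> Q)" "M h = k" "card {x\<in>P. M x \<in> Q} = s" "\<tau> = M(h := h, k := k)"
          by (auto simp: C_def cross_matchings_def)
        thus "\<tau> \<in> cross_matchings (P - {h, k}) Q s"
          using eq[OF s(1,2)] bij_betw_apply[OF b, of M] unfolding cross_matchings_def by simp
      next
        fix \<tau> assume t: "\<tau> \<in> cross_matchings (P - {h, k}) Q s"
        hence "\<tau> \<in> (\<lambda>M. M(h := h, k := k)) ` {M\<in>matchings (P \<union> Q). M h = k}"
          using bij_betw_imp_surj_on[OF b] by (simp add: cross_matchings_def)
        then obtain M where s: "M \<in> matchings (P \<union> Q)" "M h = k" "\<tau> = M(h := h, k := k)" by auto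
        hence "M \<in> {M\<in>C. M h = k}" using t eq[OF s(1,2)] by (simp add: C_def cross_matchings_def)
        thus "\<tau> \<in> (\<lambda>M. M(h := h, k := k)) ` {M\<in>C. M h = k}" using s(3) by blast
      qed
    qed
    thus "card {M\<in>C. M h = k} = card (cross_matchings (P - {h, k}) Q s)"
      by (rule bij_betw_same_card)
  qed simp
  also have "(\<Sum>k\<in>Q. card {M\<in>C. M h = k}) =
     (if s = 0 then 0 else (\<Sum>k\<in>Q. card (cross_matchings (P - {h}) (Q - {k}) (s - 1))))"
  proof (cases "s = 0")
    case True
    have "{M\<in>C. M h = k} = {}" if "k \<in> Q" for k
    proof (rule ccontr)
      assume "{M\<in>C. M h = k} \<noteq> {}"
      then obtain M where "M \<in> C" "M h = k" by auto
      hence "{x\<in>P. M x \<in> Q} = {}"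
        using True fin(1) by (simp add: C_def cross_matchings_def)
      thus False using \<open>M h = k\<close> that h by auto
    qed
    hence "card {M\<in>C. M h = k} = 0" if "k \<in> Q" for k using that by (simp only: card.empty)
    thus ?thesis using True by simp
  next
    case False
    have "(\<Sum>k\<in>Q. card {M\<in>C. M h = k}) = (\<Sum>k\<in>Q. card (cross_matchings (P - {h}) (Q - {k}) (s - 1)))"
    proof (rule sum.cong)
      fix k assume k: "k \<in> Q"
      have kQ: "k \<notin> P" "h \<notin> Q" "h \<noteq> k" using k h fin(3) by auto
      have S: "P \<union> Q - {h, k} = P - {h} \<union> (Q - {k})" using kQ by auto
      have b: "bij_betw (\<lambda>M. M(h := h, k := k)) {M\<in>matchings (P \<union> Q). M h = k} (matchings (P - {h} \<union> (Q - {k})))"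
        using matchings_fix_pair[of h "P \<union> Q" k] h k S kQ by auto
      have "bij_betw (\<lambda>M. M(h := h, k := k)) {M\<in>C. M h = k} (cross_matchings (P - {h}) (Q - {k}) (s - 1))"
      proof (rule bij_betw_imageI)
        show "inj_on (\<lambda>M. M(h := h, k := k)) {M\<in>C. M h = k}"
          by (rule inj_on_subset[OF bij_betw_imp_inj_on[OF b]]) (auto simp: C_def cross_matchings_def)
        have eq: "card {x\<in>P. M x \<in> Q} = Suc (card {x\<in>P - {h}. (M(h := h, k := k)) x \<in> Q - {k}})"
          if "M \<in> matchings (P \<union> Q)" "M h = k" for M
        proof -
          have "M x \<noteq> k" if "x \<noteq> h" for x
            using that \<open>M h = k\<close> inj_matching[OF \<open>M \<in> matchings (P \<union> Q)\<close>] by (auto dest: injD)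
          hence "{x\<in>P. M x \<in> Q} = insert h {x\<in>P - {h}. (M(h := h, k := k)) x \<in> Q - {k}}"
            using that kQ k h by auto
          thus ?thesis using fin(1) by simp
        qed
        show "(\<lambda>M. M(h := h, k := k)) ` {M\<in>C. M h = k} = cross_matchings (P - {h}) (Q - {k}) (s - 1)"
        proof (intro equalityI subsetI)
          fix \<tau> assume "\<tau> \<in> (\<lambda>M. M(h := h, k := k)) ` {M\<in>C. M h = k}"
          then obtain M where s: "M \<in> matchings (P \<union> Q)" "M h = k" "card {x\<in>P. M x \<in> Q} = s" "\<tau> = M(h := h, k := k)"
            by (auto simp: C_def cross_matchings_def)
          thus "\<tau> \<in> cross_matchings (P - {h}) (Q - {k}) (s - 1)"
            using eq[OF s(1,2)] bij_betw_apply[OF b, of M] unfolding cross_matchings_def by simp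
        next
          fix \<tau> assume t: "\<tau> \<in> cross_matchings (P - {h}) (Q - {k}) (s - 1)"
          hence "\<tau> \<in> (\<lambda>M. M(h := h, k := k)) ` {M\<in>matchings (P \<union> Q). M h = k}"
            using bij_betw_imp_surj_on[OF b] by (simp add: cross_matchings_def)
          then obtain M where s: "M \<in> matchings (P \<union> Q)" "M h = k" "\<tau> = M(h := h, k := k)" by auto
          hence "M \<in> {M\<in>C. M h = k}"
            using t eq[OF s(1,2)] False by (simp add: C_def cross_matchings_def)
          thus "\<tau> \<in> (\<lambda>M. M(h := h, k := k)) ` {M\<in>C. M h = k}" using s(3) by blast
        qed
      qed
      thus "card {M\<in>C. M h = k} = card (cross_matchings (P - {h}) (Q - {k}) (s - 1))"
        by (rule bij_betw_same_card)
    qed simp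
    thus ?thesis using False by simp
  qed
  finally show ?thesis unfolding C_def .
qed

lemma cross_matchings_none:
  assumes "finite P" "card P < s" shows "cross_matchings P Q s = {}"
proof -
  have "card {h\<in>P. M h \<in> Q} \<noteq> s" for M
    using card_mono[OF assms(1), of "{h\<in>P. M h \<in> Q}"] assms(2) by auto
  thus ?thesis by (auto simp: cross_matchings_def)
qed

text \<open>Choose the \<open>s\<close> crossing elements on both sides, join them in
  \<open>fact s\<close> ways, and pair the remaining \<open>2 * a\<close> and \<open>2 * b\<close>
  elements among themselves, in \<open>fact (2 * a) / (fact a * 2 ^ a)\<close> ways on the first
  side. The identity is multiplied out to stay in the natural numbers.\<close>

lemma card_cross_matchings:
  assumes "finite P" "finite Q" "P \<inter> Q = {}" "card P = s + 2 * a" "card Q = s + 2 * b"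
  shows "card (cross_matchings P Q s) * (fact s * fact a * fact b * 2 ^ (a + b)) = fact (s + 2 * a) * fact (s + 2 * b)"
  using assms
proof (induction "s + a + b" arbitrary: P Q s a b rule: less_induct)
  case less
  \<comment> \<open>The recursion needs an element of the first set. An empty first set is handled
    by exchanging the two sets, hence the generality in all parameters.\<close>
  have main: "card (cross_matchings P Q s) * (fact s * fact a * fact b * 2 ^ (a + b)) = fact (s + 2 * a) * fact (s + 2 * b)"
    if PQ: "finite P" "finite Q" "P \<inter> Q = {}" "card P = s + 2 * a" "card Q = s + 2 * b" and h: "h \<in> P"
      and IH: "\<And>P' Q' s' a' b'. s' + a' + b' < s + a + b \<Longrightarrow> finite P' \<Longrightarrow> finite Q' \<Longrightarrow> P' \<inter> Q' = {} \<Longrightarrow>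
        card P' = s' + 2 * a' \<Longrightarrow> card Q' = s' + 2 * b' \<Longrightarrow>
        card (cross_matchings (P' :: 'a set) Q' s') * (fact s' * fact a' * fact b' * 2 ^ (a' + b')) = fact (s' + 2 * a') * fact (s' + 2 * b')"
    for P Q :: "'a set" and s a b h
  proof -
    define Z where "Z = (fact s * fact a * fact b * 2 ^ (a + b) :: nat)"
    define R where "R = (fact (s + 2 * a) * fact (s + 2 * b) :: nat)"
    have p0: "s + 2 * a > 0" using PQ h by auto
    \<comment> \<open>In the claimed count a fraction \<open>2 * a / (s + 2 * a)\<close> of the
      matchings pairs \<open>h\<close> within \<open>P\<close>; \<open>B\<close> is the
      complementary fraction \<open>s / (s + 2 * a)\<close>.\<close>
    have A: "(s + 2 * a) * ((\<Sum>k\<in>P - {h}. card (cross_matchings (P - {h, k}) Q s)) * Z) = 2 * a * R"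
    proof (cases a)
      case 0
      have "cross_matchings (P - {h, k}) Q s = {}" if "k \<in> P - {h}" for k
      proof (rule cross_matchings_none)
        have "card (P - {h, k}) < card P" by (rule psubset_card_mono[OF PQ(1)]) (use h in auto)
        thus "card (P - {h, k}) < s" using PQ 0 by simp
      qed (use PQ in simp)
      thus ?thesis using 0 by simp
    next
      case (Suc a')
      have c: "card (cross_matchings (P - {h, k}) Q s) * Z * ((s + 2 * a) * (s + 2 * a - 1)) = 2 * a * R" if k: "k \<in> P - {h}" for k
      proof -
        have cc: "card (P - {h, k}) = s + 2 * a'"
          using h k PQ Suc by auto
        have "card (cross_matchings (P - {h, k}) Q s) * (fact s * fact a' * fact b * 2 ^ (a' + b)) = fact (s + 2 * a') * fact (s + 2 * b)"
          by (rule IH) (use PQ Suc cc in auto)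
        moreover have "Z = 2 * a * (fact s * fact a' * fact b * 2 ^ (a' + b))"
          unfolding Z_def Suc by (simp add: algebra_simps)
        ultimately have "card (cross_matchings (P - {h, k}) Q s) * Z = 2 * a * (fact (s + 2 * a') * fact (s + 2 * b))"
          by simp
        moreover have "R = (s + 2 * a) * (s + 2 * a - 1) * (fact (s + 2 * a') * fact (s + 2 * b))"
          unfolding R_def Suc by (simp add: algebra_simps)
        ultimately show ?thesis by simp
      qed
      have cP: "card (P - {h}) = s + 2 * a - 1" using h PQ by simp
      have "(s + 2 * a - 1) * ((s + 2 * a) * ((\<Sum>k\<in>P - {h}. card (cross_matchings (P - {h, k}) Q s)) * Z))
         = (\<Sum>k\<in>P - {h}. card (cross_matchings (P - {h, k}) Q s) * Z * ((s + 2 * a) * (s + 2 * a - 1)))"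
        by (simp add: sum_distrib_left ac_simps)
      also have "\<dots> = (\<Sum>k\<in>P - {h}. 2 * a * R)" by (rule sum.cong) (use c in auto)
      also have "\<dots> = (s + 2 * a - 1) * (2 * a * R)" using cP by simp
      finally show ?thesis using Suc by (subst (asm) mult_cancel1) simp
    qed
    have B: "(s + 2 * a) * ((if s = 0 then 0 else (\<Sum>k\<in>Q. card (cross_matchings (P - {h}) (Q - {k}) (s - 1)))) * Z) = s * R"
    proof (cases s)
      case 0 thus ?thesis by simp
    next
      case (Suc s')
      have c: "card (cross_matchings (P - {h}) (Q - {k}) (s - 1)) * Z * ((s + 2 * a) * (s + 2 * b)) = s * R" if k: "k \<in> Q" for k
      proof -
        have "card (cross_matchings (P - {h}) (Q - {k}) s') * (fact s' * fact a * fact b * 2 ^ (a + b)) = fact (s' + 2 * a) * fact (s' + 2 * b)"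
          by (rule IH) (use PQ h k Suc in auto)
        moreover have "Z = s * (fact s' * fact a * fact b * 2 ^ (a + b))"
          unfolding Z_def Suc by (simp add: algebra_simps)
        ultimately have m1: "card (cross_matchings (P - {h}) (Q - {k}) s') * Z = s * (fact (s' + 2 * a) * fact (s' + 2 * b))"
          by simp
        have m2: "R = (s + 2 * a) * (s + 2 * b) * (fact (s' + 2 * a) * fact (s' + 2 * b))"
          unfolding R_def Suc by (simp add: algebra_simps)
        have e: "s - 1 = s'" using Suc by simp
        show ?thesis unfolding e m1 m2 by simp
      qed
      have "(s + 2 * b) * ((s + 2 * a) * ((\<Sum>k\<in>Q. card (cross_matchings (P - {h}) (Q - {k}) (s - 1))) * Z))
         = (\<Sum>k\<in>Q. card (cross_matchings (P - {h}) (Q - {k}) (s - 1)) * Z * ((s + 2 * a) * (s + 2 * b)))"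
        by (simp add: sum_distrib_left ac_simps)
      also have "\<dots> = (\<Sum>k\<in>Q. s * R)" by (rule sum.cong) (use c in auto)
      also have "\<dots> = (s + 2 * b) * (s * R)" using PQ by simp
      finally show ?thesis using Suc by (subst (asm) mult_cancel1) simp
    qed
    have "(s + 2 * a) * (card (cross_matchings P Q s) * Z) = 2 * a * R + s * R"
      unfolding card_cross_matchings_step[OF PQ(1-3) h] using A B by (simp only: distrib_left distrib_right)
    hence "(s + 2 * a) * (card (cross_matchings P Q s) * Z) = (s + 2 * a) * R"
      by (simp only: distrib_right add.commute)
    hence "card (cross_matchings P Q s) * Z = R" using nat_mult_eq_cancel1[OF p0] by blast
    thus ?thesis unfolding Z_def R_def .
  qed
  show ?case
  proof (cases "P = {}")
    case False
    then obtain h where "h \<in> P" by auto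
    show ?thesis by (rule main[OF less.prems \<open>h \<in> P\<close>]) (rule less.hyps, auto)
  next
    case True
    hence sa: "s = 0" "a = 0" using less.prems by auto
    show ?thesis
    proof (cases "Q = {}")
      case True
      thus ?thesis using \<open>P = {}\<close> less.prems by (simp add: cross_matchings_def matchings_empty)
    next
      case False
      then obtain h where h: "h \<in> Q" by auto
      have "card (cross_matchings Q P s) * (fact s * fact b * fact a * 2 ^ (b + a)) = fact (s + 2 * b) * fact (s + 2 * a)"
        by (rule main[OF less.prems(2,1) _ less.prems(5,4) h]) (use less.prems in \<open>auto intro: less.hyps\<close>)
      thus ?thesis
        using cross_matchings_swap[OF less.prems(1,2)] by (simp add: ac_simps)
    qed
  qed
qed

section \<open>Stirling bounds\<close>

definition xlx :: "real \<Rightarrow> real" where "xlx x = x * ln x"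

lemma xlx_0 [simp]: "xlx 0 = 0" and xlx_1 [simp]: "xlx 1 = 0"
  by (simp_all add: xlx_def)

text \<open>Induction with \<open>1 / (x + 1) \<le> ln (x + 1) - ln x \<le> 1 / x\<close>. A
  logarithmic error suffices, because counts matter only up to factors subexponential in
  \<open>n\<close>.\<close>

lemma ln_fact_bounds:
  "xlx (real k) - real k \<le> ln (fact k)"
  "ln (fact k) \<le> xlx (real k) - real k + ln (real k + 1) + 1"
proof -
  have "xlx (real k) - real k \<le> ln (fact k) \<and>
      ln (fact k) \<le> xlx (real k) - real k + (if k = 0 then 0 else ln (real k)) + 1"
  proof (induction k)
    case 0 thus ?case by simp
  next
    case (Suc k)
    define x where "x = real k"
    have f: "ln (fact (Suc k) :: real) = ln (x + 1) + ln (fact k)"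
      by (simp add: ln_mult x_def)
    show ?case
    proof (cases "k = 0")
      case True
      thus ?thesis by simp
    next
      case False
      hence x: "x \<ge> 1" by (simp add: x_def)
      have l1: "ln (x + 1) - ln x \<le> 1 / x"
      proof -
        have "ln ((x + 1) / x) \<le> (x + 1) / x - 1" by (rule ln_le_minus_one) (use x in simp)
        also have "\<dots> = 1 / x" using x by (simp add: field_simps)
        finally show ?thesis using x by (simp add: ln_div)
      qed
      have l2: "ln (x + 1) - ln x \<ge> 1 / (x + 1)"
      proof -
        have "ln (x / (x + 1)) \<le> x / (x + 1) - 1" by (rule ln_le_minus_one) (use x in simp)
        also have "\<dots> = - (1 / (x + 1))" using x by (simp add: field_simps)
        finally show ?thesis using x by (simp add: ln_div)
      qed
      have lower: "xlx (x + 1) - (x + 1) \<le> ln (x + 1) + (xlx x - x)"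
      proof -
        have "x * (ln (x + 1) - ln x) \<le> x * (1 / x)" by (rule mult_left_mono[OF l1]) (use x in simp)
        thus ?thesis using x by (simp add: xlx_def algebra_simps)
      qed
      have "(x + 1) * (1 / (x + 1)) \<le> (x + 1) * (ln (x + 1) - ln x)" by (rule mult_left_mono[OF l2]) (use x in simp)
      hence "1 \<le> (x + 1) * ln (x + 1) - (x + 1) * ln x" using x by (simp add: right_diff_distrib)
      hence upper: "ln (x + 1) + (xlx x - x + ln x + 1) \<le> xlx (x + 1) - (x + 1) + ln (x + 1) + 1"
        by (simp add: xlx_def algebra_simps)
      show ?thesis using Suc lower upper False unfolding f by (simp add: x_def add.commute)
    qed
  qed
  moreover have "(if k = 0 then 0 else ln (real k)) \<le> ln (real k + 1)" by auto
  ultimately show "xlx (real k) - real k \<le> ln (fact k)"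
    "ln (fact k) \<le> xlx (real k) - real k + ln (real k + 1) + 1" by auto
qed

section \<open>Concentration of ball frequencies\<close>

text \<open>The bound of \<open>pattern_verts_tail\<close> without its powers of \<open>K\<close>
  and \<open>n\<close>: \<open>\<alpha>\<close> are the mark frequencies, \<open>\<pi>\<close> the
  edge frequencies, and \<open>\<gamma>\<close> is the proportion of half-edges given up through
  \<open>MM\<close>.\<close>

definition pattern_limit ::
  "nat list set \<Rightarrow> nat list set \<Rightarrow> (nat list \<Rightarrow> 'x) \<Rightarrow> nat list \<Rightarrow> real \<Rightarrow> ('x \<Rightarrow> real) \<Rightarrow> ('x \<Rightarrow> 'x \<Rightarrow> real) \<Rightarrow> real" where
  "pattern_limit T A x u \<gamma> \<alpha> \<pi> = (\<Prod>w\<in>T. \<alpha> (x w)) *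
     (\<Prod>w\<in>A. \<pi> (x (butlast w)) (x (if w \<in> T then w else u)) /
        ((\<alpha> (x (butlast w)) - \<gamma>) * (\<alpha> (x (if w \<in> T then w else u)) - \<gamma>)))"

text \<open>One radius \<open>\<rho>\<close> serves as distance of the frequencies, as proportion
  \<open>\<gamma>\<close> and as lower bound of the mark frequencies. Along counterexamples with
  radii tending to 0 the finite product converges, because no \<open>\<alpha> a\<close> is
  0.\<close>

lemma pattern_limit_continuous:
  fixes \<alpha> :: "'x::finite \<Rightarrow> real" and \<pi> :: "'x \<Rightarrow> 'x \<Rightarrow> real"
  assumes pos: "\<And>a. 0 < \<alpha> a" and e: "0 < e"
  shows "\<exists>\<rho>>0. \<forall>\<alpha>' \<pi>'. (\<forall>a. \<bar>\<alpha>' a - \<alpha> a\<bar> < \<rho>) \<and> (\<forall>a b. \<bar>\<pi>' a b - \<pi> a b\<bar> < \<rho>) \<longrightarrow>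
    (\<forall>a. \<rho> < \<alpha>' a) \<and> pattern_limit T A x u \<rho> \<alpha>' \<pi>' \<le> pattern_limit T A x u 0 \<alpha> \<pi> + e"
proof (rule ccontr)
  assume neg: "\<not> ?thesis"
  define d where "d m = inverse (real (Suc m))" for m
  have d0: "d m > 0" for m by (simp add: d_def)
  have dl: "d \<longlonglongrightarrow> 0" unfolding d_def by (rule LIMSEQ_inverse_real_of_nat)
  have "\<forall>m. \<exists>p. (\<forall>a. \<bar>fst p a - \<alpha> a\<bar> < d m) \<and> (\<forall>a b. \<bar>snd p a b - \<pi> a b\<bar> < d m) \<and>
     \<not> ((\<forall>a. d m < fst p a) \<and> pattern_limit T A x u (d m) (fst p) (snd p) \<le> pattern_limit T A x u 0 \<alpha> \<pi> + e)"
  proof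
    fix m
    from neg d0[of m] obtain \<alpha>' \<pi>' where "(\<forall>a. \<bar>\<alpha>' a - \<alpha> a\<bar> < d m) \<and> (\<forall>a b. \<bar>\<pi>' a b - \<pi> a b\<bar> < d m)"
      "\<not> ((\<forall>a. d m < \<alpha>' a) \<and> pattern_limit T A x u (d m) \<alpha>' \<pi>' \<le> pattern_limit T A x u 0 \<alpha> \<pi> + e)" by blast
    thus "\<exists>p. (\<forall>a. \<bar>fst p a - \<alpha> a\<bar> < d m) \<and> (\<forall>a b. \<bar>snd p a b - \<pi> a b\<bar> < d m) \<and>
     \<not> ((\<forall>a. d m < fst p a) \<and> pattern_limit T A x u (d m) (fst p) (snd p) \<le> pattern_limit T A x u 0 \<alpha> \<pi> + e)"
      by auto
  qed
  then obtain p where p: "\<And>m a. \<bar>fst (p m) a - \<alpha> a\<bar> < d m" "\<And>m a b. \<bar>snd (p m) a b - \<pi> a b\<bar> < d m"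
    "\<And>m. \<not> ((\<forall>a. d m < fst (p m) a) \<and> pattern_limit T A x u (d m) (fst (p m)) (snd (p m)) \<le> pattern_limit T A x u 0 \<alpha> \<pi> + e)"
    by metis
  have l1: "(\<lambda>m. fst (p m) a) \<longlonglongrightarrow> \<alpha> a" for a
    by (rule LIM_zero_cancel, rule tendsto_rabs_zero_cancel, rule tendsto_sandwich[OF _ _ tendsto_const dl])
       (use p(1)[of _ a] in \<open>auto intro!: always_eventually less_imp_le\<close>)
  have l2: "(\<lambda>m. snd (p m) a b) \<longlonglongrightarrow> \<pi> a b" for a b
    by (rule LIM_zero_cancel, rule tendsto_rabs_zero_cancel, rule tendsto_sandwich[OF _ _ tendsto_const dl])
       (use p(2)[of _ a b] in \<open>auto intro!: always_eventually less_imp_le\<close>)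
  have "(\<lambda>m. pattern_limit T A x u (d m) (fst (p m)) (snd (p m))) \<longlonglongrightarrow> pattern_limit T A x u 0 \<alpha> \<pi>"
    unfolding pattern_limit_def
    by (intro tendsto_intros l1 l2 dl) (use pos in \<open>simp add: less_imp_neq[symmetric]\<close>)
  hence 1: "eventually (\<lambda>m. pattern_limit T A x u (d m) (fst (p m)) (snd (p m)) < pattern_limit T A x u 0 \<alpha> \<pi> + e) sequentially"
    by (rule order_tendstoD) (use e in simp)
  have "eventually (\<lambda>m. d m < fst (p m) a) sequentially" for a
  proof -
    have "(\<lambda>m. fst (p m) a - d m) \<longlonglongrightarrow> \<alpha> a - 0" by (intro tendsto_intros l1 dl)
    hence "eventually (\<lambda>m. fst (p m) a - d m > 0) sequentially"
      by (rule order_tendstoD) (use pos in simp)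
    thus ?thesis by eventually_elim simp
  qed
  hence 2: "eventually (\<lambda>m. \<forall>a. d m < fst (p m) a) sequentially"
    by (intro eventually_all_finite) auto
  have "eventually (\<lambda>m. False) sequentially"
    using 1 2
  proof eventually_elim
    case (elim m)
    thus False using p(3)[of m] less_imp_le by blast
  qed
  thus False by simp
qed

definition type_near ::
  "nat \<Rightarrow> nat \<Rightarrow> (nat \<Rightarrow> 'x) \<Rightarrow> ('x \<Rightarrow> 'x \<Rightarrow> nat) \<Rightarrow> ('x \<Rightarrow> real) \<Rightarrow> ('x \<Rightarrow> 'x \<Rightarrow> real) \<Rightarrow> real \<Rightarrow> bool" where
  "type_near K n X E \<alpha> \<pi> \<rho> \<longleftrightarrow>
     (\<forall>a. \<bar>real (card {v\<in>{1..n}. X v = a}) / real n - \<alpha> a\<bar> < \<rho>) \<and>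
     (\<forall>a b. \<bar>real (E a b) / (real K * real n) - \<pi> a b\<bar> < \<rho>)"

text \<open>A tree pattern has one vertex more than edges and is expected about \<open>p * n\<close>
  times. With an edge that closes a cycle the numbers agree, the expected number stays bounded, and
  \<open>p = 0\<close> is allowed. In both cases a moment of order about \<open>\<theta> * n\<close>
  yields a factor \<open>r ^ k\<close>.\<close>

lemma pattern_concentration:
  fixes \<alpha> :: "'x::finite \<Rightarrow> real" and \<pi> :: "'x \<Rightarrow> 'x \<Rightarrow> real" and x :: "nat list \<Rightarrow> 'x"
  assumes K: "K \<ge> 1" and pos: "\<And>a. 0 < \<alpha> a" and \<epsilon>: "0 < \<epsilon>"
    and T: "finite T" "T \<subseteq> tree_verts K" "[] \<in> T"
    and A: "finite A" "A \<subseteq> tree_verts K - {[]}" "\<And>w. w \<in> A \<Longrightarrow> butlast w \<in> T" "A - T \<subseteq> {ws}"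
    and u: "u \<in> T"
    and p: "card T = Suc (card A) \<and> p = pattern_limit T A x u 0 \<alpha> \<pi> \<or> card T = card A \<and> p = 0"
    and p0: "0 \<le> p"
  shows "\<exists>\<rho>>0. \<exists>\<eta>>0. \<exists>n0. \<forall>n\<ge>n0. \<forall>X E. type_near K n X E \<alpha> \<pi> \<rho> \<longrightarrow>
    real (card {M \<in> typed_matchings (half_edges K n) (\<lambda>h. X (fst h)) E.
        (p + \<epsilon>) * real n \<le> real (card (pattern_verts K n X T A x u j M))})
    \<le> exp (- \<eta> * real n) * real (card (typed_matchings (half_edges K n) (\<lambda>h. X (fst h)) E))"
proof -
  obtain \<rho> where \<rho>: "\<rho> > 0" and near: "\<And>\<alpha>' \<pi>'. (\<forall>a. \<bar>\<alpha>' a - \<alpha> a\<bar> < \<rho>) \<Longrightarrow> (\<forall>a b. \<bar>\<pi>' a b - \<pi> a b\<bar> < \<rho>) \<Longrightarrow>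
      (\<forall>a. \<rho> < \<alpha>' a) \<and> pattern_limit T A x u \<rho> \<alpha>' \<pi>' \<le> pattern_limit T A x u 0 \<alpha> \<pi> + \<epsilon> / 4"
  proof -
    have "\<epsilon> / 4 > 0" using \<epsilon> by simp
    from pattern_limit_continuous[where T = T and A = A and x = x and u = u and \<pi> = \<pi> and \<alpha> = \<alpha>, OF pos this] that
    show thesis by blast
  qed
  define L where "L = Max (length ` T)"
  have L: "length w \<le> L" if "w \<in> T" for w using that T(1) by (simp add: L_def)
  define Q where "Q = card T * card T * K ^ L"
  \<comment> \<open>The first bound keeps the half-edges used by \<open>k\<close> occurrences below
    the proportion \<open>\<rho>\<close>; the second keeps the loss \<open>k * Q\<close> from
    disjointness below \<open>\<epsilon> / 4\<close> per vertex.\<close>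
  define \<theta> where "\<theta> = min (\<rho> * real K / (2 * (real (card A) + 1))) (\<epsilon> / (4 * (real Q + 1)))"
  have \<theta>: "\<theta> > 0" using \<rho> K \<epsilon> by (simp add: \<theta>_def)
  define P where "P = pattern_limit T A x u 0 \<alpha> \<pi> + \<epsilon> / 4"
  \<comment> \<open>\<open>p + \<epsilon> / 4\<close> will bound the base of the moment from above,
    and \<open>p + 3 * \<epsilon> / 4\<close> is what the loss \<open>k * Q\<close> leaves of
    \<open>p + \<epsilon>\<close>. The factor 1/2 in \<open>\<eta>\<close> pays for rounding
    \<open>\<theta> * n\<close> down.\<close>
  define r where "r = (p + \<epsilon> / 4) / (p + 3 * \<epsilon> / 4)"
  have r: "0 < r" "r < 1" using p0 \<epsilon> by (auto simp: r_def)
  define \<eta> where "\<eta> = \<theta> * (- ln r) / 2"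
  have "ln r < 0" using r by simp
  hence \<eta>: "\<eta> > 0" using \<theta> by (simp add: \<eta>_def mult_pos_neg)
  \<comment> \<open>Beyond \<open>2 / \<theta>\<close> rounding costs at most half of
    \<open>\<theta> * n\<close>; beyond the second bound the constant \<open>P\<close> of the cycle
    case is at most \<open>\<epsilon> / 4 * n\<close>.\<close>
  obtain n0 where n0: "real n0 \<ge> 2 / \<theta>" "real n0 \<ge> \<bar>P\<bar> / (\<epsilon> / 4)" "n0 \<ge> 1"
  proof -
    obtain m where "real m \<ge> max (max (2 / \<theta>) (\<bar>P\<bar> / (\<epsilon> / 4))) 1" using real_arch_simple by blast
    thus ?thesis by (intro that[of m]) auto
  qed
  show ?thesis
  proof (rule exI[of _ \<rho>], rule conjI[OF \<rho>], rule exI[of _ \<eta>], rule conjI[OF \<eta>], rule exI[of _ n0], intro allI impI)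
    fix n :: nat and X :: "nat \<Rightarrow> 'x" and E :: "'x \<Rightarrow> 'x \<Rightarrow> nat"
    assume n: "n0 \<le> n" and ty: "type_near K n X E \<alpha> \<pi> \<rho>"
    have n1: "real n \<ge> real n0" "real n > 0" using n n0(3) by auto
    define \<Omega> where "\<Omega> = typed_matchings (half_edges K n) (\<lambda>h. X (fst h)) E"
    define Nv where "Nv a = card {v\<in>{1..n}. X v = a}" for a
    define \<alpha>' where "\<alpha>' a = real (Nv a) / real n" for a
    define \<pi>' where "\<pi>' a b = real (E a b) / (real K * real n)" for a b
    define k where "k = nat \<lfloor>\<theta> * real n\<rfloor>"
    have k: "real k \<le> \<theta> * real n" "\<theta> * real n - 1 \<le> real k"
      using \<theta> by (auto simp: k_def)
    define MM where "MM = 2 * (k * card A)"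
    have nr: "\<And>a. \<rho> < \<alpha>' a" "pattern_limit T A x u \<rho> \<alpha>' \<pi>' \<le> P"
      using near[of \<alpha>' \<pi>'] ty by (auto simp: type_near_def \<alpha>'_def \<pi>'_def Nv_def P_def)
    have Nv: "real (Nv a) = \<alpha>' a * real n" for a using n1 by (simp add: \<alpha>'_def)
    have E: "real (E a b) = \<pi>' a b * (real K * real n)" for a b using n1 K by (simp add: \<pi>'_def)
    have Mr: "real MM \<le> \<rho> * (real K * real n)"
    proof -
      have "real MM \<le> 2 * (real (card A) + 1) * real k" by (simp add: MM_def algebra_simps)
      also have "\<dots> \<le> 2 * (real (card A) + 1) * (\<rho> * real K / (2 * (real (card A) + 1)) * real n)"
      proof (rule mult_left_mono)
        have "\<theta> * real n \<le> \<rho> * real K / (2 * (real (card A) + 1)) * real n"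
          by (rule mult_right_mono) (auto simp: \<theta>_def)
        thus "real k \<le> \<rho> * real K / (2 * (real (card A) + 1)) * real n" using k by linarith
      qed simp
      also have "\<dots> = \<rho> * (real K * real n)" by simp
      finally show ?thesis .
    qed
    have NM: "real MM < real (K * Nv a)" for a
    proof -
      have "\<rho> * (real K * real n) < \<alpha>' a * (real K * real n)"
        by (rule mult_strict_right_mono[OF nr(1)]) (use n1 K in simp)
      thus ?thesis using Mr by (simp add: Nv ac_simps)
    qed
    have kQ: "real k * real Q \<le> \<epsilon> / 4 * real n"
    proof -
      have "real k * real Q \<le> (\<epsilon> / (4 * (real Q + 1)) * real n) * (real Q + 1)"
      proof (rule mult_mono)
        have "\<theta> * real n \<le> \<epsilon> / (4 * (real Q + 1)) * real n"
          by (rule mult_right_mono) (auto simp: \<theta>_def)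
        thus "real k \<le> \<epsilon> / (4 * (real Q + 1)) * real n" using k by linarith
      qed (use \<epsilon> in auto)
      also have "\<dots> = \<epsilon> / 4 * real n" by (simp add: field_simps)
      finally show ?thesis .
    qed
    define b where "b = (p + \<epsilon>) * real n"
    have b: "(p + 3 * \<epsilon> / 4) * real n \<le> b - real k * real Q" using kQ by (simp add: b_def algebra_simps)
    have b0: "0 < (p + 3 * \<epsilon> / 4) * real n" using p0 \<epsilon> n1 by simp
    define B where "B = (\<Prod>w\<in>T. real (Nv (x w)) * (if w = [] then 1 else real K)) *
        (\<Prod>w\<in>A. real (E (x (butlast w)) (x (if w \<in> T then w else u))) /
          ((real (K * Nv (x (butlast w))) - real MM) * (real (K * Nv (x (if w \<in> T then w else u))) - real MM)))"
    have tail: "real (card {M\<in>\<Omega>. b \<le> real (card (pattern_verts K n X T A x u j M))}) * (b - real k * real Q) ^ k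
       \<le> real (card \<Omega>) * B ^ k"
      unfolding \<Omega>_def B_def
      by (rule pattern_verts_tail[OF K T L A u])
         (use NM b b0 in \<open>auto simp: Nv_def MM_def Q_def simp del: of_nat_mult of_nat_less_iff intro: iffD1[OF of_nat_less_iff]\<close>)
    have B1: "B \<le> real n ^ card T * real K ^ (card T - 1) * ((1 / (real K * real n)) ^ card A * pattern_limit T A x u \<rho> \<alpha>' \<pi>')"
    proof -
      have "(\<Prod>w\<in>T. real (Nv (x w)) * (if w = [] then 1 else real K)) = (\<Prod>w\<in>T. \<alpha>' (x w)) * real n ^ card T * (\<Prod>w\<in>T. if w = [] then 1 else real K)"
        unfolding Nv by (simp add: prod.distrib)
      also have "(\<Prod>w\<in>T. if w = [] then 1 else real K) = real K ^ (card T - 1)"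
      proof -
        have "(\<Prod>w\<in>T. if w = [] then 1 else real K) = (\<Prod>w\<in>T - {[]}. real K)"
          by (rule prod.mono_neutral_cong_right) (use T in auto)
        thus ?thesis using T by simp
      qed
      finally have 1: "(\<Prod>w\<in>T. real (Nv (x w)) * (if w = [] then 1 else real K)) = (\<Prod>w\<in>T. \<alpha>' (x w)) * real n ^ card T * real K ^ (card T - 1)" .
      have 2: "(\<Prod>w\<in>A. real (E (x (butlast w)) (x (if w \<in> T then w else u))) /
          ((real (K * Nv (x (butlast w))) - real MM) * (real (K * Nv (x (if w \<in> T then w else u))) - real MM)))
         \<le> (\<Prod>w\<in>A. 1 / (real K * real n) * (\<pi>' (x (butlast w)) (x (if w \<in> T then w else u)) /
        ((\<alpha>' (x (butlast w)) - \<rho>) * (\<alpha>' (x (if w \<in> T then w else u)) - \<rho>))))"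
      proof (rule prod_mono, rule conjI)
        fix w assume "w \<in> A"
        define a c where "a = x (butlast w)" and "c = x (if w \<in> T then w else u)"
        define s where "s = real K * real n"
        have s: "s > 0" using n1 K by (simp add: s_def)
        show "0 \<le> real (E (x (butlast w)) (x (if w \<in> T then w else u))) /
          ((real (K * Nv (x (butlast w))) - real MM) * (real (K * Nv (x (if w \<in> T then w else u))) - real MM))"
          using NM by (intro divide_nonneg_nonneg mult_nonneg_nonneg) (auto simp: less_imp_le)
        have la: "(\<alpha>' y - \<rho>) * s \<le> real (K * Nv y) - real MM" for y
          using Mr by (simp add: Nv s_def algebra_simps)
        have pa: "0 < (\<alpha>' y - \<rho>) * s" for y using nr(1) s by simp
        have "real (E a c) / ((real (K * Nv a) - real MM) * (real (K * Nv c) - real MM)) \<le>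
          real (E a c) / (((\<alpha>' a - \<rho>) * s) * ((\<alpha>' c - \<rho>) * s))"
        proof (rule divide_left_mono)
          show "((\<alpha>' a - \<rho>) * s) * ((\<alpha>' c - \<rho>) * s) \<le> (real (K * Nv a) - real MM) * (real (K * Nv c) - real MM)"
            by (rule mult_mono[OF la la]) (use pa[of a] pa[of c] la[of a] in linarith)+
          have z: "0 < real (K * Nv y) - real MM" for y using NM[of y] by simp
          show "0 < (real (K * Nv a) - real MM) * (real (K * Nv c) - real MM) * ((\<alpha>' a - \<rho>) * s * ((\<alpha>' c - \<rho>) * s))"
            by (rule mult_pos_pos[OF mult_pos_pos[OF z z] mult_pos_pos[OF pa pa]])
        qed simp
        also have "\<dots> = 1 / s * (\<pi>' a c / ((\<alpha>' a - \<rho>) * (\<alpha>' c - \<rho>)))"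
        proof -
          have "y * s / ((y1 * s) * (y2 * s)) = 1 / s * (y / (y1 * y2))" for y y1 y2 :: real
            by simp
          thus ?thesis unfolding E s_def[symmetric] .
        qed
        finally show "real (E (x (butlast w)) (x (if w \<in> T then w else u))) /
          ((real (K * Nv (x (butlast w))) - real MM) * (real (K * Nv (x (if w \<in> T then w else u))) - real MM))
         \<le> 1 / (real K * real n) * (\<pi>' (x (butlast w)) (x (if w \<in> T then w else u)) /
        ((\<alpha>' (x (butlast w)) - \<rho>) * (\<alpha>' (x (if w \<in> T then w else u)) - \<rho>)))"
          unfolding a_def c_def s_def .
      qed
      have al: "0 \<le> \<alpha>' y" for y by (simp add: \<alpha>'_def)
      have "B \<le> (\<Prod>w\<in>T. \<alpha>' (x w)) * real n ^ card T * real K ^ (card T - 1) *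
         (\<Prod>w\<in>A. 1 / (real K * real n) * (\<pi>' (x (butlast w)) (x (if w \<in> T then w else u)) /
        ((\<alpha>' (x (butlast w)) - \<rho>) * (\<alpha>' (x (if w \<in> T then w else u)) - \<rho>))))"
        unfolding B_def 1 by (rule mult_left_mono[OF 2]) (intro mult_nonneg_nonneg prod_nonneg zero_le_power, auto simp: al)
      also have "\<dots> = real n ^ card T * real K ^ (card T - 1) * ((1 / (real K * real n)) ^ card A * pattern_limit T A x u \<rho> \<alpha>' \<pi>')"
        unfolding prod.distrib pattern_limit_def prod_constant by simp
      finally show ?thesis .
    qed
    have B0: "0 \<le> B"
      unfolding B_def using NM
      by (intro mult_nonneg_nonneg prod_nonneg divide_nonneg_nonneg) (auto simp: less_imp_le)
    have B2: "B \<le> (p + \<epsilon> / 4) * real n"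
      using p
    proof
      assume a: "card T = Suc (card A) \<and> p = pattern_limit T A x u 0 \<alpha> \<pi>"
      have "B \<le> real n ^ Suc (card A) * real K ^ card A * ((1 / (real K * real n)) ^ card A * pattern_limit T A x u \<rho> \<alpha>' \<pi>')"
        using B1 a by simp
      also have "\<dots> = real n * pattern_limit T A x u \<rho> \<alpha>' \<pi>'"
        using K by (simp add: power_divide power_mult_distrib)
      also have "\<dots> \<le> real n * P" by (rule mult_left_mono[OF nr(2)]) simp
      also have "\<dots> = (p + \<epsilon> / 4) * real n" using a by (simp add: P_def)
      finally show ?thesis .
    next
      assume a: "card T = card A \<and> p = 0"
      have c: "card A \<noteq> 0" using a T(1,3) by (metis card_0_eq empty_iff)
      then obtain m where m: "card A = Suc m" by (cases "card A") auto
      have "B \<le> real n ^ Suc m * real K ^ m * ((1 / (real K * real n)) ^ Suc m * pattern_limit T A x u \<rho> \<alpha>' \<pi>')"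
        using B1 a m by simp
      also have "\<dots> = pattern_limit T A x u \<rho> \<alpha>' \<pi>' / real K"
        using n1 by (simp add: power_divide power_mult_distrib)
      also have "\<dots> \<le> P / real K" by (rule divide_right_mono[OF nr(2)]) simp
      also have "\<dots> \<le> \<bar>P\<bar> / 1" by (rule frac_le) (use K in auto)
      also have "\<dots> \<le> \<epsilon> / 4 * real n"
      proof -
        have "\<bar>P\<bar> / (\<epsilon> / 4) \<le> real n" using n0(2) n1 by linarith
        thus ?thesis using \<epsilon> by (simp add: field_simps)
      qed
      finally show ?thesis using a by simp
    qed
    define cb where "cb = real (card {M\<in>\<Omega>. b \<le> real (card (pattern_verts K n X T A x u j M))})"
    have "cb * ((p + 3 * \<epsilon> / 4) * real n) ^ k \<le> cb * (b - real k * real Q) ^ k"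
      by (intro mult_left_mono power_mono b) (use b0 in \<open>auto simp: cb_def\<close>)
    also have "\<dots> \<le> real (card \<Omega>) * B ^ k" unfolding cb_def by (rule tail)
    also have "\<dots> \<le> real (card \<Omega>) * ((p + \<epsilon> / 4) * real n) ^ k"
      by (intro mult_left_mono power_mono B2 B0) simp
    also have "(p + \<epsilon> / 4) * real n = r * ((p + 3 * \<epsilon> / 4) * real n)"
      using b0 p0 \<epsilon> unfolding r_def by simp
    finally have "cb * ((p + 3 * \<epsilon> / 4) * real n) ^ k \<le> (real (card \<Omega>) * r ^ k) * ((p + 3 * \<epsilon> / 4) * real n) ^ k"
      by (simp only: power_mult_distrib mult.assoc)
    hence "cb \<le> real (card \<Omega>) * r ^ k"
      using b0 by simp
    also have "r ^ k \<le> exp (- \<eta> * real n)"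
    proof -
      have "r ^ k = exp (real k * ln r)" using r by (simp add: exp_of_nat_mult)
      also have "real k * ln r \<le> (\<theta> * real n - 1) * ln r"
        by (rule mult_right_mono_neg[OF k(2)]) (use r in simp)
      also have "\<dots> \<le> (\<theta> * real n / 2) * ln r"
      proof (rule mult_right_mono_neg)
        have "\<theta> * real n \<ge> \<theta> * (2 / \<theta>)"
          by (rule mult_left_mono) (use n0(1) n1 \<theta> in auto)
        thus "\<theta> * real n / 2 \<le> \<theta> * real n - 1" using \<theta> by simp
      qed (use r in simp)
      also have "\<dots> = - \<eta> * real n" by (simp add: \<eta>_def)
      finally show ?thesis by simp
    qed
    finally have "cb \<le> real (card \<Omega>) * exp (- \<eta> * real n)" by (simp add: mult_left_mono)
    thus "real (card {M \<in> typed_matchings (half_edges K n) (\<lambda>h. X (fst h)) E.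
        (p + \<epsilon>) * real n \<le> real (card (pattern_verts K n X T A x u j M))})
    \<le> exp (- \<eta> * real n) * real (card (typed_matchings (half_edges K n) (\<lambda>h. X (fst h)) E))"
      unfolding cb_def \<Omega>_def b_def by (simp add: mult.commute)
  qed
qed

section \<open>Collisions of the exploration\<close>

lemma finite_tree_ball: "finite (tree_ball K r)"
proof (rule finite_subset[OF _ finite_lists_length_le[of "{..<K}" r]])
  show "tree_ball K r \<subseteq> {xs. set xs \<subseteq> {..<K} \<and> length xs \<le> r}"
  proof
    fix w assume w: "w \<in> tree_ball K r"
    have "w ! i < K" if "i < length w" for i
    proof -
      have "w ! i < (if i = 0 then K else K - 1)" using w that by (simp add: tree_ball_def tree_verts_def)
      thus ?thesis by (auto split: if_splits)
    qed
    thus "w \<in> {xs. set xs \<subseteq> {..<K} \<and> length xs \<le> r}"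
      using w by (auto simp: tree_ball_def in_set_conv_nth)
  qed
qed simp

lemma Nil_tree_ball [simp]: "[] \<in> tree_ball K r" by (simp add: tree_ball_def)

lemma tree_ball_verts: "tree_ball K r \<subseteq> tree_verts K" by (auto simp: tree_ball_def)

lemma butlast_tree_ball:
  assumes "w \<in> tree_ball K r" "w \<noteq> []" shows "butlast w \<in> tree_ball K r"
proof -
  have "w = butlast w @ [last w]" using assms(2) by simp
  hence "butlast w \<in> tree_verts K" using assms(1) tree_verts_snoc by (metis tree_ball_verts subsetD)
  thus ?thesis using assms unfolding tree_ball_def by auto
qed

definition prefix_closed :: "nat list set \<Rightarrow> bool" where
  "prefix_closed T \<longleftrightarrow> [] \<in> T \<and> (\<forall>w\<in>T. w \<noteq> [] \<longrightarrow> butlast w \<in> T)"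

lemma prefix_closed_tree_ball: "prefix_closed (tree_ball K r)"
  using butlast_tree_ball by (auto simp: prefix_closed_def)

definition walk_inj where
  "walk_inj K r M v \<longleftrightarrow> inj_on (\<lambda>w. fst (pos K M v w)) (tree_ball K r)"

text \<open>\<open>T\<close> is a maximal subtree on which the walk is injective, \<open>ws\<close>
  a shortest word outside it. The parent of \<open>ws\<close> lies in \<open>T\<close>, so by
  maximality the step to \<open>ws\<close> runs into a vertex of \<open>T\<close>. The entry port
  \<open>j\<close> is named because a pattern has to prescribe a half-edge.\<close>

lemma collision_exists:
  assumes M: "M \<in> matchings (half_edges K n)" and v: "v \<in> {1..n}" and ninj: "\<not> walk_inj K r M v"
  shows "\<exists>T ws u j. T \<subseteq> tree_ball K r \<and> prefix_closed T \<and> inj_on (\<lambda>w. fst (pos K M v w)) T \<and>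
    ws \<in> tree_ball K r - T \<and> ws \<noteq> [] \<and> butlast ws \<in> T \<and> u \<in> T \<and> j < K \<and> pos K M v ws = (fst (pos K M v u), j)"
proof -
  define TB where "TB = tree_ball K r"
  define f where "f w = fst (pos K M v w)" for w
  define TT where "TT = {T. T \<subseteq> TB \<and> prefix_closed T \<and> inj_on f T}"
  have "{[]} \<in> TT" by (simp add: TT_def prefix_closed_def TB_def)
  moreover have "finite TT"
    by (rule finite_subset[of _ "Pow TB"]) (auto simp: TT_def TB_def finite_tree_ball)
  ultimately obtain T where T: "T \<in> TT" and max: "\<And>T'. T' \<in> TT \<Longrightarrow> T \<subseteq> T' \<Longrightarrow> T = T'"
    using finite_has_maximal[of TT] by blast
  have "T \<noteq> TB" using T ninj by (auto simp: TT_def walk_inj_def f_def[abs_def] TB_def)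
  then obtain w0 where "w0 \<in> TB - T" using T by (auto simp: TT_def)
  then obtain ws where ws: "ws \<in> TB - T" and min: "\<And>w. w \<in> TB - T \<Longrightarrow> length ws \<le> length w"
    using arg_min_nat_lemma[of "\<lambda>w. w \<in> TB - T" w0 length] by auto
  have ne: "ws \<noteq> []" using ws T by (auto simp: TT_def prefix_closed_def)
  have bT: "butlast ws \<in> T"
  proof (rule ccontr)
    assume "butlast ws \<notin> T"
    moreover have "butlast ws \<in> TB" using ws ne butlast_tree_ball by (auto simp: TB_def)
    ultimately have "length ws \<le> length (butlast ws)" using min by blast
    thus False using ne by (cases ws rule: rev_cases) auto
  qed
  have "insert ws T \<notin> TT" using max[of "insert ws T"] ws by auto
  hence "\<not> inj_on f (insert ws T)"
    using T ws bT by (auto simp: TT_def prefix_closed_def)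
  then obtain u where u: "u \<in> T" "f ws = f u" using T by (auto simp: TT_def)
  have "snd (pos K M v ws) < K"
    using pos_range[OF M v, of ws] ws ne by (auto simp: TB_def tree_ball_def)
  thus ?thesis
    using T ws ne bT u by (intro exI[of _ T] exI[of _ ws] exI[of _ u] exI[of _ "snd (pos K M v ws)"])
      (auto simp: TT_def f_def[abs_def] TB_def prod_eq_iff)
qed

text \<open>An exponentially small proportion, uniformly over all mark vectors and types near
  \<open>\<alpha>\<close> and \<open>\<pi>\<close>. The uniformity lets the bound be summed over the
  mark vectors of one type.\<close>

definition rare :: "nat \<Rightarrow> ('x \<Rightarrow> real) \<Rightarrow> ('x \<Rightarrow> 'x \<Rightarrow> real) \<Rightarrow>
    (nat \<Rightarrow> (nat \<Rightarrow> 'x) \<Rightarrow> (nat \<times> nat \<Rightarrow> nat \<times> nat) \<Rightarrow> bool) \<Rightarrow> bool" where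
  "rare K \<alpha> \<pi> P \<longleftrightarrow> (\<exists>\<rho>>0. \<exists>\<eta>>0. \<exists>n0. \<forall>n\<ge>n0. \<forall>X E. type_near K n X E \<alpha> \<pi> \<rho> \<longrightarrow>
    real (card {M \<in> typed_matchings (half_edges K n) (\<lambda>h. X (fst h)) E. P n X M})
    \<le> exp (- \<eta> * real n) * real (card (typed_matchings (half_edges K n) (\<lambda>h. X (fst h)) E)))"

lemma finite_half_edges [simp]: "finite (half_edges K n)" by (simp add: half_edges_def)

lemma rare_mono:
  assumes "rare K \<alpha> \<pi> P" "\<And>n X M. n \<ge> 1 \<Longrightarrow> M \<in> matchings (half_edges K n) \<Longrightarrow> P' n X M \<Longrightarrow> P n X M"
  shows "rare K \<alpha> \<pi> P'"
proof -
  obtain \<rho> \<eta> n0 where *: "\<rho> > 0" "\<eta> > 0" "\<And>n X E. n \<ge> n0 \<Longrightarrow> type_near K n X E \<alpha> \<pi> \<rho> \<Longrightarrow>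
    real (card {M \<in> typed_matchings (half_edges K n) (\<lambda>h. X (fst h)) E. P n X M})
    \<le> exp (- \<eta> * real n) * real (card (typed_matchings (half_edges K n) (\<lambda>h. X (fst h)) E))"
    using assms(1) unfolding rare_def by blast
  show ?thesis
    unfolding rare_def
  proof (rule exI[of _ \<rho>], rule conjI[OF *(1)], rule exI[of _ \<eta>], rule conjI[OF *(2)], rule exI[of _ "max n0 1"], intro allI impI)
    fix n X E assume n: "max n0 1 \<le> n" and t: "type_near K n X E \<alpha> \<pi> \<rho>"
    have "card {M \<in> typed_matchings (half_edges K n) (\<lambda>h. X (fst h)) E. P' n X M} \<le>
      card {M \<in> typed_matchings (half_edges K n) (\<lambda>h. X (fst h)) E. P n X M}"
    proof (rule card_mono)
      show "finite {M \<in> typed_matchings (half_edges K n) (\<lambda>h. X (fst h)) E. P n X M}"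
        by (rule finite_subset[OF _ finite_typed[of "half_edges K n"]]) auto
    qed (use assms(2) n in \<open>auto simp: typed_matchings_def\<close>)
    thus "real (card {M \<in> typed_matchings (half_edges K n) (\<lambda>h. X (fst h)) E. P' n X M})
    \<le> exp (- \<eta> * real n) * real (card (typed_matchings (half_edges K n) (\<lambda>h. X (fst h)) E))"
      using *(3)[of n X E] n t by linarith
  qed
qed

lemma rare_disj:
  assumes "rare K \<alpha> \<pi> P" "rare K \<alpha> \<pi> P'"
  shows "rare K \<alpha> \<pi> (\<lambda>n X M. P n X M \<or> P' n X M)"
proof -
  obtain \<rho> \<eta> n0 where *: "\<rho> > 0" "\<eta> > 0" "\<And>n X E. n \<ge> n0 \<Longrightarrow> type_near K n X E \<alpha> \<pi> \<rho> \<Longrightarrow>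
    real (card {M \<in> typed_matchings (half_edges K n) (\<lambda>h. X (fst h)) E. P n X M})
    \<le> exp (- \<eta> * real n) * real (card (typed_matchings (half_edges K n) (\<lambda>h. X (fst h)) E))"
    using assms(1) unfolding rare_def by blast
  obtain \<rho>' \<eta>' n0' where **: "\<rho>' > 0" "\<eta>' > 0" "\<And>n X E. n \<ge> n0' \<Longrightarrow> type_near K n X E \<alpha> \<pi> \<rho>' \<Longrightarrow>
    real (card {M \<in> typed_matchings (half_edges K n) (\<lambda>h. X (fst h)) E. P' n X M})
    \<le> exp (- \<eta>' * real n) * real (card (typed_matchings (half_edges K n) (\<lambda>h. X (fst h)) E))"
    using assms(2) unfolding rare_def by blast
  define z where "z = min \<eta> \<eta>'"
  have z: "z > 0" using * ** by (simp add: z_def)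
  \<comment> \<open>From here on \<open>2 * exp (- z * n)\<close> is at most
    \<open>exp (- (z / 2) * n)\<close>.\<close>
  obtain n1 where n1: "real n1 \<ge> 2 * ln 2 / z" using real_arch_simple by blast
  have z': "min \<rho> \<rho>' > 0" "z / 2 > 0" using z * ** by auto
  show ?thesis
    unfolding rare_def
  proof (rule exI[of _ "min \<rho> \<rho>'"], rule conjI[OF z'(1)], rule exI[of _ "z / 2"], rule conjI[OF z'(2)],
      rule exI[of _ "max n1 (max n0 n0')"], intro allI impI)
    fix n X E assume n: "max n1 (max n0 n0') \<le> n" and t: "type_near K n X E \<alpha> \<pi> (min \<rho> \<rho>')"
    define O1 where "O1 = typed_matchings (half_edges K n) (\<lambda>h. X (fst h)) E"
    have t': "type_near K n X E \<alpha> \<pi> \<rho>" "type_near K n X E \<alpha> \<pi> \<rho>'" using t by (auto simp: type_near_def)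
    have "card {M\<in>O1. P n X M \<or> P' n X M} \<le> card {M\<in>O1. P n X M} + card {M\<in>O1. P' n X M}"
      using card_Un_le[of "{M\<in>O1. P n X M}" "{M\<in>O1. P' n X M}"] by (simp add: Collect_disj_eq[symmetric] conj_disj_distribL)
    hence "real (card {M\<in>O1. P n X M \<or> P' n X M}) \<le> exp (- \<eta> * real n) * real (card O1) + exp (- \<eta>' * real n) * real (card O1)"
      using *(3)[of n X E, OF _ t'(1)] **(3)[of n X E, OF _ t'(2)] n unfolding O1_def by linarith
    also have "\<dots> \<le> exp (- z * real n) * real (card O1) + exp (- z * real n) * real (card O1)"
      by (intro add_mono mult_right_mono) (auto simp: z_def mult_right_mono)
    also have "\<dots> = 2 * exp (- z * real n) * real (card O1)" by simp
    also have "\<dots> \<le> exp (- (z / 2) * real n) * real (card O1)"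
    proof (rule mult_right_mono)
      have "2 * ln 2 / z \<le> real n" using n1 n by simp
      hence "real n * z \<ge> 2 * ln 2" using z by (simp add: field_simps)
      hence "ln 2 - z * real n \<le> - (z / 2) * real n" by (simp add: algebra_simps)
      hence "exp (ln 2 - z * real n) \<le> exp (- (z / 2) * real n)" by simp
      thus "2 * exp (- z * real n) \<le> exp (- (z / 2) * real n)" by (simp add: exp_diff exp_minus field_simps)
    qed simp
    finally show "real (card {M \<in> typed_matchings (half_edges K n) (\<lambda>h. X (fst h)) E. P n X M \<or> P' n X M})
      \<le> exp (- (z / 2) * real n) * real (card (typed_matchings (half_edges K n) (\<lambda>h. X (fst h)) E))"
      unfolding O1_def .
  qed
qed

lemma rare_False: "rare K \<alpha> \<pi> (\<lambda>n X M. False)"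
  unfolding rare_def by (rule exI[of _ 1], rule conjI, simp, rule exI[of _ 1]) simp

lemma rare_ex:
  assumes "finite I" "\<And>i. i \<in> I \<Longrightarrow> rare K \<alpha> \<pi> (P i)"
  shows "rare K \<alpha> \<pi> (\<lambda>n X M. \<exists>i\<in>I. P i n X M)"
  using assms
proof (induction I rule: finite_induct)
  case empty
  thus ?case using rare_False by simp
next
  case (insert i I)
  have "rare K \<alpha> \<pi> (\<lambda>n X M. P i n X M \<or> (\<exists>i\<in>I. P i n X M))"
    by (rule rare_disj) (use insert in auto)
  thus ?case by simp
qed

text \<open>Probability of the marks \<open>x\<close> on the ball under the tree-indexed Markov
  chain with root law \<open>\<alpha>\<close> and transition probabilities
  \<open>\<pi> a b / \<alpha> a\<close>.\<close>

definition markov_weight :: "nat \<Rightarrow> nat \<Rightarrow> ('x \<Rightarrow> real) \<Rightarrow> ('x \<Rightarrow> 'x \<Rightarrow> real) \<Rightarrow> (nat list \<Rightarrow> 'x) \<Rightarrow> real" where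
  "markov_weight K r \<alpha> \<pi> x = \<alpha> (x []) *
     (\<Prod>w\<in>tree_ball K r - {[]}. \<pi> (x (butlast w)) (x w) / \<alpha> (x (butlast w)))"

definition occurrences where
  "occurrences K n X r x M = {v\<in>{1..n}. (\<forall>w\<in>tree_ball K r. X (fst (pos K M v w)) = x w) \<and> walk_inj K r M v}"

definition profile_close where
  "profile_close K r \<alpha> \<pi> \<epsilon> n X M \<longleftrightarrow> (\<forall>x\<in>tree_ball K r \<rightarrow>\<^sub>E UNIV.
     \<bar>real (card (occurrences K n X r x M)) / real n - markov_weight K r \<alpha> \<pi> x\<bar> \<le> \<epsilon>)"

text \<open>Upper tails suffice. Every start sees one of finitely many marked balls or a collision;
  collisions are rare and the weights sum to 1, so a ball seen too seldom would force another one to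
  be seen too often.\<close>

lemma profile_concentration:
  fixes \<alpha> :: "'x::finite \<Rightarrow> real" and \<pi> :: "'x \<Rightarrow> 'x \<Rightarrow> real"
  assumes K: "K \<ge> 1" and pos: "\<And>a. 0 < \<alpha> a" "\<And>a b. 0 \<le> \<pi> a b" and \<epsilon>: "0 < \<epsilon>"
    and total: "(\<Sum>x\<in>tree_ball K r \<rightarrow>\<^sub>E UNIV. markov_weight K r \<alpha> \<pi> x) = 1"
  shows "rare K \<alpha> \<pi> (\<lambda>n X M. \<not> profile_close K r \<alpha> \<pi> \<epsilon> n X M)"
proof -
  define TB where "TB = tree_ball K r"
  define XS where "XS = (TB \<rightarrow>\<^sub>E (UNIV :: 'x set))"
  define CS where "CS = Pow TB \<times> TB \<times> TB \<times> {..<K} \<times> XS"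
  define CS' where "CS' = {(T, ws, u, j, x). (T, ws, u, j, x) \<in> CS \<and> prefix_closed T \<and> ws \<in> TB - T \<and> ws \<noteq> [] \<and>
     butlast ws \<in> T \<and> u \<in> T}"
  have finTB: "finite TB" by (simp add: TB_def finite_tree_ball)
  have finXS: "finite XS" unfolding XS_def by (rule finite_PiE[OF finTB]) simp
  have finCS: "finite CS'"
    by (rule finite_subset[of _ CS]) (use finTB finXS in \<open>auto simp: CS'_def CS_def\<close>)
  \<comment> \<open>The tolerance \<open>\<epsilon>\<close> is shared among all balls and all kinds
    of collisions, whose total excess bounds the deficit of a single ball.\<close>
  define J where "J = real (card XS) + real (card CS') + 1"
  define e where "e = \<epsilon> / J"
  have e: "e > 0" "e \<le> \<epsilon>" "(real (card XS) + real (card CS')) * e \<le> \<epsilon>"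
    using \<epsilon> by (auto simp: e_def J_def field_simps)
  define p where "p x = markov_weight K r \<alpha> \<pi> x" for x
  have p0: "0 \<le> p x" for x
    unfolding p_def markov_weight_def using pos
    by (intro mult_nonneg_nonneg prod_nonneg divide_nonneg_nonneg) (auto simp: less_imp_le)
  \<comment> \<open>Every vertex but the root is the lower end of exactly one edge, so its factor
    \<open>\<alpha>\<close> cancels.\<close>
  have p_eq: "p x = pattern_limit TB (TB - {[]}) x [] 0 \<alpha> \<pi>" for x
  proof -
    have "pattern_limit TB (TB - {[]}) x [] 0 \<alpha> \<pi> = \<alpha> (x []) * (\<Prod>w\<in>TB - {[]}. \<alpha> (x w)) *
       (\<Prod>w\<in>TB - {[]}. \<pi> (x (butlast w)) (x w) / (\<alpha> (x (butlast w)) * \<alpha> (x w)))"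
      unfolding pattern_limit_def
      by (subst prod.remove[OF finTB, of "[]"]) (auto simp: TB_def intro!: prod.cong)
    also have "\<dots> = p x"
      unfolding p_def markov_weight_def TB_def[symmetric] mult.assoc prod.distrib[symmetric]
      using pos(1) by (intro arg_cong[of _ _ "\<lambda>y. \<alpha> (x []) * y"] prod.cong) (auto simp: less_imp_neq[symmetric])
    finally show ?thesis by simp
  qed
  have R1: "rare K \<alpha> \<pi> (\<lambda>n X M. \<exists>x\<in>XS. (p x + e) * real n \<le> real (card (pattern_verts K n X TB (TB - {[]}) x [] 0 M)))"
  proof (rule rare_ex[OF finXS])
    fix x assume "x \<in> XS"
    show "rare K \<alpha> \<pi> (\<lambda>n X M. (p x + e) * real n \<le> real (card (pattern_verts K n X TB (TB - {[]}) x [] 0 M)))"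
      unfolding rare_def
    proof (rule pattern_concentration[OF K pos(1) e(1) finTB, where ws = "[]"])
      show "card TB = Suc (card (TB - {[]})) \<and> p x = pattern_limit TB (TB - {[]}) x [] 0 \<alpha> \<pi> \<or> card TB = card (TB - {[]}) \<and> p x = 0"
        using p_eq card.remove[OF finTB, of "[]"] by (simp add: TB_def)
    qed (use finTB p0 butlast_tree_ball in \<open>auto simp: TB_def tree_ball_def\<close>)
  qed
  \<comment> \<open>\<open>insert ws (T - {[]})\<close> has as many elements as \<open>T\<close>:
    this is the cycle case, with limit 0.\<close>
  have R2: "rare K \<alpha> \<pi> (\<lambda>n X M. \<exists>c\<in>CS'. case c of (T, ws, u, j, x) \<Rightarrow>
      (0 + e) * real n \<le> real (card (pattern_verts K n X T (insert ws (T - {[]})) x u j M)))"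
  proof (rule rare_ex[OF finCS])
    fix c assume "c \<in> CS'"
    then obtain T ws u j x where c: "c = (T, ws, u, j, x)" "T \<subseteq> TB" "prefix_closed T" "ws \<in> TB - T" "ws \<noteq> []"
     "butlast ws \<in> T" "u \<in> T"
      by (auto simp: CS'_def CS_def)
    have finT: "finite T" using finTB c(2) finite_subset by blast
    have NT: "[] \<in> T" using c(3) by (simp add: prefix_closed_def)
    have "rare K \<alpha> \<pi> (\<lambda>n X M. (0 + e) * real n \<le> real (card (pattern_verts K n X T (insert ws (T - {[]})) x u j M)))"
      unfolding rare_def
    proof (rule pattern_concentration[OF K pos(1) e(1) finT _ NT, where ws = ws])
      show "T \<subseteq> tree_verts K" using c(2) tree_ball_verts by (auto simp: TB_def)
      show "card T = Suc (card (insert ws (T - {[]}))) \<and> 0 = pattern_limit T (insert ws (T - {[]})) x u 0 \<alpha> \<pi> \<or>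
         card T = card (insert ws (T - {[]})) \<and> (0::real) = 0"
        using finT c(4) card.remove[OF finT NT] by simp
      show "insert ws (T - {[]}) \<subseteq> tree_verts K - {[]}" using c tree_ball_verts by (auto simp: TB_def)
      show "butlast w \<in> T" if "w \<in> insert ws (T - {[]})" for w using that c(3,6) by (auto simp: prefix_closed_def)
    qed (use finT c in auto)
    thus "rare K \<alpha> \<pi> (\<lambda>n X M. case c of (T, ws, u, j, x) \<Rightarrow>
      (0 + e) * real n \<le> real (card (pattern_verts K n X T (insert ws (T - {[]})) x u j M)))" by (simp add: c(1))
  qed
  show ?thesis
  proof (rule rare_mono[OF rare_disj[OF R1 R2]], rule ccontr)
    fix n and X :: "nat \<Rightarrow> 'x" and M
    assume n: "n \<ge> 1" and M: "M \<in> matchings (half_edges K n)" and nc: "\<not> profile_close K r \<alpha> \<pi> \<epsilon> n X M"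
    assume neg: "\<not> ((\<exists>x\<in>XS. (p x + e) * real n \<le> real (card (pattern_verts K n X TB (TB - {[]}) x [] 0 M))) \<or>
       (\<exists>c\<in>CS'. case c of (T, ws, u, j, x) \<Rightarrow>
      (0 + e) * real n \<le> real (card (pattern_verts K n X T (insert ws (T - {[]})) x u j M))))"
    define Oc where "Oc x = occurrences K n X r x M" for x
    have "Oc x = pattern_verts K n X TB (TB - {[]}) x [] 0 M" for x
      by (auto simp: Oc_def occurrences_def pattern_verts_def TB_def walk_inj_def)
    hence up: "real (card (Oc x)) < (p x + e) * real n" if "x \<in> XS" for x using neg that by (simp add: not_le)
    define PC where "PC c = (case c of (T, ws, u, j, x) \<Rightarrow> pattern_verts K n X T (insert ws (T - {[]})) x u j M)" for c
    have upc: "real (card (PC c)) < e * real n" if "c \<in> CS'" for c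
      using neg that by (auto simp: PC_def not_le split: prod.splits)
    define cl where "cl v = restrict (\<lambda>w. X (fst (pos K M v w))) TB" for v
    have clX: "cl v \<in> XS" for v by (simp add: cl_def XS_def)
    \<comment> \<open>A start with a collision belongs to the pattern with its own marks
      \<open>cl v\<close>; only their values on \<open>T\<close> matter there.\<close>
    have cover: "{1..n} \<subseteq> (\<Union>x\<in>XS. Oc x) \<union> (\<Union>c\<in>CS'. PC c)"
    proof
      fix v assume v: "v \<in> {1..n}"
      show "v \<in> (\<Union>x\<in>XS. Oc x) \<union> (\<Union>c\<in>CS'. PC c)"
      proof (cases "walk_inj K r M v")
        case True
        hence "v \<in> Oc (cl v)" using v by (simp add: Oc_def occurrences_def cl_def TB_def)
        thus ?thesis using clX by blast
      next
        case False
        obtain T ws u j where c: "T \<subseteq> TB" "prefix_closed T" "inj_on (\<lambda>w. fst (pos K M v w)) T"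
          "ws \<in> TB - T" "ws \<noteq> []" "butlast ws \<in> T" "u \<in> T" "j < K" "pos K M v ws = (fst (pos K M v u), j)"
          using collision_exists[OF M v False] unfolding TB_def by blast
        have "(T, ws, u, j, cl v) \<in> CS'" using c clX by (auto simp: CS'_def CS_def)
        moreover have "v \<in> PC (T, ws, u, j, cl v)"
          using c v by (auto simp: PC_def pattern_verts_def cl_def)
        ultimately show ?thesis by blast
      qed
    qed
    have finOc: "finite (Oc x)" for x by (simp add: Oc_def occurrences_def)
    have finPC: "finite (PC c)" for c by (cases c) (simp add: PC_def pattern_verts_def)
    have "card {1..n} \<le> card ((\<Union>x\<in>XS. Oc x) \<union> (\<Union>c\<in>CS'. PC c))"
      by (rule card_mono[OF _ cover]) (use finXS finCS finOc finPC in auto)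
    also have "\<dots> \<le> card (\<Union>x\<in>XS. Oc x) + card (\<Union>c\<in>CS'. PC c)" by (rule card_Un_le)
    also have "\<dots> \<le> (\<Sum>x\<in>XS. card (Oc x)) + (\<Sum>c\<in>CS'. card (PC c))"
      by (intro add_mono card_UN_le finXS finCS)
    finally have "n \<le> (\<Sum>x\<in>XS. card (Oc x)) + (\<Sum>c\<in>CS'. card (PC c))" by simp
    hence "real n \<le> real ((\<Sum>x\<in>XS. card (Oc x)) + (\<Sum>c\<in>CS'. card (PC c)))" by (simp only: of_nat_le_iff)
    hence cnt: "real n \<le> (\<Sum>x\<in>XS. real (card (Oc x))) + (\<Sum>c\<in>CS'. real (card (PC c)))"
      by simp
    have pcs: "(\<Sum>c\<in>CS'. real (card (PC c))) \<le> real (card CS') * (e * real n)"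
      using sum_mono[of CS' "\<lambda>c. real (card (PC c))" "\<lambda>_. e * real n"] upc by (simp add: less_imp_le)
    have "profile_close K r \<alpha> \<pi> \<epsilon> n X M"
      unfolding profile_close_def TB_def[symmetric] XS_def[symmetric] p_def[symmetric] Oc_def[symmetric]
    proof
      fix x assume x: "x \<in> XS"
      have up1: "real (card (Oc x)) \<le> (p x + \<epsilon>) * real n"
      proof -
        have "(p x + e) * real n \<le> (p x + \<epsilon>) * real n" by (rule mult_right_mono) (use e in auto)
        thus ?thesis using up[OF x] by linarith
      qed
      have s1: "(\<Sum>x\<in>XS. real (card (Oc x))) = real (card (Oc x)) + (\<Sum>y\<in>XS - {x}. real (card (Oc y)))"
        by (rule sum.remove[OF finXS x])
      have s2: "(\<Sum>y\<in>XS - {x}. real (card (Oc y))) \<le> (\<Sum>y\<in>XS - {x}. (p y + e) * real n)"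
        by (rule sum_mono) (use up in \<open>auto intro: less_imp_le\<close>)
      have s3: "(\<Sum>y\<in>XS - {x}. (p y + e) * real n) = (1 - p x + real (card (XS - {x})) * e) * real n"
      proof -
        have "(\<Sum>y\<in>XS. p y) = p x + (\<Sum>y\<in>XS - {x}. p y)" by (rule sum.remove[OF finXS x])
        moreover have "(\<Sum>y\<in>XS. p y) = 1" using total by (simp add: XS_def TB_def p_def)
        ultimately have "(\<Sum>y\<in>XS - {x}. p y) = 1 - p x" by simp
        thus ?thesis by (simp add: sum_distrib_right[symmetric] sum.distrib)
      qed
      have s4: "real (card (XS - {x})) * e \<le> real (card XS) * e"
        by (rule mult_right_mono) (use e finXS in \<open>auto intro: card_mono\<close>)
      have "real n - real (card CS') * (e * real n) - (1 - p x + real (card XS) * e) * real n \<le> real (card (Oc x))"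
      proof -
        have "(1 - p x + real (card (XS - {x})) * e) * real n \<le> (1 - p x + real (card XS) * e) * real n"
          by (rule mult_right_mono) (use s4 in auto)
        thus ?thesis using cnt pcs s1 s2 s3 by linarith
      qed
      moreover have "(real (card XS) + real (card CS')) * e * real n \<le> \<epsilon> * real n"
        by (rule mult_right_mono[OF e(3)]) simp
      ultimately have lo1: "(p x - \<epsilon>) * real n \<le> real (card (Oc x))" by (simp add: algebra_simps)
      have "real (card (Oc x)) / real n \<le> p x + \<epsilon>" "p x - \<epsilon> \<le> real (card (Oc x)) / real n"
        using up1 lo1 n by (auto simp: field_simps)
      thus "\<bar>real (card (Oc x)) / real n - p x\<bar> \<le> \<epsilon>" by linarith
    qed
    thus False using nc by simp
  qed
qed

section \<open>Convexity and continuity of \<open>x * ln x\<close>\<close>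

lemma xlx_tangent:
  assumes "0 \<le> x" "0 < y" shows "xlx y + (ln y + 1) * (x - y) \<le> xlx x"
proof (cases "x = 0")
  case True
  thus ?thesis using assms by (simp add: xlx_def)
next
  case False
  hence x: "x > 0" using assms by simp
  have "ln (y / x) \<le> y / x - 1" by (rule ln_le_minus_one) (use x assms in simp)
  hence "x * (ln y - ln x) \<le> x * (y / x - 1)" using x assms by (intro mult_left_mono) (auto simp: ln_div)
  thus ?thesis using x by (simp add: xlx_def algebra_simps)
qed

lemma xlx_convex:
  assumes "0 \<le> a" "0 \<le> b" "0 \<le> t" "t \<le> 1"
  shows "xlx ((1 - t) * a + t * b) \<le> (1 - t) * xlx a + t * xlx b"
proof (cases "(1 - t) * a + t * b = 0")
  case True
  hence "(1 - t) * a = 0" "t * b = 0" using assms by (auto simp: add_nonneg_eq_0_iff)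
  thus ?thesis by auto
next
  case False
  define y where "y = (1 - t) * a + t * b"
  have y: "y > 0" using False assms by (simp add: y_def less_le)
  have "(1 - t) * (xlx y + (ln y + 1) * (a - y)) + t * (xlx y + (ln y + 1) * (b - y)) \<le> (1 - t) * xlx a + t * xlx b"
    by (intro add_mono mult_left_mono xlx_tangent) (use assms y in auto)
  moreover have "(1 - t) * (xlx y + (ln y + 1) * (a - y)) + t * (xlx y + (ln y + 1) * (b - y)) =
     xlx y + (ln y + 1) * (((1 - t) * a + t * b) - y)" by (simp add: algebra_simps)
  ultimately show ?thesis by (simp add: y_def)
qed

lemma xlx_nonpos: "0 \<le> x \<Longrightarrow> x \<le> 1 \<Longrightarrow> xlx x \<le> 0"
  by (cases "x = 0") (auto simp: xlx_def mult_nonneg_nonpos)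

lemma xlx_scale: "0 < t \<Longrightarrow> 0 < b \<Longrightarrow> xlx (t * b) = t * xlx b + t * b * ln t"
  by (simp add: xlx_def ln_mult algebra_simps)

lemma continuous_on_xlx: "continuous_on {0..} xlx"
proof (rule continuous_on_eq_continuous_within[THEN iffD2, rule_format])
  fix x :: real assume "x \<in> {0..}"
  then consider "x = 0" | "x > 0" by fastforce
  thus "continuous (at x within {0..}) xlx"
  proof cases
    case 1
    \<comment> \<open>\<open>ln t \<le> t - 1\<close> at \<open>t = 1 / sqrt y\<close> bounds
      \<open>- y * ln y\<close> by a multiple of \<open>sqrt y\<close>, which gives continuity at
      0.\<close>
    have b: "\<bar>xlx y\<bar> \<le> 2 * sqrt y" if "0 \<le> y" "y \<le> 1" for y
    proof (cases "y = 0")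
      case False
      hence y: "y > 0" using that by simp
      have "ln (1 / sqrt y) \<le> 1 / sqrt y - 1" by (rule ln_le_minus_one) (use y in simp)
      hence "- (ln y / 2) \<le> 1 / sqrt y" using y by (simp add: ln_div ln_sqrt)
      hence "y * (- (ln y / 2)) \<le> y * (1 / sqrt y)" by (rule mult_left_mono) (use y in simp)
      also have "y * (1 / sqrt y) = sqrt y" using y by (simp add: real_div_sqrt)
      finally have "- xlx y \<le> 2 * sqrt y" by (simp add: xlx_def)
      thus ?thesis using xlx_nonpos[OF that] by simp
    qed simp
    have "((\<lambda>y. 2 * sqrt y) \<longlongrightarrow> 2 * sqrt 0) (at 0 within {0..})"
      by (intro tendsto_intros)
    hence "((\<lambda>y. 2 * sqrt y) \<longlongrightarrow> 0) (at 0 within {0..})" by simp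
    moreover have "eventually (\<lambda>y. norm (xlx y) \<le> 2 * sqrt y) (at 0 within {0..})"
    proof -
      have "eventually (\<lambda>y::real. dist y 0 < 1) (at 0 within {0..})"
        by (rule eventually_at[THEN iffD2]) (auto intro: exI[of _ 1])
      moreover have "eventually (\<lambda>y::real. y \<in> {0..}) (at 0 within {0..})"
        by (simp add: eventually_at_filter)
      ultimately show ?thesis by eventually_elim (use b in \<open>auto simp: dist_real_def\<close>)
    qed
    ultimately have "(xlx \<longlongrightarrow> 0) (at 0 within {0..})" by (rule Lim_null_comparison[rotated])
    thus ?thesis unfolding 1 by (simp add: continuous_within)
  next
    case 2
    hence "isCont (\<lambda>y. y * ln y) x" by (intro continuous_intros) auto
    hence "isCont xlx x" by (simp add: xlx_def[abs_def])
    thus ?thesis by (rule continuous_at_imp_continuous_at_within)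
  qed
qed

section \<open>Maximisers of the entropy\<close>

text \<open>
  The edge law of two marks \<open>a\<close>, \<open>b\<close> is coded as \<open>(p, q, s)\<close>: the pairs \<open>(a, a)\<close> and \<open>(b, b)\<close> have
  probabilities \<open>p\<close> and \<open>q\<close>, and each of \<open>(a, b)\<close>, \<open>(b, a)\<close> has probability \<open>s\<close>.
\<close>

definition edge_entropy :: "real \<Rightarrow> real \<Rightarrow> real \<Rightarrow> real \<Rightarrow> real" where
  "edge_entropy K p q s = (K - 1) * (xlx (p + s) + xlx (q + s)) - (K / 2) * (xlx p + xlx q + 2 * xlx s)"

definition edge_laws :: "(real \<times> real \<times> real) set" where
  "edge_laws = {(p, q, s). 0 \<le> p \<and> 0 \<le> q \<and> 0 \<le> s \<and> p + q + 2 * s = 1}"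

definition feasible :: "real \<Rightarrow> real \<Rightarrow> real \<Rightarrow> real \<Rightarrow> (real \<times> real \<times> real) set" where
  "feasible h1 h2 h0 c = {(p, q, s). 0 \<le> p \<and> 0 \<le> q \<and> 0 \<le> s \<and> p + q + 2 * s = 1 \<and> c \<le> p * h1 + q * h2 + 2 * s * h0}"

lemma edge_entropy_swap: "edge_entropy K q p s = edge_entropy K p q s"
  by (simp add: edge_entropy_def algebra_simps)

lemma continuous_on_edge_entropy: "continuous_on edge_laws (\<lambda>(p, q, s). edge_entropy K p q s)"
proof -
  have x: "continuous_on edge_laws (\<lambda>z. xlx (f z))" if "continuous_on edge_laws f" "\<And>z. z \<in> edge_laws \<Longrightarrow> 0 \<le> f z"
    for f :: "real \<times> real \<times> real \<Rightarrow> real"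
    by (rule continuous_on_compose2[OF continuous_on_xlx that(1)]) (use that(2) in auto)
  have "continuous_on edge_laws (\<lambda>z. edge_entropy K (fst z) (fst (snd z)) (snd (snd z)))"
    unfolding edge_entropy_def by (intro continuous_intros x) (auto simp: edge_laws_def)
  thus ?thesis by (simp add: case_prod_beta')
qed

lemma compact_feasible: "compact (feasible h1 h2 h0 c)"
proof (rule compact_eq_bounded_closed[THEN iffD2], rule conjI)
  have "feasible h1 h2 h0 c \<subseteq> {0..1} \<times> {0..1} \<times> {0..1}" by (auto simp: feasible_def)
  thus "bounded (feasible h1 h2 h0 c)"
    by (rule bounded_subset[rotated]) (intro bounded_Times bounded_closed_interval)
  have "feasible h1 h2 h0 c = {z. 0 \<le> fst z} \<inter> {z. 0 \<le> fst (snd z)} \<inter> {z. 0 \<le> snd (snd z)} \<inter>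
     {z. fst z + fst (snd z) + 2 * snd (snd z) = 1} \<inter> {z. c \<le> fst z * h1 + fst (snd z) * h2 + 2 * snd (snd z) * h0}"
    by (auto simp: feasible_def)
  moreover have "closed \<dots>"
    by (intro closed_Int closed_Collect_le closed_Collect_eq continuous_intros)
  ultimately show "closed (feasible h1 h2 h0 c)" by simp
qed

lemma feasible_subset: "feasible h1 h2 h0 c \<subseteq> edge_laws"
  by (auto simp: feasible_def edge_laws_def)

text \<open>The segment from the uniform law, whose energy is below \<open>c\<close>, to an extreme
  law of energy above \<open>c\<close> crosses the level \<open>c\<close>; all its points but the
  far end have positive coordinates.\<close>

lemma interior_feasible:
  fixes h1 h2 h0 c :: real
  assumes "(h1 + h2 + 2 * h0) / 4 < c" "c < max h1 (max h2 h0)"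
  shows "\<exists>p q s. 0 < p \<and> 0 < q \<and> 0 < s \<and> p + q + 2 * s = 1 \<and> p * h1 + q * h2 + 2 * s * h0 = c"
proof -
  define r where "r = (h1 + h2 + 2 * h0) / 4"
  have ex: "\<exists>p q s. 0 < p \<and> 0 < q \<and> 0 < s \<and> p + q + 2 * s = 1 \<and> p * h1 + q * h2 + 2 * s * h0 = c"
    if v: "0 \<le> v1" "0 \<le> v2" "0 \<le> v3" "v1 + v2 + 2 * v3 = 1" "c < v1 * h1 + v2 * h2 + 2 * v3 * h0" for v1 v2 v3
  proof -
    define m where "m = v1 * h1 + v2 * h2 + 2 * v3 * h0"
    define t where "t = (m - c) / (m - r)"
    have rc: "r < c" "c < m" using assms(1) v(5) by (auto simp: r_def m_def)
    have t: "0 < t" "t < 1" using rc by (auto simp: t_def)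
    define p q s where "p = (1 - t) * v1 + t / 4" and "q = (1 - t) * v2 + t / 4" and "s = (1 - t) * v3 + t / 4"
    have "0 < p" "0 < q" "0 < s" unfolding p_def q_def s_def using t v by (auto intro: add_nonneg_pos)
    moreover have "p + q + 2 * s = (1 - t) * (v1 + v2 + 2 * v3) + t" by (simp add: p_def q_def s_def algebra_simps)
    moreover have "p * h1 + q * h2 + 2 * s * h0 = m - t * (m - r)"
      by (simp add: p_def q_def s_def m_def r_def field_simps)
    moreover have "t * (m - r) = m - c" using rc by (simp add: t_def)
    ultimately show ?thesis using v(4) by auto
  qed
  consider "c < h1" | "c < h2" | "c < h0" using assms(2) by linarith
  thus ?thesis
  proof cases
    case 1 show ?thesis by (rule ex[of 1 0 0]) (use 1 in auto)
  next
    case 2 show ?thesis by (rule ex[of 0 1 0]) (use 2 in auto)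
  next
    case 3 show ?thesis by (rule ex[of 0 0 "1/2"]) (use 3 in auto)
  qed
qed

text \<open>At a law with a single mark one marginal vanishes and
  \<open>boundary_not_maximal\<close> does not apply. After a move by \<open>e\<close> the singular
  vertex and edge terms combine to \<open>- e * ln e\<close>, which exceeds the linear loss
  \<open>(K - 1) * e\<close> once \<open>ln e \<le> - K\<close>.\<close>

lemma entropy_near_vertex:
  assumes "2 \<le> K" "0 < e" "e \<le> exp (- K)"
  shows "0 < edge_entropy K (1 - 2 * e) 0 e"
proof -
  have "exp (- K) \<le> exp (- ln 2 * 1)" using assms(1) ln_2_less_1 by (simp)
  hence e: "e \<le> 1 / 2" using assms(3) by (simp add: exp_minus)
  have "1 * ((0::real)) + (ln 1 + 1) * ((1 - e) - 1) \<le> xlx (1 - e)" using xlx_tangent[of "1 - e" 1] e by simp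
  hence 1: "- e \<le> xlx (1 - e)" by simp
  have 2: "xlx (1 - 2 * e) \<le> 0" by (rule xlx_nonpos) (use e assms in auto)
  have "ln e \<le> - K" using assms by (metis ln_exp ln_le_cancel_iff exp_gt_zero)
  hence "e * ln e \<le> e * (- K)" by (rule mult_left_mono) (use assms in simp)
  hence "e * K \<le> - xlx e" by (simp add: xlx_def)
  moreover have "edge_entropy K (1 - 2 * e) 0 e = (K - 1) * xlx (1 - e) - xlx e - (K / 2) * xlx (1 - 2 * e)"
    by (simp add: edge_entropy_def algebra_simps)
  moreover have "(K - 1) * (- e) \<le> (K - 1) * xlx (1 - e)" by (rule mult_left_mono[OF 1]) (use assms in simp)
  moreover have "(K / 2) * xlx (1 - 2 * e) \<le> 0" using 2 assms(1) by (simp add: mult_nonneg_nonpos)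
  ultimately show ?thesis using assms(2) by (simp add: algebra_simps)
qed

text \<open>If a single-mark law is feasible, so is a law near one of the two that has some mixed
  edges. With slack in the constraint any small move is allowed; without slack it is allowed if
  \<open>h0\<close> exceeds \<open>c\<close>, and otherwise the other single-mark law has
  slack.\<close>

lemma exists_positive_entropy:
  assumes K: "2 \<le> K" and c: "c < max h1 (max h2 h0)" and v: "c \<le> h1 \<or> c \<le> h2"
  shows "\<exists>p q s. (p, q, s) \<in> feasible h1 h2 h0 c \<and> 0 < edge_entropy K p q s"
proof -
  have strict: "\<exists>e. 0 < e \<and> e \<le> exp (- K) \<and> e \<le> 1 / 4 \<and> c \<le> (1 - 2 * e) * h + 2 * e * h0" if "c < h \<or> c \<le> h \<and> c < h0" for h
  proof (cases "c < h")
    case True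
    define e where "e = min (min (exp (- K)) (1 / 4)) ((h - c) / (2 * (\<bar>h\<bar> + \<bar>h0\<bar> + 1)))"
    have e: "0 < e" using True by (simp add: e_def)
    have "e * (2 * (\<bar>h\<bar> + \<bar>h0\<bar> + 1)) \<le> h - c"
    proof -
      have "e \<le> (h - c) / (2 * (\<bar>h\<bar> + \<bar>h0\<bar> + 1))" by (simp add: e_def)
      thus ?thesis by (simp add: pos_le_divide_eq)
    qed
    moreover have "2 * e * (h - h0) \<le> e * (2 * (\<bar>h\<bar> + \<bar>h0\<bar> + 1))"
    proof -
      have "2 * e * (h - h0) \<le> 2 * e * (\<bar>h\<bar> + \<bar>h0\<bar> + 1)" by (rule mult_left_mono) (use e in auto)
      thus ?thesis by (simp add: algebra_simps)
    qed
    ultimately have "c \<le> (1 - 2 * e) * h + 2 * e * h0" by (simp add: algebra_simps)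
    moreover have "e \<le> exp (- K)" "e \<le> 1 / 4"
      unfolding e_def by (rule min.coboundedI1, rule min.coboundedI1, rule order_refl, rule min.coboundedI1, rule min.coboundedI2, rule order_refl)
    ultimately show ?thesis using e by blast
  next
    case False
    hence h: "c = h" "c < h0" using that by auto
    define e where "e = min (exp (- K)) (1 / 4)"
    have "0 < e" by (simp add: e_def)
    hence "c \<le> (1 - 2 * e) * h + 2 * e * h0" using h by (simp add: algebra_simps)
    moreover have "e \<le> exp (- K)" "e \<le> 1 / 4" by (auto simp: e_def)
    ultimately show ?thesis using \<open>0 < e\<close> by blast
  qed
  consider "c < h1 \<or> c \<le> h1 \<and> c < h0" | "c < h2 \<or> c \<le> h2 \<and> c < h0" using c v by linarith
  thus ?thesis
  proof cases
    case 1
    then obtain e where e: "0 < e" "e \<le> exp (- K)" "e \<le> 1 / 4" "c \<le> (1 - 2 * e) * h1 + 2 * e * h0" using strict by blast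
    have "(1 - 2 * e, 0, e) \<in> feasible h1 h2 h0 c" using e by (simp add: feasible_def)
    thus ?thesis using entropy_near_vertex[OF K e(1,2)] by blast
  next
    case 2
    then obtain e where e: "0 < e" "e \<le> exp (- K)" "e \<le> 1 / 4" "c \<le> (1 - 2 * e) * h2 + 2 * e * h0" using strict by blast
    have "(0, 1 - 2 * e, e) \<in> feasible h1 h2 h0 c" using e by (simp add: feasible_def)
    thus ?thesis using entropy_near_vertex[OF K e(1,2)] edge_entropy_swap by metis
  qed
qed

text \<open>
  At a boundary point with positive marginals the slope of the entropy towards the interior is infinite.
\<close>

lemma boundary_not_maximal:
  assumes K: "2 \<le> K" and m: "0 \<le> p" "0 \<le> q" "0 \<le> s" "0 < p + s" "0 < q + s" "p = 0 \<or> q = 0 \<or> s = 0"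
    and z: "0 < p'" "0 < q'" "0 < s'"
  shows "\<exists>t. 0 < t \<and> t < 1 \<and> edge_entropy K p q s <
     edge_entropy K ((1 - t) * p + t * p') ((1 - t) * q + t * q') ((1 - t) * s + t * s')"
proof -
  define A where "A = (ln (p + s) + 1) * ((p' + s') - (p + s)) + (ln (q + s) + 1) * ((q' + s') - (q + s))"
  define B where "B = (xlx p' - xlx p) + (xlx q' - xlx q) + 2 * (xlx s' - xlx s)"
  define w where "w = (if p = 0 then p' else 0) + (if q = 0 then q' else 0) + 2 * (if s = 0 then s' else 0)"
  have w: "w > 0" using m(6) z by (auto simp: w_def)
  define C where "C = (K - 1) * A - (K / 2) * B"
  \<comment> \<open>Up to a factor \<open>t\<close> the entropy changes by at least
    \<open>C - (K / 2) * w * ln t\<close>, where \<open>w\<close> collects the coordinates that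
    leave 0. This \<open>t\<close> makes the logarithmic term equal to
    \<open>\<bar>C\<bar> + 1\<close>.\<close>
  define t where "t = exp (- (\<bar>C\<bar> + 1) / ((K / 2) * w))"
  have kw: "(K / 2) * w > 0" using K w by simp
  have t: "0 < t" "t < 1" using kw by (auto simp: t_def divide_neg_pos)
  have lt: "(K / 2) * w * ln t = - (\<bar>C\<bar> + 1)" using K w by (simp add: t_def)
  have up: "xlx ((1 - t) * a + t * b) \<le> xlx a + t * (xlx b - xlx a) + t * (if a = 0 then b else 0) * ln t"
    if "0 \<le> a" "0 < b" for a b
  proof (cases "a = 0")
    case True
    thus ?thesis using xlx_scale[OF t(1) that(2)] by simp
  next
    case False
    thus ?thesis using xlx_convex[of a b t] that t by (simp add: algebra_simps)
  qed
  have lo: "xlx a + t * ((ln a + 1) * (b - a)) \<le> xlx ((1 - t) * a + t * b)" if "0 < a" "0 < b" for a b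
  proof -
    have "xlx a + (ln a + 1) * (((1 - t) * a + t * b) - a) \<le> xlx ((1 - t) * a + t * b)"
      by (rule xlx_tangent) (use that t in \<open>auto intro: add_nonneg_nonneg\<close>)
    thus ?thesis by (simp add: algebra_simps)
  qed
  define P Q S where "P = (1 - t) * p + t * p'" and "Q = (1 - t) * q + t * q'" and "S = (1 - t) * s + t * s'"
  have PS: "P + S = (1 - t) * (p + s) + t * (p' + s')" "Q + S = (1 - t) * (q + s) + t * (q' + s')"
    by (auto simp: P_def Q_def S_def algebra_simps)
  have "xlx (p + s) + xlx (q + s) + t * A \<le> xlx (P + S) + xlx (Q + S)"
    using lo[of "p + s" "p' + s'"] lo[of "q + s" "q' + s'"] m z unfolding PS A_def by (simp add: algebra_simps)
  hence 1: "(K - 1) * (xlx (p + s) + xlx (q + s) + t * A) \<le> (K - 1) * (xlx (P + S) + xlx (Q + S))"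
    by (rule mult_left_mono) (use K in simp)
  have "xlx P + xlx Q + 2 * xlx S \<le> xlx p + xlx q + 2 * xlx s + t * B + t * w * ln t"
    using up[OF m(1) z(1)] up[OF m(2) z(2)] up[OF m(3) z(3)]
    unfolding P_def[symmetric] Q_def[symmetric] S_def[symmetric] B_def w_def by (simp add: algebra_simps)
  hence 2: "(K / 2) * (xlx P + xlx Q + 2 * xlx S) \<le> (K / 2) * (xlx p + xlx q + 2 * xlx s + t * B + t * w * ln t)"
    by (rule mult_left_mono) (use K in simp)
  have "edge_entropy K p q s + t * (C - (K / 2) * w * ln t) \<le> edge_entropy K P Q S"
    using 1 2 unfolding edge_entropy_def C_def by (simp add: algebra_simps)
  moreover have "t * (C - (K / 2) * w * ln t) > 0" unfolding lt using t by simp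
  ultimately show ?thesis using t unfolding P_def Q_def S_def by auto
qed

lemma edge_entropy_stationary:
  assumes m: "0 < p" "0 < q" "0 < s" and d0: "0 < d"
    and max: "\<And>t. \<bar>t\<bar> < d \<Longrightarrow> edge_entropy K (p + t * d1) (q + t * d2) (s + t * d3) \<le> edge_entropy K p q s"
  shows "((K - 1) * (ln (p + s) + 1) - (K / 2) * (ln p + 1)) * d1 +
      ((K - 1) * (ln (q + s) + 1) - (K / 2) * (ln q + 1)) * d2 +
      ((K - 1) * (ln (p + s) + ln (q + s) + 2) - K * (ln s + 1)) * d3 = 0" (is "?D = 0")
proof -
  have x: "((\<lambda>t. xlx (a + t * e)) has_real_derivative (ln a + 1) * e) (at 0)" if "0 < a" for a e
    unfolding xlx_def by (auto intro!: derivative_eq_intros simp: that less_imp_neq[OF that, symmetric] algebra_simps)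
  have "((\<lambda>t. edge_entropy K (p + t * d1) (q + t * d2) (s + t * d3)) has_real_derivative
     (K - 1) * ((ln (p + s) + 1) * (d1 + d3) + (ln (q + s) + 1) * (d2 + d3)) -
     (K / 2) * ((ln p + 1) * d1 + (ln q + 1) * d2 + 2 * ((ln s + 1) * d3))) (at 0)"
  proof -
    have e: "edge_entropy K (p + t * d1) (q + t * d2) (s + t * d3) =
      (K - 1) * (xlx ((p + s) + t * (d1 + d3)) + xlx ((q + s) + t * (d2 + d3))) -
      (K / 2) * (xlx (p + t * d1) + xlx (q + t * d2) + 2 * xlx (s + t * d3))" for t
      by (simp add: edge_entropy_def algebra_simps)
    show ?thesis unfolding e
      by (intro DERIV_diff DERIV_cmult DERIV_add x) (use m in auto)
  qed
  moreover have "(K - 1) * ((ln (p + s) + 1) * (d1 + d3) + (ln (q + s) + 1) * (d2 + d3)) -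
     (K / 2) * ((ln p + 1) * d1 + (ln q + 1) * d2 + 2 * ((ln s + 1) * d3)) = ?D"
    by (simp add: field_simps)
  ultimately have "((\<lambda>t. edge_entropy K (p + t * d1) (q + t * d2) (s + t * d3)) has_real_derivative ?D) (at 0)" by simp
  thus ?thesis by (rule DERIV_local_max[OF _ d0]) (use max in auto)
qed

text \<open>Boundary points are excluded by strict increase of the entropy. The energy constraint is
  active, because without it the only stationary point is the uniform law, whose energy is below
  \<open>c\<close>. What remains is the Lagrange condition for two equality constraints, and the
  coefficient \<open>b\<close> of the energies is the inverse temperature.\<close>

theorem entropy_maximiser:
  assumes K: "2 \<le> K" and c: "(h1 + h2 + 2 * h0) / 4 < c" "c < max h1 (max h2 h0)"
    and m: "(p, q, s) \<in> feasible h1 h2 h0 c"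
    and max: "\<And>p' q' s'. (p', q', s') \<in> feasible h1 h2 h0 c \<Longrightarrow> edge_entropy K p' q' s' \<le> edge_entropy K p q s"
  defines "g \<equiv> (K - 1) / K"
  shows "0 < p \<and> 0 < q \<and> 0 < s \<and> p * h1 + q * h2 + 2 * s * h0 = c \<and>
    (\<exists>b k. ln p = 2 * g * ln (p + s) + b * h1 + k \<and> ln q = 2 * g * ln (q + s) + b * h2 + k \<and>
       ln s = g * ln (p + s) + g * ln (q + s) + b * h0 + k)"
proof -
  have m': "0 \<le> p" "0 \<le> q" "0 \<le> s" "p + q + 2 * s = 1" "c \<le> p * h1 + q * h2 + 2 * s * h0"
    using m by (auto simp: feasible_def)
  obtain p0 q0 s0 where z: "0 < p0" "0 < q0" "0 < s0" "p0 + q0 + 2 * s0 = 1" "p0 * h1 + q0 * h2 + 2 * s0 * h0 = c"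
    using interior_feasible[OF c] by blast
  have pos: "0 < p \<and> 0 < q \<and> 0 < s"
  proof (rule ccontr)
    assume bd: "\<not> (0 < p \<and> 0 < q \<and> 0 < s)"
    show False
    proof (cases "0 < p + s \<and> 0 < q + s")
      case True
      then obtain t where t: "0 < t" "t < 1" and gt: "edge_entropy K p q s <
         edge_entropy K ((1 - t) * p + t * p0) ((1 - t) * q + t * q0) ((1 - t) * s + t * s0)"
        using boundary_not_maximal[OF K m'(1-3) _ _ _ z(1-3)] bd m'(1-3) by fastforce
      have "((1 - t) * p + t * p0, (1 - t) * q + t * q0, (1 - t) * s + t * s0) \<in> feasible h1 h2 h0 c"
      proof -
        have "(1 - t) * p + t * p0 + ((1 - t) * q + t * q0) + 2 * ((1 - t) * s + t * s0) = (1 - t) * (p + q + 2 * s) + t * (p0 + q0 + 2 * s0)"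
          by (simp add: algebra_simps)
        hence "(1 - t) * p + t * p0 + ((1 - t) * q + t * q0) + 2 * ((1 - t) * s + t * s0) = 1" using m' z by simp
        moreover have "c \<le> ((1 - t) * p + t * p0) * h1 + ((1 - t) * q + t * q0) * h2 + 2 * ((1 - t) * s + t * s0) * h0"
        proof -
          have "c = (1 - t) * c + t * c" by (simp add: algebra_simps)
          also have "\<dots> \<le> (1 - t) * (p * h1 + q * h2 + 2 * s * h0) + t * (p0 * h1 + q0 * h2 + 2 * s0 * h0)"
            unfolding z(5) by (rule add_right_mono, rule mult_left_mono[OF m'(5)]) (use t in simp)
          also have "\<dots> = ((1 - t) * p + t * p0) * h1 + ((1 - t) * q + t * q0) * h2 + 2 * ((1 - t) * s + t * s0) * h0"
            by (simp add: algebra_simps)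
          finally show ?thesis .
        qed
        ultimately show ?thesis using m'(1-3) z(1-3) t by (simp add: feasible_def)
      qed
      thus False using max gt by fastforce
    next
      case False
      hence v: "(p = 1 \<and> q = 0 \<and> s = 0) \<or> (p = 0 \<and> q = 1 \<and> s = 0)" using m' by auto
      hence "edge_entropy K p q s = 0" by (auto simp: edge_entropy_def)
      moreover have "c \<le> h1 \<or> c \<le> h2" using v m'(5) by auto
      ultimately show False using exists_positive_entropy[OF K c(2)] max by (metis less_le_not_le order_less_le_trans)
    qed
  qed
  define g1 where "g1 = (K - 1) * (ln (p + s) + 1) - (K / 2) * (ln p + 1)"
  define g2 where "g2 = (K - 1) * (ln (q + s) + 1) - (K / 2) * (ln q + 1)"
  define g3 where "g3 = (K - 1) * (ln (p + s) + ln (q + s) + 2) - K * (ln s + 1)"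
  \<comment> \<open>\<open>ev\<close> says that small steps in the given direction respect the
    energy constraint. It holds for every direction if the constraint has slack, and for directions
    of constant energy in any case.\<close>
  have stat: "g1 * d1 + g2 * d2 + g3 * d3 = 0"
    if d: "d1 + d2 + 2 * d3 = 0" and ev: "\<exists>e>0. \<forall>t. \<bar>t\<bar> < e \<longrightarrow> c \<le> p * h1 + q * h2 + 2 * s * h0 + t * (d1 * h1 + d2 * h2 + 2 * d3 * h0)"
    for d1 d2 d3
  proof -
    obtain e where e: "e > 0" "\<And>t. \<bar>t\<bar> < e \<Longrightarrow> c \<le> p * h1 + q * h2 + 2 * s * h0 + t * (d1 * h1 + d2 * h2 + 2 * d3 * h0)"
      using ev by blast
    define M where "M = \<bar>d1\<bar> + \<bar>d2\<bar> + \<bar>d3\<bar> + 1"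
    define e' where "e' = min e (min p (min q s) / M)"
    have M: "M > 0" by (simp add: M_def)
    have e': "e' > 0" using e(1) pos M by (simp add: e'_def)
    have nn: "0 \<le> y + t * d" if "\<bar>t\<bar> < e'" "min p (min q s) \<le> y" "\<bar>d\<bar> \<le> M" for t y d
    proof -
      have "\<bar>t * d\<bar> \<le> (min p (min q s) / M) * M"
        unfolding abs_mult using that M by (intro mult_mono) (auto simp: e'_def)
      also have "\<dots> = min p (min q s)" using M by simp
      finally have "\<bar>t * d\<bar> \<le> y" using that(2) by linarith
      thus ?thesis by linarith
    qed
    show ?thesis
      unfolding g1_def g2_def g3_def
    proof (rule edge_entropy_stationary[OF _ _ _ e'])
      fix t assume t: "\<bar>t\<bar> < e'"
      have "(p + t * d1, q + t * d2, s + t * d3) \<in> feasible h1 h2 h0 c"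
      proof -
        have "0 \<le> p + t * d1" "0 \<le> q + t * d2" "0 \<le> s + t * d3" by (rule nn[OF t]; simp add: M_def)+
        moreover have "p + t * d1 + (q + t * d2) + 2 * (s + t * d3) = (p + q + 2 * s) + t * (d1 + d2 + 2 * d3)" by (simp add: algebra_simps)
        moreover have "(p + t * d1) * h1 + (q + t * d2) * h2 + 2 * (s + t * d3) * h0 = p * h1 + q * h2 + 2 * s * h0 + t * (d1 * h1 + d2 * h2 + 2 * d3 * h0)"
          by (simp add: algebra_simps)
        moreover have "\<bar>t\<bar> < e" using t by (simp add: e'_def)
        ultimately show ?thesis using m'(4) d e(2)[of t] by (simp add: feasible_def)
      qed
      thus "edge_entropy K (p + t * d1) (q + t * d2) (s + t * d3) \<le> edge_entropy K p q s" by (rule max)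
    qed (use pos in auto)
  qed
  have eq: "p * h1 + q * h2 + 2 * s * h0 = c"
  proof (rule ccontr)
    assume "p * h1 + q * h2 + 2 * s * h0 \<noteq> c"
    hence gt: "c < p * h1 + q * h2 + 2 * s * h0" using m'(5) by simp
    have ev: "\<exists>e>0. \<forall>t. \<bar>t\<bar> < e \<longrightarrow> c \<le> p * h1 + q * h2 + 2 * s * h0 + t * D" for D
    proof -
      define e where "e = (p * h1 + q * h2 + 2 * s * h0 - c) / (\<bar>D\<bar> + 1)"
      have "e > 0" using gt by (simp add: e_def)
      moreover have "c \<le> p * h1 + q * h2 + 2 * s * h0 + t * D" if "\<bar>t\<bar> < e" for t
      proof -
        have "\<bar>t * D\<bar> \<le> e * (\<bar>D\<bar> + 1)" unfolding abs_mult using that by (intro mult_mono) auto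
        also have "\<dots> = p * h1 + q * h2 + 2 * s * h0 - c" by (simp add: e_def)
        finally show ?thesis by simp
      qed
      ultimately show ?thesis by blast
    qed
    \<comment> \<open>Two directions span the plane of total mass 0. Together they give
      \<open>p * q = s * s\<close>, so the edge law is a product law, and then the factors
      \<open>K - 1\<close> and \<open>K\<close> in \<open>e2\<close> force all entries to be
      equal.\<close>
    have "g1 = g2" using stat[of 1 "-1" 0] ev by simp
    moreover have "2 * g1 = g3" using stat[of 2 0 "-1"] ev by simp
    ultimately have e1: "(K - 1) * (ln (p + s) - ln (q + s)) = (K / 2) * (ln p - ln q)"
      and e2: "(K - 1) * (ln (p + s) - ln (q + s)) = K * (ln p - ln s)"
      unfolding g1_def g2_def g3_def by (simp_all add: field_simps)
    have "K * (ln p - ln q) = 2 * ((K / 2) * (ln p - ln q))" by simp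
    also have "\<dots> = 2 * (K * (ln p - ln s))" using e1 e2 by auto
    finally have "K * (ln p - ln q) = K * (2 * (ln p - ln s))" by simp
    hence "ln p - ln q = 2 * (ln p - ln s)" using K by simp
    hence "ln p + ln q = 2 * ln s" by simp
    hence "ln (p * q) = ln (s * s)" using pos by (simp add: ln_mult)
    hence pq: "p * q = s * s" using pos by simp
    have "(p + s) * s = p * (q + s)" using pq by (simp add: algebra_simps)
    hence "ln ((p + s) * s) = ln (p * (q + s))" by simp
    hence "ln (p + s) + ln s = ln p + ln (q + s)" using pos by (simp add: ln_mult)
    hence L: "ln (p + s) - ln (q + s) = ln p - ln s" by linarith
    have "(K - 1) * (ln p - ln s) = K * (ln p - ln s)" using e2 unfolding L .
    hence "ln p = ln s" by simp
    hence ps: "p = s" using pos by simp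
    hence qs: "q = s" using pq pos by simp
    have "s = 1 / 4" using m'(4) ps qs by simp
    hence "p * h1 + q * h2 + 2 * s * h0 = (h1 + h2 + 2 * h0) / 4" using ps qs by (simp add: field_simps)
    thus False using gt c(1) by simp
  qed
  \<comment> \<open>The direction is the cross product of \<open>(1, 1, 2)\<close> and
    \<open>(h1, h2, 2 * h0)\<close>, the coefficients of mass and energy. Orthogonality to it puts
    the gradient into their span, which yields the multipliers \<open>la\<close> and
    \<open>mu\<close>.\<close>
  have cr: "g1 * (2 * h0 - 2 * h2) + g2 * (2 * h1 - 2 * h0) + g3 * (h2 - h1) = 0"
  proof (rule stat)
    show "2 * h0 - 2 * h2 + (2 * h1 - 2 * h0) + 2 * (h2 - h1) = 0" by simp
    have "(2 * h0 - 2 * h2) * h1 + (2 * h1 - 2 * h0) * h2 + 2 * (h2 - h1) * h0 = 0" by (simp add: algebra_simps)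
    thus "\<exists>e>0. \<forall>t. \<bar>t\<bar> < e \<longrightarrow> c \<le> p * h1 + q * h2 + 2 * s * h0 + t * ((2 * h0 - 2 * h2) * h1 + (2 * h1 - 2 * h0) * h2 + 2 * (h2 - h1) * h0)"
      using m'(5) by (intro exI[of _ 1]) simp
  qed
  have "\<exists>la mu. g1 = la + mu * h1 \<and> g2 = la + mu * h2 \<and> g3 = 2 * la + 2 * mu * h0"
  proof (cases "h1 = h2")
    case False
    define mu where "mu = (g1 - g2) / (h1 - h2)"
    define la where "la = g1 - mu * h1"
    have mu: "mu * (h1 - h2) = g1 - g2" using False by (simp add: mu_def)
    have "g1 = la + mu * h1" "g2 = la + mu * h2" using mu by (auto simp: la_def algebra_simps)
    moreover have "(g3 - (2 * la + 2 * mu * h0)) * (h2 - h1) = 0"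
      using cr unfolding calculation by (simp add: algebra_simps)
    ultimately show ?thesis using False by auto
  next
    case True
    \<comment> \<open>If all three energies were equal, no \<open>c\<close> could lie strictly
      between their mean and their maximum.\<close>
    have ne: "h0 \<noteq> h1" using c True by auto
    have "(g1 - g2) * (2 * (h0 - h1)) = 0" using cr True by (simp add: algebra_simps)
    hence "g1 = g2" using ne by simp
    define mu where "mu = (g3 / 2 - g1) / (h0 - h1)"
    define la where "la = g1 - mu * h1"
    have "mu * (h0 - h1) = g3 / 2 - g1" using ne by (simp add: mu_def)
    thus ?thesis using True \<open>g1 = g2\<close> by (intro exI[of _ la] exI[of _ mu]) (auto simp: la_def algebra_simps)
  qed
  then obtain la mu where lm: "g1 = la + mu * h1" "g2 = la + mu * h2" "g3 = 2 * la + 2 * mu * h0" by blast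
  \<comment> \<open>The stationarity equations are solved for \<open>ln p\<close> and
    \<open>ln q\<close> on division by \<open>K / 2\<close>, and for \<open>ln s\<close> on division
    by \<open>K\<close>.\<close>
  define b where "b = - 2 * mu / K"
  define k where "k = - (2 / K) * (la - (K - 1) + K / 2)"
  have k0: "K \<noteq> 0" using K by simp
  have kg: "K * g = K - 1" and kb: "K * b = - 2 * mu" and kk: "K * k = - 2 * (la - (K - 1) + K / 2)"
    using k0 by (simp_all add: g_def b_def k_def)
  have ex1: "K * (2 * g * L + b * h + k) = 2 * (K * g) * L + (K * b) * h + K * k" for L h by (simp add: algebra_simps)
  have ex2: "K * (g * L + g * L' + b * h + k) = (K * g) * L + (K * g) * L' + (K * b) * h + K * k" for L L' h by (simp add: algebra_simps)
  have "K * ln p = K * (2 * g * ln (p + s) + b * h1 + k)"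
    unfolding ex1 kg kb kk using lm(1) unfolding g1_def by (simp add: field_simps)
  moreover have "K * ln q = K * (2 * g * ln (q + s) + b * h2 + k)"
    unfolding ex1 kg kb kk using lm(2) unfolding g2_def by (simp add: field_simps)
  moreover have "K * ln s = K * (g * ln (p + s) + g * ln (q + s) + b * h0 + k)"
    unfolding ex2 kg kb kk using lm(3) unfolding g3_def by (simp add: field_simps)
  ultimately have "ln p = 2 * g * ln (p + s) + b * h1 + k \<and> ln q = 2 * g * ln (q + s) + b * h2 + k \<and>
       ln s = g * ln (p + s) + g * ln (q + s) + b * h0 + k" using k0 by simp
  thus ?thesis using pos eq by blast
qed

text \<open>The lower bound for the number of simple configurations rounds the edge law to a lattice
  and perturbs the energy by repairs. It needs positive entries and slack in the constraint; both
  are available, at an arbitrarily small loss of entropy, on a segment towards an interior law of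
  energy \<open>c' > c\<close>.\<close>

lemma entropy_interior_approx:
  assumes c: "(h1 + h2 + 2 * h0) / 4 < c" "c < max h1 (max h2 h0)" and m: "(p, q, s) \<in> feasible h1 h2 h0 c" and e: "0 < e"
  shows "\<exists>p' q' s'. 0 < p' \<and> 0 < q' \<and> 0 < s' \<and> p' + q' + 2 * s' = 1 \<and> c < p' * h1 + q' * h2 + 2 * s' * h0 \<and>
    edge_entropy K p q s - e < edge_entropy K p' q' s'"
proof -
  define c' where "c' = (c + max h1 (max h2 h0)) / 2"
  have c': "c < c'" "(h1 + h2 + 2 * h0) / 4 < c'" "c' < max h1 (max h2 h0)" using c by (auto simp: c'_def)
  obtain p0 q0 s0 where z: "0 < p0" "0 < q0" "0 < s0" "p0 + q0 + 2 * s0 = 1" "p0 * h1 + q0 * h2 + 2 * s0 * h0 = c'"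
    using interior_feasible[OF c'(2,3)] by blast
  have m': "0 \<le> p" "0 \<le> q" "0 \<le> s" "p + q + 2 * s = 1" "c \<le> p * h1 + q * h2 + 2 * s * h0"
    using m by (auto simp: feasible_def)
  define P Q S where "P t = (1 - t) * p + t * p0" and "Q t = (1 - t) * q + t * q0" and "S t = (1 - t) * s + t * s0" for t
  have sum1: "P t + Q t + 2 * S t = 1" for t
  proof -
    have "P t + Q t + 2 * S t = (1 - t) * (p + q + 2 * s) + t * (p0 + q0 + 2 * s0)" by (simp add: P_def Q_def S_def algebra_simps)
    thus ?thesis using m' z by simp
  qed
  have nn: "0 \<le> P t" "0 \<le> Q t" "0 \<le> S t" if "0 \<le> t" "t \<le> 1" for t
    unfolding P_def Q_def S_def using m' z that by auto
  have inL: "(P t, Q t, S t) \<in> edge_laws" if "0 \<le> t" "t \<le> 1" for t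
    using nn[OF that] sum1 by (simp add: edge_laws_def)
  have "continuous_on {0..1} (\<lambda>t. (\<lambda>(p, q, s). edge_entropy K p q s) (P t, Q t, S t))"
    by (rule continuous_on_compose2[OF continuous_on_edge_entropy])
       (auto simp: P_def Q_def S_def inL[unfolded P_def Q_def S_def] intro!: continuous_intros)
  hence "((\<lambda>t. edge_entropy K (P t) (Q t) (S t)) \<longlongrightarrow> edge_entropy K (P 0) (Q 0) (S 0)) (at 0 within {0..1})"
    by (simp add: continuous_on_def)
  hence "eventually (\<lambda>t. edge_entropy K p q s - e < edge_entropy K (P t) (Q t) (S t)) (at 0 within {0..1})"
    by (intro order_tendstoD(1)) (use e in \<open>auto simp: P_def Q_def S_def\<close>)
  then obtain d where d: "d > 0" "\<And>t. t \<in> {0..1} \<Longrightarrow> t \<noteq> 0 \<Longrightarrow> dist t 0 < d \<Longrightarrow> edge_entropy K p q s - e < edge_entropy K (P t) (Q t) (S t)"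
    unfolding eventually_at by blast
  define t where "t = min (d / 2) (1 / 2)"
  have t: "0 < t" "t < 1" "t < d" using d(1) by (auto simp: t_def)
  have "0 < P t" "0 < Q t" "0 < S t" unfolding P_def Q_def S_def using m' z t by (auto intro: add_nonneg_pos)
  moreover have "c < P t * h1 + Q t * h2 + 2 * S t * h0"
  proof -
    have "P t * h1 + Q t * h2 + 2 * S t * h0 = (1 - t) * (p * h1 + q * h2 + 2 * s * h0) + t * (p0 * h1 + q0 * h2 + 2 * s0 * h0)"
      by (simp add: P_def Q_def S_def algebra_simps)
    moreover have "(1 - t) * c \<le> (1 - t) * (p * h1 + q * h2 + 2 * s * h0)" by (rule mult_left_mono[OF m'(5)]) (use t in simp)
    moreover have "t * c < t * (p0 * h1 + q0 * h2 + 2 * s0 * h0)" using c'(1) t z(5) by simp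
    ultimately show ?thesis by (simp add: algebra_simps)
  qed
  ultimately show ?thesis using d(2)[of t] t sum1[of t]
    by auto
qed

section \<open>Asymptotic number of configurations of a given type\<close>

lemma even_card_matching:
  assumes "finite S" "M \<in> matchings S" shows "even (card S)"
  using assms
proof (induction "card S" arbitrary: S M rule: less_induct)
  case less
  show ?case
  proof (cases "S = {}")
    case False
    then obtain h where h: "h \<in> S" by auto
    define k where "k = M h"
    have k: "k \<in> S" "h \<noteq> k" using matchingsD(1,2)[OF less.prems(2) h] by (auto simp: k_def)
    have "M(h := h, k := k) \<in> matchings (S - {h, k})"
      using bij_betw_apply[OF matchings_fix_pair[OF h k]] less.prems(2) k_def by simp
    moreover have c: "card S = card (S - {h, k}) + 2"
    proof -
      have "card {h, k} = 2" using k by simp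
      moreover have "card {h, k} \<le> card S" by (rule card_mono) (use less.prems(1) h k in auto)
      moreover have "card (S - {h, k}) = card S - card {h, k}" by (rule card_Diff_subset) (use h k in auto)
      ultimately show ?thesis by linarith
    qed
    ultimately have "even (card (S - {h, k}))" using less.hyps[of "S - {h, k}"] less.prems(1) by simp
    thus ?thesis using c by simp
  qed simp
qed

text \<open>\<open>p\<close> and \<open>q\<close> are the numbers of half-edges with mark
  \<open>a\<close> and with the other mark, \<open>s\<close> is the number of those with mark
  \<open>a\<close> whose partner has the other mark.\<close>

definition two_type :: "'x \<Rightarrow> nat \<Rightarrow> nat \<Rightarrow> nat \<Rightarrow> 'x \<Rightarrow> 'x \<Rightarrow> nat" where
  "two_type a p q s c d = (if c = d then (if c = a then p - s else q - s) else s)"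

lemma typed_eq_cross:
  assumes S: "finite S" and ab: "a \<noteq> b" "UNIV = {a, b}"
    and P: "P = {h\<in>S. col h = a}" and Q: "Q = {h\<in>S. col h = b}"
  shows "typed_matchings S col (two_type a (card P) (card Q) s) = cross_matchings P Q s"
proof -
  have PQ: "P \<union> Q = S" "P \<inter> Q = {}" using ab by (auto simp: P Q)
  have fin: "finite P" "finite Q" using S by (auto simp: P Q)
  have "(\<forall>c d. card {h\<in>S. col h = c \<and> col (M h) = d} = two_type a (card P) (card Q) s c d) \<longleftrightarrow> card {h\<in>P. M h \<in> Q} = s"
    if M: "M \<in> matchings S" for M
  proof -
    have m: "M h \<in> S" if "h \<in> S" for h using matchingsD(1)[OF M that] .
    have e1: "{h\<in>S. col h = a \<and> col (M h) = b} = {h\<in>P. M h \<in> Q}" using m by (auto simp: P Q)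
    have e2: "{h\<in>S. col h = b \<and> col (M h) = a} = {h\<in>Q. M h \<in> P}" using m by (auto simp: P Q)
    have e3: "{h\<in>S. col h = a \<and> col (M h) = a} = P - {h\<in>P. M h \<in> Q}"
      using m ab by (auto simp: P Q)
    have e4: "{h\<in>S. col h = b \<and> col (M h) = b} = Q - {h\<in>Q. M h \<in> P}"
      using m ab by (auto simp: P Q)
    have b: "card {h\<in>Q. M h \<in> P} = card {h\<in>P. M h \<in> Q}"
    proof -
      have "bij_betw M {h\<in>Q. M h \<in> P} {h\<in>P. M h \<in> Q}"
        by (rule bij_betwI[where g = M]) (auto simp: matchingsD(3)[OF M])
      thus ?thesis by (rule bij_betw_same_card)
    qed
    have c3: "card (P - {h\<in>P. M h \<in> Q}) = card P - card {h\<in>P. M h \<in> Q}"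
      by (rule card_Diff_subset) (use fin in auto)
    have c4: "card (Q - {h\<in>Q. M h \<in> P}) = card Q - card {h\<in>Q. M h \<in> P}"
      by (rule card_Diff_subset) (use fin in auto)
    have all: "(\<forall>c. R c) \<longleftrightarrow> R a \<and> R b" for R :: "'b \<Rightarrow> bool" using ab by auto
    show ?thesis
      unfolding all e1 e2 e3 e4 c3 c4 b two_type_def using ab(1) by auto
  qed
  thus ?thesis unfolding typed_matchings_def cross_matchings_def PQ(1) by blast
qed

text \<open>Leading part of the logarithm of the number of all matchings of \<open>K * n\<close>
  half-edges. It is common to all types and cancels in conditional probabilities.\<close>

definition rate_base :: "real \<Rightarrow> nat \<Rightarrow> real" where
  "rate_base K n = real n * (K / 2 * ln (K * real n) - K / 2)"

lemma ln_fact_approx: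
  assumes "k \<le> m" shows "\<bar>ln (fact k) - (xlx (real k) - real k)\<bar> \<le> ln (real m + 1) + 1"
proof -
  have "ln (real k + 1) \<le> ln (real m + 1)" using assms by simp
  moreover have "0 \<le> ln (real m + 1)" by simp
  ultimately show ?thesis using ln_fact_bounds[of k] by linarith
qed

lemma xlx_scale': "0 < t \<Longrightarrow> 0 \<le> y \<Longrightarrow> xlx (t * y) = t * xlx y + t * y * ln t"
  using xlx_scale[of t y] by (cases "y = 0") auto

text \<open>Stirling's formula for the eight factorials in the binomial coefficient and the number
  of matchings, with one error term each. The choice of the marks contributes the coefficient
  \<open>- 1\<close> and the labelled half-edges the coefficient \<open>K\<close> of the vertex
  terms.\<close>

lemma type_count_asymptotics:
  fixes K n na nb s ea eb :: nat
  assumes K: "K \<ge> 1" and n: "n \<ge> 1" "na + nb = n" and e: "K * na = s + 2 * ea" "K * nb = s + 2 * eb"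
    and C: "real C * (fact s * fact ea * fact eb * 2 ^ (ea + eb)) = fact (K * na) * fact (K * nb)"
  defines "p \<equiv> 2 * real ea / (real K * real n)" and "q \<equiv> 2 * real eb / (real K * real n)" and "t \<equiv> real s / (real K * real n)"
  shows "C > 0" and "\<bar>ln (real ((n choose na) * C)) - (rate_base K n + real n * edge_entropy K p q t)\<bar>
      \<le> 8 * (ln (real (K * n) + 1) + 1)"
proof -
  define N where "N = real K * real n"
  have N: "N > 0" using K n by (simp add: N_def)
  have "K * na + K * nb = K * n" using n(2) by (metis distrib_left)
  hence "real (K * na) + real (K * nb) = N" unfolding N_def by (simp only: of_nat_add[symmetric] of_nat_mult[symmetric])
  hence Ns: "2 * real s + 2 * real ea + 2 * real eb = N" unfolding e by simp
  have le: "K * na \<le> K * n" "K * nb \<le> K * n" using n(2) by auto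
  have nk: "n \<le> K * n" using K by simp
  have bounds: "n \<le> K * n" "na \<le> K * n" "nb \<le> K * n" "s \<le> K * n" "ea \<le> K * n" "eb \<le> K * n"
    using le e nk n(2) by linarith+
  have pqt: "real ea = N / 2 * p" "real eb = N / 2 * q" "real s = N * t"
    using N by (auto simp: p_def q_def t_def N_def)
  have pos: "0 \<le> p" "0 \<le> q" "0 \<le> t" by (auto simp: p_def q_def t_def)
  have sum1: "p + q + 2 * t = 1"
  proof -
    have "N * (p + q + 2 * t) = N * 1" using Ns unfolding pqt by (simp add: algebra_simps)
    thus ?thesis using N by simp
  qed
  have ab: "real na = real n * (p + t)" "real nb = real n * (q + t)"
    "real (K * na) = N * (p + t)" "real (K * nb) = N * (q + t)"
  proof -
    show 1: "real (K * na) = N * (p + t)" unfolding e using pqt by (simp add: algebra_simps)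
    show 2: "real (K * nb) = N * (q + t)" unfolding e using pqt by (simp add: algebra_simps)
    have "real K * real na = real K * (real n * (p + t))" using 1 by (simp add: N_def)
    thus "real na = real n * (p + t)" using K by simp
    have "real K * real nb = real K * (real n * (q + t))" using 2 by (simp add: N_def)
    thus "real nb = real n * (q + t)" using K by simp
  qed
  have C0: "real C > 0"
  proof (rule ccontr)
    assume "\<not> real C > 0"
    hence "real C = 0" by simp
    hence "(fact (K * na) * fact (K * nb) :: real) = 0" using C by simp
    thus False by simp
  qed
  thus "C > 0" by simp
  have b0: "real (n choose na) > 0" using n(2) by simp
  have "ln (real C * (fact s * fact ea * fact eb * 2 ^ (ea + eb))) = ln (fact (K * na) * fact (K * nb) :: real)"
    by (simp only: C)
  hence lC: "ln (real C) = ln (fact (K * na)) + ln (fact (K * nb)) - ln (fact s) - ln (fact ea) - ln (fact eb) - real (ea + eb) * ln 2"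
    using C0 by (simp add: ln_mult ln_realpow)
  have "real (fact na * fact nb * (n choose na)) = fact n"
    using binomial_fact_lemma[of na n] n(2) by (metis diff_add_inverse le_add1 of_nat_fact)
  hence "ln (fact na * fact nb * real (n choose na)) = ln (fact n :: real)" by simp
  hence lb: "ln (real (n choose na)) = ln (fact n) - ln (fact na) - ln (fact nb)"
    using b0 by (simp add: ln_mult)
  define F where "F k = xlx (real k) - real k" for k
  define er where "er = ln (real (K * n) + 1) + 1"
  have ap: "ln (fact k) - F k \<le> er \<and> F k - ln (fact k) \<le> er" if "k \<le> K * n" for k
    using ln_fact_approx[OF that] by (simp add: F_def er_def abs_le_iff)
  have main: "F n - F na - F nb + F (K * na) + F (K * nb) - F s - F ea - F eb - real (ea + eb) * ln 2
     = rate_base K n + real n * edge_entropy K p q t"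
  proof -
    have n0: "real n > 0" using n by simp
    have x: "xlx (real n) = real n * ln (real n)" by (simp add: xlx_def)
    have x1: "xlx (real na) = real n * xlx (p + t) + real n * (p + t) * ln (real n)"
      unfolding ab using xlx_scale'[OF n0, of "p + t"] pos by simp
    have x2: "xlx (real nb) = real n * xlx (q + t) + real n * (q + t) * ln (real n)"
      unfolding ab using xlx_scale'[OF n0, of "q + t"] pos by simp
    have x3: "xlx (real (K * na)) = N * xlx (p + t) + N * (p + t) * ln N"
      unfolding ab using xlx_scale'[OF N, of "p + t"] pos by simp
    have x4: "xlx (real (K * nb)) = N * xlx (q + t) + N * (q + t) * ln N"
      unfolding ab using xlx_scale'[OF N, of "q + t"] pos by simp
    have x5: "xlx (real s) = N * xlx t + N * t * ln N" unfolding pqt using xlx_scale'[OF N, of t] pos by simp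
    have lN2: "ln (N / 2) = ln N - ln 2" using N by (simp add: ln_div)
    have x6: "xlx (real ea) = N / 2 * xlx p + N / 2 * p * (ln N - ln 2)"
      unfolding pqt using xlx_scale'[of "N / 2" p] N pos by (simp add: lN2)
    have x7: "xlx (real eb) = N / 2 * xlx q + N / 2 * q * (ln N - ln 2)"
      unfolding pqt using xlx_scale'[of "N / 2" q] N pos by (simp add: lN2)
    have t: "t = (1 - p - q) / 2" using sum1 by simp
    have lin: "real na + real nb = real n" "real (K * na) + real (K * nb) = N" "real s + real ea + real eb = N / 2"
    proof -
      show "real na + real nb = real n" using n(2) by simp
      show "real (K * na) + real (K * nb) = N" by fact
      show "real s + real ea + real eb = N / 2" using Ns by simp
    qed
    have l2: "real (ea + eb) * ln 2 = N / 2 * p * ln 2 + N / 2 * q * ln 2" unfolding of_nat_add pqt by (simp only: distrib_right)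
    have "F n - F na - F nb + F (K * na) + F (K * nb) - F s - F ea - F eb - real (ea + eb) * ln 2 =
       xlx (real n) - xlx (real na) - xlx (real nb) + xlx (real (K * na)) + xlx (real (K * nb)) - xlx (real s) - xlx (real ea) - xlx (real eb)
         - real (ea + eb) * ln 2 - N / 2"
      unfolding F_def using lin by linarith
    \<comment> \<open>The coefficients of \<open>ln n\<close> and \<open>ln N\<close> are kept
      unsimplified; total mass 1 turns them into 0 and \<open>1 / 2\<close>.\<close>
    also have "\<dots> = (real K - 1) * real n * (xlx (p + t) + xlx (q + t)) - N / 2 * (xlx p + xlx q + 2 * xlx t)
        + real n * ln (real n) * (1 - (p + q + 2 * t)) + N * ln N * ((p + q + 2 * t) - t - p / 2 - q / 2) - N / 2"
      unfolding x x1 x2 x3 x4 x5 x6 x7 l2 unfolding N_def by (simp add: field_simps)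
    also have "(p + q + 2 * t) - t - p / 2 - q / 2 = 1 / 2" using t by simp
    also have "(real K - 1) * real n * (xlx (p + t) + xlx (q + t)) - N / 2 * (xlx p + xlx q + 2 * xlx t)
        + real n * ln (real n) * (1 - (p + q + 2 * t)) + N * ln N * (1 / 2) - N / 2
       = rate_base K n + real n * edge_entropy K p q t"
      unfolding sum1 rate_base_def edge_entropy_def N_def by (simp add: algebra_simps)
    finally show ?thesis .
  qed
  have "ln (real ((n choose na) * C)) = ln (real (n choose na)) + ln (real C)" using b0 C0 by (simp add: ln_mult)
  hence tot: "ln (real ((n choose na) * C)) = ln (fact n) - ln (fact na) - ln (fact nb) +
     ln (fact (K * na)) + ln (fact (K * nb)) - ln (fact s) - ln (fact ea) - ln (fact eb) - real (ea + eb) * ln 2"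
    unfolding lb lC by simp
  have "\<bar>ln (real ((n choose na) * C)) - (F n - F na - F nb + F (K * na) + F (K * nb) - F s - F ea - F eb - real (ea + eb) * ln 2)\<bar> \<le> 8 * er"
    unfolding tot
    using ap[OF bounds(1)] ap[OF bounds(2)] ap[OF bounds(3)] ap[OF bounds(4)] ap[OF bounds(5)] ap[OF bounds(6)] ap[OF le(1)] ap[OF le(2)]
    by auto
  thus "\<bar>ln (real ((n choose na) * C)) - (rate_base K n + real n * edge_entropy K p q t)\<bar> \<le> 8 * (ln (real (K * n) + 1) + 1)"
    unfolding main er_def .
qed

section \<open>Repairing defects by switchings\<close>

text \<open>The half-edges on loops and multiple edges. A matching without them is a simple graph
  with numbered ports.\<close>

definition defective :: "(nat \<times> nat) set \<Rightarrow> (nat \<times> nat \<Rightarrow> nat \<times> nat) \<Rightarrow> (nat \<times> nat) set" where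
  "defective S M = {h\<in>S. fst (M h) = fst h \<or>
     (\<exists>h'\<in>S. h' \<noteq> h \<and> fst h' = fst h \<and> fst (M h') = fst (M h))}"

definition switch :: "('h \<Rightarrow> 'h) \<Rightarrow> 'h \<Rightarrow> 'h \<Rightarrow> 'h \<Rightarrow> 'h" where
  "switch M h x = M(h := x, x := h, M h := M x, M x := M h)"

lemma switch_matching:
  assumes M: "M \<in> matchings S" and hx: "h \<in> S" "x \<in> S" "x \<noteq> h" "x \<noteq> M h"
  shows "switch M h x \<in> matchings S"
proof -
  define k y where "k = M h" and "y = M x"
  note D = matchingsD[OF M]
  have s: "M k = h" "M y = x" "k \<in> S" "y \<in> S" "k \<noteq> h" "y \<noteq> x"
    using D hx by (auto simp: k_def y_def)
  have ne: "h \<noteq> y" "k \<noteq> y" "x \<noteq> k" using hx s D(3) by auto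
  have o: "M z \<noteq> h" "M z \<noteq> x" "M z \<noteq> k" "M z \<noteq> y" if "z \<noteq> h" "z \<noteq> x" "z \<noteq> k" "z \<noteq> y" for z
    using that s k_def y_def D(3) by metis+
  have sw: "switch M h x = M(h := x, x := h, k := y, y := k)" by (simp add: switch_def k_def y_def)
  define \<tau> where "\<tau> = M(h := x, x := h, k := y, y := k)"
  have t: "\<tau> h = x" "\<tau> x = h" "\<tau> k = y" "\<tau> y = k"
    using ne s by (auto simp: \<tau>_def)
  have t': "\<tau> z = M z" if "z \<noteq> h" "z \<noteq> x" "z \<noteq> k" "z \<noteq> y" for z using that by (simp add: \<tau>_def)
  have all: "\<tau> z \<in> S \<and> \<tau> z \<noteq> z \<and> \<tau> (\<tau> z) = z" if z: "z \<in> S" for z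
  proof -
    consider "z = h" | "z = x" | "z = k" | "z = y" | "z \<noteq> h" "z \<noteq> x" "z \<noteq> k" "z \<noteq> y" by blast
    thus ?thesis
    proof cases
      case 1 thus ?thesis using t hx by simp
    next
      case 2 thus ?thesis using t hx by simp
    next
      case 3 thus ?thesis using t s ne by simp
    next
      case 4 thus ?thesis using t s ne by simp
    next
      case 5
      thus ?thesis using t'[OF 5] t'[OF o[OF 5]] D(1,2,3)[of z] z by simp
    qed
  qed
  have "\<tau> z = z" if "z \<notin> S" for z
  proof -
    have "z \<noteq> h" "z \<noteq> x" "z \<noteq> k" "z \<noteq> y" using that hx s by auto
    thus ?thesis using t' D(4)[OF that] by simp
  qed
  thus ?thesis unfolding sw \<tau>_def[symmetric] matchings_def using all by blast
qed

text \<open>The ends of the edge of \<open>x\<close> avoid the ends of the edge of \<open>h\<close>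
  and the neighbours of these ends. Hence neither new edge is a loop or parallel to another edge,
  removing edges creates no defect, and \<open>h\<close> is cured.\<close>

lemma defective_switch:
  assumes M: "M \<in> matchings S" and h: "h \<in> defective S M" and x: "x \<in> S" "fst (M x) \<noteq> fst x"
    and Z: "\<And>z. z \<in> S \<Longrightarrow> fst z \<in> {fst h, fst (M h)} \<Longrightarrow> fst x \<noteq> fst z \<and> fst (M x) \<noteq> fst z \<and> fst x \<noteq> fst (M z) \<and> fst (M x) \<noteq> fst (M z)"
  shows "switch M h x \<in> matchings S" "defective S (switch M h x) \<subset> defective S M"
proof -
  define k y where "k = M h" and "y = M x"
  have hS: "h \<in> S" using h by (simp add: defective_def)
  note D = matchingsD[OF M]
  have s: "M k = h" "M y = x" "k \<in> S" "y \<in> S" "k \<noteq> h" "y \<noteq> x"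
    using D hS x by (auto simp: k_def y_def)
  have ne: "x \<noteq> h" "x \<noteq> k" "y \<noteq> h" "y \<noteq> k"
    using Z[OF hS] by (auto simp: k_def y_def)
  show m: "switch M h x \<in> matchings S"
    by (rule switch_matching[OF M hS x(1)]) (use ne in \<open>auto simp: k_def\<close>)
  define \<tau> where "\<tau> = switch M h x"
  have t: "\<tau> h = x" "\<tau> x = h" "\<tau> k = y" "\<tau> y = k" "\<And>z. z \<notin> {h, x, k, y} \<Longrightarrow> \<tau> z = M z"
    using s by (auto simp: \<tau>_def switch_def k_def y_def)
  have Zh: "fst x \<noteq> fst z" "fst y \<noteq> fst z" "fst x \<noteq> fst (M z)" "fst y \<noteq> fst (M z)"
    if "z \<in> S" "fst z = fst h \<or> fst z = fst k" for z using Z[OF that(1)] that(2) by (auto simp: k_def y_def)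
  \<comment> \<open>If \<open>h\<close> lies on a loop, its two ends are joined to \<open>x\<close>
    and \<open>M x\<close>; these must belong to different vertices, or a double edge would
    arise.\<close>
  have xy: "fst x \<noteq> fst y" using x(2) by (simp add: y_def)
  have Zx: "fst (M z) \<noteq> fst h" "fst (M z) \<noteq> fst k" if "z \<in> S" "fst z = fst x \<or> fst z = fst y" for z
    using Zh[of "M z"] D(1)[OF that(1)] D(3)[of z] that(2) by metis+
  have good: "z \<notin> defective S \<tau>" if z: "z \<in> {h, x, k, y}" for z
  proof
    assume d: "z \<in> defective S \<tau>"
    have nl: "fst (\<tau> z) \<noteq> fst z" using z t(1-4) Zh[OF hS] Zh[OF s(3)] by auto
    then obtain z' where z': "z' \<in> S" "z' \<noteq> z" "fst z' = fst z" "fst (\<tau> z') = fst (\<tau> z)"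
      using d by (auto simp: defective_def)
    show False
    proof (cases "z' \<in> {h, x, k, y}")
      case True
      thus False using z z' t(1-4) Zh[OF hS] Zh[OF s(3)] xy by auto
    next
      case False
      hence "\<tau> z' = M z'" by (rule t(5))
      thus False using z z' t(1-4) Zh[OF z'(1)] Zx[OF z'(1)] by auto
    qed
  qed
  have "defective S \<tau> \<subseteq> defective S M"
  proof
    fix z assume z: "z \<in> defective S \<tau>"
    hence zn: "z \<notin> {h, x, k, y}" using good by blast
    hence tz: "\<tau> z = M z" by (rule t(5))
    have zS: "z \<in> S" using z by (simp add: defective_def)
    show "z \<in> defective S M"
    proof (cases "fst (\<tau> z) = fst z")
      case True
      thus ?thesis using tz zS by (simp add: defective_def)
    next
      case False
      then obtain z' where z': "z' \<in> S" "z' \<noteq> z" "fst z' = fst z" "fst (\<tau> z') = fst (\<tau> z)"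
        using z by (auto simp: defective_def)
      have "z' \<in> defective S \<tau>" using z' zS by (auto simp: defective_def)
      hence "z' \<notin> {h, x, k, y}" using good by blast
      hence "\<tau> z' = M z'" by (rule t(5))
      thus ?thesis using z' tz zS by (auto simp: defective_def)
    qed
  qed
  moreover have "h \<notin> defective S \<tau>" using good by simp
  ultimately show "defective S (switch M h x) \<subset> defective S M" using h unfolding \<tau>_def by blast
qed

text \<open>\<open>Z\<close> consists of the ends of the edge of \<open>h\<close> and their
  neighbours, at most \<open>2 * (K + 1)\<close> vertices. At most \<open>4 * K * (K + 1)\<close>
  half-edges lie in \<open>Z\<close> or are matched into it; any other half-edge that is not
  defective will do.\<close>

lemma exists_switch_partner:
  assumes M: "M \<in> matchings (half_edges K n)" and h: "h \<in> half_edges K n"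
    and large: "K * n > 4 * K * (K + 1) + card (defective (half_edges K n) M)"
  shows "\<exists>x\<in>half_edges K n. fst (M x) \<noteq> fst x \<and> (\<forall>z\<in>half_edges K n. fst z \<in> {fst h, fst (M h)} \<longrightarrow>
     fst x \<noteq> fst z \<and> fst (M x) \<noteq> fst z \<and> fst x \<noteq> fst (M z) \<and> fst (M x) \<noteq> fst (M z))"
proof -
  define S where "S = half_edges K n"
  note D = matchingsD[OF M, folded S_def]
  define H where "H = {z\<in>S. fst z \<in> {fst h, fst (M h)}}"
  define Z where "Z = {fst h, fst (M h)} \<union> (\<lambda>z. fst (M z)) ` H"
  have cH: "card H \<le> 2 * K"
  proof -
    have "H \<subseteq> {fst h, fst (M h)} \<times> {..<K}" by (auto simp: H_def S_def half_edges_def)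
    hence "card H \<le> card ({fst h, fst (M h)} \<times> {..<K})" by (intro card_mono) auto
    also have "\<dots> \<le> 2 * K" by (simp add: card_insert_if)
    finally show ?thesis .
  qed
  have finH: "finite H" by (simp add: H_def S_def)
  have cZ: "card Z \<le> 2 * (K + 1)"
  proof -
    have "card Z \<le> card {fst h, fst (M h)} + card ((\<lambda>z. fst (M z)) ` H)" unfolding Z_def by (rule card_Un_le)
    also have "\<dots> \<le> 2 + 2 * K"
      by (intro add_mono order_trans[OF card_image_le[OF finH] cH]) (simp add: card_insert_if)
    finally show ?thesis by simp
  qed
  have finZ: "finite Z" using finH by (simp add: Z_def)
  define B1 where "B1 = {x\<in>S. fst x \<in> Z}"
  define B2 where "B2 = {x\<in>S. fst (M x) \<in> Z}"
  have c1: "card B1 \<le> 2 * (K + 1) * K"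
  proof -
    have "B1 \<subseteq> Z \<times> {..<K}" by (auto simp: B1_def S_def half_edges_def)
    hence "card B1 \<le> card (Z \<times> {..<K})" using finZ by (intro card_mono) auto
    also have "\<dots> \<le> 2 * (K + 1) * K" unfolding card_cartesian_product card_lessThan by (rule mult_le_mono1[OF cZ])
    finally show ?thesis .
  qed
  have c2: "card B2 \<le> card B1"
  proof (rule card_inj_on_le[where f = M])
    show "inj_on M B2" using inj_matching[OF M] by (rule inj_on_subset) simp
    show "M ` B2 \<subseteq> B1" using D(1) by (auto simp: B1_def B2_def)
    show "finite B1" by (simp add: B1_def S_def)
  qed
  have "card (B1 \<union> B2 \<union> defective S M) \<le> card B1 + card B2 + card (defective S M)"
    using card_Un_le[of "B1 \<union> B2" "defective S M"] card_Un_le[of B1 B2] by linarith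
  also have "\<dots> \<le> 4 * K * (K + 1) + card (defective S M)" using c1 c2 by simp
  also have "\<dots> < card S" using large by (simp add: S_def half_edges_def mult.commute)
  finally have "card (B1 \<union> B2 \<union> defective S M) < card S" .
  hence "\<not> S \<subseteq> B1 \<union> B2 \<union> defective S M"
    using card_mono[of "B1 \<union> B2 \<union> defective S M" S] by (force simp: B1_def B2_def S_def defective_def)
  then obtain x where x: "x \<in> S" "x \<notin> B1" "x \<notin> B2" "x \<notin> defective S M" by auto
  show ?thesis
  proof (intro bexI[of _ x] conjI ballI impI)
    show "fst (M x) \<noteq> fst x" using x(1,4) by (auto simp: defective_def)
    fix z assume z: "z \<in> half_edges K n" "fst z \<in> {fst h, fst (M h)}"
    hence "fst z \<in> Z" "fst (M z) \<in> Z" by (auto simp: Z_def H_def S_def)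
    thus "fst x \<noteq> fst z" "fst (M x) \<noteq> fst z" "fst x \<noteq> fst (M z)" "fst (M x) \<noteq> fst (M z)"
      using x(1-3) by (auto simp: B1_def B2_def)
  qed (use x in \<open>simp add: S_def\<close>)
qed

text \<open>Each switch changes the partners of four half-edges and cures at least one, whence the
  factor 4. The number of defects only decreases, so the room for a partner persists.\<close>

lemma repair_defects:
  assumes "M \<in> matchings (half_edges K n)" "card (defective (half_edges K n) M) \<le> J"
    and "K * n > 4 * K * (K + 1) + J"
  shows "\<exists>M'\<in>matchings (half_edges K n). defective (half_edges K n) M' = {} \<and>
    card {h\<in>half_edges K n. M h \<noteq> M' h} \<le> 4 * card (defective (half_edges K n) M)"
  using assms(1,2)
proof (induction "card (defective (half_edges K n) M)" arbitrary: M rule: less_induct)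
  case less
  define S where "S = half_edges K n"
  have finS: "finite S" by (simp add: S_def)
  have finD: "finite (defective S \<tau>)" for \<tau> using finS by (simp add: defective_def)
  show ?case
  proof (cases "defective S M = {}")
    case True
    thus ?thesis using less.prems by (intro bexI[of _ M]) (auto simp: S_def)
  next
    case False
    then obtain h where h: "h \<in> defective S M" by auto
    hence hS: "h \<in> S" by (simp add: defective_def)
    have "K * n > 4 * K * (K + 1) + card (defective (half_edges K n) M)" using less.prems(2) assms(3) by linarith
    from exists_switch_partner[OF less.prems(1) hS[unfolded S_def] this]
    obtain x where x: "x \<in> S" "fst (M x) \<noteq> fst x" "\<And>z. z \<in> S \<Longrightarrow> fst z \<in> {fst h, fst (M h)} \<Longrightarrow>
     fst x \<noteq> fst z \<and> fst (M x) \<noteq> fst z \<and> fst x \<noteq> fst (M z) \<and> fst (M x) \<noteq> fst (M z)"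
      unfolding S_def by blast
    define \<tau> where "\<tau> = switch M h x"
    have \<tau>: "\<tau> \<in> matchings S" "defective S \<tau> \<subset> defective S M"
      unfolding \<tau>_def using defective_switch[of M S h x] less.prems(1) h x unfolding S_def by blast+
    have lt: "card (defective S \<tau>) < card (defective S M)" by (rule psubset_card_mono[OF finD \<tau>(2)])
    obtain M' where s': "M' \<in> matchings S" "defective S M' = {}" "card {h\<in>S. \<tau> h \<noteq> M' h} \<le> 4 * card (defective S \<tau>)"
      using less.hyps[of \<tau>] \<tau>(1) lt less.prems(2) unfolding S_def by fastforce
    have "{z\<in>S. M z \<noteq> M' z} \<subseteq> {h, x, M h, M x} \<union> {z\<in>S. \<tau> z \<noteq> M' z}"
      by (auto simp: \<tau>_def switch_def)
    hence "card {z\<in>S. M z \<noteq> M' z} \<le> card ({h, x, M h, M x} \<union> {z\<in>S. \<tau> z \<noteq> M' z})"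
      by (intro card_mono) (use finS in auto)
    also have "\<dots> \<le> card {h, x, M h, M x} + card {z\<in>S. \<tau> z \<noteq> M' z}" by (rule card_Un_le)
    also have "card {h, x, M h, M x} \<le> 4" by (simp add: card_insert_if)
    finally have "card {z\<in>S. M z \<noteq> M' z} \<le> 4 * card (defective S M)" using s'(3) lt by linarith
    thus ?thesis using s' unfolding S_def by blast
  qed
qed

text \<open>First moment, with \<open>m = K * n\<close>. A loop prescribes one pair, of probability
  at most \<open>1 / (d ^ 2 * m)\<close>, with at most \<open>m * K\<close> candidates. A double
  edge prescribes two pairs, of probability at most \<open>1 / (d ^ 4 * m ^ 2)\<close>, with at most
  \<open>m ^ 2 * K ^ 2\<close> candidates. The sum does not grow with \<open>n\<close>.\<close>

lemma expected_defects:
  fixes X :: "nat \<Rightarrow> 'x::finite" and E :: "'x \<Rightarrow> 'x \<Rightarrow> nat"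
  assumes K: "K \<ge> 1" and n: "n \<ge> 1" and d: "0 < d" and large: "\<And>v. v \<in> {1..n} \<Longrightarrow> d * real (K * n) + 4 \<le> real (K * card {u\<in>{1..n}. X u = X v})"
    and E: "\<And>a b. E a b \<le> K * n"
  defines "\<Omega> \<equiv> typed_matchings (half_edges K n) (\<lambda>h. X (fst h)) E"
  shows "(\<Sum>M\<in>\<Omega>. real (card (defective (half_edges K n) M))) \<le> (real K / d ^ 2 + real K ^ 2 / d ^ 4) * real (card \<Omega>)"
proof -
  define S where "S = half_edges K n"
  define col where "col = (\<lambda>h::nat\<times>nat. X (fst h))"
  have Om: "\<Omega> = typed_matchings S col E" by (simp add: \<Omega>_def S_def col_def)
  have finS: "finite S" by (simp add: S_def)
  have finO: "finite \<Omega>" unfolding Om by (rule finite_typed[OF finS])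
  have om: "M \<in> matchings S" if "M \<in> \<Omega>" for M using that by (simp add: Om typed_matchings_def)
  define N where "N a = card {h\<in>S. col h = a}" for a
  define m where "m = real (K * n)"
  have m0: "m > 0" using K n by (simp add: m_def)
  have cS: "real (card S) = m" by (simp add: S_def half_edges_def m_def)
  \<comment> \<open>The 4 is the value of \<open>MM\<close> in \<open>typed_partial_bound\<close>
    for two prescribed pairs; it serves for one pair, too.\<close>
  have NS: "d * m \<le> real (N (col h)) - 4" if "h \<in> S" for h
  proof -
    have "{h'\<in>S. col h' = col h} = {u\<in>{1..n}. X u = X (fst h)} \<times> {..<K}"
      by (auto simp: S_def half_edges_def col_def)
    hence "N (col h) = K * card {u\<in>{1..n}. X u = X (fst h)}"
      unfolding N_def by simp
    moreover have "fst h \<in> {1..n}" using that by (auto simp: S_def half_edges_def)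
    ultimately show ?thesis using large[of "fst h"] by (simp add: m_def)
  qed
  have dm: "d * m > 0" using d m0 by simp
  have pair: "real (card {M\<in>\<Omega>. M h = k}) \<le> real (card \<Omega>) * (1 / (d ^ 2 * m))" if hk: "h \<in> S" "k \<in> S" "h \<noteq> k" for h k
  proof -
    have "real (card {M\<in>typed_matchings S col E. \<forall>i\<in>{()}. M ((\<lambda>_. h) i) = (\<lambda>_. k) i}) \<le>
       real (card (typed_matchings S col E)) * (\<Prod>i\<in>{()}. real (E (col ((\<lambda>_. h) i)) (col ((\<lambda>_. k) i))) /
            ((real (N (col ((\<lambda>_. h) i))) - real 4) * (real (N (col ((\<lambda>_. k) i))) - real 4)))"
      by (rule typed_partial_bound[OF finS]) (use hk NS[OF hk(1)] NS[OF hk(2)] dm in \<open>auto simp: N_def\<close>)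
    also have "\<dots> \<le> real (card (typed_matchings S col E)) * (1 / (d ^ 2 * m))"
    proof (rule mult_left_mono)
      have "real (E (col h) (col k)) / ((real (N (col h)) - 4) * (real (N (col k)) - 4)) \<le> m / ((d * m) * (d * m))"
        by (rule frac_le) (use E NS[OF hk(1)] NS[OF hk(2)] dm m0 in \<open>auto simp: m_def simp del: of_nat_mult intro!: mult_mono\<close>)
      also have "\<dots> = 1 / (d ^ 2 * m)" by (simp add: power2_eq_square)
      finally show "(\<Prod>i\<in>{()}. real (E (col ((\<lambda>_. h) i)) (col ((\<lambda>_. k) i))) /
            ((real (N (col ((\<lambda>_. h) i))) - real 4) * (real (N (col ((\<lambda>_. k) i))) - real 4))) \<le> 1 / (d ^ 2 * m)" by simp
    qed simp
    finally show ?thesis by (simp add: Om)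
  qed
  have two: "real (card {M\<in>\<Omega>. M h = k \<and> M h' = k'}) \<le> real (card \<Omega>) * (1 / (d ^ 4 * m ^ 2))"
    if hk: "h \<in> S" "k \<in> S" "h' \<in> S" "k' \<in> S" "h \<noteq> k" "h' \<noteq> k'" "h \<noteq> h'" "k \<noteq> k'" "h \<noteq> k'" "h' \<noteq> k" for h k h' k'
  proof -
    define f where "f i = (if i then h else h')" for i :: bool
    define g where "g i = (if i then k else k')" for i :: bool
    have "real (card {M\<in>typed_matchings S col E. \<forall>i\<in>UNIV. M (f i) = g i}) \<le>
       real (card (typed_matchings S col E)) * (\<Prod>i\<in>UNIV. real (E (col (f i)) (col (g i))) /
            ((real (N (col (f i))) - real 4) * (real (N (col (g i))) - real 4)))"
      by (rule typed_partial_bound[OF finS])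
         (use hk NS[OF hk(1)] NS[OF hk(2)] NS[OF hk(3)] NS[OF hk(4)] dm in \<open>auto simp: N_def f_def g_def inj_on_def UNIV_bool split: if_splits\<close>)
    also have "\<dots> \<le> real (card (typed_matchings S col E)) * (1 / (d ^ 4 * m ^ 2))"
    proof (rule mult_left_mono)
      have "(\<Prod>i\<in>UNIV. real (E (col (f i)) (col (g i))) / ((real (N (col (f i))) - real 4) * (real (N (col (g i))) - real 4)))
        \<le> (\<Prod>i\<in>(UNIV::bool set). m / ((d * m) * (d * m)))"
      proof (rule prod_mono, rule conjI)
        fix i :: bool
        have fg: "f i \<in> S" "g i \<in> S" using hk by (auto simp: f_def g_def)
        show "real (E (col (f i)) (col (g i))) / ((real (N (col (f i))) - real 4) * (real (N (col (g i))) - real 4)) \<le> m / ((d * m) * (d * m))"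
          by (rule frac_le) (use E NS[OF fg(1)] NS[OF fg(2)] dm m0 in \<open>auto simp: m_def simp del: of_nat_mult intro!: mult_mono\<close>)
        show "0 \<le> real (E (col (f i)) (col (g i))) / ((real (N (col (f i))) - real 4) * (real (N (col (g i))) - real 4))"
          using NS[OF fg(1)] NS[OF fg(2)] dm by simp
      qed
      also have "\<dots> = (1 / (d ^ 2 * m)) ^ 2" by (simp add: power2_eq_square)
      also have "\<dots> = 1 / (d ^ 4 * m ^ 2)" by (simp add: power_divide power_mult_distrib flip: power_mult)
      finally show "(\<Prod>i\<in>UNIV. real (E (col (f i)) (col (g i))) / ((real (N (col (f i))) - real 4) * (real (N (col (g i))) - real 4)))
        \<le> 1 / (d ^ 4 * m ^ 2)" .
    qed simp
    finally have "real (card {M\<in>typed_matchings S col E. \<forall>i\<in>UNIV. M (f i) = g i}) \<le> real (card (typed_matchings S col E)) * (1 / (d ^ 4 * m ^ 2))" .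
    moreover have "{M\<in>typed_matchings S col E. \<forall>i\<in>UNIV. M (f i) = g i} = {M\<in>\<Omega>. M h = k \<and> M h' = k'}"
      by (auto simp: Om f_def g_def)
    ultimately show ?thesis by (simp add: Om)
  qed
  define L where "L = {(h, k). h \<in> S \<and> k \<in> S \<and> h \<noteq> k \<and> fst k = fst h}"
  define W where "W = {(h, k, h', k'). h \<in> S \<and> k \<in> S \<and> h' \<in> S \<and> k' \<in> S \<and> h' \<noteq> h \<and> fst h' = fst h \<and> fst k' = fst k \<and> fst k \<noteq> fst h \<and> k' \<noteq> k}"
  have cL: "real (card L) \<le> m * real K" and finL: "finite L"
  proof -
    have sub: "L \<subseteq> (\<lambda>(h, j). (h, (fst h, j))) ` (S \<times> {..<K})"
      by (auto simp: L_def S_def half_edges_def image_iff)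
    thus "finite L" by (rule finite_subset) (use finS in auto)
    have "card L \<le> card (S \<times> {..<K})" by (rule surj_card_le[OF _ sub]) (use finS in auto)
    hence "real (card L) \<le> real (card S * K)" by (simp only: card_cartesian_product card_lessThan of_nat_le_iff)
    thus "real (card L) \<le> m * real K" using cS by simp
  qed
  have cW: "real (card W) \<le> m ^ 2 * real K ^ 2" and finW: "finite W"
  proof -
    have sub: "W \<subseteq> (\<lambda>((h, j), (k, i)). (h, k, (fst h, j), (fst k, i))) ` ((S \<times> {..<K}) \<times> (S \<times> {..<K}))"
    proof
      fix w assume "w \<in> W"
      obtain h k h' k' where w0: "w = (h, k, h', k')" by (cases w)
      hence w: "w = (h, k, h', k')" "h \<in> S" "k \<in> S" "h' \<in> S" "k' \<in> S" "fst h' = fst h" "fst k' = fst k"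
        using \<open>w \<in> W\<close> by (simp_all add: W_def)
      hence "w = (\<lambda>((h, j), (k, i)). (h, k, (fst h, j), (fst k, i))) ((h, snd h'), (k, snd k'))"
        by (auto simp: prod_eq_iff)
      moreover have "((h, snd h'), (k, snd k')) \<in> (S \<times> {..<K}) \<times> (S \<times> {..<K})"
        using w by (auto simp: S_def half_edges_def)
      ultimately show "w \<in> (\<lambda>((h, j), (k, i)). (h, k, (fst h, j), (fst k, i))) ` ((S \<times> {..<K}) \<times> (S \<times> {..<K}))" by blast
    qed
    thus "finite W" by (rule finite_subset) (use finS in auto)
    have "card W \<le> card ((S \<times> {..<K}) \<times> (S \<times> {..<K}))" by (rule surj_card_le[OF _ sub]) (use finS in auto)
    hence "real (card W) \<le> real ((card S * K) * (card S * K))" by (simp only: card_cartesian_product card_lessThan of_nat_le_iff)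
    thus "real (card W) \<le> m ^ 2 * real K ^ 2" using cS by (simp add: power2_eq_square ac_simps)
  qed
  have def_le: "card (defective S M) \<le> card {(h, k)\<in>L. M h = k} + card {(h, k, h', k')\<in>W. M h = k \<and> M h' = k'}" if s: "M \<in> \<Omega>" for M
  proof -
    note D = matchingsD[OF om[OF s]]
    have "defective S M \<subseteq> fst ` {(h, k)\<in>L. M h = k} \<union> fst ` {(h, k, h', k')\<in>W. M h = k \<and> M h' = k'}"
    proof
      fix h assume h: "h \<in> defective S M"
      hence hS: "h \<in> S" by (simp add: defective_def)
      show "h \<in> fst ` {(h, k)\<in>L. M h = k} \<union> fst ` {(h, k, h', k')\<in>W. M h = k \<and> M h' = k'}"
      proof (cases "fst (M h) = fst h")
        case True
        hence "(h, M h) \<in> {(h, k)\<in>L. M h = k}" using hS D(1)[OF hS] D(2)[OF hS] by (auto simp: L_def)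
        thus ?thesis by (intro UnI1 image_eqI[of _ _ "(h, M h)"]) simp_all
      next
        case False
        then obtain h' where h': "h' \<in> S" "h' \<noteq> h" "fst h' = fst h" "fst (M h') = fst (M h)"
          using h by (auto simp: defective_def)
        have "M h' \<noteq> M h" using h'(2) D(3) by metis
        hence "(h, M h, h', M h') \<in> {(h, k, h', k')\<in>W. M h = k \<and> M h' = k'}"
          using hS h' D(1) False by (simp add: W_def)
        thus ?thesis by (intro UnI2 image_eqI[of _ _ "(h, M h, h', M h')"]) simp_all
      qed
    qed
    hence "card (defective S M) \<le> card (fst ` {(h, k)\<in>L. M h = k} \<union> fst ` {(h, k, h', k')\<in>W. M h = k \<and> M h' = k'})"
      by (rule card_mono[rotated]) (use finL finW in \<open>auto intro: finite_subset\<close>)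
    also have "\<dots> \<le> card (fst ` {(h, k)\<in>L. M h = k}) + card (fst ` {(h, k, h', k')\<in>W. M h = k \<and> M h' = k'})" by (rule card_Un_le)
    also have "\<dots> \<le> card {(h, k)\<in>L. M h = k} + card {(h, k, h', k')\<in>W. M h = k \<and> M h' = k'}"
      by (intro add_mono card_image_le) (use finL finW in \<open>auto intro: finite_subset\<close>)
    finally show ?thesis .
  qed
  have swapL: "(\<Sum>M\<in>\<Omega>. real (card {y\<in>Y. R M y})) = (\<Sum>y\<in>Y. real (card {M\<in>\<Omega>. R M y}))" if "finite Y"
    for Y :: "'y set" and R
  proof -
    have "(\<Sum>M\<in>\<Omega>. real (card {y\<in>Y. R M y})) = (\<Sum>M\<in>\<Omega>. \<Sum>y\<in>Y. if R M y then 1 else 0)"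
      using that by (simp add: sum.If_cases Int_def)
    also have "\<dots> = (\<Sum>y\<in>Y. \<Sum>M\<in>\<Omega>. if R M y then 1 else 0)" by (rule sum.swap)
    also have "\<dots> = (\<Sum>y\<in>Y. real (card {M\<in>\<Omega>. R M y}))"
      using finO by (simp add: sum.If_cases Int_def)
    finally show ?thesis .
  qed
  have "(\<Sum>M\<in>\<Omega>. real (card (defective S M))) \<le>
     (\<Sum>M\<in>\<Omega>. real (card {p\<in>L. M (fst p) = snd p}) + real (card {p\<in>W. M (fst p) = fst (snd p) \<and> M (fst (snd (snd p))) = snd (snd (snd p))}))"
  proof (rule sum_mono)
    fix M assume s: "M \<in> \<Omega>"
    have m1: "{(h, k)\<in>L. M h = k} = {p\<in>L. M (fst p) = snd p}" by auto
    have m2: "{(h, k, h', k')\<in>W. M h = k \<and> M h' = k'} = {p\<in>W. M (fst p) = fst (snd p) \<and> M (fst (snd (snd p))) = snd (snd (snd p))}" by auto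
    show "real (card (defective S M)) \<le> real (card {p\<in>L. M (fst p) = snd p}) + real (card {p\<in>W. M (fst p) = fst (snd p) \<and> M (fst (snd (snd p))) = snd (snd (snd p))})"
      using def_le[OF s] unfolding m1 m2 of_nat_add[symmetric] of_nat_le_iff .
  qed
  also have "\<dots> = (\<Sum>p\<in>L. real (card {M\<in>\<Omega>. M (fst p) = snd p})) +
     (\<Sum>p\<in>W. real (card {M\<in>\<Omega>. M (fst p) = fst (snd p) \<and> M (fst (snd (snd p))) = snd (snd (snd p))}))"
    unfolding sum.distrib by (simp only: swapL[OF finL] swapL[OF finW])
  also have "\<dots> \<le> (\<Sum>p\<in>L. real (card \<Omega>) * (1 / (d ^ 2 * m))) + (\<Sum>p\<in>W. real (card \<Omega>) * (1 / (d ^ 4 * m ^ 2)))"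
  proof (intro add_mono sum_mono)
    fix p assume "p \<in> L"
    thus "real (card {M\<in>\<Omega>. M (fst p) = snd p}) \<le> real (card \<Omega>) * (1 / (d ^ 2 * m))"
      by (intro pair) (auto simp: L_def)
  next
    fix p assume "p \<in> W"
    thus "real (card {M\<in>\<Omega>. M (fst p) = fst (snd p) \<and> M (fst (snd (snd p))) = snd (snd (snd p))}) \<le> real (card \<Omega>) * (1 / (d ^ 4 * m ^ 2))"
      by (intro two) (auto simp: W_def)
  qed
  also have "\<dots> = real (card L) * (real (card \<Omega>) * (1 / (d ^ 2 * m))) + real (card W) * (real (card \<Omega>) * (1 / (d ^ 4 * m ^ 2)))" by simp
  also have "\<dots> \<le> (m * real K) * (real (card \<Omega>) * (1 / (d ^ 2 * m))) + (m ^ 2 * real K ^ 2) * (real (card \<Omega>) * (1 / (d ^ 4 * m ^ 2)))"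
    by (intro add_mono mult_right_mono cL cW) (use m0 d in auto)
  also have "\<dots> = (real K / d ^ 2 + real K ^ 2 / d ^ 4) * real (card \<Omega>)"
    using m0 by (simp add: field_simps)
  finally show ?thesis by (simp add: S_def)
qed

section \<open>Tree-indexed Markov chains\<close>

locale markov_law =
  fixes K :: nat and \<alpha> :: "'x::finite \<Rightarrow> real" and \<pi> :: "'x \<Rightarrow> 'x \<Rightarrow> real"
  assumes K: "K \<ge> 2" and \<alpha>_pos: "0 < \<alpha> a" and \<pi>_nonneg: "0 \<le> \<pi> a b"
    and \<pi>_sum: "(\<Sum>b\<in>UNIV. \<pi> a b) = \<alpha> a" and \<alpha>_sum: "(\<Sum>a\<in>UNIV. \<alpha> a) = 1"
begin

definition root_law :: "'x pmf" where "root_law = embed_pmf \<alpha>"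
definition step_law :: "'x \<Rightarrow> 'x pmf" where "step_law a = embed_pmf (\<lambda>b. \<pi> a b / \<alpha> a)"

lemma pmf_root_law: "pmf root_law a = \<alpha> a"
  unfolding root_law_def
proof (rule pmf_embed_pmf)
  show "(\<integral>\<^sup>+x. ennreal (\<alpha> x) \<partial>count_space UNIV) = 1"
    using \<alpha>_sum \<alpha>_pos by (simp add: nn_integral_count_space_finite less_imp_le)
qed (simp add: less_imp_le \<alpha>_pos)

lemma pmf_step_law: "pmf (step_law a) b = \<pi> a b / \<alpha> a"
  unfolding step_law_def
proof (rule pmf_embed_pmf)
  have "(\<Sum>b\<in>UNIV. \<pi> a b / \<alpha> a) = 1"
    using \<pi>_sum[of a] \<alpha>_pos[of a] by (simp add: sum_divide_distrib[symmetric])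
  thus "(\<integral>\<^sup>+b. ennreal (\<pi> a b / \<alpha> a) \<partial>count_space UNIV) = 1"
    using \<alpha>_pos \<pi>_nonneg by (simp add: nn_integral_count_space_finite less_imp_le)
qed (simp add: less_imp_le \<alpha>_pos \<pi>_nonneg)

text \<open>
  The tree-indexed chain is driven by independent random maps: the mark of a vertex is the image of the
  mark of its parent under the random map of the vertex.
\<close>

definition driver :: "nat list \<Rightarrow> ('x \<Rightarrow> 'x) pmf" where
  "driver w = (if w = [] then map_pmf (\<lambda>a _. a) root_law else Pi_pmf UNIV undefined step_law)"

text \<open>The word is read backwards, so that the list recursion passes from a vertex to its
  parent. Under \<open>driver\<close> the map at the root is almost surely constant, which makes its
  argument arbitrary.\<close>

fun rev_mark :: "(nat list \<Rightarrow> 'x \<Rightarrow> 'x) \<Rightarrow> nat list \<Rightarrow> 'x" where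
  "rev_mark F [] = F [] undefined"
| "rev_mark F (i # w) = F (rev w @ [i]) (rev_mark F w)"

definition mark_of :: "(nat list \<Rightarrow> 'x \<Rightarrow> 'x) \<Rightarrow> nat list \<Rightarrow> 'x" where
  "mark_of F w = rev_mark F (rev w)"

lemma mark_of_Nil: "mark_of F [] = F [] undefined"
  by (simp add: mark_of_def)

lemma mark_of_snoc: "mark_of F (w @ [i]) = F (w @ [i]) (mark_of F w)"
  by (simp add: mark_of_def)

definition driver_space :: "(nat list \<Rightarrow> 'x \<Rightarrow> 'x) measure" where
  "driver_space = PiM (tree_verts K) (\<lambda>w. measure_pmf (driver w))"

definition tree_chain :: "(nat list \<Rightarrow> 'x) measure" where
  "tree_chain = distr driver_space (PiM (tree_verts K) (\<lambda>_. count_space UNIV)) (\<lambda>F. restrict (mark_of F) (tree_verts K))"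

lemma prob_driver_space: "prob_space driver_space"
  unfolding driver_space_def by (rule prob_space_PiM) (rule prob_space_measure_pmf)

lemma measurable_driver:
  assumes "w \<in> tree_verts K" shows "(\<lambda>F. F w a) \<in> driver_space \<rightarrow>\<^sub>M count_space UNIV"
proof -
  have "(\<lambda>F. F w) \<in> driver_space \<rightarrow>\<^sub>M measure_pmf (driver w)"
    unfolding driver_space_def by (rule measurable_component_singleton[OF assms])
  thus ?thesis by (rule measurable_compose) simp
qed

lemma measurable_mark_of:
  "w \<in> tree_verts K \<Longrightarrow> (\<lambda>F. mark_of F w) \<in> driver_space \<rightarrow>\<^sub>M count_space UNIV"
proof (induction w rule: rev_induct)
  case Nil
  thus ?case unfolding mark_of_Nil by (rule measurable_driver)
next
  case (snoc i w)
  have "(\<lambda>F. mark_of F w) \<in> driver_space \<rightarrow>\<^sub>M count_space UNIV"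
    by (rule snoc.IH) (use snoc.prems in \<open>simp add: tree_verts_snoc\<close>)
  thus ?case
    unfolding mark_of_snoc
    by (rule measurable_compose_countable[rotated]) (rule measurable_driver[OF snoc.prems])
qed

lemma measurable_marks:
  "(\<lambda>F. restrict (mark_of F) (tree_verts K)) \<in> driver_space \<rightarrow>\<^sub>M PiM (tree_verts K) (\<lambda>_. count_space UNIV)"
  by (rule measurable_restrict) (rule measurable_mark_of)

lemma prob_tree_chain: "prob_space tree_chain"
  unfolding tree_chain_def by (rule prob_space.prob_space_distr[OF prob_driver_space measurable_marks])

lemma sets_tree_chain: "sets tree_chain = sets (PiM (tree_verts K) (\<lambda>_. count_space UNIV))"
  by (simp add: tree_chain_def)

lemma space_tree_chain: "space tree_chain = tree_verts K \<rightarrow>\<^sub>E UNIV"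
  by (simp add: tree_chain_def space_PiM)

lemma cylinder_sets:
  assumes "finite T" "T \<subseteq> tree_verts K"
  shows "{y\<in>space tree_chain. \<forall>w\<in>T. y w = x w} \<in> sets tree_chain"
proof -
  have "{y\<in>space tree_chain. \<forall>w\<in>T. y w = x w} = (\<Inter>w\<in>T. {y\<in>space tree_chain. y w = x w}) \<inter> space tree_chain" by auto
  moreover have "{y\<in>space tree_chain. y w = x w} \<in> sets tree_chain" if "w \<in> T" for w
  proof -
    have "(\<lambda>y. y w) \<in> tree_chain \<rightarrow>\<^sub>M count_space UNIV"
      unfolding measurable_cong_sets[OF sets_tree_chain refl] using that assms(2) by auto
    hence "(\<lambda>y. y w) -` {x w} \<inter> space tree_chain \<in> sets tree_chain" by simp
    thus ?thesis by (simp add: Int_def conj_commute)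
  qed
  ultimately show ?thesis
    by simp
qed

text \<open>On a prefix-closed set the marks are as prescribed if and only if each driving map sends
  the prescribed mark of the parent to that of the vertex. These are conditions on independent
  coordinates.\<close>

lemma prob_cylinder:
  assumes T: "finite T" "T \<subseteq> tree_verts K" "prefix_closed T"
  shows "measure tree_chain {y\<in>space tree_chain. \<forall>w\<in>T. y w = x w} =
    \<alpha> (x []) * (\<Prod>w\<in>T - {[]}. \<pi> (x (butlast w)) (x w) / \<alpha> (x (butlast w)))"
proof -
  let ?A = "{y\<in>space tree_chain. \<forall>w\<in>T. y w = x w}"
  define A where "A w = (if w = [] then {f. f undefined = x []} else {f. f (x (butlast w)) = x w})" for w :: "nat list"
  interpret P: product_prob_space "\<lambda>w. measure_pmf (driver w)" "tree_verts K"
    by unfold_locales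
  have NT: "[] \<in> T" using T(3) by (simp add: prefix_closed_def)
  have sp: "space driver_space = tree_verts K \<rightarrow>\<^sub>E UNIV" by (simp add: driver_space_def space_PiM)
  have iff: "(\<forall>w\<in>T. mark_of F w = x w) \<longleftrightarrow> (\<forall>w\<in>T. F w \<in> A w)" for F
  proof
    assume a: "\<forall>w\<in>T. mark_of F w = x w"
    show "\<forall>w\<in>T. F w \<in> A w"
    proof
      fix w assume w: "w \<in> T"
      show "F w \<in> A w"
      proof (cases w rule: rev_cases)
        case Nil thus ?thesis using bspec[OF a NT] by (simp add: A_def mark_of_Nil)
      next
        case (snoc v i)
        have "v \<in> T" using T(3) w snoc unfolding prefix_closed_def by fastforce
        thus ?thesis using a w snoc by (simp add: A_def) (metis mark_of_snoc)
      qed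
    qed
  next
    assume a: "\<forall>w\<in>T. F w \<in> A w"
    have "w \<in> T \<Longrightarrow> mark_of F w = x w" for w
    proof (induction w rule: rev_induct)
      case Nil thus ?case using a by (auto simp: A_def mark_of_Nil dest: bspec[of _ _ "[]"])
    next
      case (snoc i v)
      have "v \<in> T" using T(3) snoc.prems unfolding prefix_closed_def by fastforce
      hence "mark_of F v = x v" by (rule snoc.IH)
      moreover have "F (v @ [i]) \<in> A (v @ [i])" using a snoc.prems by blast
      ultimately show ?case by (simp add: A_def mark_of_snoc)
    qed
    thus "\<forall>w\<in>T. mark_of F w = x w" by blast
  qed
  have ev: "(\<lambda>F. restrict (mark_of F) (tree_verts K)) -` ?A \<inter> space driver_space
     = prod_emb (tree_verts K) (\<lambda>w. measure_pmf (driver w)) T (Pi\<^sub>E T A)"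
  proof -
    have "restrict (mark_of F) (tree_verts K) w = mark_of F w" if "w \<in> T" for F w using that T(2) by auto
    hence "(\<lambda>F. restrict (mark_of F) (tree_verts K)) -` ?A \<inter> space driver_space
      = {F\<in>space driver_space. \<forall>w\<in>T. mark_of F w = x w}"
      by (auto simp: space_tree_chain)
    also have "\<dots> = {F\<in>space driver_space. \<forall>w\<in>T. F w \<in> A w}" by (simp only: iff)
    also have "\<dots> = prod_emb (tree_verts K) (\<lambda>w. measure_pmf (driver w)) T (Pi\<^sub>E T A)"
      unfolding prod_emb_def sp by auto
    finally show ?thesis .
  qed
  have cyl: "?A \<in> sets (PiM (tree_verts K) (\<lambda>_. count_space UNIV))"
    using cylinder_sets[OF T(1,2)] by (simp add: sets_tree_chain)
  have "emeasure tree_chain ?A =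
     emeasure driver_space ((\<lambda>F. restrict (mark_of F) (tree_verts K)) -` ?A \<inter> space driver_space)"
    by (subst (1) tree_chain_def) (rule emeasure_distr[OF measurable_marks cyl])
  also have "\<dots> = (\<Prod>w\<in>T. emeasure (measure_pmf (driver w)) (A w))"
    unfolding ev unfolding driver_space_def by (rule P.emeasure_PiM_emb[OF T(2,1)]) simp
  also have "\<dots> = (\<Prod>w\<in>T. ennreal (if w = [] then \<alpha> (x []) else \<pi> (x (butlast w)) (x w) / \<alpha> (x (butlast w))))"
  proof (rule prod.cong)
    fix w assume "w \<in> T"
    show "emeasure (measure_pmf (driver w)) (A w) = ennreal (if w = [] then \<alpha> (x []) else \<pi> (x (butlast w)) (x w) / \<alpha> (x (butlast w)))"
    proof (cases "w = []")
      case True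
      have "measure (measure_pmf (driver w)) (A w) = pmf root_law (x [])"
      proof -
        have "(\<lambda>a _. a) -` A w = {x []}" using True by (auto simp: A_def)
        thus ?thesis using True by (simp add: driver_def measure_pmf_single)
      qed
      thus ?thesis using True by (simp add: measure_pmf.emeasure_eq_measure pmf_root_law)
    next
      case False
      have "map_pmf (\<lambda>f. f (x (butlast w))) (driver w) = step_law (x (butlast w))"
        using False by (simp add: driver_def Pi_pmf_component)
      hence "pmf (map_pmf (\<lambda>f. f (x (butlast w))) (driver w)) (x w) = pmf (step_law (x (butlast w))) (x w)" by simp
      hence "measure (measure_pmf (driver w)) (A w) = pmf (step_law (x (butlast w))) (x w)"
        using False by (simp add: pmf_map A_def vimage_def)
      thus ?thesis using False by (simp add: measure_pmf.emeasure_eq_measure pmf_step_law)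
    qed
  qed simp
  also have "\<dots> = ennreal (\<Prod>w\<in>T. if w = [] then \<alpha> (x []) else \<pi> (x (butlast w)) (x w) / \<alpha> (x (butlast w)))"
    by (rule prod_ennreal) (use \<alpha>_pos \<pi>_nonneg in \<open>auto simp: less_imp_le\<close>)
  also have "(\<Prod>w\<in>T. if w = [] then \<alpha> (x []) else \<pi> (x (butlast w)) (x w) / \<alpha> (x (butlast w))) =
     \<alpha> (x []) * (\<Prod>w\<in>T - {[]}. \<pi> (x (butlast w)) (x w) / \<alpha> (x (butlast w)))"
    by (subst prod.remove[OF T(1) NT]) (auto intro!: prod.cong)
  finally show ?thesis
    using \<alpha>_pos \<pi>_nonneg by (simp add: measure_def prod_nonneg less_imp_le)
qed

lemma prob_ball_cylinder:
  "measure tree_chain {y\<in>space tree_chain. \<forall>w\<in>tree_ball K r. y w = x w} = markov_weight K r \<alpha> \<pi> x"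
  unfolding markov_weight_def by (rule prob_cylinder[OF finite_tree_ball tree_ball_verts prefix_closed_tree_ball])

text \<open>A function of finitely many marks is a finite combination of indicators of cylinders,
  which gives measurability and the integral at once.\<close>

lemma integral_cylinder_function:
  fixes f :: "(nat list \<Rightarrow> 'x) \<Rightarrow> real"
  assumes T: "finite T" "T \<subseteq> tree_verts K" and f: "\<And>y. f y = f (restrict y T)"
  shows "f \<in> borel_measurable tree_chain"
    "(\<integral>y. f y \<partial>tree_chain) = (\<Sum>x\<in>T \<rightarrow>\<^sub>E UNIV. measure tree_chain {y\<in>space tree_chain. \<forall>w\<in>T. y w = x w} * f x)"
proof -
  interpret prob_space tree_chain by (rule prob_tree_chain)
  define C where "C x = {y\<in>space tree_chain. \<forall>w\<in>T. y w = x w}" for x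
  have Cs: "C x \<in> sets tree_chain" for x unfolding C_def by (rule cylinder_sets[OF T])
  have finP: "finite (T \<rightarrow>\<^sub>E (UNIV::'x set))" by (rule finite_PiE[OF T(1)]) simp
  have eq: "f y = (\<Sum>x\<in>T \<rightarrow>\<^sub>E UNIV. f x * indicator (C x) y)" if "y \<in> space tree_chain" for y
  proof -
    have "(\<Sum>x\<in>T \<rightarrow>\<^sub>E UNIV. f x * indicator (C x) y) = (\<Sum>x\<in>{restrict y T}. f x * indicator (C x) y)"
    proof (rule sum.mono_neutral_right[OF finP])
      show "\<forall>x\<in>(T \<rightarrow>\<^sub>E UNIV) - {restrict y T}. f x * indicator (C x) y = 0"
      proof
        fix x assume x: "x \<in> (T \<rightarrow>\<^sub>E UNIV) - {restrict y T}"
        have "y \<notin> C x"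
        proof
          assume "y \<in> C x"
          hence "restrict y T = x" using x by (intro ext) (auto simp: C_def PiE_def extensional_def restrict_def)
          thus False using x by simp
        qed
        thus "f x * indicator (C x) y = 0" by simp
      qed
    qed auto
    also have "\<dots> = f y" using that f[of y] by (simp add: C_def)
    finally show ?thesis by simp
  qed
  have m: "(\<lambda>y. \<Sum>x\<in>T \<rightarrow>\<^sub>E UNIV. f x * indicator (C x) y) \<in> borel_measurable tree_chain"
    using Cs by simp
  thus "f \<in> borel_measurable tree_chain" by (subst measurable_cong[OF eq])
  have "(\<integral>y. f y \<partial>tree_chain) = (\<integral>y. (\<Sum>x\<in>T \<rightarrow>\<^sub>E UNIV. f x * indicator (C x) y) \<partial>tree_chain)"
    by (rule Bochner_Integration.integral_cong[OF refl eq])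
  also have "\<dots> = (\<Sum>x\<in>T \<rightarrow>\<^sub>E UNIV. (\<integral>y. f x * indicator (C x) y \<partial>tree_chain))"
    using Cs by (intro Bochner_Integration.integral_sum integrable_mult_right integrable_real_indicator) (auto simp: emeasure_eq_measure)
  also have "\<dots> = (\<Sum>x\<in>T \<rightarrow>\<^sub>E UNIV. measure tree_chain (C x) * f x)"
    using Cs by (intro sum.cong) auto
  finally show "(\<integral>y. f y \<partial>tree_chain) = (\<Sum>x\<in>T \<rightarrow>\<^sub>E UNIV. measure tree_chain {y\<in>space tree_chain. \<forall>w\<in>T. y w = x w} * f x)"
    unfolding C_def .
qed

lemma markov_weight_sum: "(\<Sum>x\<in>tree_ball K r \<rightarrow>\<^sub>E UNIV. markov_weight K r \<alpha> \<pi> x) = 1"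
proof -
  interpret prob_space tree_chain by (rule prob_tree_chain)
  have "(\<integral>y. 1 \<partial>tree_chain) = (\<Sum>x\<in>tree_ball K r \<rightarrow>\<^sub>E UNIV. measure tree_chain {y\<in>space tree_chain. \<forall>w\<in>tree_ball K r. y w = x w} * (1::real))"
    by (rule integral_cylinder_function(2)[OF finite_tree_ball tree_ball_verts]) simp
  thus ?thesis by (simp add: prob_ball_cylinder prob_space)
qed

lemma tree_chain_marginal:
  assumes "x \<in> tree_ball K r \<rightarrow>\<^sub>E UNIV"
  shows "measure (distr tree_chain (Pi\<^sub>M (tree_ball K r) (\<lambda>_. count_space UNIV)) (\<lambda>y. restrict y (tree_ball K r))) {x} = markov_weight K r \<alpha> \<pi> x"
proof -
  define T where "T = tree_ball K r"
  have m: "(\<lambda>y. restrict y T) \<in> tree_chain \<rightarrow>\<^sub>M Pi\<^sub>M T (\<lambda>_. count_space UNIV)"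
    unfolding measurable_cong_sets[OF sets_tree_chain refl]
    by (rule measurable_restrict_subset) (simp add: T_def tree_ball_verts)
  have x: "x \<in> T \<rightarrow>\<^sub>E UNIV" using assms by (simp add: T_def)
  have "{x} = Pi\<^sub>E T (\<lambda>i. {x i})" using x by (auto simp: PiE_def Pi_def extensional_def fun_eq_iff) metis
  also have "\<dots> \<in> sets (Pi\<^sub>M T (\<lambda>_. count_space UNIV))"
    by (rule sets_PiM_I_finite) (auto simp: T_def finite_tree_ball)
  finally have xs: "{x} \<in> sets (Pi\<^sub>M T (\<lambda>_. count_space UNIV))" .
  have "measure (distr tree_chain (Pi\<^sub>M T (\<lambda>_. count_space UNIV)) (\<lambda>y. restrict y T)) {x} =
      measure tree_chain ((\<lambda>y. restrict y T) -` {x} \<inter> space tree_chain)"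
    by (rule measure_distr[OF m xs])
  also have "(\<lambda>y. restrict y T) -` {x} \<inter> space tree_chain = {y\<in>space tree_chain. \<forall>w\<in>T. y w = x w}"
    using x by (auto simp: fun_eq_iff PiE_def extensional_def)
  finally show ?thesis unfolding T_def prob_ball_cylinder .
qed

end

section \<open>Products over tree balls and splitting Gibbs measures\<close>

lemma inj_snoc: "inj_on (\<lambda>(u, i). u @ [i]) A"
  by (auto simp: inj_on_def)

lemma tree_ball_split:
  assumes "r \<ge> 1"
  shows "tree_ball K r - {[]} = (\<lambda>(u, i). u @ [i]) ` (SIGMA u:tree_ball K (r - 1). {..<(if u = [] then K else K - 1)})"
proof (intro equalityI subsetI)
  fix w assume w: "w \<in> tree_ball K r - {[]}"
  hence e: "w = butlast w @ [last w]" by simp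
  hence "butlast w @ [last w] \<in> tree_verts K" using w by (simp add: tree_ball_def)
  hence "butlast w \<in> tree_verts K" "last w < (if butlast w = [] then K else K - 1)" by (auto simp: tree_verts_snoc)
  moreover have "length (butlast w) \<le> r - 1" using w by (auto simp: tree_ball_def)
  ultimately have "(butlast w, last w) \<in> (SIGMA u:tree_ball K (r - 1). {..<(if u = [] then K else K - 1)})"
    by (simp add: tree_ball_def)
  thus "w \<in> (\<lambda>(u, i). u @ [i]) ` (SIGMA u:tree_ball K (r - 1). {..<(if u = [] then K else K - 1)})"
    using e by (intro image_eqI[of _ _ "(butlast w, last w)"]) simp_all
next
  fix w assume "w \<in> (\<lambda>(u, i). u @ [i]) ` (SIGMA u:tree_ball K (r - 1). {..<(if u = [] then K else K - 1)})"
  then obtain u i where "w = u @ [i]" "u \<in> tree_ball K (r - 1)" "i < (if u = [] then K else K - 1)" by auto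
  thus "w \<in> tree_ball K r - {[]}" using assms tree_verts_snoc[of u i K] by (auto simp: tree_ball_def)
qed

text \<open>Grouping by parent: the root has \<open>K\<close> children, every other inner vertex
  \<open>K - 1\<close>.\<close>

lemma prod_tree_ball_parents:
  fixes g :: "nat list \<Rightarrow> real"
  assumes "r \<ge> 1"
  shows "(\<Prod>w\<in>tree_ball K r - {[]}. g (butlast w)) = (\<Prod>u\<in>tree_ball K (r - 1). g u ^ (if u = [] then K else K - 1))"
proof -
  have "(\<Prod>w\<in>tree_ball K r - {[]}. g (butlast w)) =
     (\<Prod>p\<in>(SIGMA u:tree_ball K (r - 1). {..<(if u = [] then K else K - 1)}). g (fst p))"
    unfolding tree_ball_split[OF assms] by (subst prod.reindex[OF inj_snoc]) (auto intro!: prod.cong)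
  also have "\<dots> = (\<Prod>u\<in>tree_ball K (r - 1). \<Prod>i<(if u = [] then K else K - 1). g u)"
    by (subst prod.Sigma) (auto simp: finite_tree_ball case_prod_beta)
  finally show ?thesis by simp
qed

lemma tree_arcs_image: "tree_arcs K r = (\<lambda>w. (butlast w, w)) ` (tree_ball K r - {[]})"
proof (intro equalityI subsetI)
  fix p assume "p \<in> tree_arcs K r"
  then obtain u a where "p = (u, u @ [a])" "u @ [a] \<in> tree_ball K r" by (auto simp: tree_arcs_def)
  thus "p \<in> (\<lambda>w. (butlast w, w)) ` (tree_ball K r - {[]})" by (intro image_eqI[of _ _ "u @ [a]"]) auto
next
  fix p assume "p \<in> (\<lambda>w. (butlast w, w)) ` (tree_ball K r - {[]})"
  then obtain w where w: "p = (butlast w, w)" "w \<in> tree_ball K r" "w \<noteq> []" by auto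
  hence "w = butlast w @ [last w]" by simp
  thus "p \<in> tree_arcs K r"
    using w unfolding tree_arcs_def by (intro CollectI exI[of _ "butlast w"] exI[of _ "last w"]) simp
qed

text \<open>
  With exponent \<open>g = (K - 1) / K\<close> the powers of \<open>\<alpha>\<close> cancel at every inner vertex of the ball; this
  identifies the Markov law of a splitting edge law with a splitting Gibbs measure.
\<close>

lemma (in markov_law) tree_chain_TISGM:
  assumes g: "g = (real K - 1) / real K" and C: "C > 0"
    and split: "\<And>a b. \<pi> a b = C * \<alpha> a powr g * \<alpha> b powr g * \<psi> a b"
    and \<psi>: "\<And>a b. 0 < \<psi> a b"
    and \<nu>: "\<nu> = pmf_of_set UNIV"
  shows "tree_chain \<in> TISGM K \<psi> (pmf \<nu>)"
proof -
  define Z where "Z = (\<Sum>a\<in>UNIV. \<alpha> a powr g)"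
  have Z: "Z > 0" unfolding Z_def by (rule sum_pos) (simp_all add: less_imp_neq[OF \<alpha>_pos, symmetric])
  \<comment> \<open>The boundary law of the splitting measure: the power of \<open>\<alpha>\<close>
    that is left over at a leaf, normalised.\<close>
  define l where "l = embed_pmf (\<lambda>a. \<alpha> a powr g / Z)"
  have pmf_l: "pmf l a = \<alpha> a powr g / Z" for a
    unfolding l_def
  proof (rule pmf_embed_pmf)
    have "(\<Sum>b\<in>UNIV. \<alpha> b powr g / Z) = 1" using Z by (simp add: sum_divide_distrib[symmetric] Z_def[symmetric])
    thus "(\<integral>\<^sup>+b. ennreal (\<alpha> b powr g / Z) \<partial>count_space UNIV) = 1"
      using Z by (simp add: nn_integral_count_space_finite)
  qed (use Z in simp)
  have k0: "real K > 0" using K by simp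
  have main: "measure (distr tree_chain (Pi\<^sub>M (tree_ball K r) (\<lambda>_. count_space UNIV)) (\<lambda>y. restrict y (tree_ball K r))) {x}
          = gibbs_weight K \<psi> (pmf \<nu>) l r x / partition_function K \<psi> (pmf \<nu>) l r"
    if r: "r \<ge> 1" and x: "x \<in> tree_ball K r \<rightarrow>\<^sub>E UNIV" for r x
  proof -
    define TB where "TB = tree_ball K r"
    define TI where "TI = tree_ball K (r - 1)"
    have fin: "finite TB" "finite TI" by (auto simp: TB_def TI_def finite_tree_ball)
    have sub: "TI \<subseteq> TB" "[] \<in> TI" by (auto simp: TB_def TI_def tree_ball_def)
    \<comment> \<open>The constants that do not depend on the marks: one \<open>C\<close> for each
      edge, one \<open>Z\<close> for each leaf, and one factor from the uniform \<open>\<nu>\<close>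
      for each inner vertex. Summation over all marks identifies \<open>J\<close> as the inverse of
      the partition function.\<close>
    define J where "J = C ^ card (TB - {[]}) * Z ^ card (TB - TI) * real CARD('x) ^ card TI"
    have J: "J > 0" using C Z by (simp add: J_def)
    have mg: "markov_weight K r \<alpha> \<pi> y = J * gibbs_weight K \<psi> (pmf \<nu>) l r y" for y
    proof -
      have G: "gibbs_weight K \<psi> (pmf \<nu>) l r y = (\<Prod>w\<in>TB - {[]}. \<psi> (y (butlast w)) (y w)) * (1 / real CARD('x)) ^ card TI *
         ((\<Prod>v\<in>TB - TI. \<alpha> (y v) powr g) / Z ^ card (TB - TI))"
      proof -
        have "(\<Prod>(u, v)\<in>tree_arcs K r. \<psi> (y u) (y v)) = (\<Prod>w\<in>TB - {[]}. \<psi> (y (butlast w)) (y w))"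
          unfolding tree_arcs_image TB_def by (subst prod.reindex) (auto simp: inj_on_def)
        moreover have "(\<Prod>v\<in>TI. pmf \<nu> (y v)) = (1 / real CARD('x)) ^ card TI"
          by (simp add: \<nu>)
        moreover have "(\<Prod>v\<in>TB - TI. pmf l (y v)) = (\<Prod>v\<in>TB - TI. \<alpha> (y v) powr g) / Z ^ card (TB - TI)"
          by (simp add: pmf_l prod_dividef)
        ultimately show ?thesis by (simp add: gibbs_weight_def TB_def TI_def)
      qed
      have step: "\<pi> (y (butlast w)) (y w) / \<alpha> (y (butlast w)) = C * \<alpha> (y (butlast w)) powr (g - 1) * \<alpha> (y w) powr g * \<psi> (y (butlast w)) (y w)" for w
        unfolding split using \<alpha>_pos[of "y (butlast w)"] by (simp add: powr_diff)
      \<comment> \<open>An inner vertex receives the exponent \<open>g - 1\<close> from each child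
        edge and, unless it is the root, \<open>g\<close> from the edge to its parent. The sum is
        \<open>- 1\<close> at the root, against its own factor \<open>\<alpha>\<close>, and 0
        elsewhere.\<close>
      have pow: "(\<alpha> a powr (g - 1)) ^ K = 1 / \<alpha> a" "(\<alpha> a powr (g - 1)) ^ (K - 1) = 1 / \<alpha> a powr g" for a
      proof -
        have e: "(g - 1) * real K = - 1" "(g - 1) * real (K - 1) = - g"
          using k0 by (simp_all add: g field_simps)
        have "(\<alpha> a powr (g - 1)) ^ m = \<alpha> a powr ((g - 1) * real m)" for m
          using \<alpha>_pos[of a] by (simp add: powr_powr[symmetric] powr_realpow)
        thus "(\<alpha> a powr (g - 1)) ^ K = 1 / \<alpha> a" "(\<alpha> a powr (g - 1)) ^ (K - 1) = 1 / \<alpha> a powr g"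
          using e \<alpha>_pos[of a] by (simp_all add: powr_minus_divide)
      qed
      have "(\<Prod>w\<in>TB - {[]}. \<alpha> (y (butlast w)) powr (g - 1)) = (\<Prod>u\<in>TI. (\<alpha> (y u) powr (g - 1)) ^ (if u = [] then K else K - 1))"
        unfolding TB_def TI_def by (rule prod_tree_ball_parents[OF r])
      also have "\<dots> = 1 / \<alpha> (y []) * (\<Prod>u\<in>TI - {[]}. 1 / \<alpha> (y u) powr g)"
        by (subst prod.remove[OF fin(2) sub(2)]) (auto simp: pow(1) pow(2)[unfolded One_nat_def] intro!: prod.cong)
      finally have p1: "(\<Prod>w\<in>TB - {[]}. \<alpha> (y (butlast w)) powr (g - 1)) = 1 / \<alpha> (y []) * (\<Prod>u\<in>TI - {[]}. 1 / \<alpha> (y u) powr g)" .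
      have "TB - {[]} = (TI - {[]}) \<union> (TB - TI)" using sub by auto
      hence p2: "(\<Prod>w\<in>TB - {[]}. \<alpha> (y w) powr g) = (\<Prod>w\<in>TI - {[]}. \<alpha> (y w) powr g) * (\<Prod>w\<in>TB - TI. \<alpha> (y w) powr g)"
        using fin by (simp add: prod.union_disjoint[symmetric] disjoint_iff)
      have p3: "(\<Prod>u\<in>TI - {[]}. 1 / \<alpha> (y u) powr g) * (\<Prod>w\<in>TI - {[]}. \<alpha> (y w) powr g) = 1"
        unfolding prod.distrib[symmetric] using \<alpha>_pos by (intro prod.neutral) (simp add: less_imp_neq[symmetric])
      have "markov_weight K r \<alpha> \<pi> y = \<alpha> (y []) * (C ^ card (TB - {[]}) * (\<Prod>w\<in>TB - {[]}. \<alpha> (y (butlast w)) powr (g - 1)) *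
          (\<Prod>w\<in>TB - {[]}. \<alpha> (y w) powr g) * (\<Prod>w\<in>TB - {[]}. \<psi> (y (butlast w)) (y w)))"
        unfolding markov_weight_def TB_def[symmetric] step by (simp add: prod.distrib)
      also have "\<dots> = (\<alpha> (y []) * (1 / \<alpha> (y []))) * C ^ card (TB - {[]}) *
          ((\<Prod>u\<in>TI - {[]}. 1 / \<alpha> (y u) powr g) * (\<Prod>w\<in>TI - {[]}. \<alpha> (y w) powr g)) * (\<Prod>w\<in>TB - TI. \<alpha> (y w) powr g) *
          (\<Prod>w\<in>TB - {[]}. \<psi> (y (butlast w)) (y w))"
        unfolding p1 p2 by simp
      also have "\<dots> = C ^ card (TB - {[]}) * (\<Prod>w\<in>TB - TI. \<alpha> (y w) powr g) * (\<Prod>w\<in>TB - {[]}. \<psi> (y (butlast w)) (y w))"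
        unfolding p3 using \<alpha>_pos[of "y []"] by simp
      also have "\<dots> = J * gibbs_weight K \<psi> (pmf \<nu>) l r y"
        unfolding G J_def using Z by (simp add: power_divide)
      finally show ?thesis .
    qed
    have "1 = (\<Sum>y\<in>tree_ball K r \<rightarrow>\<^sub>E UNIV. J * gibbs_weight K \<psi> (pmf \<nu>) l r y)"
      using markov_weight_sum[of r] by (simp add: mg)
    also have "\<dots> = J * partition_function K \<psi> (pmf \<nu>) l r"
      by (simp add: partition_function_def sum_distrib_left)
    finally have KP: "J * partition_function K \<psi> (pmf \<nu>) l r = 1" by simp
    hence "partition_function K \<psi> (pmf \<nu>) l r = 1 / J" using J by (simp add: field_simps)
    thus ?thesis unfolding tree_chain_marginal[OF x] mg by simp
  qed
  show ?thesis
    unfolding TISGM_def using prob_tree_chain sets_tree_chain main by blast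
qed

lemma relpow_subset: "R \<subseteq> S \<Longrightarrow> R ^^ k \<subseteq> S ^^ k" for R S :: "('a \<times> 'a) set"
  by (induction k) auto

section \<open>The local topology near trees\<close>

text \<open>The part of \<open>wf_rmgraph\<close> that suffices for comparing paths and balls and
  passes to balls at once.\<close>

definition pre_graph :: "('v, 'x) rmgraph \<Rightarrow> bool" where
  "pre_graph G \<longleftrightarrow> edges G \<subseteq> verts G \<times> verts G \<and> root G \<in> verts G"

definition shape_iso :: "('v \<Rightarrow> 'w) \<Rightarrow> ('v, 'x) rmgraph \<Rightarrow> ('w, 'y) rmgraph \<Rightarrow> bool" where
  "shape_iso \<phi> G H \<longleftrightarrow> bij_betw \<phi> (verts G) (verts H) \<and> \<phi> (root G) = root H \<and>
     (\<forall>u\<in>verts G. \<forall>v\<in>verts G. (u, v) \<in> edges G \<longleftrightarrow> (\<phi> u, \<phi> v) \<in> edges H)"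

lemma rmiso_iff: "rmiso G H \<longleftrightarrow> (\<exists>\<phi>. shape_iso \<phi> G H \<and> (\<forall>v\<in>verts G. mark H (\<phi> v) = mark G v))"
  unfolding rmiso_def shape_iso_def by blast

lemma rball_simps:
  "verts (rball r G) = {v \<in> verts G. \<exists>k\<le>r. (root G, v) \<in> edges G ^^ k}"
  "edges (rball r G) = edges G \<inter> verts (rball r G) \<times> verts (rball r G)"
  "root (rball r G) = root G" "mark (rball r G) = mark G"
  by (simp_all add: rball_def Let_def)

lemma pre_graph_wf: "wf_rmgraph G \<Longrightarrow> pre_graph G"
  by (simp add: wf_rmgraph_def pre_graph_def)

lemma pre_graph_rball: "pre_graph G \<Longrightarrow> pre_graph (rball r G)"
  unfolding pre_graph_def by (auto simp: rball_simps intro: exI[of _ 0])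

lemma shape_iso_relpow:
  assumes \<phi>: "shape_iso \<phi> G H" and G: "pre_graph G" and k: "(u, v) \<in> edges G ^^ k" and u: "u \<in> verts G"
  shows "(\<phi> u, \<phi> v) \<in> edges H ^^ k \<and> v \<in> verts G"
  using k
proof (induction k arbitrary: v)
  case 0
  thus ?case using u by simp
next
  case (Suc k)
  then obtain y where y: "(u, y) \<in> edges G ^^ k" "(y, v) \<in> edges G" by auto
  have "v \<in> verts G" "y \<in> verts G" using G y(2) by (auto simp: pre_graph_def)
  moreover have "(\<phi> y, \<phi> v) \<in> edges H" using \<phi> y(2) calculation by (auto simp: shape_iso_def)
  ultimately show ?case using Suc.IH[OF y(1)] by auto
qed

lemma shape_iso_inverse:
  assumes \<phi>: "shape_iso \<phi> G H" and G: "pre_graph G"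
  shows "shape_iso (inv_into (verts G) \<phi>) H G"
proof -
  have b: "bij_betw \<phi> (verts G) (verts H)" using \<phi> by (simp add: shape_iso_def)
  have b': "bij_betw (inv_into (verts G) \<phi>) (verts H) (verts G)" by (rule bij_betw_inv_into[OF b])
  have i: "\<phi> (inv_into (verts G) \<phi> w) = w" "inv_into (verts G) \<phi> w \<in> verts G" if "w \<in> verts H" for w
    using that b b' by (auto simp: bij_betw_inv_into_right bij_betwE)
  have r: "inv_into (verts G) \<phi> (root H) = root G"
    using \<phi> G by (metis bij_betw_inv_into_left pre_graph_def shape_iso_def)
  show ?thesis
    unfolding shape_iso_def
  proof (intro conjI b' r ballI)
    fix u v assume "u \<in> verts H" "v \<in> verts H"
    thus "(u, v) \<in> edges H \<longleftrightarrow> (inv_into (verts G) \<phi> u, inv_into (verts G) \<phi> v) \<in> edges G"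
      using \<phi> i by (simp add: shape_iso_def)
  qed
qed

lemma shape_iso_rball:
  assumes \<phi>: "shape_iso \<phi> G H" and G: "pre_graph G" and H: "pre_graph H"
  shows "shape_iso \<phi> (rball r G) (rball r H)"
proof -
  define \<psi> where "\<psi> = inv_into (verts G) \<phi>"
  have \<psi>: "shape_iso \<psi> H G" unfolding \<psi>_def by (rule shape_iso_inverse[OF \<phi> G])
  have b: "bij_betw \<phi> (verts G) (verts H)" using \<phi> by (simp add: shape_iso_def)
  have i: "\<phi> (\<psi> w) = w" if "w \<in> verts H" for w using that b by (simp add: \<psi>_def bij_betw_inv_into_right)
  have j: "\<psi> (\<phi> v) = v" if "v \<in> verts G" for v using that b by (simp add: \<psi>_def bij_betw_inv_into_left)
  have m1: "\<phi> v \<in> verts (rball r H)" if "v \<in> verts (rball r G)" for v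
  proof -
    obtain k where k: "k \<le> r" "(root G, v) \<in> edges G ^^ k" "v \<in> verts G" using \<open>v \<in> verts (rball r G)\<close> by (auto simp: rball_simps)
    have "(\<phi> (root G), \<phi> v) \<in> edges H ^^ k" using shape_iso_relpow[OF \<phi> G k(2)] G by (simp add: pre_graph_def)
    hence "(root H, \<phi> v) \<in> edges H ^^ k" using \<phi> by (simp add: shape_iso_def)
    moreover have "\<phi> v \<in> verts H" using b k(3) by (auto dest: bij_betwE)
    ultimately show ?thesis using k(1) by (auto simp: rball_simps)
  qed
  have m2: "\<psi> v \<in> verts (rball r G)" if "v \<in> verts (rball r H)" for v
  proof -
    obtain k where k: "k \<le> r" "(root H, v) \<in> edges H ^^ k" "v \<in> verts H" using \<open>v \<in> verts (rball r H)\<close> by (auto simp: rball_simps)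
    have "(\<psi> (root H), \<psi> v) \<in> edges G ^^ k" using shape_iso_relpow[OF \<psi> H k(2)] H by (simp add: pre_graph_def)
    hence "(root G, \<psi> v) \<in> edges G ^^ k" using \<psi> by (simp add: shape_iso_def)
    moreover have "\<psi> v \<in> verts G" using \<psi> k(3) by (auto simp: shape_iso_def dest: bij_betwE)
    ultimately show ?thesis using k(1) by (auto simp: rball_simps)
  qed
  have "bij_betw \<phi> (verts (rball r G)) (verts (rball r H))"
    by (rule bij_betwI[where g = \<psi>]) (use m1 m2 i j in \<open>auto simp: rball_simps(1)\<close>)
  moreover have "(u, v) \<in> edges (rball r G) \<longleftrightarrow> (\<phi> u, \<phi> v) \<in> edges (rball r H)"
    if uv: "u \<in> verts (rball r G)" "v \<in> verts (rball r G)" for u v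
  proof -
    have "u \<in> verts G" "v \<in> verts G" using uv by (auto simp: rball_simps)
    hence "(u, v) \<in> edges G \<longleftrightarrow> (\<phi> u, \<phi> v) \<in> edges H" using \<phi> by (auto simp: shape_iso_def)
    thus ?thesis using m1 uv unfolding rball_simps(2) by blast
  qed
  moreover have "\<phi> (root (rball r G)) = root (rball r H)" using \<phi> by (simp add: shape_iso_def rball_simps)
  ultimately show ?thesis unfolding shape_iso_def by blast
qed

lemma rmiso_rball:
  assumes "rmiso G H" "pre_graph G" "pre_graph H" shows "rmiso (rball r G) (rball r H)"
proof -
  obtain \<phi> where "shape_iso \<phi> G H" and m: "\<forall>v\<in>verts G. mark H (\<phi> v) = mark G v"
    using assms(1) unfolding rmiso_iff by blast
  hence "shape_iso \<phi> (rball r G) (rball r H)" using assms shape_iso_rball by blast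
  thus ?thesis unfolding rmiso_iff by (intro exI[of _ \<phi>]) (use m in \<open>auto simp: rball_simps\<close>)
qed

text \<open>A path of length at most \<open>r\<close> from the root stays in the larger ball, so
  distances up to \<open>r\<close> are the same there.\<close>

lemma rball_rball:
  assumes r: "r \<le> r'" and G: "pre_graph G" shows "rball r (rball r' G) = rball r G"
proof -
  define B where "B = verts (rball r' G)"
  have E: "edges (rball r' G) = edges G \<inter> B \<times> B" by (simp add: B_def rball_simps)
  have path: "(root G, v) \<in> (edges G \<inter> B \<times> B) ^^ k \<and> v \<in> B" if "(root G, v) \<in> edges G ^^ k" "k \<le> r'" for k v
    using that
  proof (induction k arbitrary: v)
    case 0
    thus ?case using G by (auto simp: B_def rball_simps pre_graph_def intro: exI[of _ 0])
  next
    case (Suc k)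
    then obtain y where y: "(root G, y) \<in> edges G ^^ k" "(y, v) \<in> edges G" by auto
    have "v \<in> verts G" using y(2) G by (auto simp: pre_graph_def)
    hence "v \<in> B" unfolding B_def rball_simps using Suc.prems by blast
    thus ?case using Suc.IH[OF y(1)] Suc.prems(2) y(2) by auto
  qed
  have mono: "(root G, v) \<in> edges G ^^ k" if "(root G, v) \<in> (edges G \<inter> B \<times> B) ^^ k" for k v
    using that by (induction k arbitrary: v) auto
  have V: "verts (rball r (rball r' G)) = verts (rball r G)"
  proof (intro equalityI subsetI)
    fix v assume "v \<in> verts (rball r (rball r' G))"
    then obtain k where k: "v \<in> B" "k \<le> r" "(root G, v) \<in> (edges G \<inter> B \<times> B) ^^ k"
      unfolding rball_simps(1)[of r "rball r' G"] E rball_simps(3) B_def[symmetric] by blast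
    have "v \<in> verts G" using k(1) by (simp add: B_def rball_simps(1))
    thus "v \<in> verts (rball r G)" unfolding rball_simps(1) using mono[OF k(3)] k(2) by blast
  next
    fix v assume "v \<in> verts (rball r G)"
    then obtain k where k: "v \<in> verts G" "k \<le> r" "(root G, v) \<in> edges G ^^ k" by (auto simp: rball_simps)
    hence "(root G, v) \<in> (edges G \<inter> B \<times> B) ^^ k \<and> v \<in> B" using path r by auto
    thus "v \<in> verts (rball r (rball r' G))" using k(2)
      unfolding rball_simps(1)[of r "rball r' G"] E rball_simps(3) B_def[symmetric] by blast
  qed
  have "verts (rball r G) \<subseteq> B" unfolding B_def rball_simps using r le_trans by blast
  hence "edges (rball r (rball r' G)) = edges (rball r G)"
    unfolding rball_simps(2)[of r] V E by blast
  thus ?thesis using V by (intro rmgraph.equality) (auto simp: rball_simps(3,4))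
qed

section \<open>Representatives and a base of the local topology\<close>

lemma rep_wf: "wf_rmgraph (rep_gstar g)"
  using Quotient_rep_reflp[OF Quotient_gstar, of g] by blast

lemma rep_iso:
  fixes G :: "('v::countable, 'x) rmgraph"
  assumes "wf_rmgraph G" shows "rmiso (rep_gstar (iso_class G)) G"
proof -
  have w: "wf_rmgraph (relabel to_nat G)" by (rule wf_relabel) (use assms in auto)
  have "rmiso (rep_gstar (abs_gstar (relabel to_nat G))) (relabel to_nat G)"
    using Quotient_rep_abs[OF Quotient_gstar, of "relabel to_nat G"] w rmiso_refl by blast
  moreover have "rmiso (relabel to_nat G) G"
    by (rule rmiso_sym[OF rmiso_relabel]) (use assms in \<open>auto simp: wf_rmgraph_def\<close>)
  ultimately show ?thesis unfolding iso_class_def by (rule rmiso_trans)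
qed

lemma rep_eqI: "rmiso (rep_gstar g) (rep_gstar g') \<Longrightarrow> g = g'"
  using Quotient_rel_rep[OF Quotient_gstar, of g g'] rep_wf by blast

lemma rball_sym:
  assumes "rmiso (rball r G) (rball r H)" "pre_graph G" shows "rmiso (rball r H) (rball r G)"
  by (rule rmiso_sym[OF assms(1)]) (use pre_graph_rball[OF assms(2)] in \<open>simp add: pre_graph_def\<close>)

lemmas rep_pre = pre_graph_wf[OF rep_wf]

lemma nbhd_self: "g \<in> local_nbhd r g" by (simp add: local_nbhd_def rmiso_refl)

text \<open>For a fixed radius the neighbourhoods are the classes of an equivalence relation, as
  balls in an ultrametric space. Every property that is constant on them is therefore locally
  constant.\<close>

lemma nbhd_eq: assumes "g' \<in> local_nbhd r g" shows "local_nbhd r g' = local_nbhd r g"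
  using assms rball_sym[OF _ rep_pre] unfolding local_nbhd_def by (auto intro: rmiso_trans)

lemma nbhd_mono: assumes "r \<le> r'" shows "local_nbhd r' g \<subseteq> local_nbhd r g"
proof
  fix g' assume "g' \<in> local_nbhd r' g"
  hence "rmiso (rball r (rball r' (rep_gstar g'))) (rball r (rball r' (rep_gstar g)))"
    unfolding local_nbhd_def mem_Collect_eq by (rule rmiso_rball[OF _ pre_graph_rball pre_graph_rball]) (rule rep_pre)+
  thus "g' \<in> local_nbhd r g" by (simp add: rball_rball[OF assms rep_pre] local_nbhd_def)
qed

lemma open_local_nbhd: "open (local_nbhd r g)"
  unfolding open_gstar_def by (rule generate_topology.Basis) auto

lemma open_nbhd_subset:
  assumes "open U" "g \<in> U" shows "\<exists>r. local_nbhd r g \<subseteq> U"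
proof -
  have "generate_topology {local_nbhd r g |r g. True} U" using assms(1) by (simp add: open_gstar_def)
  hence "\<forall>g\<in>U. \<exists>r. local_nbhd r g \<subseteq> U"
  proof induction
    case (Int a b)
    show ?case
    proof
      fix g assume "g \<in> a \<inter> b"
      then obtain r s where "local_nbhd r g \<subseteq> a" "local_nbhd s g \<subseteq> b" using Int by blast
      hence "local_nbhd (max r s) g \<subseteq> a \<inter> b"
        using nbhd_mono[of r "max r s" g] nbhd_mono[of s "max r s" g] by auto
      thus "\<exists>r. local_nbhd r g \<subseteq> a \<inter> b" by blast
    qed
  next
    case (UN K)
    thus ?case by blast
  next
    case (Basis s)
    thus ?case using nbhd_eq by blast
  qed simp
  thus ?thesis using assms(2) by blast
qed

lemma open_if_nbhds: assumes "\<And>g. g \<in> U \<Longrightarrow> \<exists>r. local_nbhd r g \<subseteq> U" shows "open U"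
proof (subst open_subopen, intro ballI)
  fix g assume "g \<in> U"
  then obtain r where "local_nbhd r g \<subseteq> U" using assms by blast
  thus "\<exists>T. open T \<and> g \<in> T \<and> T \<subseteq> U"
    by (intro exI[of _ "local_nbhd r g"] conjI open_local_nbhd nbhd_self)
qed

lemma iso_class_nbhd:
  fixes G :: "('v::countable, 'x) rmgraph" and H :: "('w::countable, 'x) rmgraph"
  assumes "wf_rmgraph G" "wf_rmgraph H" "rmiso (rball r G) (rball r H)"
  shows "iso_class G \<in> local_nbhd r (iso_class H)"
proof -
  have "rmiso (rball r (rep_gstar (iso_class G))) (rball r G)"
    by (rule rmiso_rball[OF rep_iso[OF assms(1)] rep_pre pre_graph_wf[OF assms(1)]])
  moreover have "rmiso (rball r H) (rball r (rep_gstar (iso_class H)))"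
    by (rule rball_sym[OF rmiso_rball[OF rep_iso[OF assms(2)] rep_pre pre_graph_wf[OF assms(2)]] rep_pre])
  ultimately show ?thesis unfolding local_nbhd_def using assms(3) by (auto intro: rmiso_trans)
qed

section \<open>Balls in the regular tree and balls seen by the exploration\<close>

lemma marked_tree_simps:
  "verts (marked_tree K x) = tree_verts K" "root (marked_tree K x) = []" "mark (marked_tree K x) = x"
  "(u, v) \<in> edges (marked_tree K x) \<longleftrightarrow> (v \<in> tree_verts K \<and> (\<exists>a. v = u @ [a])) \<or> (u \<in> tree_verts K \<and> (\<exists>a. u = v @ [a]))"
  by (auto simp: marked_tree_def Let_def tree_arcs_def tree_ball_def)

lemma verts_rball_tree: "verts (rball r (marked_tree K x)) = tree_ball K r"
proof -
  have 1: "length v \<le> k" if "([], v) \<in> edges (marked_tree K x) ^^ k" for v k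
    using that
  proof (induction k arbitrary: v)
    case (Suc k)
    then obtain y where y: "([], y) \<in> edges (marked_tree K x) ^^ k" "(y, v) \<in> edges (marked_tree K x)" by auto
    have "length y \<le> k" by (rule Suc.IH[OF y(1)])
    thus ?case using y(2) by (auto simp: marked_tree_simps(4))
  qed simp
  have 2: "([], v) \<in> edges (marked_tree K x) ^^ length v" if "v \<in> tree_verts K" for v
    using that
  proof (induction v rule: rev_induct)
    case (snoc a v)
    have "([], v) \<in> edges (marked_tree K x) ^^ length v" by (rule snoc.IH) (use snoc.prems in \<open>simp add: tree_verts_snoc\<close>)
    moreover have "(v, v @ [a]) \<in> edges (marked_tree K x)" using snoc.prems by (simp add: marked_tree_simps(4))
    ultimately show ?case by auto
  qed simp
  show ?thesis unfolding rball_simps(1) marked_tree_simps tree_ball_def using 1 2 le_trans by blast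
qed

definition tree_class :: "nat \<Rightarrow> (nat list \<Rightarrow> 'x) \<Rightarrow> 'x gstar" where
  "tree_class K x = iso_class (marked_tree K x)"

lemma tree_class_nbhd:
  assumes "\<And>w. w \<in> tree_ball K r \<Longrightarrow> x w = y w"
  shows "local_nbhd r (tree_class K x) = local_nbhd r (tree_class K y)"
proof -
  have "rmiso (rball r (marked_tree K x)) (rball r (marked_tree K y))"
    unfolding rmiso_def
  proof (rule exI[of _ id], intro conjI ballI)
    show "bij_betw id (verts (rball r (marked_tree K x))) (verts (rball r (marked_tree K y)))"
      by (simp add: verts_rball_tree)
    show "(u, v) \<in> edges (rball r (marked_tree K x)) \<longleftrightarrow> (id u, id v) \<in> edges (rball r (marked_tree K y))" for u v
      by (simp add: rball_simps(2) verts_rball_tree marked_tree_simps(4))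
  qed (use assms in \<open>auto simp: rball_simps(3,4) marked_tree_simps verts_rball_tree\<close>)
  hence "tree_class K x \<in> local_nbhd r (tree_class K y)"
    unfolding tree_class_def by (intro iso_class_nbhd wf_marked_tree)
  thus ?thesis by (rule nbhd_eq)
qed

definition graph_of :: "nat \<Rightarrow> nat \<Rightarrow> (nat \<times> nat \<Rightarrow> nat \<times> nat) \<Rightarrow> (nat \<times> nat) set" where
  "graph_of K n M = (\<lambda>h. (fst h, fst (M h))) ` half_edges K n"

text \<open>The entry port of the present vertex leads back to its parent in the walk; every other
  port is \<open>skip\<close> of the index of a child.\<close>

lemma graph_of_neighbour:
  assumes M: "M \<in> matchings (half_edges K n)" and v: "v \<in> {1..n}" and w: "w \<in> tree_ball K k"
    and e: "(fst (pos K M v w), z) \<in> graph_of K n M"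
  shows "\<exists>w'\<in>tree_ball K (Suc k). z = fst (pos K M v w') \<and> ((\<exists>a. w' = w @ [a]) \<or> (\<exists>a. w = w' @ [a]))"
proof -
  obtain j where j: "j < K" "z = fst (M (fst (pos K M v w), j))"
    using e by (auto simp: graph_of_def half_edges_def)
  show ?thesis
  proof (cases w rule: rev_cases)
    case Nil
    have "[j] \<in> tree_ball K (Suc k)" using tree_verts_snoc[of "[]" j K] j(1) by (simp add: tree_ball_def)
    moreover have "z = fst (pos K M v [j])"
      using j Nil pos_snoc[of K M v "[]" j] by (simp add: skip_def)
    ultimately show ?thesis using Nil by auto
  next
    case (snoc u i)
    define e' where "e' = snd (pos K M v w)"
    have e': "e' < K" using pos_range[OF M v, of w] w snoc by (auto simp: e'_def tree_ball_def)
    show ?thesis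
    proof (cases "j = e'")
      case True
      have "M (pos K M v w) = (fst (pos K M v u), skip (snd (pos K M v u)) i)"
        unfolding snoc pos_snoc using matchingsD(3)[OF M] by simp
      moreover have "(fst (pos K M v w), j) = pos K M v w" using True by (simp add: e'_def)
      ultimately have "z = fst (pos K M v u)" using j(2) by simp
      moreover have "u \<in> tree_ball K (Suc k)" using w snoc by (auto simp: tree_ball_def tree_verts_snoc)
      ultimately show ?thesis using snoc by blast
    next
      case False
      define c where "c = (if j < e' then j else j - 1)"
      have c: "skip e' c = j" "c < K - 1" using False j(1) e' by (auto simp: c_def skip_def)
      have "w @ [c] \<in> tree_ball K (Suc k)" using w c(2) tree_verts_snoc[of w c K] by (auto simp: tree_ball_def)
      moreover have "z = fst (pos K M v (w @ [c]))" using c(1) j(2) by (simp add: pos_snoc e'_def)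
      ultimately show ?thesis by blast
    qed
  qed
qed

lemma graph_of_step:
  assumes "M \<in> matchings (half_edges K n)" "v \<in> {1..n}" "w @ [a] \<in> tree_verts K"
  shows "(fst (pos K M v w), fst (pos K M v (w @ [a]))) \<in> graph_of K n M"
  using pos_port[OF assms] unfolding graph_of_def pos_snoc by (rule rev_image_eqI) simp

text \<open>Injectivity is required one level beyond the ball: an edge between two vertices of the
  ball is a step of the walk to a word of length at most \<open>r + 1\<close>, and injectivity there
  makes it an edge of the tree.\<close>

lemma walk_class_nbhd:
  fixes X :: "nat \<Rightarrow> 'x"
  assumes M: "M \<in> matchings (half_edges K n)" and E: "E = graph_of K n M" "E \<in> regular_graphs K n"
    and v: "v \<in> {1..n}" and inj: "walk_inj K (Suc r) M v"
    and X: "\<And>w. w \<in> tree_ball K r \<Longrightarrow> X (fst (pos K M v w)) = x w"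
  shows "iso_class (component E X v) \<in> local_nbhd r (tree_class K x)"
proof -
  define G where "G = component E X v"
  have wfG: "wf_rmgraph G" unfolding G_def by (rule wf_component[OF E(2)])
  define f where "f w = fst (pos K M v w)" for w
  have symE: "sym E" using E(2) by (simp add: regular_graphs_def)
  have eG: "edges G = E \<inter> verts G \<times> verts G" "verts G = E\<^sup>* `` {v}" "root G = v" "mark G = X"
    by (auto simp: G_def component_def)
  have injf: "inj_on f (tree_ball K (Suc r))" using inj by (simp add: walk_inj_def f_def[abs_def])
  have sub: "tree_ball K r \<subseteq> tree_ball K (Suc r)" by (auto simp: tree_ball_def)
  have pathE: "(v, z) \<in> edges G ^^ k" if "(v, z) \<in> E ^^ k" for z k
    using that
  proof (induction k arbitrary: z)
    case (Suc k)
    then obtain y where y: "(v, y) \<in> E ^^ k" "(y, z) \<in> E" by auto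
    have "y \<in> verts G" "z \<in> verts G"
      using y relpow_imp_rtrancl[OF y(1)] unfolding eG(2) by (auto intro: rtrancl_into_rtrancl)
    thus ?case using Suc.IH[OF y(1)] y(2) eG(1) by auto
  qed simp
  have a1: "\<exists>w\<in>tree_ball K k. z = f w" if "(v, z) \<in> E ^^ k" for z k
    using that
  proof (induction k arbitrary: z)
    case 0
    thus ?case by (intro bexI[of _ "[]"]) (auto simp: f_def)
  next
    case (Suc k)
    then obtain y where y: "(v, y) \<in> E ^^ k" "(y, z) \<in> E" by auto
    obtain w where "w \<in> tree_ball K k" "y = f w" using Suc.IH[OF y(1)] by blast
    thus ?case using graph_of_neighbour[OF M v, of w k z] y(2) E(1) by (auto simp: f_def)
  qed
  have a2: "(v, f w) \<in> E ^^ length w" if "w \<in> tree_verts K" for w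
    using that
  proof (induction w rule: rev_induct)
    case Nil thus ?case by (simp add: f_def)
  next
    case (snoc a w)
    have "(v, f w) \<in> E ^^ length w" by (rule snoc.IH) (use snoc.prems in \<open>simp add: tree_verts_snoc\<close>)
    moreover have "(f w, f (w @ [a])) \<in> E" unfolding f_def E(1) by (rule graph_of_step[OF M v snoc.prems])
    ultimately show ?case by auto
  qed
  have VB: "verts (rball r G) = f ` tree_ball K r"
  proof (intro equalityI subsetI)
    fix z assume "z \<in> verts (rball r G)"
    then obtain k where k: "k \<le> r" "(v, z) \<in> edges G ^^ k" by (auto simp: rball_simps(1) eG(3))
    have "(v, z) \<in> E ^^ k" using k(2) relpow_subset[of "edges G" E k] eG(1) by auto
    then obtain w where "w \<in> tree_ball K k" "z = f w" using a1 by blast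
    thus "z \<in> f ` tree_ball K r" using k(1) by (auto simp: tree_ball_def)
  next
    fix z assume "z \<in> f ` tree_ball K r"
    then obtain w where w: "w \<in> tree_verts K" "length w \<le> r" "z = f w" by (auto simp: tree_ball_def)
    have "(v, z) \<in> E ^^ length w" using a2[OF w(1)] w(3) by simp
    hence "(v, z) \<in> edges G ^^ length w" "z \<in> verts G"
      using pathE relpow_imp_rtrancl unfolding eG(2) by auto
    thus "z \<in> verts (rball r G)" using w(2) by (auto simp: rball_simps(1) eG(3))
  qed
  have edge: "(u, w) \<in> edges (rball r (marked_tree K x)) \<longleftrightarrow> (f u, f w) \<in> edges (rball r G)"
    if uw: "u \<in> tree_ball K r" "w \<in> tree_ball K r" for u w
  proof
    assume "(u, w) \<in> edges (rball r (marked_tree K x))"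
    hence "(\<exists>a. w = u @ [a]) \<or> (\<exists>a. u = w @ [a])" by (auto simp: rball_simps(2) marked_tree_simps(4))
    hence "(f u, f w) \<in> E"
    proof
      assume "\<exists>a. w = u @ [a]"
      thus ?thesis using graph_of_step[OF M v, of u] uw(2) E(1) by (auto simp: f_def tree_ball_def)
    next
      assume "\<exists>a. u = w @ [a]"
      hence "(f w, f u) \<in> E" using graph_of_step[OF M v, of w] uw(1) E(1) by (auto simp: f_def tree_ball_def)
      thus ?thesis using symE by (meson symD)
    qed
    moreover have "f u \<in> verts (rball r G)" "f w \<in> verts (rball r G)" using uw VB by auto
    ultimately show "(f u, f w) \<in> edges (rball r G)" unfolding rball_simps(2) eG(1) by (auto simp: rball_simps(1))
  next
    assume "(f u, f w) \<in> edges (rball r G)"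
    hence "(f u, f w) \<in> E" by (auto simp: rball_simps(2) eG(1))
    then obtain w' where w': "w' \<in> tree_ball K (Suc r)" "f w = f w'" "(\<exists>a. w' = u @ [a]) \<or> (\<exists>a. u = w' @ [a])"
      using graph_of_neighbour[OF M v uw(1)] E(1) unfolding f_def by blast
    have "w = w'" using inj_onD[OF injf w'(2)] uw(2) w'(1) sub by blast
    thus "(u, w) \<in> edges (rball r (marked_tree K x))"
      using w'(3) uw by (auto simp: rball_simps(2) verts_rball_tree marked_tree_simps(4) tree_ball_def)
  qed
  have "rmiso (rball r (marked_tree K x)) (rball r G)"
    unfolding rmiso_def
  proof (rule exI[of _ f], intro conjI ballI)
    show "bij_betw f (verts (rball r (marked_tree K x))) (verts (rball r G))"
      unfolding verts_rball_tree VB by (rule inj_on_imp_bij_betw[OF inj_on_subset[OF injf sub]])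
    show "f (root (rball r (marked_tree K x))) = root (rball r G)"
      by (simp add: rball_simps(3) marked_tree_simps eG(3) f_def)
    show "mark (rball r G) (f w) = mark (rball r (marked_tree K x)) w" if "w \<in> verts (rball r (marked_tree K x))" for w
      using that X by (simp add: rball_simps(4) marked_tree_simps eG(4) verts_rball_tree f_def)
  qed (use edge in \<open>auto simp: verts_rball_tree\<close>)
  hence "tree_class K x \<in> local_nbhd r (iso_class G)"
    unfolding tree_class_def by (intro iso_class_nbhd wf_marked_tree wfG)
  hence "local_nbhd r (tree_class K x) = local_nbhd r (iso_class G)" by (rule nbhd_eq)
  thus ?thesis using nbhd_self[of "iso_class G" r] unfolding G_def by simp
qed

text \<open>
  Koenig's lemma for the isomorphisms between balls, in the form of compactness of a product of finite
  discrete spaces: a graph all of whose balls are tree balls is the tree.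
\<close>

lemma tree_classes_limit:
  fixes g :: "'x gstar"
  assumes near: "\<And>r. \<exists>x. tree_class K x \<in> local_nbhd r g"
  shows "g \<in> tree_classes K"
proof -
  define G where "G = rep_gstar g"
  have wfG: "wf_rmgraph G" unfolding G_def by (rule rep_wf)
  have preG: "pre_graph G" by (rule pre_graph_wf[OF wfG])
  define T where "T = (marked_tree K (\<lambda>_. undefined) :: (nat list, 'x) rmgraph)"
  have preT: "pre_graph T" unfolding T_def by (rule pre_graph_wf[OF wf_marked_tree])
  have VT: "verts (rball r T) = tree_ball K r" for r by (simp add: T_def verts_rball_tree)
  define I where "I r \<phi> \<longleftrightarrow> shape_iso \<phi> (rball r T) (rball r G)" for r \<phi>
  have ex: "\<exists>\<phi>. I r \<phi>" for r
  proof -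
    obtain x where x: "tree_class K x \<in> local_nbhd r g" using near by blast
    have "rmiso (rball r (marked_tree K x)) (rball r (rep_gstar (tree_class K x)))"
      unfolding tree_class_def
      by (rule rball_sym[OF rmiso_rball[OF rep_iso[OF wf_marked_tree] rep_pre pre_graph_wf[OF wf_marked_tree]] rep_pre])
    moreover have "rmiso (rball r (rep_gstar (tree_class K x))) (rball r G)"
      using x by (simp add: local_nbhd_def G_def)
    ultimately have "rmiso (rball r (marked_tree K x)) (rball r G)" by (rule rmiso_trans)
    then obtain \<phi> where "shape_iso \<phi> (rball r (marked_tree K x)) (rball r G)" unfolding rmiso_iff by blast
    hence "I r \<phi>" unfolding I_def shape_iso_def T_def
      by (simp add: verts_rball_tree rball_simps(2,3) marked_tree_simps)
    thus ?thesis by blast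
  qed
  have dn: "I r \<phi>" if "I r' \<phi>" "r \<le> r'" for r r' \<phi>
    using shape_iso_rball[OF that(1)[unfolded I_def] pre_graph_rball[OF preT] pre_graph_rball[OF preG], of r]
    by (simp add: rball_rball[OF that(2) preT] rball_rball[OF that(2) preG] I_def)
  have cong: "I r \<phi> \<longleftrightarrow> I r \<phi>'" if "\<And>w. w \<in> tree_ball K r \<Longrightarrow> \<phi> w = \<phi>' w" for r \<phi> \<phi>'
  proof -
    have "root (rball r T) \<in> tree_ball K r" by (simp add: T_def rball_simps(3) marked_tree_simps)
    thus ?thesis unfolding I_def shape_iso_def VT using that
      by (simp add: bij_betw_cong[of "tree_ball K r" \<phi> \<phi>'])
  qed
  have finB: "finite (verts (rball r G))" for r
  proof -
    obtain \<phi> where "I r \<phi>" using ex by blast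
    hence "bij_betw \<phi> (tree_ball K r) (verts (rball r G))" by (simp add: I_def shape_iso_def VT)
    thus ?thesis using finite_tree_ball bij_betw_finite by blast
  qed
  \<comment> \<open>A word of length \<open>m\<close> may only be sent into the finite ball of
    radius \<open>m\<close>, so the space of candidates is compact.\<close>
  define XT where "XT = product_topology (\<lambda>w. discrete_topology (verts (rball (length w) G))) (tree_verts K)"
  have compXT: "compact_space XT"
    unfolding XT_def compact_space_product_topology using finB by (simp add: compact_space_discrete_topology)
  have tXT: "topspace XT = (\<Pi>\<^sub>E w\<in>tree_verts K. verts (rball (length w) G))" by (simp add: XT_def)
  define C where "C r = {\<phi>\<in>topspace XT. I r \<phi>}" for r
  have clC: "closedin XT (C r)" for r
    unfolding closedin_def
  proof
    show "C r \<subseteq> topspace XT" by (auto simp: C_def)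
    show "openin XT (topspace XT - C r)"
    proof (subst openin_subopen, intro ballI)
      fix \<phi> assume \<phi>: "\<phi> \<in> topspace XT - C r"
      define N where "N = (\<Inter>w\<in>tree_ball K r. {\<phi>'\<in>topspace XT. \<phi>' w \<in> {\<phi> w}})"
      have "openin XT N"
        unfolding N_def
      proof (rule openin_INT2)
        show "finite (tree_ball K r)" by (rule finite_tree_ball)
        show "tree_ball K r \<noteq> {}" using Nil_tree_ball by blast
        fix w assume w: "w \<in> tree_ball K r"
        hence wT: "w \<in> tree_verts K" using tree_ball_verts by blast
        have "continuous_map XT (discrete_topology (verts (rball (length w) G))) (\<lambda>\<phi>. \<phi> w)"
          unfolding XT_def by (rule continuous_map_product_projection[OF wT])
        moreover have "\<phi> w \<in> verts (rball (length w) G)" using \<phi> wT by (auto simp: tXT)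
        ultimately show "openin XT {\<phi>'\<in>topspace XT. \<phi>' w \<in> {\<phi> w}}"
          by (intro openin_continuous_map_preimage) auto
      qed
      moreover have "\<phi> \<in> N" using \<phi> by (auto simp: N_def)
      moreover have "N \<subseteq> topspace XT - C r"
      proof
        fix \<phi>' assume p: "\<phi>' \<in> N"
        hence "\<forall>w\<in>tree_ball K r. \<phi>' \<in> topspace XT" by (auto simp: N_def)
        hence "\<phi>' \<in> topspace XT" using Nil_tree_ball by blast
        moreover have "I r \<phi>' \<longleftrightarrow> I r \<phi>" by (rule cong) (use p in \<open>auto simp: N_def\<close>)
        ultimately show "\<phi>' \<in> topspace XT - C r" using \<phi> by (auto simp: C_def)
      qed
      ultimately show "\<exists>T. openin XT T \<and> \<phi> \<in> T \<and> T \<subseteq> topspace XT - C r" by blast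
    qed
  qed
  have neC: "C r \<noteq> {}" for r
  proof -
    obtain \<phi> where \<phi>: "I r \<phi>" using ex by blast
    \<comment> \<open>Outside the ball any admissible value will do; the root belongs to balls of
      every radius.\<close>
    define \<phi>' where "\<phi>' = restrict (\<lambda>w. if w \<in> tree_ball K r then \<phi> w else root G) (tree_verts K)"
    have e: "\<phi>' w = \<phi> w" if "w \<in> tree_ball K r" for w using that tree_ball_verts by (auto simp: \<phi>'_def)
    have "\<phi>' \<in> topspace XT"
      unfolding tXT
    proof (rule PiE_I)
      fix w assume w: "w \<in> tree_verts K"
      show "\<phi>' w \<in> verts (rball (length w) G)"
      proof (cases "w \<in> tree_ball K r")
        case True
        hence "I (length w) \<phi>" using dn[OF \<phi>, of "length w"] by (simp add: tree_ball_def)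
        hence "bij_betw \<phi> (tree_ball K (length w)) (verts (rball (length w) G))" by (simp add: I_def shape_iso_def VT)
        moreover have "w \<in> tree_ball K (length w)" using w by (simp add: tree_ball_def)
        ultimately show ?thesis using e[OF True] by (auto dest: bij_betwE)
      next
        case False
        thus ?thesis using w pre_graph_rball[OF preG, of "length w"] by (simp add: \<phi>'_def pre_graph_def rball_simps(3))
      qed
    qed (simp add: \<phi>'_def)
    moreover have "I r \<phi>'" using cong[of r \<phi>' \<phi>] e \<phi> by blast
    ultimately show ?thesis by (auto simp: C_def)
  qed
  have decC: "decseq C" unfolding decseq_def C_def using dn by blast
  have "(\<Inter>r. C r) \<noteq> {}" by (rule compact_space_imp_nest[OF compXT clC neC decC])
  then obtain \<phi> where \<phi>: "\<And>r. I r \<phi>" by (auto simp: C_def)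
  have b: "bij_betw \<phi> (tree_ball K r) (verts (rball r G))" for r using \<phi>[of r] by (simp add: I_def shape_iso_def VT)
  have ball: "\<exists>r. u \<in> tree_ball K r \<and> v \<in> tree_ball K r" if "u \<in> tree_verts K" "v \<in> tree_verts K" for u v
    using that by (intro exI[of _ "max (length u) (length v)"]) (auto simp: tree_ball_def)
  have "shape_iso \<phi> T G"
    unfolding shape_iso_def
  proof (intro conjI ballI)
    have VTT: "verts T = tree_verts K" by (simp add: T_def marked_tree_simps)
    show "bij_betw \<phi> (verts T) (verts G)"
      unfolding VTT bij_betw_def
    proof
      show "inj_on \<phi> (tree_verts K)"
      proof (rule inj_onI)
        fix u v assume uv: "u \<in> tree_verts K" "v \<in> tree_verts K" "\<phi> u = \<phi> v"
        then obtain r where "u \<in> tree_ball K r" "v \<in> tree_ball K r" using ball by blast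
        thus "u = v" using b[of r] uv(3) by (auto simp: bij_betw_def dest: inj_onD)
      qed
      show "\<phi> ` tree_verts K = verts G"
      proof (intro equalityI subsetI)
        fix z assume "z \<in> \<phi> ` tree_verts K"
        then obtain w where w: "w \<in> tree_verts K" "z = \<phi> w" by auto
        hence "w \<in> tree_ball K (length w)" by (simp add: tree_ball_def)
        hence "z \<in> verts (rball (length w) G)" using b[of "length w"] w(2) by (auto dest: bij_betwE)
        thus "z \<in> verts G" by (simp add: rball_simps)
      next
        fix z assume z: "z \<in> verts G"
        hence "(root G, z) \<in> (edges G)\<^sup>*" using wfG by (auto simp: wf_rmgraph_def)
        then obtain k where "(root G, z) \<in> edges G ^^ k" using rtrancl_imp_relpow by blast
        hence "z \<in> verts (rball k G)" using z by (auto simp: rball_simps)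
        hence "z \<in> \<phi> ` tree_ball K k" using b[of k] by (simp add: bij_betw_def)
        thus "z \<in> \<phi> ` tree_verts K" using tree_ball_verts by blast
      qed
    qed
    show "\<phi> (root T) = root G" using \<phi>[of 0] by (simp add: I_def shape_iso_def rball_simps(3))
    fix u v assume "u \<in> verts T" "v \<in> verts T"
    then obtain r where r: "u \<in> tree_ball K r" "v \<in> tree_ball K r" using ball VTT by blast
    hence "(u, v) \<in> edges (rball r T) \<longleftrightarrow> (\<phi> u, \<phi> v) \<in> edges (rball r G)"
      using \<phi>[of r] by (auto simp: I_def shape_iso_def VT)
    moreover have "\<phi> u \<in> verts (rball r G)" "\<phi> v \<in> verts (rball r G)" using r b[of r] by (auto dest: bij_betwE)
    ultimately show "(u, v) \<in> edges T \<longleftrightarrow> (\<phi> u, \<phi> v) \<in> edges G" using r VT by (auto simp: rball_simps(2))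
  qed
  hence "rmiso (marked_tree K (mark G \<circ> \<phi>)) G"
    unfolding rmiso_iff by (intro exI[of _ \<phi>]) (auto simp: shape_iso_def T_def marked_tree_simps)
  hence "rmiso (rep_gstar (tree_class K (mark G \<circ> \<phi>))) (rep_gstar g)"
    unfolding tree_class_def G_def by (rule rmiso_trans[OF rep_iso[OF wf_marked_tree]])
  hence "tree_class K (mark G \<circ> \<phi>) = g" by (rule rep_eqI)
  thus ?thesis unfolding tree_classes_def tree_class_def by blast
qed

lemma closed_tree_classes: "closed (tree_classes K :: 'x::finite gstar set)"
  unfolding closed_def
proof (rule open_if_nbhds)
  fix g :: "'x gstar" assume "g \<in> - tree_classes K"
  then obtain r where r: "\<And>x. tree_class K x \<notin> local_nbhd r g" using tree_classes_limit by blast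
  have "local_nbhd r g \<subseteq> - tree_classes K"
    using r unfolding tree_classes_def tree_class_def by auto
  thus "\<exists>r. local_nbhd r g \<subseteq> - tree_classes K" by blast
qed

section \<open>Weak convergence of the empirical measures\<close>

context markov_law
begin

text \<open>Whether the neighbourhood of radius \<open>r\<close> lies in \<open>U\<close> depends
  only on the marks in a finite ball, and the preimage of an open set is the union of these events
  over \<open>r\<close>.\<close>

lemma measurable_tree_class: "tree_class K \<in> tree_chain \<rightarrow>\<^sub>M borel"
proof (rule borel_measurableI)
  fix U :: "'x gstar set" assume U: "open U"
  define V where "V r = {y\<in>space tree_chain. local_nbhd r (tree_class K y) \<subseteq> U}" for r
  have "V r \<in> sets tree_chain" for r
  proof -
    define f where "f y = (if local_nbhd r (tree_class K y) \<subseteq> U then 1 else 0 :: real)" for y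
    have "f y = f (restrict y (tree_ball K r))" for y
    proof -
      have "local_nbhd r (tree_class K y) = local_nbhd r (tree_class K (restrict y (tree_ball K r)))"
        by (rule tree_class_nbhd) simp
      thus ?thesis by (simp add: f_def)
    qed
    hence "f \<in> borel_measurable tree_chain"
      by (rule integral_cylinder_function(1)[OF finite_tree_ball tree_ball_verts])
    hence "f -` {1} \<inter> space tree_chain \<in> sets tree_chain" by simp
    moreover have "f -` {1} \<inter> space tree_chain = V r" by (auto simp: f_def V_def split: if_splits)
    ultimately show ?thesis by simp
  qed
  moreover have "tree_class K -` U \<inter> space tree_chain = (\<Union>r. V r)"
  proof (intro equalityI subsetI)
    fix y assume "y \<in> tree_class K -` U \<inter> space tree_chain"
    thus "y \<in> (\<Union>r. V r)" using open_nbhd_subset[OF U, of "tree_class K y"] by (auto simp: V_def)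
  next
    fix y assume "y \<in> (\<Union>r. V r)"
    thus "y \<in> tree_class K -` U \<inter> space tree_chain" using nbhd_self by (auto simp: V_def)
  qed
  ultimately show "tree_class K -` U \<inter> space tree_chain \<in> sets tree_chain" by auto
qed

lemma tree_law_alt: "tree_law K tree_chain = distr tree_chain borel (tree_class K)"
  by (simp add: tree_law_def tree_class_def[abs_def])

lemma tree_law_prob: "tree_law K tree_chain \<in> prob_measures"
  unfolding prob_measures_def tree_law_alt
  using prob_space.prob_space_distr[OF prob_tree_chain measurable_tree_class] by simp

lemma tree_law_tree: "tree_law K tree_chain \<in> tree_prob_measures K"
proof -
  have "AE g in tree_law K tree_chain. g \<in> tree_classes K"
    unfolding tree_law_alt
  proof (subst AE_distr_iff[OF measurable_tree_class])
    show "{g \<in> space borel. g \<in> tree_classes K} \<in> sets borel"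
      using borel_closed[OF closed_tree_classes] by simp
    show "AE y in tree_chain. tree_class K y \<in> tree_classes K"
      by (simp add: tree_classes_def tree_class_def)
  qed
  thus ?thesis using tree_law_prob by (simp add: tree_prob_measures_def)
qed

text \<open>A bounded continuous function need not depend on finitely many marks, but with
  probability close to 1 under the chain it oscillates little on neighbourhoods of a suitable fixed
  radius. For that radius the frequencies of finitely many balls decide the integral up to the
  tolerance.\<close>

lemma empirical_integral_tendsto:
  fixes f :: "'x gstar \<Rightarrow> real" and n :: "nat \<Rightarrow> nat" and X :: "nat \<Rightarrow> nat \<Rightarrow> 'x"
  assumes f: "continuous_on UNIV f" "bounded (range f)"
    and n: "\<And>j. n j \<ge> 1" and M: "\<And>j. M j \<in> matchings (half_edges K (n j))"
    and E: "\<And>j. graph_of K (n j) (M j) \<in> regular_graphs K (n j)"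
    and conv: "\<And>r x. x \<in> tree_ball K r \<rightarrow>\<^sub>E UNIV \<Longrightarrow>
      (\<lambda>j. real (card (occurrences K (n j) (X j) r x (M j))) / real (n j)) \<longlonglongrightarrow> markov_weight K r \<alpha> \<pi> x"
  shows "(\<lambda>j. \<integral>g. f g \<partial>component_empirical (n j) (graph_of K (n j) (M j), X j)) \<longlonglongrightarrow> (\<integral>g. f g \<partial>tree_law K tree_chain)"
proof -
  interpret TC: prob_space tree_chain by (rule prob_tree_chain)
  obtain B0 where B0: "\<And>g. \<bar>f g\<bar> \<le> B0" using f(2) unfolding bounded_iff by auto
  define B where "B = \<bar>B0\<bar>"
  have B: "\<bar>f g\<bar> \<le> B" "0 \<le> B" for g using B0[of g] by (auto simp: B_def)
  have fm: "f \<in> borel_measurable borel" by (rule borel_measurable_continuous_onI[OF f(1)])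
  define F where "F y = f (tree_class K y)" for y
  have intF: "(\<integral>g. f g \<partial>tree_law K tree_chain) = (\<integral>y. F y \<partial>tree_chain)"
    unfolding tree_law_alt F_def by (rule integral_distr[OF measurable_tree_class fm])
  have Fm: "F \<in> borel_measurable tree_chain"
    unfolding F_def by (rule measurable_compose[OF measurable_tree_class fm])
  define cl where "cl j v = iso_class (component (graph_of K (n j) (M j)) (X j) v)" for j v
  define D where "D j = (\<integral>g. f g \<partial>component_empirical (n j) (graph_of K (n j) (M j), X j))" for j
  have D: "D j = (\<Sum>v\<in>{1..n j}. f (cl j v)) / real (n j)" for j
  proof -
    have "(\<lambda>v. cl j v) \<in> uniform_count_measure {1..n j} \<rightarrow>\<^sub>M borel"
      by simp
    hence "D j = (\<integral>v. f (cl j v) \<partial>uniform_count_measure {1..n j})"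
      unfolding D_def component_empirical_def cl_def by (simp add: integral_distr[OF _ fm])
    thus ?thesis by (simp add: integral_uniform_count_measure)
  qed
  have main: "eventually (\<lambda>j. \<bar>D j - (\<integral>y. F y \<partial>tree_chain)\<bar> < e) sequentially" if e: "e > 0" for e
  proof -
    \<comment> \<open>The empirical measure and the chain are each compared with a sum over finitely
      many balls. In the limit either comparison costs at most
      \<open>2 * \<epsilon> + 2 * B * \<epsilon>\<close>.\<close>
    define \<epsilon> where "\<epsilon> = e / (4 * (1 + B) + 1)"
    have \<epsilon>: "\<epsilon> > 0" using e B(2) by (simp add: \<epsilon>_def)
    \<comment> \<open>With the oscillation taken over all pairs in the neighbourhood, the property
      depends on the neighbourhood alone, hence only on the marks in the ball of radius
      \<open>r\<close>.\<close>
    define good where "good r y \<longleftrightarrow> (\<forall>g'\<in>local_nbhd r (tree_class K y). \<bar>f g' - f (tree_class K y)\<bar> \<le> 2 * \<epsilon> \<and> (\<forall>g''\<in>local_nbhd r (tree_class K y). \<bar>f g' - f g''\<bar> \<le> 2 * \<epsilon>))" for r y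
    have good_cong: "good r y \<longleftrightarrow> good r y'" if "\<And>w. w \<in> tree_ball K r \<Longrightarrow> y w = y' w" for r y y'
    proof -
      have *: "local_nbhd r (tree_class K y) = local_nbhd r (tree_class K y')" by (rule tree_class_nbhd[OF that])
      have "good r z \<longleftrightarrow> (\<forall>g'\<in>local_nbhd r (tree_class K z). \<forall>g''\<in>local_nbhd r (tree_class K z). \<bar>f g' - f g''\<bar> \<le> 2 * \<epsilon>)" for z
        unfolding good_def using nbhd_self[of "tree_class K z" r] by blast
      thus ?thesis by (simp add: *)
    qed
    define V where "V r = {y\<in>space tree_chain. good r y}" for r
    have Vs: "V r \<in> sets tree_chain" for r
    proof -
      define h where "h y = (if good r y then 1 else 0 :: real)" for y
      have "h y = h (restrict y (tree_ball K r))" for y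
        using good_cong[of r y "restrict y (tree_ball K r)"] by (simp add: h_def)
      hence "h \<in> borel_measurable tree_chain"
        by (rule integral_cylinder_function(1)[OF finite_tree_ball tree_ball_verts])
      hence "h -` {1} \<inter> space tree_chain \<in> sets tree_chain" by simp
      moreover have "h -` {1} \<inter> space tree_chain = V r" by (auto simp: h_def V_def split: if_splits)
      ultimately show ?thesis by simp
    qed
    have inc: "incseq V"
      unfolding incseq_def V_def good_def using nbhd_mono by blast
    have UV: "(\<Union>r. V r) = space tree_chain"
    proof (intro equalityI subsetI)
      fix y assume y: "y \<in> space tree_chain"
      have "open (f -` {f (tree_class K y) - \<epsilon> <..< f (tree_class K y) + \<epsilon>})"
        using f(1) by (simp add: continuous_on_open_vimage[OF open_UNIV])
      then obtain r where r: "local_nbhd r (tree_class K y) \<subseteq> f -` {f (tree_class K y) - \<epsilon> <..< f (tree_class K y) + \<epsilon>}"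
        using open_nbhd_subset \<epsilon> by (metis add.commute diff_less_eq greaterThanLessThan_iff less_add_same_cancel2 vimageI)
      have "\<bar>f g' - f (tree_class K y)\<bar> < \<epsilon>" if "g' \<in> local_nbhd r (tree_class K y)" for g'
        using subsetD[OF r that] by auto
      hence "good r y" unfolding good_def by (smt (verit) \<epsilon>)
      thus "y \<in> (\<Union>r. V r)" using y by (auto simp: V_def)
    qed (auto simp: V_def)
    have "(\<lambda>r. measure tree_chain (V r)) \<longlonglongrightarrow> measure tree_chain (\<Union>r. V r)"
      by (rule TC.finite_Lim_measure_incseq[OF _ inc]) (use Vs in auto)
    hence "(\<lambda>r. measure tree_chain (V r)) \<longlonglongrightarrow> 1" by (simp add: UV TC.prob_space)
    hence "eventually (\<lambda>r. 1 - \<epsilon> < measure tree_chain (V r)) sequentially"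
      by (rule order_tendstoD) (use \<epsilon> in simp)
    then obtain r where r: "1 - \<epsilon> < measure tree_chain (V r)" by (auto simp: eventually_sequentially)
    \<comment> \<open>One level more than the radius, as \<open>walk_class_nbhd\<close>
      demands.\<close>
    define T where "T = tree_ball K (Suc r)"
    have T: "finite T" "T \<subseteq> tree_verts K" "tree_ball K r \<subseteq> T"
      using finite_tree_ball[of K "Suc r"] tree_ball_verts[of K "Suc r"] by (simp_all add: T_def) (auto simp: tree_ball_def)
    define XS where "XS = (T \<rightarrow>\<^sub>E (UNIV :: 'x set))"
    have finXS: "finite XS" unfolding XS_def by (rule finite_PiE[OF T(1)]) simp
    define p where "p x = markov_weight K (Suc r) \<alpha> \<pi> x" for x
    have p: "p x = measure tree_chain {y\<in>space tree_chain. \<forall>w\<in>T. y w = x w}" for x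
      unfolding p_def T_def by (rule prob_ball_cylinder[symmetric])
    define S where "S = (\<Sum>x\<in>XS. p x * F x)"
    define bad where "bad = (\<Sum>x\<in>XS. p x * (if good r x then 0 else 1))"
    have Fr: "(\<lambda>y. F (restrict y T)) \<in> borel_measurable tree_chain" "(\<integral>y. F (restrict y T) \<partial>tree_chain) = S"
      using integral_cylinder_function[OF T(1,2), of "\<lambda>y. F (restrict y T)"] unfolding S_def XS_def p
      by (simp_all cong: sum.cong add: PiE_restrict)
    define b where "b y = (if good r y then 0 else 1 :: real)" for y
    have gr: "good r y \<longleftrightarrow> good r (restrict y T)" for y by (rule good_cong) (use T(3) in auto)
    have br: "b y = b (restrict y T)" for y unfolding b_def using gr by simp
    have bm: "b \<in> borel_measurable tree_chain" "(\<integral>y. b y \<partial>tree_chain) = bad"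
      using integral_cylinder_function[OF T(1,2), where f = b, OF br] unfolding bad_def XS_def p b_def by simp_all
    have bad1: "bad < \<epsilon>"
    proof -
      have "bad = (\<integral>y. indicator (space tree_chain - V r) y \<partial>tree_chain)"
        unfolding bm(2)[symmetric] by (rule Bochner_Integration.integral_cong) (auto simp: b_def V_def)
      also have "\<dots> = measure tree_chain (space tree_chain - V r)" using Vs by simp
      also have "\<dots> = 1 - measure tree_chain (V r)" by (rule TC.prob_compl[OF Vs])
      finally show ?thesis using r by simp
    qed
    have bound: "\<bar>F y - F (restrict y T)\<bar> \<le> 2 * \<epsilon> + 2 * B * b y" for y
    proof (cases "good r y")
      case True
      have "local_nbhd r (tree_class K (restrict y T)) = local_nbhd r (tree_class K y)"
        by (rule tree_class_nbhd) (use T(3) in auto)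
      hence "tree_class K (restrict y T) \<in> local_nbhd r (tree_class K y)" using nbhd_self by blast
      hence "\<bar>F (restrict y T) - F y\<bar> \<le> 2 * \<epsilon>" using True unfolding good_def F_def by blast
      thus ?thesis using True by (simp add: b_def)
    next
      case False
      thus ?thesis using B(1)[of "tree_class K y"] B(1)[of "tree_class K (restrict y T)"] \<epsilon> by (simp add: F_def b_def)
    qed
    have intF': "integrable tree_chain F" "integrable tree_chain (\<lambda>y. F (restrict y T))" "integrable tree_chain b"
      by (rule TC.integrable_const_bound[of _ B], use B in \<open>auto simp: F_def\<close>, use Fm in \<open>simp add: F_def\<close>)
         (rule TC.integrable_const_bound[of _ B], use B Fr in \<open>auto simp: F_def\<close>,
          rule TC.integrable_const_bound[of _ 1], use bm in \<open>auto simp: b_def\<close>)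
    have FS: "\<bar>(\<integral>y. F y \<partial>tree_chain) - S\<bar> \<le> 2 * \<epsilon> + 2 * B * bad"
    proof -
      have "(\<integral>y. F y \<partial>tree_chain) - S = (\<integral>y. F y - F (restrict y T) \<partial>tree_chain)"
        using intF' Fr(2) by simp
      also have "\<bar>\<dots>\<bar> \<le> (\<integral>y. \<bar>F y - F (restrict y T)\<bar> \<partial>tree_chain)" by simp
      also have "\<dots> \<le> (\<integral>y. 2 * \<epsilon> + 2 * B * b y \<partial>tree_chain)"
        by (rule integral_mono) (use intF' bound in auto)
      also have "\<dots> = 2 * \<epsilon> + 2 * B * bad" using intF' bm(2) by (simp add: TC.prob_space)
      finally show ?thesis .
    qed
    define fr where "fr j x = real (card (occurrences K (n j) (X j) (Suc r) x (M j))) / real (n j)" for j x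
    have frl: "(\<lambda>j. fr j x) \<longlonglongrightarrow> p x" if "x \<in> XS" for x
      unfolding fr_def p_def by (rule conv) (use that in \<open>simp add: XS_def T_def\<close>)
    \<comment> \<open>The three terms are the oscillation, the bad balls, and the vertices whose
      walk is not injective. The last proportion tends to 0 because the weights sum to 1.\<close>
    define Rj where "Rj j = 2 * \<epsilon> * (\<Sum>x\<in>XS. fr j x) + 2 * B * (\<Sum>x\<in>XS. fr j x * (if good r x then 0 else 1)) + B * (1 - (\<Sum>x\<in>XS. fr j x))" for j
    have DR: "\<bar>D j - (\<Sum>x\<in>XS. fr j x * F x)\<bar> \<le> Rj j" for j
    proof -
      define Oc where "Oc x = occurrences K (n j) (X j) (Suc r) x (M j)" for x
      define U where "U = (\<Union>x\<in>XS. Oc x)"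
      have fO: "finite (Oc x)" "Oc x \<subseteq> {1..n j}" for x by (auto simp: Oc_def occurrences_def)
      have n0: "real (n j) > 0" using n[of j] by simp
      have dj: "Oc x \<inter> Oc y = {}" if "x \<in> XS" "y \<in> XS" "x \<noteq> y" for x y
      proof (rule ccontr)
        assume "Oc x \<inter> Oc y \<noteq> {}"
        then obtain v where "\<forall>w\<in>T. X j (fst (pos K (M j) v w)) = x w" "\<forall>w\<in>T. X j (fst (pos K (M j) v w)) = y w"
          by (auto simp: Oc_def occurrences_def T_def)
        hence "x = y" using that(1,2) unfolding XS_def by (intro PiE_ext[of x T "\<lambda>_. UNIV" y]) auto
        thus False using that(3) by simp
      qed
      have sumU: "(\<Sum>v\<in>U. h v) = (\<Sum>x\<in>XS. \<Sum>v\<in>Oc x. h v)" for h :: "nat \<Rightarrow> real"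
        unfolding U_def by (rule sum.UNION_disjoint[OF finXS]) (use fO dj in auto)
      have Usub: "U \<subseteq> {1..n j}" using fO by (auto simp: U_def)
      have frO: "real (card (Oc x)) = fr j x * real (n j)" for x using n0 by (simp add: fr_def Oc_def)
      have cU: "real (card U) = (\<Sum>x\<in>XS. fr j x) * real (n j)"
        using sumU[of "\<lambda>_. 1"] by (simp add: frO sum_distrib_right)
      have near: "\<bar>f (cl j v) - F x\<bar> \<le> 2 * \<epsilon> + 2 * B * (if good r x then 0 else 1)" if v: "v \<in> Oc x" for v x
      proof (cases "good r x")
        case True
        have "cl j v \<in> local_nbhd r (tree_class K x)"
          unfolding cl_def
          by (rule walk_class_nbhd[OF M refl E]) (use v T(3) in \<open>auto simp: Oc_def occurrences_def T_def\<close>)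
        thus ?thesis using True unfolding good_def F_def by simp
      next
        case False
        thus ?thesis using B(1)[of "cl j v"] B(1)[of "tree_class K x"] \<epsilon> by (simp add: F_def)
      qed
      have "(\<Sum>v\<in>{1..n j}. f (cl j v)) = (\<Sum>v\<in>U. f (cl j v)) + (\<Sum>v\<in>{1..n j} - U. f (cl j v))"
        using sum.subset_diff[OF Usub] by (simp add: add.commute)
      moreover have "(\<Sum>x\<in>XS. fr j x * F x) * real (n j) = (\<Sum>x\<in>XS. \<Sum>v\<in>Oc x. F x)"
        unfolding sum_distrib_right by (simp add: frO ac_simps)
      ultimately have "(\<Sum>v\<in>{1..n j}. f (cl j v)) - (\<Sum>x\<in>XS. fr j x * F x) * real (n j) =
         (\<Sum>x\<in>XS. \<Sum>v\<in>Oc x. f (cl j v) - F x) + (\<Sum>v\<in>{1..n j} - U. f (cl j v))"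
        by (simp add: sumU sum_subtractf)
      also have "\<bar>\<dots>\<bar> \<le> (\<Sum>x\<in>XS. \<Sum>v\<in>Oc x. 2 * \<epsilon> + 2 * B * (if good r x then 0 else 1)) + (\<Sum>v\<in>{1..n j} - U. B)"
      proof (rule order_trans[OF abs_triangle_ineq], rule add_mono)
        show "\<bar>\<Sum>x\<in>XS. \<Sum>v\<in>Oc x. f (cl j v) - F x\<bar> \<le> (\<Sum>x\<in>XS. \<Sum>v\<in>Oc x. 2 * \<epsilon> + 2 * B * (if good r x then 0 else 1))"
          by (rule order_trans[OF sum_abs], rule sum_mono, rule order_trans[OF sum_abs], rule sum_mono) (rule near)
        show "\<bar>\<Sum>v\<in>{1..n j} - U. f (cl j v)\<bar> \<le> (\<Sum>v\<in>{1..n j} - U. B)"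
          by (rule order_trans[OF sum_abs], rule sum_mono) (rule B(1))
      qed
      also have "\<dots> = Rj j * real (n j)"
      proof -
        have "real (card ({1..n j} - U)) = (1 - (\<Sum>x\<in>XS. fr j x)) * real (n j)"
          unfolding left_diff_distrib cU[symmetric]
          using Usub card_mono[OF _ Usub] by (simp add: card_Diff_subset finite_subset)
        hence c: "(\<Sum>v\<in>{1..n j} - U. B) = B * (1 - (\<Sum>x\<in>XS. fr j x)) * real (n j)"
          by simp
        have "(\<Sum>x\<in>XS. \<Sum>v\<in>Oc x. 2 * \<epsilon> + 2 * B * (if good r x then 0 else 1)) =
           (\<Sum>x\<in>XS. (2 * \<epsilon> * fr j x + 2 * B * (fr j x * (if good r x then 0 else 1))) * real (n j))"
          by (rule sum.cong) (auto simp: frO algebra_simps)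
        also have "\<dots> = (2 * \<epsilon> * (\<Sum>x\<in>XS. fr j x) + 2 * B * (\<Sum>x\<in>XS. fr j x * (if good r x then 0 else 1))) * real (n j)"
          unfolding sum_distrib_right[symmetric] sum.distrib sum_distrib_left[symmetric] by simp
        finally show ?thesis unfolding c Rj_def by (simp only: distrib_right)
      qed
      finally have "\<bar>(\<Sum>v\<in>{1..n j}. f (cl j v)) - (\<Sum>x\<in>XS. fr j x * F x) * real (n j)\<bar> \<le> Rj j * real (n j)" .
      moreover have "D j - (\<Sum>x\<in>XS. fr j x * F x) = ((\<Sum>v\<in>{1..n j}. f (cl j v)) - (\<Sum>x\<in>XS. fr j x * F x) * real (n j)) / real (n j)"
        unfolding D using n0 by (simp add: field_simps)
      moreover have "\<bar>x / real (n j)\<bar> \<le> Rj j" if "\<bar>x\<bar> \<le> Rj j * real (n j)" for x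
        using that n0 by (simp add: pos_divide_le_eq)
      ultimately show ?thesis by simp
    qed
    have Rl: "Rj \<longlonglongrightarrow> 2 * \<epsilon> * (\<Sum>x\<in>XS. p x) + 2 * B * (\<Sum>x\<in>XS. p x * (if good r x then 0 else 1)) + B * (1 - (\<Sum>x\<in>XS. p x))"
      unfolding Rj_def by (intro tendsto_intros frl)
    have "(\<Sum>x\<in>XS. p x) = 1" unfolding p_def XS_def T_def by (rule markov_weight_sum)
    hence Rl': "Rj \<longlonglongrightarrow> 2 * \<epsilon> + 2 * B * bad" using Rl by (simp add: bad_def)
    have Sl: "(\<lambda>j. \<Sum>x\<in>XS. fr j x * F x) \<longlonglongrightarrow> S" unfolding S_def by (intro tendsto_intros frl)
    have "(\<lambda>j. Rj j + \<bar>(\<Sum>x\<in>XS. fr j x * F x) - S\<bar> + \<bar>S - (\<integral>y. F y \<partial>tree_chain)\<bar>) \<longlonglongrightarrow>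
       2 * \<epsilon> + 2 * B * bad + \<bar>S - S\<bar> + \<bar>S - (\<integral>y. F y \<partial>tree_chain)\<bar>"
      by (intro tendsto_intros Rl' Sl)
    moreover have "2 * \<epsilon> + 2 * B * bad + \<bar>S - S\<bar> + \<bar>S - (\<integral>y. F y \<partial>tree_chain)\<bar> < e"
    proof -
      have "2 * B * bad \<le> 2 * B * \<epsilon>" by (rule mult_left_mono) (use bad1 B(2) in auto)
      hence "2 * \<epsilon> + 2 * B * bad + \<bar>S - S\<bar> + \<bar>S - (\<integral>y. F y \<partial>tree_chain)\<bar> \<le> 4 * (1 + B) * \<epsilon>"
        using FS by (simp add: algebra_simps)
      also have "\<dots> < (4 * (1 + B) + 1) * \<epsilon>" using \<epsilon> by simp
      also have "\<dots> = e" using B(2) by (simp add: \<epsilon>_def)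
      finally show ?thesis .
    qed
    ultimately have "eventually (\<lambda>j. Rj j + \<bar>(\<Sum>x\<in>XS. fr j x * F x) - S\<bar> + \<bar>S - (\<integral>y. F y \<partial>tree_chain)\<bar> < e) sequentially"
      by (rule order_tendstoD)
    thus ?thesis
    proof eventually_elim
      case (elim j)
      thus ?case using DR[of j] by linarith
    qed
  qed
  have "D \<longlonglongrightarrow> (\<integral>y. F y \<partial>tree_chain)"
    by (rule tendstoI) (use main in \<open>simp add: dist_real_def\<close>)
  thus ?thesis unfolding D_def intF .
qed

lemma component_empirical_prob:
  assumes "n \<ge> 1" shows "component_empirical n \<omega> \<in> prob_measures"
proof -
  obtain E X where w: "\<omega> = (E, X)" by (cases \<omega>)
  have "prob_space (uniform_count_measure {1..n})" by (rule prob_space_uniform_count_measure) (use assms in auto)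
  thus ?thesis
    unfolding w component_empirical_def prob_measures_def
    by (auto intro!: prob_space.prob_space_distr simp: measurable_def sets_uniform_count_measure space_uniform_count_measure)
qed

text \<open>Suppose that it fails for every radius \<open>j\<close> with tolerance
  \<open>1 / (j + 1)\<close>. The counterexamples have ball frequencies converging to those of the
  chain, so by \<open>empirical_integral_tendsto\<close> they end up in every subbasic set around
  its law. Induction over the generation of the topology extends this to
  \<open>\<O>\<close>.\<close>

theorem profile_close_imp_open:
  fixes \<O> :: "'x gstar measure set"
  assumes \<O>: "openin weak_topology \<O>" "tree_law K tree_chain \<in> \<O>"
  shows "\<exists>R. \<exists>\<epsilon>>0. \<forall>n\<ge>1. \<forall>M X. M \<in> matchings (half_edges K n) \<longrightarrow> graph_of K n M \<in> regular_graphs K n \<longrightarrow>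
     (\<forall>r\<le>R. profile_close K r \<alpha> \<pi> \<epsilon> n X M) \<longrightarrow> component_empirical n (graph_of K n M, X) \<in> \<O>"
proof (rule ccontr)
  assume neg: "\<not> ?thesis"
  define bad where "bad j c \<longleftrightarrow> (case c of (n, M, X) \<Rightarrow> n \<ge> 1 \<and> M \<in> matchings (half_edges K n) \<and>
     graph_of K n M \<in> regular_graphs K n \<and> (\<forall>r\<le>j. profile_close K r \<alpha> \<pi> (inverse (real (Suc j))) n X M) \<and>
     component_empirical n (graph_of K n M, X) \<notin> \<O>)" for j and c :: "nat \<times> (nat \<times> nat \<Rightarrow> nat \<times> nat) \<times> (nat \<Rightarrow> 'x)"
  have "\<exists>c. bad j c" for j
  proof -
    have "inverse (real (Suc j)) > 0" by simp
    then obtain n M X where "n \<ge> 1" "M \<in> matchings (half_edges K n)" "graph_of K n M \<in> regular_graphs K n"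
      "\<forall>r\<le>j. profile_close K r \<alpha> \<pi> (inverse (real (Suc j))) n X M" "component_empirical n (graph_of K n M, X) \<notin> \<O>"
      using neg by meson
    thus ?thesis by (intro exI[of _ "(n, M, X)"]) (simp add: bad_def)
  qed
  then obtain c where c: "\<And>j. bad j (c j)" by metis
  define n M X where "n j = fst (c j)" and "M j = fst (snd (c j))" and "X j = snd (snd (c j))" for j
  have P: "n j \<ge> 1" "M j \<in> matchings (half_edges K (n j))" "graph_of K (n j) (M j) \<in> regular_graphs K (n j)"
    "\<And>r. r \<le> j \<Longrightarrow> profile_close K r \<alpha> \<pi> (inverse (real (Suc j))) (n j) (X j) (M j)"
    "component_empirical (n j) (graph_of K (n j) (M j), X j) \<notin> \<O>" for j
    using c[of j] by (auto simp: bad_def n_def M_def X_def split: prod.splits)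
  have conv: "(\<lambda>j. real (card (occurrences K (n j) (X j) r x (M j))) / real (n j)) \<longlonglongrightarrow> markov_weight K r \<alpha> \<pi> x"
    if x: "x \<in> tree_ball K r \<rightarrow>\<^sub>E UNIV" for r x
  proof (rule LIM_zero_cancel, rule tendsto_rabs_zero_cancel, rule tendsto_sandwich[OF _ _ tendsto_const LIMSEQ_inverse_real_of_nat])
    show "\<forall>\<^sub>F j in sequentially. \<bar>real (card (occurrences K (n j) (X j) r x (M j))) / real (n j) - markov_weight K r \<alpha> \<pi> x\<bar> \<le> inverse (real (Suc j))"
      using P(4) x unfolding eventually_sequentially profile_close_def by blast
  qed simp
  define \<mu> where "\<mu> j = component_empirical (n j) (graph_of K (n j) (M j), X j)" for j
  define \<B> where "\<B> = {{\<mu> \<in> prob_measures. (\<integral>x. f x \<partial>\<mu>) \<in> V} |(f :: 'x gstar \<Rightarrow> real) V.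
        continuous_on UNIV f \<and> bounded (range f) \<and> open V}"
  have "generate_topology_on \<B> \<O>"
    using \<O>(1) unfolding weak_topology_def openin_topology_generated_by_iff \<B>_def .
  hence "tree_law K tree_chain \<in> \<O> \<longrightarrow> eventually (\<lambda>j. \<mu> j \<in> \<O>) sequentially"
  proof induction
    case Empty
    thus ?case by simp
  next
    case (Int a b)
    thus ?case by (auto simp: eventually_conj_iff)
  next
    case (UN J)
    show ?case
    proof
      assume "tree_law K tree_chain \<in> \<Union> J"
      then obtain k where k: "k \<in> J" "tree_law K tree_chain \<in> k" by auto
      hence "eventually (\<lambda>j. \<mu> j \<in> k) sequentially" using UN by blast
      thus "eventually (\<lambda>j. \<mu> j \<in> \<Union> J) sequentially" by eventually_elim (use k(1) in blast)
    qed
  next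
    case (Basis s)
    then obtain f :: "'x gstar \<Rightarrow> real" and V where s: "s = {\<mu> \<in> prob_measures. (\<integral>x. f x \<partial>\<mu>) \<in> V}" and f: "continuous_on UNIV f" "bounded (range f)" "open V"
      unfolding \<B>_def mem_Collect_eq by blast
    have L: "(\<lambda>j. \<integral>x. f x \<partial>\<mu> j) \<longlonglongrightarrow> (\<integral>x. f x \<partial>tree_law K tree_chain)"
      unfolding \<mu>_def by (rule empirical_integral_tendsto[OF f(1,2) P(1-3)]) (rule conv)
    show ?case
    proof
      assume "tree_law K tree_chain \<in> s"
      hence "(\<integral>x. f x \<partial>tree_law K tree_chain) \<in> V" by (simp add: s)
      hence "eventually (\<lambda>j. (\<integral>x. f x \<partial>\<mu> j) \<in> V) sequentially"
        using topological_tendstoD[OF _ f(3)] L by blast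
      thus "eventually (\<lambda>j. \<mu> j \<in> s) sequentially"
        by eventually_elim (simp add: s \<mu>_def component_empirical_prob[OF P(1)])
    qed
  qed
  hence "eventually (\<lambda>j. \<mu> j \<in> \<O>) sequentially" using \<O>(2) by blast
  thus False using P(5) by (auto simp: \<mu>_def)
qed

end

section \<open>Edge marginal of the chain\<close>

definition root_edge_law :: "('v, 'x) rmgraph \<Rightarrow> ('x \<times> 'x) pmf" where
  "root_edge_law G = map_pmf (\<lambda>u. (mark G (root G), mark G u)) (pmf_of_set (edges G `` {root G}))"

text \<open>The root, its neighbours and their marks lie in the ball of radius 1. The uniform law on
  the neighbours is transported by the isomorphism provided that there are any.\<close>

lemma root_edge_law_iso:
  assumes wf: "wf_rmgraph G" "wf_rmgraph H" and iso: "rmiso (rball 1 G) (rball 1 H)" and ne: "edges G `` {root G} \<noteq> {}"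
  shows "root_edge_law G = root_edge_law H"
proof -
  obtain \<phi> where \<phi>: "shape_iso \<phi> (rball 1 G) (rball 1 H)" and m: "\<And>v. v \<in> verts (rball 1 G) \<Longrightarrow> mark H (\<phi> v) = mark G v"
    using iso unfolding rmiso_iff by (auto simp: rball_simps)
  have nb: "edges K `` {root K} = {u\<in>verts (rball 1 K). (root K, u) \<in> edges (rball 1 K)}" if "wf_rmgraph K" for K :: "('z, 'y) rmgraph"
  proof -
    have "root K \<in> verts (rball 1 K)" "u \<in> verts (rball 1 K)" if "(root K, u) \<in> edges K" for u
      using pre_graph_wf[OF \<open>wf_rmgraph K\<close>] that
      by (auto simp: pre_graph_def rball_simps intro: exI[of _ 0] exI[of _ "Suc 0"])
    thus ?thesis by (auto simp: rball_simps(2))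
  qed
  have r: "root G \<in> verts (rball 1 G)" "root H \<in> verts (rball 1 H)" "\<phi> (root G) = root H"
    using pre_graph_rball[OF pre_graph_wf[OF wf(1)], of 1] pre_graph_rball[OF pre_graph_wf[OF wf(2)], of 1] \<phi>
    by (auto simp: pre_graph_def rball_simps(3) shape_iso_def)
  have b: "bij_betw \<phi> (verts (rball 1 G)) (verts (rball 1 H))" using \<phi> by (simp add: shape_iso_def)
  have bn: "bij_betw \<phi> (edges G `` {root G}) (edges H `` {root H})"
    unfolding nb[OF wf(1)] nb[OF wf(2)]
  proof (rule bij_betw_imageI)
    show "inj_on \<phi> {u \<in> verts (rball 1 G). (root G, u) \<in> edges (rball 1 G)}"
      using b by (auto simp: bij_betw_def inj_on_def)
    show "\<phi> ` {u \<in> verts (rball 1 G). (root G, u) \<in> edges (rball 1 G)} = {u \<in> verts (rball 1 H). (root H, u) \<in> edges (rball 1 H)}"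
    proof (intro equalityI subsetI)
      fix z assume "z \<in> \<phi> ` {u \<in> verts (rball 1 G). (root G, u) \<in> edges (rball 1 G)}"
      then obtain u where "z = \<phi> u" "u \<in> verts (rball 1 G)" "(root G, u) \<in> edges (rball 1 G)" by auto
      thus "z \<in> {u \<in> verts (rball 1 H). (root H, u) \<in> edges (rball 1 H)}"
        using \<phi> r b unfolding shape_iso_def by (auto dest: bij_betwE)
    next
      fix z assume z: "z \<in> {u \<in> verts (rball 1 H). (root H, u) \<in> edges (rball 1 H)}"
      then obtain u where u: "u \<in> verts (rball 1 G)" "z = \<phi> u" using b by (auto simp: bij_betw_def)
      hence "(root G, u) \<in> edges (rball 1 G)" using \<phi> r z unfolding shape_iso_def by auto
      thus "z \<in> \<phi> ` {u \<in> verts (rball 1 G). (root G, u) \<in> edges (rball 1 G)}" using u by blast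
    qed
  qed
  have fin: "finite (edges G `` {root G})" using wf(1) by (auto simp: wf_rmgraph_def)
  have "root_edge_law H = map_pmf (\<lambda>u. (mark H (root H), mark H u)) (map_pmf \<phi> (pmf_of_set (edges G `` {root G})))"
    unfolding root_edge_law_def using map_pmf_of_set_bij_betw[OF bn ne fin] by simp
  also have "\<dots> = root_edge_law G"
    unfolding root_edge_law_def pmf.map_comp
  proof (rule map_pmf_cong[OF refl])
    fix u assume "u \<in> set_pmf (pmf_of_set (edges G `` {root G}))"
    hence "u \<in> verts (rball 1 G)" using nb[OF wf(1)] ne fin by auto
    thus "((\<lambda>u. (mark H (root H), mark H u)) \<circ> \<phi>) u = (mark G (root G), mark G u)"
      using m r by (metis comp_apply)
  qed
  finally show ?thesis by simp
qed

lemma root_edge_pmf_law: "root_edge_pmf g = root_edge_law (rep_gstar g)"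
  by (simp add: root_edge_pmf_def root_edge_law_def Let_def)

lemma isolated_root:
  assumes wf: "wf_rmgraph G" and iso: "edges G `` {root G} = {}" shows "verts G = {root G}" "edges G = {}"
proof -
  show v: "verts G = {root G}"
  proof (intro equalityI subsetI)
    fix v assume "v \<in> verts G"
    hence "(root G, v) \<in> (edges G)\<^sup>*" using wf by (auto simp: wf_rmgraph_def)
    thus "v \<in> {root G}" using iso by (cases rule: converse_rtranclE) auto
  qed (use wf in \<open>auto simp: wf_rmgraph_def\<close>)
  show "edges G = {}" using wf v by (auto simp: wf_rmgraph_def irrefl_def)
qed

text \<open>Local constancy is what makes \<open>edge_marginal\<close> measurable. If both roots are
  isolated, the ball of radius 1 is the whole graph and the two classes coincide.\<close>

lemma root_edge_pmf_nbhd: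
  assumes "g' \<in> local_nbhd 1 g" shows "root_edge_pmf g' = root_edge_pmf g"
proof -
  define G G' where "G = rep_gstar g" and "G' = rep_gstar g'"
  have wf: "wf_rmgraph G" "wf_rmgraph G'" by (simp_all add: G_def G'_def rep_wf)
  have iso: "rmiso (rball 1 G') (rball 1 G)" using assms by (simp add: local_nbhd_def G_def G'_def)
  have iso': "rmiso (rball 1 G) (rball 1 G')" by (rule rball_sym[OF iso pre_graph_wf[OF wf(2)]])
  consider "edges G' `` {root G'} \<noteq> {}" | "edges G `` {root G} \<noteq> {}" | "edges G' `` {root G'} = {}" "edges G `` {root G} = {}" by blast
  thus ?thesis
  proof cases
    case 1
    thus ?thesis unfolding root_edge_pmf_law using root_edge_law_iso[OF wf(2,1) iso] by (simp add: G_def G'_def)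
  next
    case 2
    thus ?thesis unfolding root_edge_pmf_law using root_edge_law_iso[OF wf iso'] by (simp add: G_def G'_def)
  next
    case 3
    note i = isolated_root[OF wf(1) 3(2)] isolated_root[OF wf(2) 3(1)]
    have V: "verts (rball 1 G) = {root G}" "verts (rball 1 G') = {root G'}"
      using i by (auto simp: rball_simps intro: exI[of _ 0])
    have "rmiso G' G"
      unfolding rmiso_def
    proof (rule exI[of _ "\<lambda>_. root G"], intro conjI ballI)
      show "bij_betw (\<lambda>_. root G) (verts G') (verts G)" by (simp add: i)
      obtain \<phi> where "shape_iso \<phi> (rball 1 G') (rball 1 G)" "\<forall>v\<in>verts (rball 1 G'). mark (rball 1 G) (\<phi> v) = mark (rball 1 G') v"
        using iso unfolding rmiso_iff by blast
      hence "mark G (root G) = mark G' (root G')" unfolding V shape_iso_def by (simp add: rball_simps)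
      thus "mark G (root G) = mark G' v" if "v \<in> verts G'" for v using that by (simp add: i)
    qed (auto simp: i)
    hence "g' = g" unfolding G_def G'_def by (rule rep_eqI)
    thus ?thesis by simp
  qed
qed

lemma measurable_root_edge_pmf: "root_edge_pmf \<in> borel \<rightarrow>\<^sub>M (count_space UNIV :: ('x::finite \<times> 'x) pmf measure)"
proof (rule measurableI)
  fix A :: "('x \<times> 'x) pmf set"
  have "open (root_edge_pmf -` A)"
    by (rule open_if_nbhds) (use root_edge_pmf_nbhd in fastforce)
  thus "root_edge_pmf -` A \<inter> space borel \<in> sets borel" by simp
qed simp

context markov_law
begin

lemma root_edge_pmf_tree:
  "root_edge_pmf (tree_class K y) = map_pmf (\<lambda>i. (y [], y [i])) (pmf_of_set {..<K})"
proof -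
  have nb: "edges (marked_tree K y) `` {root (marked_tree K y)} = (\<lambda>i. [i]) ` {..<K}"
  proof -
    have "[i] \<in> tree_verts K \<longleftrightarrow> i < K" for i by (simp add: tree_verts_def)
    thus ?thesis by (intro set_eqI) (simp add: Image_singleton marked_tree_simps, blast)
  qed
  have k0: "{..<K} \<noteq> {}" using K by (simp add: lessThan_empty_iff)
  have "root_edge_law (marked_tree K y) = root_edge_law (rep_gstar (tree_class K y))"
  proof (rule root_edge_law_iso[OF wf_marked_tree rep_wf])
    show "rmiso (rball 1 (marked_tree K y)) (rball 1 (rep_gstar (tree_class K y)))"
      unfolding tree_class_def
      by (rule rball_sym[OF rmiso_rball[OF rep_iso[OF wf_marked_tree] rep_pre pre_graph_wf[OF wf_marked_tree]] rep_pre])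
  qed (use nb k0 in auto)
  hence "root_edge_pmf (tree_class K y) = root_edge_law (marked_tree K y)" by (simp add: root_edge_pmf_law)
  also have "\<dots> = map_pmf (\<lambda>u. (y [], y u)) (map_pmf (\<lambda>i. [i]) (pmf_of_set {..<K}))"
    unfolding root_edge_law_def nb using k0 by (simp add: marked_tree_simps map_pmf_of_set_inj inj_on_def)
  finally show ?thesis by (simp add: pmf.map_comp o_def)
qed

text \<open>Each of the \<open>K\<close> edges at the root has law \<open>\<pi>\<close> under the
  chain, so averaging over them changes nothing.\<close>

lemma edge_marginal_expectation:
  fixes h :: "'x \<Rightarrow> 'x \<Rightarrow> real"
  shows "(\<integral>(x, y). h x y \<partial>edge_marginal (tree_law K tree_chain)) = (\<Sum>a\<in>UNIV. \<Sum>b\<in>UNIV. \<pi> a b * h a b)"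
proof -
  let ?A = "(\<Sum>a\<in>UNIV. \<Sum>b\<in>UNIV. \<pi> a b * h a b)"
  interpret TC: prob_space tree_chain by (rule prob_tree_chain)
  interpret TL: prob_space "tree_law K tree_chain" using tree_law_prob by (simp add: prob_measures_def)
  define H where "H = (\<lambda>(x, y). h x y)"
  define B where "B = Max (range (\<lambda>p. \<bar>H p\<bar>))"
  have B: "\<bar>H p\<bar> \<le> B" for p unfolding B_def by simp
  have one: "(\<integral>y. h (y []) (y [i]) \<partial>tree_chain) = ?A"
    "integrable tree_chain (\<lambda>y. h (y []) (y [i]))" if i: "i < K" for i
  proof -
    define T where "T = {[], [i]}"
    have T: "finite T" "T \<subseteq> tree_verts K" "prefix_closed T"
      using i tree_verts_snoc[of "[]" i K] by (auto simp: T_def prefix_closed_def)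
    have Ti: "T - {[]} = {[i]}" by (auto simp: T_def)
    note I = integral_cylinder_function[OF T(1,2), of "\<lambda>y. h (y []) (y [i])"]
    have cong: "h (y []) (y [i]) = h (restrict y T []) (restrict y T [i])" for y by (simp add: T_def)
    have "(\<integral>y. h (y []) (y [i]) \<partial>tree_chain) = (\<Sum>x\<in>T \<rightarrow>\<^sub>E UNIV. measure tree_chain {y\<in>space tree_chain. \<forall>w\<in>T. y w = x w} * h (x []) (x [i]))"
      by (rule I(2)[OF cong])
    also have "\<dots> = (\<Sum>x\<in>T \<rightarrow>\<^sub>E UNIV. \<pi> (x []) (x [i]) * h (x []) (x [i]))"
      unfolding prob_cylinder[OF T] Ti using \<alpha>_pos by (intro sum.cong) (auto simp: less_imp_neq[symmetric])
    also have "\<dots> = (\<Sum>p\<in>UNIV. \<pi> (fst p) (snd p) * h (fst p) (snd p))"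
      by (rule sum.reindex_bij_witness[where j = "\<lambda>x. (x [], x [i])" and
            i = "\<lambda>p. restrict (\<lambda>w. if w = [] then fst p else snd p) T"])
         (auto simp: T_def fun_eq_iff restrict_def PiE_def extensional_def)
    also have "\<dots> = ?A"
      by (simp add: sum.cartesian_product case_prod_beta)
    finally show "(\<integral>y. h (y []) (y [i]) \<partial>tree_chain) = ?A" .
    show "integrable tree_chain (\<lambda>y. h (y []) (y [i]))"
    proof (rule TC.integrable_const_bound[of _ B])
      show "AE y in tree_chain. norm (h (y []) (y [i])) \<le> B" using B[of "(_, _)"] by (simp add: H_def)
    qed (rule I(1)[OF cong])
  qed
  have m1: "root_edge_pmf \<in> tree_law K tree_chain \<rightarrow>\<^sub>M count_space UNIV"
    unfolding tree_law_alt using measurable_root_edge_pmf by simp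
  have m2: "(\<lambda>g. measure_pmf (root_edge_pmf g)) \<in> tree_law K tree_chain \<rightarrow>\<^sub>M subprob_algebra (count_space UNIV)"
    by (rule measurable_compose[OF m1]) (rule measurable_measure_pmf)
  have "(\<integral>p. H p \<partial>edge_marginal (tree_law K tree_chain)) = (\<integral>g. (\<integral>p. H p \<partial>measure_pmf (root_edge_pmf g)) \<partial>tree_law K tree_chain)"
    unfolding edge_marginal_def
    by (rule integral_bind[where K = "count_space UNIV" and B = B and B' = 1])
       (use m2 B TL.finite_measure_axioms in \<open>auto simp: measure_pmf.emeasure_space_1 intro!: AE_I2 measure_pmf.subprob_emeasure_le_1\<close>)
  also have "\<dots> = (\<integral>y. (\<integral>p. H p \<partial>measure_pmf (root_edge_pmf (tree_class K y))) \<partial>tree_chain)"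
  proof -
    have "(\<lambda>g. (\<integral>p. H p \<partial>measure_pmf (root_edge_pmf g))) \<in> borel_measurable borel"
      by (rule measurable_compose[OF measurable_root_edge_pmf]) simp
    thus ?thesis unfolding tree_law_alt by (rule integral_distr[OF measurable_tree_class])
  qed
  also have "\<dots> = (\<integral>y. (\<Sum>i<K. h (y []) (y [i])) / real K \<partial>tree_chain)"
  proof (rule Bochner_Integration.integral_cong[OF refl])
    fix y
    show "(\<integral>p. H p \<partial>measure_pmf (root_edge_pmf (tree_class K y))) = (\<Sum>i<K. h (y []) (y [i])) / real K"
      unfolding root_edge_pmf_tree using K by (simp add: integral_pmf_of_set H_def lessThan_empty_iff)
  qed
  also have "\<dots> = (\<Sum>i<K. (\<integral>y. h (y []) (y [i]) \<partial>tree_chain)) / real K"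
    using one(2) by simp
  also have "\<dots> = (\<Sum>i<K. \<Sum>a\<in>UNIV. \<Sum>b\<in>UNIV. \<pi> a b * h a b) / real K"
    using one(1) by simp
  also have "\<dots> = ?A" using K by simp
  finally show ?thesis by (simp add: H_def)
qed

end

section \<open>Simple graphs as configurations\<close>

definition simple_configs :: "nat \<Rightarrow> nat \<Rightarrow> (nat \<times> nat \<Rightarrow> nat \<times> nat) set" where
  "simple_configs K n = {M \<in> matchings (half_edges K n). defective (half_edges K n) M = {}}"

lemma simple_configsD:
  assumes "M \<in> simple_configs K n" "v \<in> {1..n}"
  shows "graph_of K n M `` {v} = (\<lambda>i. fst (M (v, i))) ` {..<K}" "inj_on (\<lambda>i. fst (M (v, i))) {..<K}"
proof -
  show "graph_of K n M `` {v} = (\<lambda>i. fst (M (v, i))) ` {..<K}"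
  proof (intro equalityI subsetI)
    fix u assume "u \<in> graph_of K n M `` {v}"
    then obtain h where h: "h \<in> half_edges K n" "fst h = v" "u = fst (M h)" by (auto simp: graph_of_def)
    hence "h = (v, snd h)" "snd h < K" by (auto simp: half_edges_def)
    thus "u \<in> (\<lambda>i. fst (M (v, i))) ` {..<K}" using h(3) by (intro image_eqI[of _ _ "snd h"]) auto
  next
    fix u assume "u \<in> (\<lambda>i. fst (M (v, i))) ` {..<K}"
    then obtain i where i: "i < K" "u = fst (M (v, i))" by auto
    hence "(v, i) \<in> half_edges K n" using assms(2) by (simp add: half_edges_def)
    thus "u \<in> graph_of K n M `` {v}" using i(2) unfolding graph_of_def by (intro ImageI[of v]) (auto intro!: image_eqI[of _ _ "(v, i)"])
  qed
  show "inj_on (\<lambda>i. fst (M (v, i))) {..<K}"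
  proof (rule inj_onI, rule ccontr)
    fix i j assume ij: "i \<in> {..<K}" "j \<in> {..<K}" "fst (M (v, i)) = fst (M (v, j))" "i \<noteq> j"
    hence "(v, i) \<in> half_edges K n" "(v, j) \<in> half_edges K n" using assms(2) by (auto simp: half_edges_def)
    hence "(v, i) \<in> defective (half_edges K n) M"
      using ij unfolding defective_def by auto
    thus False using assms(1) by (simp add: simple_configs_def)
  qed
qed

lemma graph_of_regular:
  assumes s: "M \<in> simple_configs K n" shows "graph_of K n M \<in> regular_graphs K n"
proof -
  have m: "M \<in> matchings (half_edges K n)" and d: "defective (half_edges K n) M = {}"
    using s by (auto simp: simple_configs_def)
  note D = matchingsD[OF m]
  have "graph_of K n M \<subseteq> {1..n} \<times> {1..n}"
    using D(1) unfolding graph_of_def half_edges_def by fastforce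
  moreover have "sym (graph_of K n M)"
  proof (rule symI)
    fix u v assume "(u, v) \<in> graph_of K n M"
    then obtain h where "h \<in> half_edges K n" "u = fst h" "v = fst (M h)" by (auto simp: graph_of_def)
    thus "(v, u) \<in> graph_of K n M" unfolding graph_of_def
      using D(1,3) by (intro image_eqI[of _ _ "M h"]) auto
  qed
  moreover have "irrefl (graph_of K n M)"
  proof (rule irreflI)
    fix v show "(v, v) \<notin> graph_of K n M"
    proof
      assume "(v, v) \<in> graph_of K n M"
      then obtain h where "h \<in> half_edges K n" "v = fst h" "v = fst (M h)" by (auto simp: graph_of_def)
      hence "h \<in> defective (half_edges K n) M" by (simp add: defective_def)
      thus False using d by simp
    qed
  qed
  moreover have "card (graph_of K n M `` {v}) = K" if "v \<in> {1..n}" for v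
    using simple_configsD[OF s that] by (simp add: card_image)
  ultimately show ?thesis by (simp add: regular_graphs_def)
qed

lemma edge_average_config:
  assumes s: "M \<in> simple_configs K n"
  shows "edge_average h n (graph_of K n M, X) = (\<Sum>e\<in>half_edges K n. h (X (fst e)) (X (fst (M e)))) / real n"
proof -
  have "(\<Sum>u\<in>graph_of K n M `` {v}. h (X v) (X u)) = (\<Sum>i<K. h (X v) (X (fst (M (v, i)))))" if "v \<in> {1..n}" for v
    unfolding simple_configsD(1)[OF s that] by (simp add: sum.reindex[OF simple_configsD(2)[OF s that]])
  hence "(\<Sum>v\<in>{1..n}. \<Sum>u\<in>graph_of K n M `` {v}. h (X v) (X u)) = (\<Sum>v\<in>{1..n}. \<Sum>i<K. h (X v) (X (fst (M (v, i)))))"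
    by simp
  also have "\<dots> = (\<Sum>e\<in>half_edges K n. h (X (fst e)) (X (fst (M e))))"
    unfolding half_edges_def by (simp add: sum.cartesian_product case_prod_beta)
  finally show ?thesis by (simp add: edge_average_def)
qed

lemma card_bijections:
  assumes "finite A" "finite B" "card A = card B"
  shows "card {f \<in> A \<rightarrow>\<^sub>E B. bij_betw f A B} = fact (card A)"
  using assms
proof (induction A arbitrary: B rule: finite_induct)
  case empty
  thus ?case by (simp add: bij_betw_def)
next
  case (insert a A)
  define S where "S = (SIGMA y:B. {f \<in> A \<rightarrow>\<^sub>E B - {y}. bij_betw f A (B - {y})})"
  have "bij_betw (\<lambda>(y, f). f(a := y)) S {f \<in> insert a A \<rightarrow>\<^sub>E B. bij_betw f (insert a A) B}"
  proof (rule bij_betwI[where g = "\<lambda>f. (f a, f(a := undefined))"])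
    show "(\<lambda>(y, f). f(a := y)) \<in> S \<rightarrow> {f \<in> insert a A \<rightarrow>\<^sub>E B. bij_betw f (insert a A) B}"
    proof
      fix p assume "p \<in> S"
      then obtain y f where p: "p = (y, f)" "y \<in> B" "f \<in> A \<rightarrow>\<^sub>E B - {y}" "bij_betw f A (B - {y})" by (auto simp: S_def)
      have "bij_betw (f(a := y)) A (B - {y})"
        using p(4) insert.hyps(2) by (subst bij_betw_cong[of A _ f]) auto
      hence "bij_betw (f(a := y)) (insert a A) (insert y (B - {y}))"
        using notIn_Un_bij_betw[of a A "f(a := y)" "B - {y}"] insert.hyps(2) by simp
      moreover have "insert y (B - {y}) = B" using p(2) by auto
      moreover have "f(a := y) \<in> insert a A \<rightarrow>\<^sub>E B" using p(2,3) by (auto simp: PiE_def)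
      ultimately show "(\<lambda>(y, f). f(a := y)) p \<in> {f \<in> insert a A \<rightarrow>\<^sub>E B. bij_betw f (insert a A) B}" by (simp add: p(1))
    qed
    show "(\<lambda>f. (f a, f(a := undefined))) \<in> {f \<in> insert a A \<rightarrow>\<^sub>E B. bij_betw f (insert a A) B} \<rightarrow> S"
    proof
      fix f assume f: "f \<in> {f \<in> insert a A \<rightarrow>\<^sub>E B. bij_betw f (insert a A) B}"
      hence b: "bij_betw f (insert a A) B" by simp
      have "bij_betw f A (B - {f a})"
      proof -
        have "inj_on f A" "f ` A = B - {f a}"
          using b insert.hyps(2) by (auto simp: bij_betw_def inj_on_def)
        thus ?thesis by (simp add: bij_betw_def)
      qed
      hence "bij_betw (f(a := undefined)) A (B - {f a})"
        using insert.hyps(2) by (subst bij_betw_cong[of A _ f]) auto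
      moreover have "f(a := undefined) \<in> A \<rightarrow>\<^sub>E B - {f a}"
        using f bij_betwE[OF calculation] by auto
      moreover have "f a \<in> B" using f by auto
      ultimately show "(f a, f(a := undefined)) \<in> S" by (simp add: S_def)
    qed
    show "(\<lambda>f. (f a, f(a := undefined))) ((\<lambda>(y, f). f(a := y)) p) = p" if "p \<in> S" for p
    proof -
      obtain y f where p: "p = (y, f)" "f \<in> A \<rightarrow>\<^sub>E B - {y}" using \<open>p \<in> S\<close> unfolding S_def by blast
      hence "f a = undefined" using insert.hyps(2) by auto
      thus ?thesis by (simp add: p(1) fun_upd_idem)
    qed
  qed simp
  hence "card {f \<in> insert a A \<rightarrow>\<^sub>E B. bij_betw f (insert a A) B} = card S" by (simp add: bij_betw_same_card)
  also have "\<dots> = (\<Sum>y\<in>B. card {f \<in> A \<rightarrow>\<^sub>E B - {y}. bij_betw f A (B - {y})})"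
    unfolding S_def using insert.prems insert.hyps
    by (intro card_SigmaI) (auto intro!: finite_subset[OF _ finite_PiE[of A "\<lambda>_. B"]])
  also have "\<dots> = (\<Sum>y\<in>B. fact (card A))"
    by (rule sum.cong[OF refl], rule insert.IH) (use insert.prems insert.hyps in auto)
  also have "\<dots> = fact (card (insert a A))"
    using insert.prems(2)[symmetric] insert.hyps by simp
  finally show ?case .
qed

text \<open>A configuration over \<open>E\<close> amounts to a bijection at each vertex from its
  ports to its neighbours: the port at the other end of an edge is the one that the bijection there
  assigns to this edge.\<close>

lemma card_configs_of_graph:
  assumes E: "E \<in> regular_graphs K n"
  shows "card {M \<in> simple_configs K n. graph_of K n M = E} = fact K ^ n"
proof -
  define S where "S = half_edges K n"
  have Er: "E \<subseteq> {1..n} \<times> {1..n}" "sym E" "irrefl E" "\<And>v. v \<in> {1..n} \<Longrightarrow> card (E `` {v}) = K"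
    using E by (auto simp: regular_graphs_def)
  have finE: "finite (E `` {v})" for v by (rule finite_subset[of _ "{1..n}"]) (use Er(1) in auto)
  define BS where "BS = PiE {1..n} (\<lambda>v. {f \<in> {..<K} \<rightarrow>\<^sub>E E `` {v}. bij_betw f {..<K} (E `` {v})})"
  have "card BS = (\<Prod>v\<in>{1..n}. card {f \<in> {..<K} \<rightarrow>\<^sub>E E `` {v}. bij_betw f {..<K} (E `` {v})})"
    unfolding BS_def by (rule card_PiE) simp
  also have "\<dots> = (\<Prod>v\<in>{1..n}. fact K)"
    by (rule prod.cong[OF refl], subst card_bijections) (use finE Er(4) in auto)
  finally have cB: "card BS = fact K ^ n" by simp
  define F where "F M = (\<lambda>v\<in>{1..n}. \<lambda>i\<in>{..<K}. fst (M (v, i)))" for M :: "nat \<times> nat \<Rightarrow> nat \<times> nat"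
  \<comment> \<open>The second component looks up the port under which the neighbour lists
    \<open>fst h\<close>.\<close>
  define G where "G b = (\<lambda>h. if h \<in> S then (b (fst h) (snd h), inv_into {..<K} (b (b (fst h) (snd h))) (fst h)) else h)" for b :: "nat \<Rightarrow> nat \<Rightarrow> nat"
  define A where "A = {M \<in> simple_configs K n. graph_of K n M = E}"
  have "bij_betw F A BS"
  proof (rule bij_betwI[where g = G])
    have bF: "bij_betw (F M v) {..<K} (E `` {v})" if "M \<in> A" "v \<in> {1..n}" for M v
    proof -
      have "bij_betw (\<lambda>i. fst (M (v, i))) {..<K} (E `` {v})"
        using simple_configsD[of M K n v] that by (auto simp: A_def bij_betw_def)
      thus ?thesis using that(2) by (subst bij_betw_cong[of _ _ "\<lambda>i. fst (M (v, i))"]) (auto simp: F_def)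
    qed
    show "F \<in> A \<rightarrow> BS"
    proof
      fix M assume s: "M \<in> A"
      have "F M v \<in> {..<K} \<rightarrow>\<^sub>E E `` {v}" if "v \<in> {1..n}" for v
        using bij_betwE[OF bF[OF s that]] that by (auto simp: F_def)
      thus "F M \<in> BS" using bF[OF s] by (auto simp: BS_def F_def)
    qed
    show "G \<in> BS \<rightarrow> A"
    proof
      fix b assume b: "b \<in> BS"
      have bb: "bij_betw (b v) {..<K} (E `` {v})" if "v \<in> {1..n}" for v using b that by (auto simp: BS_def)
      have e: "(fst h, b (fst h) (snd h)) \<in> E" "b (fst h) (snd h) \<in> {1..n}" if "h \<in> S" for h
        proof -
        have "fst h \<in> {1..n}" "snd h \<in> {..<K}" using that by (auto simp: S_def half_edges_def)
        hence "b (fst h) (snd h) \<in> E `` {fst h}" using bij_betwE[OF bb[of "fst h"]] by blast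
        thus "(fst h, b (fst h) (snd h)) \<in> E" "b (fst h) (snd h) \<in> {1..n}" using Er(1) by auto
      qed
      have Gh: "G b h \<in> S \<and> b (fst (G b h)) (snd (G b h)) = fst h" if "h \<in> S" for h
      proof -
        define u where "u = b (fst h) (snd h)"
        have u: "(fst h, u) \<in> E" "u \<in> {1..n}" using e[OF that] by (auto simp: u_def)
        hence "fst h \<in> E `` {u}" using Er(2) by (auto dest: symD)
        hence im: "fst h \<in> b u ` {..<K}" using bb[OF u(2)] by (simp add: bij_betw_def)
        have "G b h = (u, inv_into {..<K} (b u) (fst h))" using that by (simp add: G_def u_def)
        thus ?thesis using u(2) inv_into_into[OF im] f_inv_into_f[OF im] by (simp add: S_def half_edges_def)
      qed
      have fG: "fst (G b h) = b (fst h) (snd h)" if "h \<in> S" for h using that by (simp add: G_def)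
      have GG: "G b (G b h) = h" if h: "h \<in> S" for h
      proof -
        have f: "fst (G b (G b h)) = fst h" using fG[of "G b h"] Gh[OF h] by simp
        have "b (fst (G b (G b h))) (snd (G b (G b h))) = fst (G b h)" using Gh[of "G b h"] Gh[OF h] by simp
        hence "b (fst h) (snd (G b (G b h))) = b (fst h) (snd h)" using f fG[OF h] by simp
        moreover have "snd (G b (G b h)) < K" "snd h < K" "fst h \<in> {1..n}"
          using Gh[of "G b h"] Gh[OF h] h by (auto simp: S_def half_edges_def)
        ultimately have "snd (G b (G b h)) = snd h" using bb[of "fst h"] by (auto simp: bij_betw_def dest: inj_onD)
        thus ?thesis using f by (simp add: prod_eq_iff)
      qed
      have nl: "fst (G b h) \<noteq> fst h" if "h \<in> S" for h
        using e(1)[OF that] fG[OF that] Er(3) by (auto simp: irrefl_def)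
      have m: "G b \<in> matchings S"
        unfolding matchings_def using Gh GG nl by (auto simp: G_def)
      have d: "defective S (G b) = {}"
      proof (rule ccontr)
        assume "defective S (G b) \<noteq> {}"
        then obtain h h' where h: "h \<in> S" "h' \<in> S" "h' \<noteq> h" "fst h' = fst h" "fst (G b h') = fst (G b h)"
          using nl unfolding defective_def by blast
        hence "b (fst h) (snd h') = b (fst h) (snd h)" using fG by simp
        moreover have "snd h < K" "snd h' < K" "fst h \<in> {1..n}" using h by (auto simp: S_def half_edges_def)
        ultimately have "snd h' = snd h" using bb[of "fst h"] by (auto simp: bij_betw_def dest: inj_onD)
        thus False using h by (simp add: prod_eq_iff)
      qed
      have gr: "graph_of K n (G b) = E"
      proof (intro equalityI subsetI)
        fix p assume "p \<in> graph_of K n (G b)"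
        then obtain h where "h \<in> S" "p = (fst h, fst (G b h))" by (auto simp: graph_of_def S_def)
        thus "p \<in> E" using e(1) fG by simp
      next
        fix p assume p: "p \<in> E"
        hence v: "fst p \<in> {1..n}" "snd p \<in> E `` {fst p}" using Er(1) by auto
        then obtain i where i: "i < K" "snd p = b (fst p) i" using bb[OF v(1)] unfolding bij_betw_def by blast
        hence "(fst p, i) \<in> S" using v(1) by (simp add: S_def half_edges_def)
        thus "p \<in> graph_of K n (G b)"
          unfolding graph_of_def S_def[symmetric] using fG i(2) by (intro image_eqI[of _ _ "(fst p, i)"]) (auto simp: prod_eq_iff)
      qed
      show "G b \<in> A" using m d gr by (simp add: A_def simple_configs_def S_def)
    qed
    show "G (F M) = M" if s: "M \<in> A" for M
    proof
      fix h
      have m: "M \<in> matchings S" using s by (simp add: A_def simple_configs_def S_def)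
      show "G (F M) h = M h"
      proof (cases "h \<in> S")
        case False
        thus ?thesis using matchingsD(4)[OF m] by (simp add: G_def)
      next
        case True
        have h: "fst h \<in> {1..n}" "snd h < K" using True by (auto simp: S_def half_edges_def)
        have sh: "fst (M h) \<in> {1..n}" "snd (M h) < K" using matchingsD(1)[OF m True] by (auto simp: S_def half_edges_def)
        have 1: "F M (fst h) (snd h) = fst (M h)" using h by (simp add: F_def)
        have 2: "F M (fst (M h)) (snd (M h)) = fst h" using sh matchingsD(3)[OF m, of h] by (simp add: F_def)
        have "inj_on (F M (fst (M h))) {..<K}" using bF[OF s sh(1)] by (simp add: bij_betw_def)
        hence "inv_into {..<K} (F M (fst (M h))) (fst h) = snd (M h)"
          using 2 sh(2) by (metis inv_into_f_f lessThan_iff)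
        thus ?thesis using True 1 by (simp add: G_def)
      qed
    qed
    show "F (G b) = b" if b: "b \<in> BS" for b
    proof
      fix v
      show "F (G b) v = b v"
      proof (cases "v \<in> {1..n}")
        case True
        have "b v \<in> extensional {..<K}" using b True by (auto simp: BS_def PiE_def)
        thus ?thesis using True by (intro extensionalityI[of _ "{..<K}"]) (auto simp: F_def G_def S_def half_edges_def)
      next
        case False
        thus ?thesis using b by (auto simp: F_def BS_def extensional_def)
      qed
    qed
  qed
  thus ?thesis using cB by (simp add: A_def bij_betw_same_card)
qed

lemma finite_regular_graphs: "finite (regular_graphs K n)"
  by (rule finite_subset[of _ "Pow ({1..n} \<times> {1..n})"]) (auto simp: regular_graphs_def)

lemma finite_simple_configs: "finite (simple_configs K n)"
  using finite_matchings[OF finite_half_edges] by (simp add: simple_configs_def)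

text \<open>The default \<open>undefined\<close> outside \<open>{1..n}\<close> is that of
  \<open>Pi_pmf\<close> in \<open>graph_marks_law\<close>.\<close>

definition mark_space :: "nat \<Rightarrow> (nat \<Rightarrow> 'x) set" where
  "mark_space n = PiE_dflt {1..n} undefined (\<lambda>_. UNIV)"

lemma finite_mark_space: "finite (mark_space n :: (nat \<Rightarrow> 'x::finite) set)"
  unfolding mark_space_def by auto

lemma card_graphs_configs:
  fixes P :: "(nat \<times> nat) set \<times> (nat \<Rightarrow> 'x::finite) \<Rightarrow> bool"
  shows "card {(M, X). M \<in> simple_configs K n \<and> X \<in> mark_space n \<and> P (graph_of K n M, X)} =
    fact K ^ n * card {\<omega> \<in> regular_graphs K n \<times> mark_space n. P \<omega>}"
proof -
  define A where "A = {\<omega> \<in> regular_graphs K n \<times> mark_space n. P \<omega>}"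
  define Fb where "Fb \<omega> = {M \<in> simple_configs K n. graph_of K n M = fst \<omega>} \<times> {snd \<omega>}" for \<omega> :: "(nat \<times> nat) set \<times> (nat \<Rightarrow> 'x)"
  have finA: "finite A" unfolding A_def using finite_regular_graphs finite_mark_space by (auto intro!: finite_subset[OF _ finite_cartesian_product])
  have "{(M, X). M \<in> simple_configs K n \<and> X \<in> mark_space n \<and> P (graph_of K n M, X)} = (\<Union>\<omega>\<in>A. Fb \<omega>)"
    using graph_of_regular by (fastforce simp: A_def Fb_def)
  also have "card \<dots> = (\<Sum>\<omega>\<in>A. card (Fb \<omega>))"
    by (rule card_UN_disjoint[OF finA]) (use finite_simple_configs in \<open>auto simp: Fb_def\<close>)
  also have "\<dots> = (\<Sum>\<omega>\<in>A. fact K ^ n)"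
    by (rule sum.cong[OF refl]) (auto simp: Fb_def A_def card_cartesian_product card_configs_of_graph)
  finally show ?thesis by (simp add: A_def)
qed

text \<open>Uniform \<open>\<nu>\<close> makes the pair of graph and marks uniform, and the number
  \<open>fact K ^ n\<close> of configurations over each graph cancels.\<close>

lemma cond_prob_ratio:
  fixes \<nu> :: "'x::finite pmf"
  assumes \<nu>: "\<nu> = pmf_of_set UNIV" and ne: "regular_graphs K n \<noteq> {}"
  shows "\<P>(\<omega> in measure_pmf (graph_marks_law K \<nu> n). P \<omega> \<bar> Q \<omega>) =
    real (card {(M, X). M \<in> simple_configs K n \<and> X \<in> mark_space n \<and> P (graph_of K n M, X) \<and> Q (graph_of K n M, X)}) /
    real (card {(M, X). M \<in> simple_configs K n \<and> X \<in> mark_space n \<and> Q (graph_of K n M, X)})"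
proof -
  define RX where "RX = regular_graphs K n \<times> (mark_space n :: (nat \<Rightarrow> 'x) set)"
  have ms: "mark_space n \<noteq> ({} :: (nat \<Rightarrow> 'x) set)"
    unfolding mark_space_def PiE_dflt_def by auto
  have fin: "finite RX" "RX \<noteq> {}"
    using finite_regular_graphs finite_mark_space ne ms by (auto simp: RX_def)
  have "graph_marks_law K \<nu> n = pair_pmf (pmf_of_set (regular_graphs K n)) (pmf_of_set (mark_space n))"
    unfolding graph_marks_law_def \<nu> mark_space_def by (subst Pi_pmf_of_set) auto
  also have "\<dots> = pmf_of_set RX"
    unfolding RX_def
    using pmf_of_set[OF ne finite_regular_graphs] pmf_of_set[OF ms finite_mark_space] pmf_of_set[OF fin(2,1)]
    by (intro pmf_eqI) (auto simp: RX_def pmf_pair card_cartesian_product indicator_def)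
  finally have law: "graph_marks_law K \<nu> n = pmf_of_set RX" .
  have mm: "measure (measure_pmf (pmf_of_set RX)) {\<omega>. R \<omega>} = real (card {\<omega>\<in>RX. R \<omega>}) / real (card RX)" for R
    using measure_pmf_of_set[OF fin(2,1), of "{\<omega>. R \<omega>}"] by (simp add: Int_def)
  have cR: "real (card RX) > 0" using fin by auto
  have f0: "real (fact K ^ n) > 0" by simp
  have "\<P>(\<omega> in measure_pmf (graph_marks_law K \<nu> n). P \<omega> \<bar> Q \<omega>) =
     real (card {\<omega>\<in>RX. P \<omega> \<and> Q \<omega>}) / real (card {\<omega>\<in>RX. Q \<omega>})"
    unfolding cond_prob_def law using cR by (simp add: mm)
  also have "\<dots> = real (fact K ^ n * card {\<omega>\<in>RX. P \<omega> \<and> Q \<omega>}) / real (fact K ^ n * card {\<omega>\<in>RX. Q \<omega>})"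
    by simp
  finally show ?thesis
    using card_graphs_configs[of K n "\<lambda>\<omega>. P \<omega> \<and> Q \<omega>"] card_graphs_configs[of K n Q] by (simp only: RX_def)
qed

definition entropy_of :: "nat \<Rightarrow> real \<times> real \<times> real \<Rightarrow> real" where
  "entropy_of K z = (case z of (p, q, s) \<Rightarrow> edge_entropy K p q s)"

section \<open>Configurations with two marks\<close>

locale two_marks =
  fixes K :: nat and a b :: "'x::finite" and h :: "'x \<Rightarrow> 'x \<Rightarrow> real"
  assumes K: "K \<ge> 2" and ab: "a \<noteq> b" "UNIV = {a, b}" and h_sym: "h x y = h y x"
begin

definition cnt :: "nat \<Rightarrow> (nat \<Rightarrow> 'x) \<Rightarrow> nat" where "cnt n X = card {v\<in>{1..n}. X v = a}"

definition crs :: "nat \<Rightarrow> (nat \<Rightarrow> 'x) \<Rightarrow> (nat \<times> nat \<Rightarrow> nat \<times> nat) \<Rightarrow> nat" where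
  "crs n X M = card {e\<in>half_edges K n. X (fst e) = a \<and> X (fst (M e)) = b}"

definition edge_type :: "nat \<Rightarrow> nat \<Rightarrow> nat \<Rightarrow> real \<times> real \<times> real" where
  "edge_type n na s = ((real K * real na - real s) / (real K * real n),
     (real K * (real n - real na) - real s) / (real K * real n), real s / (real K * real n))"

definition valid_type :: "nat \<Rightarrow> nat \<Rightarrow> nat \<Rightarrow> bool" where
  "valid_type n na s \<longleftrightarrow> na \<le> n \<and> (\<exists>ea eb. K * na = s + 2 * ea \<and> K * (n - na) = s + 2 * eb)"

definition configs_of_type where
  "configs_of_type n na s X =
     typed_matchings (half_edges K n) (\<lambda>e. X (fst e)) (two_type a (K * na) (K * (n - na)) s)"

definition type_space :: "nat \<Rightarrow> nat \<Rightarrow> nat \<Rightarrow> ((nat \<Rightarrow> 'x) \<times> (nat \<times> nat \<Rightarrow> nat \<times> nat)) set" where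
  "type_space n na s = (SIGMA X:{X\<in>mark_space n. cnt n X = na}. configs_of_type n na s X)"

lemma not_a_iff: "x \<noteq> a \<longleftrightarrow> x = b"
  using ab by auto

lemma card_b: "card {v\<in>{1..n}. X v = b} = n - cnt n X"
proof -
  have "X v = b \<longleftrightarrow> X v \<noteq> a" for v using not_a_iff by blast
  hence "{v\<in>{1..n}. X v = b} = {1..n} - {v\<in>{1..n}. X v = a}" by blast
  moreover have "card ({1..n} - {v\<in>{1..n}. X v = a}) = card {1..n} - card {v\<in>{1..n}. X v = a}"
    by (rule card_Diff_subset) auto
  ultimately show ?thesis by (simp add: cnt_def)
qed

lemma cnt_le: "cnt n X \<le> n"
proof -
  have "card {v\<in>{1..n}. X v = a} \<le> card {1..n}" by (rule card_mono) auto
  thus ?thesis by (simp add: cnt_def)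
qed

lemma card_half_edges_mark:
  "card {e\<in>half_edges K n. X (fst e) = a} = K * cnt n X" "card {e\<in>half_edges K n. X (fst e) = b} = K * (n - cnt n X)"
proof -
  have "{e\<in>half_edges K n. X (fst e) = x} = {v\<in>{1..n}. X v = x} \<times> {..<K}" for x by (auto simp: half_edges_def)
  hence *: "card {e\<in>half_edges K n. X (fst e) = x} = card {v\<in>{1..n}. X v = x} * K" for x
    by simp
  show "card {e\<in>half_edges K n. X (fst e) = a} = K * cnt n X" unfolding * by (simp add: cnt_def)
  show "card {e\<in>half_edges K n. X (fst e) = b} = K * (n - cnt n X)" unfolding * card_b by simp
qed

lemma configs_of_type_cross:
  assumes "cnt n X = na"
  shows "configs_of_type n na s X =
    cross_matchings {e\<in>half_edges K n. X (fst e) = a} {e\<in>half_edges K n. X (fst e) = b} s"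
  unfolding configs_of_type_def assms[symmetric] card_half_edges_mark[symmetric]
  by (rule typed_eq_cross[OF _ ab refl refl]) simp

text \<open>The half-edges of a mark that are not matched to the other mark are matched among
  themselves, so their number is even; this is the parity condition in
  \<open>valid_type\<close>.\<close>

lemma config_in_type:
  assumes M: "M \<in> matchings (half_edges K n)"
  shows "M \<in> configs_of_type n (cnt n X) (crs n X M) X" "valid_type n (cnt n X) (crs n X M)"
proof -
  define S where "S = half_edges K n"
  define P where "P = {e\<in>S. X (fst e) = a}"
  define Q where "Q = {e\<in>S. X (fst e) = b}"
  note D = matchingsD[OF M, folded S_def]
  have finS: "finite S" by (simp add: S_def)
  have PQ: "P \<union> Q = S" "P \<inter> Q = {}" using not_a_iff by (auto simp: P_def Q_def)
  have crs: "crs n X M = card {e\<in>P. M e \<in> Q}"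
    unfolding crs_def S_def[symmetric] using D(1) by (intro arg_cong[of _ _ card]) (auto simp: P_def Q_def)
  have cm: "M \<in> cross_matchings P Q (crs n X M)"
    using M crs PQ by (simp add: cross_matchings_def S_def)
  thus "M \<in> configs_of_type n (cnt n X) (crs n X M) X"
    unfolding configs_of_type_cross[OF refl] P_def Q_def S_def .
  have half: "\<exists>e. card Y = card {x\<in>Y. M x \<in> Y'} + 2 * e" if Y: "Y \<union> Y' = S" "Y \<inter> Y' = {}" for Y Y'
  proof -
    define W where "W = Y - {x\<in>Y. M x \<in> Y'}"
    have finY: "finite Y" using Y finS by blast
    have W: "M x \<in> W \<and> M x \<noteq> x" if "x \<in> W" for x
    proof -
      have "x \<in> S" "M x \<in> S" "M (M x) = x" "M x \<noteq> x" "x \<in> Y" "M x \<notin> Y'" using that Y D(1-3)[of x] by (auto simp: W_def)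
      thus ?thesis using Y by (auto simp: W_def)
    qed
    have "(\<lambda>x. if x \<in> W then M x else x) \<in> matchings W"
      unfolding matchings_def using W D(3) by auto
    hence "even (card W)" by (rule even_card_matching[rotated]) (use finY in \<open>simp add: W_def\<close>)
    then obtain k where "card W = 2 * k" by auto
    moreover have "card W = card Y - card {x\<in>Y. M x \<in> Y'}"
      unfolding W_def by (rule card_Diff_subset) (use finY in auto)
    moreover have "card {x\<in>Y. M x \<in> Y'} \<le> card Y" by (rule card_mono[OF finY]) auto
    ultimately have "card Y = card {x\<in>Y. M x \<in> Y'} + 2 * k" by simp
    thus ?thesis ..
  qed
  have "card {x\<in>Q. M x \<in> P} = crs n X M"
  proof -
    have "M \<in> cross_matchings Q P (crs n X M)"
      using cm cross_matchings_swap[of P Q] finS by (simp add: P_def Q_def)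
    thus ?thesis by (simp add: cross_matchings_def)
  qed
  then obtain ea eb where "card P = crs n X M + 2 * ea" "card Q = crs n X M + 2 * eb"
    using half[of P Q] half[of Q P] PQ crs by auto
  thus "valid_type n (cnt n X) (crs n X M)"
    unfolding valid_type_def using cnt_le card_half_edges_mark[of n X] by (auto simp: P_def Q_def S_def)
qed

lemma type_space_crs:
  assumes "(X, M) \<in> type_space n na s" shows "cnt n X = na" "crs n X M = s" "M \<in> matchings (half_edges K n)" "X \<in> mark_space n"
proof -
  show 1: "cnt n X = na" "X \<in> mark_space n" using assms by (auto simp: type_space_def)
  have t: "M \<in> configs_of_type n na s X" using assms by (simp add: type_space_def)
  thus "M \<in> matchings (half_edges K n)" by (simp add: configs_of_type_def typed_matchings_def)
  have "crs n X M = two_type a (K * na) (K * (n - na)) s a b"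
    using t unfolding configs_of_type_def typed_matchings_def crs_def by blast
  thus "crs n X M = s" using ab(1) by (simp add: two_type_def)
qed

lemma edge_type_eq:
  assumes "K * na = s + 2 * ea" "K * (n - na) = s + 2 * eb" "na \<le> n"
  shows "edge_type n na s = (2 * real ea / (real K * real n), 2 * real eb / (real K * real n), real s / (real K * real n))"
proof -
  have "real K * real na = real s + 2 * real ea" using assms(1) by (metis of_nat_add of_nat_mult of_nat_numeral)
  moreover have "real K * (real n - real na) = real s + 2 * real eb"
    using assms(2,3) by (metis of_nat_add of_nat_mult of_nat_numeral of_nat_diff)
  ultimately show ?thesis by (simp add: edge_type_def)
qed

lemma edge_type_laws:
  assumes "valid_type n na s" "n \<ge> 1" shows "edge_type n na s \<in> edge_laws"
proof -
  obtain ea eb where e: "K * na = s + 2 * ea" "K * (n - na) = s + 2 * eb" "na \<le> n" using assms(1) by (auto simp: valid_type_def)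
  have k: "real K * real n > 0" using K assms(2) by simp
  have "(s + 2 * ea) + (s + 2 * eb) = K * n" using e by (metis distrib_left le_add_diff_inverse)
  hence "2 * real ea + 2 * real eb + 2 * real s = real K * real n" by (simp flip: of_nat_mult)
  hence "(2 * real ea + 2 * real eb + 2 * real s) / (real K * real n) = 1" using k by (simp only: divide_self)
  hence "2 * real ea / (real K * real n) + 2 * real eb / (real K * real n) + 2 * (real s / (real K * real n)) = 1"
    by (simp add: add_divide_distrib)
  thus ?thesis unfolding edge_type_eq[OF e] edge_laws_def by simp
qed

definition energy :: "real \<times> real \<times> real \<Rightarrow> real" where
  "energy z = (case z of (p, q, s) \<Rightarrow> p * h a a + q * h b b + 2 * s * h a b)"

lemma edge_sum:
  assumes M: "M \<in> matchings (half_edges K n)" and n: "n \<ge> 1"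
  shows "(\<Sum>e\<in>half_edges K n. h (X (fst e)) (X (fst (M e)))) / real n = real K * energy (edge_type n (cnt n X) (crs n X M))"
proof -
  define S where "S = half_edges K n"
  define E where "E = two_type a (K * cnt n X) (K * (n - cnt n X)) (crs n X M)"
  define N where "N x y = {e\<in>S. X (fst e) = x \<and> X (fst (M e)) = y}" for x y
  have cN: "card (N x y) = E x y" for x y
    using config_in_type(1)[OF M, of X] by (simp add: configs_of_type_def typed_matchings_def N_def E_def S_def)
  have finS: "finite S" by (simp add: S_def)
  have "S = (\<Union>p\<in>UNIV. N (fst p) (snd p))" by (auto simp: N_def)
  hence "(\<Sum>e\<in>S. h (X (fst e)) (X (fst (M e)))) = (\<Sum>p\<in>UNIV. \<Sum>e\<in>N (fst p) (snd p). h (X (fst e)) (X (fst (M e))))"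
    using finS sum.UNION_disjoint[of UNIV "\<lambda>p. N (fst p) (snd p)" "\<lambda>e. h (X (fst e)) (X (fst (M e)))"]
    by (auto simp: N_def)
  also have "\<dots> = (\<Sum>p\<in>UNIV. real (E (fst p) (snd p)) * h (fst p) (snd p))"
    by (rule sum.cong[OF refl]) (simp add: N_def flip: cN)
  also have "\<dots> = (\<Sum>x\<in>UNIV. \<Sum>y\<in>UNIV. real (E x y) * h x y)"
    by (simp add: sum.cartesian_product case_prod_beta)
  also have "\<dots> = real (E a a) * h a a + real (E b b) * h b b + (real (E a b) + real (E b a)) * h a b"
    unfolding ab(2) using ab(1) h_sym[of b a] by (simp add: algebra_simps)
  finally have sum: "(\<Sum>e\<in>S. h (X (fst e)) (X (fst (M e)))) = real (E a a) * h a a + real (E b b) * h b b + (real (E a b) + real (E b a)) * h a b" .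
  obtain ea eb where e: "K * cnt n X = crs n X M + 2 * ea" "K * (n - cnt n X) = crs n X M + 2 * eb" "cnt n X \<le> n"
    using config_in_type(2)[OF M, of X] by (auto simp: valid_type_def)
  have Ev: "E a a = 2 * ea" "E b b = 2 * eb" "E a b = crs n X M" "E b a = crs n X M"
    using ab(1) e by (auto simp: E_def two_type_def)
  have k: "real K > 0" "real n > 0" using K n by auto
  show ?thesis
    unfolding S_def[symmetric] sum Ev edge_type_eq[OF e] energy_def using k by (simp add: field_simps)
qed

definition err :: "nat \<Rightarrow> real" where "err n = 8 * (ln (real (K * n) + 1) + 1)"

lemma finite_type_space: "finite (type_space n na s)"
  unfolding type_space_def configs_of_type_def
  by (intro finite_SigmaI finite_typed finite_half_edges finite_subset[OF _ finite_mark_space]) blast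

lemma card_marks: "na \<le> n \<Longrightarrow> card {X\<in>mark_space n. cnt n X = na} = n choose na"
proof -
  let ?A = "{X\<in>mark_space n. cnt n X = na}"
  have "bij_betw (\<lambda>X. {v\<in>{1..n}. X v = a}) ?A {B. B \<subseteq> {1..n} \<and> card B = na}"
  proof (rule bij_betwI[where g = "\<lambda>B v. if v \<in> {1..n} then (if v \<in> B then a else b) else undefined"])
    show "(\<lambda>X. {v\<in>{1..n}. X v = a}) \<in> ?A \<rightarrow> {B. B \<subseteq> {1..n} \<and> card B = na}"
      by (auto simp: cnt_def)
    show "(\<lambda>B v. if v \<in> {1..n} then (if v \<in> B then a else b) else undefined) \<in> {B. B \<subseteq> {1..n} \<and> card B = na} \<rightarrow> ?A"
    proof
      fix B assume B: "B \<in> {B. B \<subseteq> {1..n} \<and> card B = na}"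
      have "{v\<in>{1..n}. (if v \<in> {1..n} then (if v \<in> B then a else b) else undefined) = a} = B" using B ab(1) by auto
      thus "(\<lambda>v. if v \<in> {1..n} then (if v \<in> B then a else b) else undefined) \<in> ?A"
        using B by (simp add: mark_space_def PiE_dflt_def cnt_def)
    qed
    show "(\<lambda>v. if v \<in> {1..n} then (if v \<in> {v\<in>{1..n}. X v = a} then a else b) else undefined) = X"
      if "X \<in> ?A" for X
      using that not_a_iff by (auto simp: mark_space_def PiE_dflt_def)
    show "{v\<in>{1..n}. (if v \<in> {1..n} then (if v \<in> B then a else b) else undefined) = a} = B" if "B \<in> {B. B \<subseteq> {1..n} \<and> card B = na}" for B
      using that ab(1) by auto
  qed
  thus ?thesis using n_subsets[of "{1..n}" na] by (simp add: bij_betw_same_card)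
qed

lemma card_type_space:
  assumes v: "valid_type n na s" and n: "n \<ge> 1"
  shows "card (type_space n na s) > 0"
    "\<bar>ln (real (card (type_space n na s))) - (rate_base K n + real n * entropy_of K (edge_type n na s))\<bar> \<le> err n"
proof -
  obtain ea eb where e: "K * na = s + 2 * ea" "K * (n - na) = s + 2 * eb" "na \<le> n" using v by (auto simp: valid_type_def)
  have ch: "(n choose na) > 0" using e(3) by simp
  have cc: "card (configs_of_type n na s X) * (fact s * fact ea * fact eb * 2 ^ (ea + eb)) = fact (K * na) * fact (K * (n - na))"
    if "cnt n X = na" for X
  proof -
    have disj: "{e\<in>half_edges K n. X (fst e) = a} \<inter> {e\<in>half_edges K n. X (fst e) = b} = {}" using ab(1) by auto
    show ?thesis
      unfolding configs_of_type_cross[OF that] e(1,2)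
      by (rule card_cross_matchings[OF _ _ disj]) (use card_half_edges_mark[of n X] that e in auto)
  qed
  define Z where "Z = (fact s * fact ea * fact eb * 2 ^ (ea + eb) :: nat)"
  have Z: "Z > 0" by (simp add: Z_def)
  \<comment> \<open>The number of matchings is the same for all mark vectors with \<open>na\<close>
    marks \<open>a\<close>; the quotient names it without reference to one of them.\<close>
  define C where "C = (fact (K * na) * fact (K * (n - na))) div Z"
  have ccC: "card (configs_of_type n na s X) = C" if "cnt n X = na" for X
    using cc[OF that] Z unfolding C_def Z_def[symmetric] by (metis div_mult_self_is_m)
  have "card {X\<in>mark_space n. cnt n X = na} > 0" using ch card_marks[OF e(3)] by simp
  then obtain X0 where X0: "cnt n X0 = na" by (metis (mono_tags, lifting) card_gt_0_iff ex_in_conv mem_Collect_eq)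
  have Ceq: "C * Z = fact (K * na) * fact (K * (n - na))" using cc[OF X0] ccC[OF X0] by (simp add: Z_def)
  hence "real (C * Z) = real (fact (K * na) * fact (K * (n - na)))" by simp
  hence Creal: "real C * (fact s * fact ea * fact eb * 2 ^ (ea + eb)) = fact (K * na) * fact (K * (n - na))"
    by (simp add: Z_def)
  have "card (type_space n na s) = (\<Sum>X\<in>{X\<in>mark_space n. cnt n X = na}. card (configs_of_type n na s X))"
    unfolding type_space_def configs_of_type_def
    by (intro card_SigmaI ballI finite_typed finite_half_edges finite_subset[OF _ finite_mark_space]) blast
  also have "\<dots> = (\<Sum>X\<in>{X\<in>mark_space n. cnt n X = na}. C)" by (rule sum.cong[OF refl]) (use ccC in simp)
  also have "\<dots> = (n choose na) * C" using card_marks[OF e(3)] by simp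
  finally have card: "card (type_space n na s) = (n choose na) * C" .
  have "1 \<le> K" using K by simp
  note T = type_count_asymptotics[OF this n _ e(1,2) Creal]
  have T1: "C > 0" by (rule T(1)) (use e(3) in simp)
  have T2: "\<bar>ln (real ((n choose na) * C)) - (rate_base K n + real n * edge_entropy K (2 * real ea / (real K * real n)) (2 * real eb / (real K * real n)) (real s / (real K * real n)))\<bar>
      \<le> 8 * (ln (real (K * n) + 1) + 1)"
    by (rule T(2)) (use e(3) in simp)
  show "card (type_space n na s) > 0" using card T1 ch by simp
  show "\<bar>ln (real (card (type_space n na s))) - (rate_base K n + real n * entropy_of K (edge_type n na s))\<bar> \<le> err n"
    using T2 unfolding card entropy_of_def edge_type_eq[OF e] err_def by simp
qed

section \<open>Entropy bounds for the conditioning event\<close>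

definition con_set :: "nat \<Rightarrow> real \<Rightarrow> ((nat \<times> nat \<Rightarrow> nat \<times> nat) \<times> (nat \<Rightarrow> 'x)) set" where
  "con_set n c = {(M, X). M \<in> simple_configs K n \<and> X \<in> mark_space n \<and> c \<le> edge_average h n (graph_of K n M, X)}"

definition feas :: "real \<Rightarrow> (real \<times> real \<times> real) set" where
  "feas c = feasible (h a a) (h b b) (h a b) (c / real K)"

lemma feas_iff: "z \<in> feas c \<longleftrightarrow> z \<in> edge_laws \<and> c \<le> real K * energy z"
proof -
  have "c / real K \<le> y \<longleftrightarrow> c \<le> real K * y" for y using K by (simp add: pos_divide_le_eq mult.commute)
  thus ?thesis by (cases z) (auto simp: feas_def feasible_def edge_laws_def energy_def)
qed

lemma con_set_iff:
  assumes "n \<ge> 1" "M \<in> simple_configs K n" "X \<in> mark_space n"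
  shows "(M, X) \<in> con_set n c \<longleftrightarrow> edge_type n (cnt n X) (crs n X M) \<in> feas c"
proof -
  have m: "M \<in> matchings (half_edges K n)" using assms(2) by (simp add: simple_configs_def)
  show ?thesis
    using assms edge_sum[OF m assms(1), of X] edge_type_laws[OF config_in_type(2)[OF m] assms(1), of X]
    by (simp add: con_set_def feas_iff edge_average_config)
qed

text \<open>There are at most \<open>(n + 1) * (K * n + 1)\<close> types, a subexponential number,
  so a bound for single types carries over to the union.\<close>

lemma con_set_bound:
  assumes n: "n \<ge> 1" and B: "\<And>na s. valid_type n na s \<Longrightarrow> edge_type n na s \<in> feas c \<Longrightarrow>
      real (card {(X, M)\<in>type_space n na s. M \<in> simple_configs K n \<and> P M X}) \<le> B" and B0: "0 \<le> B"
  shows "real (card {(M, X)\<in>con_set n c. P M X}) \<le> (real n + 1) * (real (K * n) + 1) * B"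
proof -
  let ?A = "{(M, X)\<in>con_set n c. P M X}"
  define I where "I = {(na, s). na \<le> n \<and> s \<le> K * n \<and> valid_type n na s \<and> edge_type n na s \<in> feas c}"
  have subI: "I \<subseteq> {..n} \<times> {..K * n}" by (auto simp: I_def)
  hence finI: "finite I" by (rule finite_subset) simp
  define U where "U i = {(X, M)\<in>type_space n (fst i) (snd i). M \<in> simple_configs K n \<and> P M X}" for i
  have finU: "finite (U i)" for i unfolding U_def by (rule finite_subset[OF _ finite_type_space]) auto
  have "?A \<subseteq> (\<lambda>(X, M). (M, X)) ` (\<Union>i\<in>I. U i)"
  proof
    fix p assume p: "p \<in> ?A"
    obtain M X where pp: "p = (M, X)" by (cases p)
    have c: "(M, X) \<in> con_set n c" "P M X" "M \<in> simple_configs K n" "X \<in> mark_space n"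
      using p pp by (auto simp: con_set_def)
    have m: "M \<in> matchings (half_edges K n)" using c(3) by (simp add: simple_configs_def)
    note t = config_in_type[OF m, of X]
    have "crs n X M \<le> K * cnt n X" using t(2) by (auto simp: valid_type_def)
    also have "\<dots> \<le> K * n" using cnt_le by simp
    finally have "(cnt n X, crs n X M) \<in> I"
      using t(2) cnt_le con_set_iff[OF n c(3,4)] c(1) by (simp add: I_def)
    moreover have "(X, M) \<in> U (cnt n X, crs n X M)" using c t(1) by (simp add: U_def type_space_def)
    ultimately show "p \<in> (\<lambda>(X, M). (M, X)) ` (\<Union>i\<in>I. U i)" unfolding pp by auto
  qed
  hence "card ?A \<le> card (\<Union>i\<in>I. U i)"
    by (rule surj_card_le[rotated]) (use finI finU in auto)
  also have "\<dots> \<le> (\<Sum>i\<in>I. card (U i))" by (rule card_UN_le[OF finI])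
  finally have "real (card ?A) \<le> (\<Sum>i\<in>I. real (card (U i)))"
    unfolding of_nat_sum[symmetric] of_nat_le_iff .
  also have "\<dots> \<le> (\<Sum>i\<in>I. B)" by (rule sum_mono) (use B in \<open>auto simp: I_def U_def\<close>)
  also have "\<dots> = real (card I) * B" by simp
  also have "\<dots> \<le> real ((n + 1) * (K * n + 1)) * B"
  proof (rule mult_right_mono[OF _ B0])
    have "card I \<le> card ({..n} \<times> {..K * n})" by (rule card_mono[OF _ subI]) simp
    thus "real (card I) \<le> real ((n + 1) * (K * n + 1))" by (simp only: card_cartesian_product card_atMost Suc_eq_plus1 of_nat_le_iff)
  qed
  finally show ?thesis by (simp add: algebra_simps)
qed

definition top_rate :: "real \<Rightarrow> real" where
  "top_rate c = Sup (entropy_of K ` feas c)"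

definition c_max :: real where "c_max = real K * max (h a a) (max (h b b) (h a b))"
definition c_mean :: real where "c_mean = real K * ((h a a + h b b + 2 * h a b) / 4)"

lemma admissible:
  assumes "c_mean < c" "c < c_max"
  shows "(h a a + h b b + 2 * h a b) / 4 < c / real K" "c / real K < max (h a a) (max (h b b) (h a b))"
  using assms K unfolding c_mean_def c_max_def by (simp_all add: pos_less_divide_eq pos_divide_less_eq mult.commute)

lemma continuous_on_entropy_of: "continuous_on edge_laws (entropy_of K)"
  using continuous_on_edge_entropy[of K] by (simp add: entropy_of_def[abs_def])

lemma top_rate_attained:
  assumes "c_mean < c" "c < c_max"
  shows "\<exists>z\<in>feas c. entropy_of K z = top_rate c" "z' \<in> feas c \<Longrightarrow> entropy_of K z' \<le> top_rate c"
proof -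
  obtain p q s where "0 < p" "0 < q" "0 < s" "p + q + 2 * s = 1" "p * h a a + q * h b b + 2 * s * h a b = c / real K"
    using interior_feasible[OF admissible[OF assms]] by blast
  hence "(p, q, s) \<in> feas c" by (simp add: feas_def feasible_def)
  hence ne: "feas c \<noteq> {}" by blast
  have "continuous_on (feas c) (entropy_of K)"
    unfolding feas_def by (rule continuous_on_subset[OF continuous_on_entropy_of feasible_subset])
  then obtain z where z: "z \<in> feas c" "\<And>z'. z' \<in> feas c \<Longrightarrow> entropy_of K z' \<le> entropy_of K z"
    using continuous_attains_sup[OF _ ne] compact_feasible unfolding feas_def by metis
  have "top_rate c = entropy_of K z" unfolding top_rate_def by (rule cSup_eq_maximum) (use z in auto)
  thus "\<exists>z\<in>feas c. entropy_of K z = top_rate c" "z' \<in> feas c \<Longrightarrow> entropy_of K z' \<le> top_rate c"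
    using z by auto
qed

lemma top_rate_antimono:
  assumes "c_mean < c" "c \<le> c'" "c' < c_max" shows "top_rate c' \<le> top_rate c"
proof -
  obtain z where z: "z \<in> feas c'" "entropy_of K z = top_rate c'" using top_rate_attained(1)[of c'] assms by auto
  hence "z \<in> feas c" using assms(2) by (auto simp: feas_iff)
  thus ?thesis using top_rate_attained(2)[of c z] assms z(2) by auto
qed

lemma top_rate_approx:
  assumes "c_mean < c" "c < c_max" "0 < e"
  shows "\<exists>p q s. 0 < p \<and> 0 < q \<and> 0 < s \<and> p + q + 2 * s = 1 \<and> c < real K * energy (p, q, s) \<and> top_rate c - e < entropy_of K (p, q, s)"
proof -
  obtain p q s where z: "(p, q, s) \<in> feas c" "entropy_of K (p, q, s) = top_rate c" using top_rate_attained(1)[OF assms(1,2)] by auto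
  have "c / real K < y \<longleftrightarrow> c < real K * y" for y using K by (simp add: pos_divide_less_eq mult.commute)
  thus ?thesis
    using entropy_interior_approx[OF admissible[OF assms(1,2)] z(1)[unfolded feas_def] assms(3), of K] z(2)
    by (simp add: entropy_of_def energy_def)
qed

text \<open>A nearly optimal law of energy strictly above \<open>c\<close> remains feasible for all
  slightly stronger constraints.\<close>

lemma top_rate_right_continuous:
  assumes "c_mean < c" "c < c_max" "0 < e"
  shows "\<exists>d>0. \<forall>\<delta>. 0 < \<delta> \<and> \<delta> < d \<longrightarrow> c + \<delta> < c_max \<and> top_rate c - e < top_rate (c + \<delta>)"
proof -
  obtain p q s where z: "0 < p" "0 < q" "0 < s" "p + q + 2 * s = 1" "c < real K * energy (p, q, s)" "top_rate c - e < entropy_of K (p, q, s)"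
    using top_rate_approx[OF assms] by blast
  define d where "d = min (c_max - c) (real K * energy (p, q, s) - c)"
  have "c + \<delta> < c_max \<and> top_rate c - e < top_rate (c + \<delta>)" if "0 < \<delta> \<and> \<delta> < d" for \<delta>
  proof -
    have "(p, q, s) \<in> feas (c + \<delta>)" using z that by (auto simp: feas_iff edge_laws_def d_def)
    moreover have "c_mean < c + \<delta>" "c + \<delta> < c_max" using assms that by (auto simp: d_def)
    ultimately show ?thesis using top_rate_attained(2)[of "c + \<delta>" "(p, q, s)"] z(6) by auto
  qed
  moreover have "d > 0" using assms z by (simp add: d_def)
  ultimately show ?thesis by blast
qed

text \<open>\<open>C\<close> and \<open>D\<close> make room for the additional losses of the lower
  bound: the fibres of the repair map and a factor 2.\<close>

lemma err_sublinear:
  assumes "0 < e"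
  shows "eventually (\<lambda>n. ln ((real n + 1) * (real (K * n) + 1)) + 2 * err n + C * ln (real (K * n) + 1) + D \<le> e * real n) sequentially"
proof -
  have lim: "(\<lambda>n. ln (k * real n + 1) / real n) \<longlonglongrightarrow> 0" if "k > 0" for k :: real
  proof -
    have "((\<lambda>x::real. ln x / x) \<longlongrightarrow> 0) at_top" by (rule ln_x_over_x_tendsto_0)
    moreover have "filterlim (\<lambda>n. 1 + k * real n) at_top sequentially"
      by (rule filterlim_tendsto_add_at_top[OF tendsto_const
            filterlim_tendsto_pos_mult_at_top[OF tendsto_const that filterlim_real_sequentially]])
    hence "filterlim (\<lambda>n. k * real n + 1) at_top sequentially" by (simp add: add.commute)
    ultimately have "(\<lambda>n. ln (k * real n + 1) / (k * real n + 1)) \<longlonglongrightarrow> 0" by (rule filterlim_compose)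
    moreover have "(\<lambda>n. k + 1 / real n) \<longlonglongrightarrow> k + 0" by (intro tendsto_intros lim_1_over_n)
    ultimately have "(\<lambda>n. (ln (k * real n + 1) / (k * real n + 1)) * (k + 1 / real n)) \<longlonglongrightarrow> 0 * (k + 0)" by (rule tendsto_mult)
    hence "(\<lambda>n. (ln (k * real n + 1) / (k * real n + 1)) * (k + 1 / real n)) \<longlonglongrightarrow> 0" by simp
    moreover have "eventually (\<lambda>n. (ln (k * real n + 1) / (k * real n + 1)) * (k + 1 / real n) = ln (k * real n + 1) / real n) sequentially"
      using eventually_gt_at_top[of 0]
    proof eventually_elim
      case (elim n)
      have "k * real n + 1 > 0" using that by (simp add: add_nonneg_pos)
      moreover have "k + 1 / real n = (k * real n + 1) / real n" using elim by (simp add: field_simps)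
      ultimately show ?case by simp
    qed
    ultimately show ?thesis by (rule Lim_transform_eventually)
  qed
  have "(\<lambda>n. ln (1 * real n + 1) / real n + (1 + 16 + C) * (ln (real K * real n + 1) / real n) + (16 + D) * (1 / real n)) \<longlonglongrightarrow> 0 + (1 + 16 + C) * 0 + (16 + D) * 0"
    by (intro tendsto_intros lim lim_1_over_n) (use K in auto)
  hence "eventually (\<lambda>n. ln (1 * real n + 1) / real n + (1 + 16 + C) * (ln (real K * real n + 1) / real n) + (16 + D) * (1 / real n) < e) sequentially"
    by (rule order_tendstoD) (use assms in simp)
  thus ?thesis using eventually_gt_at_top[of 0]
  proof eventually_elim
    case (elim n)
    have "(ln (1 * real n + 1) / real n + (1 + 16 + C) * (ln (real K * real n + 1) / real n) + (16 + D) * (1 / real n)) * real n \<le> e * real n"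
      by (rule mult_right_mono) (use elim in auto)
    moreover have "(ln (1 * real n + 1) / real n + (1 + 16 + C) * (ln (real K * real n + 1) / real n) + (16 + D) * (1 / real n)) * real n =
       ln (real n + 1) + (17 + C) * ln (real K * real n + 1) + (16 + D)" using elim by (simp add: field_simps)
    moreover have "ln ((real n + 1) * (real (K * n) + 1)) = ln (real n + 1) + ln (real K * real n + 1)"
      using ln_mult_pos[of "real n + 1" "real (K * n) + 1"] by (simp add: add_nonneg_pos)
    ultimately show ?case by (simp add: err_def algebra_simps)
  qed
qed

lemma card_type_space_le:
  assumes "valid_type n na s" "n \<ge> 1" "entropy_of K (edge_type n na s) \<le> y"
  shows "real (card (type_space n na s)) \<le> exp (rate_base K n + real n * y + err n)"
proof -
  have "real n * entropy_of K (edge_type n na s) \<le> real n * y" by (rule mult_left_mono[OF assms(3)]) simp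
  hence "ln (real (card (type_space n na s))) \<le> rate_base K n + real n * y + err n"
    using card_type_space(2)[OF assms(1,2)] by linarith
  thus ?thesis using card_type_space(1)[OF assms(1,2)] by (metis exp_le_cancel_iff exp_ln of_nat_0_less_iff)
qed

lemma con_set_upper:
  assumes c: "c_mean < c" "c < c_max" and e: "0 < e"
  shows "eventually (\<lambda>n. real (card (con_set n c)) \<le> exp (rate_base K n + real n * (top_rate c + e))) sequentially"
  using err_sublinear[OF e, of 0 0] eventually_ge_at_top[of 1]
proof eventually_elim
  case (elim n)
  have "real (card {(M, X)\<in>con_set n c. True}) \<le> (real n + 1) * (real (K * n) + 1) * exp (rate_base K n + real n * top_rate c + err n)"
  proof (rule con_set_bound[OF elim(2)])
    fix na s assume v: "valid_type n na s" "edge_type n na s \<in> feas c"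
    have "card {(X, M)\<in>type_space n na s. M \<in> simple_configs K n \<and> True} \<le> card (type_space n na s)"
      by (rule card_mono[OF finite_type_space]) auto
    thus "real (card {(X, M)\<in>type_space n na s. M \<in> simple_configs K n \<and> True}) \<le> exp (rate_base K n + real n * top_rate c + err n)"
      using card_type_space_le[OF v(1) elim(2) top_rate_attained(2)[OF c v(2)]] by linarith
  qed simp
  also have "\<dots> = exp (ln ((real n + 1) * (real (K * n) + 1)) + (rate_base K n + real n * top_rate c + err n))"
    by (subst exp_add, subst exp_ln) (auto intro!: mult_pos_pos simp: add_nonneg_pos)
  also have "\<dots> \<le> exp (rate_base K n + real n * (top_rate c + e))"
  proof -
    have "0 \<le> err n" by (simp add: err_def)
    thus ?thesis using elim(1) by (simp add: algebra_simps)
  qed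
  finally show ?case by simp
qed

end

section \<open>Lower bound through repaired configurations\<close>

lemma foldr_updates:
  "foldr (\<lambda>p f. f(fst p := snd p)) (map (\<lambda>x. (x, g x)) ys) \<tau> = (\<lambda>x. if x \<in> set ys then g x else \<tau> x)"
  by (induction ys) auto

text \<open>A nearby matching is coded by \<open>m\<close> pairs of a half-edge and its new partner.
  Shorter lists are padded with one half-edge and its own partner, which leaves the result of the
  updates unchanged.\<close>

lemma card_near_matchings:
  assumes S: "finite S" "S \<noteq> {}" and \<tau>: "\<tau> \<in> matchings S"
  shows "card {M\<in>matchings S. card {e\<in>S. M e \<noteq> \<tau> e} \<le> m} \<le> (card S * card S) ^ m"
proof -
  define L where "L = {l. set l \<subseteq> S \<times> S \<and> length l = m}"
  define U where "U l = foldr (\<lambda>p f. f(fst p := snd p)) l \<tau>" for l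
  have finL: "finite L" unfolding L_def by (rule finite_lists_length_eq) (use S in simp)
  obtain e0 where e0: "e0 \<in> S" using S by auto
  have "{M\<in>matchings S. card {e\<in>S. M e \<noteq> \<tau> e} \<le> m} \<subseteq> U ` L"
  proof
    fix M assume "M \<in> {M\<in>matchings S. card {e\<in>S. M e \<noteq> \<tau> e} \<le> m}"
    hence s: "M \<in> matchings S" and c: "card {e\<in>S. M e \<noteq> \<tau> e} \<le> m" by auto
    obtain xs where xs: "set xs = {e\<in>S. M e \<noteq> \<tau> e}" "distinct xs"
      using finite_distinct_list[of "{e\<in>S. M e \<noteq> \<tau> e}"] S by auto
    define ys where "ys = xs @ replicate (m - length xs) e0"
    have "length xs \<le> m" using c xs distinct_card by metis
    hence len: "length ys = m" by (simp add: ys_def)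
    have "set xs \<subseteq> S" unfolding xs(1) by blast
    hence sy: "set ys \<subseteq> S" using e0 by (simp add: ys_def set_replicate_conv_if)
    have "U (map (\<lambda>x. (x, M x)) ys) = M"
    proof
      fix x
      have "M x = \<tau> x" if "x \<notin> set ys"
      proof (cases "x \<in> S")
        case True
        thus ?thesis using that xs by (auto simp: ys_def)
      next
        case False
        thus ?thesis using matchingsD(4)[OF s] matchingsD(4)[OF \<tau>] by simp
      qed
      thus "U (map (\<lambda>x. (x, M x)) ys) x = M x" unfolding U_def foldr_updates by simp
    qed
    moreover have "map (\<lambda>x. (x, M x)) ys \<in> L" using sy len matchingsD(1)[OF s] by (auto simp: L_def)
    ultimately show "M \<in> U ` L" by (metis imageI)
  qed
  hence "card {M\<in>matchings S. card {e\<in>S. M e \<noteq> \<tau> e} \<le> m} \<le> card L" by (rule surj_card_le[OF finL])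
  also have "card L = (card S * card S) ^ m"
    unfolding L_def by (subst card_lists_length_eq) (use S in \<open>auto simp: card_cartesian_product\<close>)
  finally show ?thesis .
qed

text \<open>Markov's inequality for an integer-valued quantity: exceeding \<open>K\<close> means
  being at least \<open>K + 1\<close>.\<close>

lemma markov_half:
  fixes f :: "'t \<Rightarrow> nat"
  assumes "finite A" "(\<Sum>x\<in>A. real (f x)) \<le> K1 * real (card A)" "2 * K1 \<le> real K + 1"
  shows "real (card A) \<le> 2 * real (card {x\<in>A. f x \<le> K})"
proof -
  have "(real K + 1) * real (card {x\<in>A. \<not> f x \<le> K}) = (\<Sum>x\<in>{x\<in>A. \<not> f x \<le> K}. real K + 1)" by simp
  also have "\<dots> \<le> (\<Sum>x\<in>{x\<in>A. \<not> f x \<le> K}. real (f x))" by (rule sum_mono) auto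
  also have "\<dots> \<le> (\<Sum>x\<in>A. real (f x))" by (rule sum_mono2) (use assms(1) in auto)
  also have "\<dots> \<le> K1 * real (card A)" by (rule assms(2))
  also have "\<dots> \<le> (real K + 1) / 2 * real (card A)" by (rule mult_right_mono) (use assms(3) in auto)
  finally have "(real K + 1) * real (card {x\<in>A. \<not> f x \<le> K}) \<le> (real K + 1) * (real (card A) / 2)" by simp
  hence "real (card {x\<in>A. \<not> f x \<le> K}) \<le> real (card A) / 2" by simp
  moreover have "card A = card {x\<in>A. f x \<le> K} + card {x\<in>A. \<not> f x \<le> K}"
  proof -
    have "A = {x\<in>A. f x \<le> K} \<union> {x\<in>A. \<not> f x \<le> K}" by auto
    thus ?thesis using assms(1) card_Un_disjoint[of "{x\<in>A. f x \<le> K}" "{x\<in>A. \<not> f x \<le> K}"] by auto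
  qed
  ultimately show ?thesis by simp
qed

lemma floor_ratio_tendsto: "(\<lambda>n. real (nat \<lfloor>y * real n\<rfloor>) / real n) \<longlonglongrightarrow> y" if "0 \<le> y" for y :: real
proof (rule tendsto_sandwich)
  show "eventually (\<lambda>n. y - 1 / real n \<le> real (nat \<lfloor>y * real n\<rfloor>) / real n) sequentially"
    using eventually_gt_at_top[of 0]
  proof eventually_elim
    case (elim n)
    have "y * real n - 1 \<le> real (nat \<lfloor>y * real n\<rfloor>)" by linarith
    hence "(y * real n - 1) / real n \<le> real (nat \<lfloor>y * real n\<rfloor>) / real n" by (rule divide_right_mono) simp
    thus ?case using elim by (simp add: diff_divide_distrib)
  qed
  show "eventually (\<lambda>n. real (nat \<lfloor>y * real n\<rfloor>) / real n \<le> y) sequentially"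
    using eventually_gt_at_top[of 0]
  proof eventually_elim
    case (elim n)
    have "real (nat \<lfloor>y * real n\<rfloor>) \<le> y * real n" using that by simp
    thus ?case using elim by (simp add: divide_le_eq)
  qed
  have "(\<lambda>n. y - 1 / real n) \<longlonglongrightarrow> y - 0" by (intro tendsto_intros lim_1_over_n)
  thus "(\<lambda>n. y - 1 / real n) \<longlonglongrightarrow> y" by simp
qed simp

context two_marks
begin

text \<open>
  Most configurations of a fixed type have boundedly many defects. Repairing them is a map with
  subexponential fibres that hardly changes the energy, so simple graphs are as many as configurations.
\<close>

lemma simple_lower_bound:
  assumes n: "n \<ge> 1" and v: "valid_type n na s" and d: "0 < d" "d \<le> 1"
    and large: "d * real (K * n) + 4 \<le> real (K * na)" "d * real (K * n) + 4 \<le> real (K * (n - na))"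
    and J: "2 * (real K / d ^ 2 + real K ^ 2 / d ^ 4) \<le> real J + 1" "K * n > 4 * K * (K + 1) + J"
    and H: "\<And>x y. \<bar>h x y\<bar> \<le> H"
    and c: "c + 8 * real J * H / real n \<le> real K * energy (edge_type n na s)"
  shows "real (card (type_space n na s)) \<le> 2 * real (card (con_set n c)) * real (K * n) ^ (8 * J)"
proof -
  let ?A = "(real K / d ^ 2 + real K ^ 2 / d ^ 4)"
  define S where "S = half_edges K n"
  have cS: "card S = K * n" by (simp add: S_def half_edges_def)
  have finS: "finite S" "S \<noteq> {}" using cS n K by (auto simp: S_def intro: card_gt_0_iff[THEN iffD1])
  have H0: "0 \<le> H" using H[of a a] by linarith
  define Gd where "Gd = {p\<in>type_space n na s. card (defective S (snd p)) \<le> J}"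
  have finG: "finite Gd" unfolding Gd_def using finite_type_space by simp
  have half: "real (card (type_space n na s)) \<le> 2 * real (card Gd)"
    unfolding Gd_def
  proof (rule markov_half[OF finite_type_space _ J(1)])
    define D where "D = {X\<in>mark_space n. cnt n X = na}"
    have finD: "finite D" unfolding D_def by (rule finite_subset[OF _ finite_mark_space]) blast
    have finC: "finite (configs_of_type n na s X)" for X unfolding configs_of_type_def by (rule finite_typed[OF finite_half_edges])
    have "(\<Sum>p\<in>type_space n na s. real (card (defective S (snd p)))) = (\<Sum>X\<in>D. \<Sum>M\<in>configs_of_type n na s X. real (card (defective S M)))"
      unfolding type_space_def D_def[symmetric] by (subst sum.Sigma) (use finD finC in \<open>auto simp: case_prod_beta\<close>)
    also have "\<dots> \<le> (\<Sum>X\<in>D. ?A * real (card (configs_of_type n na s X)))"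
    proof (rule sum_mono)
      fix X assume X: "X \<in> D"
      show "(\<Sum>M\<in>configs_of_type n na s X. real (card (defective S M))) \<le> ?A * real (card (configs_of_type n na s X))"
        unfolding configs_of_type_def S_def
      proof (rule expected_defects[OF _ n d(1)])
        show "1 \<le> K" using K by simp
        fix v assume "v \<in> {1..n}"
        show "d * real (K * n) + 4 \<le> real (K * card {u\<in>{1..n}. X u = X v})"
        proof (cases "X v = a")
          case True
          thus ?thesis using large(1) X by (simp add: D_def cnt_def)
        next
          case False
          hence "X v = b" using not_a_iff by blast
          thus ?thesis using large(2) X card_b[of n X] by (simp add: D_def)
        qed
      next
        fix x y
        have "na \<le> n" "s \<le> K * na" using v by (auto simp: valid_type_def)
        moreover have "K * na \<le> K * n" "K * (n - na) \<le> K * n" using calculation by (auto intro: mult_le_mono2)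
        ultimately have "K * na - s \<le> K * n" "K * (n - na) - s \<le> K * n" "s \<le> K * n" by linarith+
        thus "two_type a (K * na) (K * (n - na)) s x y \<le> K * n" unfolding two_type_def by simp
      qed
    qed
    also have "\<dots> = ?A * real (card (type_space n na s))"
      unfolding type_space_def D_def[symmetric] using finD finC by (subst card_SigmaI) (auto simp: sum_distrib_left)
    finally show "(\<Sum>p\<in>type_space n na s. real (card (defective S (snd p)))) \<le> ?A * real (card (type_space n na s))" .
  qed
  have rep: "\<exists>M'. M' \<in> simple_configs K n \<and> card {e\<in>S. snd p e \<noteq> M' e} \<le> 4 * J" if p: "p \<in> Gd" for p
  proof -
    have "(fst p, snd p) \<in> type_space n na s" using p by (simp add: Gd_def)
    hence m: "snd p \<in> matchings (half_edges K n)" by (rule type_space_crs(3))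
    have cd: "card (defective (half_edges K n) (snd p)) \<le> J" using p by (simp add: Gd_def S_def)
    obtain M' where "M' \<in> matchings (half_edges K n)" "defective (half_edges K n) M' = {}"
      "card {h\<in>half_edges K n. snd p h \<noteq> M' h} \<le> 4 * card (defective (half_edges K n) (snd p))"
      using repair_defects[OF m cd J(2)] by blast
    thus ?thesis using cd by (intro exI[of _ M']) (auto simp: simple_configs_def S_def)
  qed
  define R where "R p = (SOME M'. M' \<in> simple_configs K n \<and> card {e\<in>S. snd p e \<noteq> M' e} \<le> 4 * J)" for p :: "(nat \<Rightarrow> 'x) \<times> (nat \<times> nat \<Rightarrow> nat \<times> nat)"
  have R: "R p \<in> simple_configs K n" "card {e\<in>S. snd p e \<noteq> R p e} \<le> 4 * J" if "p \<in> Gd" for p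
    using someI_ex[OF rep[OF that]] by (auto simp: R_def)
  have fincon: "finite (con_set n c)"
    by (rule finite_subset[of _ "simple_configs K n \<times> mark_space n"])
       (use finite_simple_configs finite_mark_space in \<open>auto simp: con_set_def\<close>)
  \<comment> \<open>Each of the at most \<open>4 * J\<close> changed half-edges alters the energy
    sum by at most \<open>2 * H\<close>; this is the slack \<open>8 * J * H / n\<close> in the
    hypothesis.\<close>
  have inC: "(R p, fst p) \<in> con_set n c" if p: "p \<in> Gd" for p
  proof -
    obtain X M where pp: "p = (X, M)" by (cases p)
    have t: "(X, M) \<in> type_space n na s" using p pp by (simp add: Gd_def)
    note tc = type_space_crs[OF t]
    define f where "f \<tau> e = h (X (fst e)) (X (fst (\<tau> e)))" for \<tau> :: "nat \<times> nat \<Rightarrow> nat \<times> nat" and e :: "nat \<times> nat"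
    define Df where "Df = {e\<in>S. M e \<noteq> R p e}"
    have "(\<Sum>e\<in>S. f M e) - (\<Sum>e\<in>S. f (R p) e) = (\<Sum>e\<in>S. f M e - f (R p) e)" by (simp add: sum_subtractf)
    also have "\<dots> = (\<Sum>e\<in>Df. f M e - f (R p) e)"
      by (rule sum.mono_neutral_right) (use finS in \<open>auto simp: Df_def f_def\<close>)
    also have "\<dots> \<le> (\<Sum>e\<in>Df. 2 * H)"
    proof (rule sum_mono)
      fix e
      have "\<bar>f M e\<bar> \<le> H" "\<bar>f (R p) e\<bar> \<le> H" unfolding f_def by (rule H)+
      thus "f M e - f (R p) e \<le> 2 * H" by linarith
    qed
    also have "\<dots> = real (card Df) * (2 * H)" by simp
    also have "\<dots> \<le> real (4 * J) * (2 * H)"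
      by (rule mult_right_mono) (use R(2)[OF p] H0 pp in \<open>auto simp: Df_def simp del: of_nat_mult\<close>)
    finally have "(\<Sum>e\<in>S. f M e) - 8 * real J * H \<le> (\<Sum>e\<in>S. f (R p) e)" by simp
    hence "((\<Sum>e\<in>S. f M e) - 8 * real J * H) / real n \<le> (\<Sum>e\<in>S. f (R p) e) / real n" by (rule divide_right_mono) simp
    moreover have "(\<Sum>e\<in>S. f M e) / real n = real K * energy (edge_type n na s)"
      using edge_sum[OF tc(3) n, of X] tc(1,2) by (simp add: f_def S_def)
    ultimately have "c \<le> (\<Sum>e\<in>S. f (R p) e) / real n" using c by (simp add: diff_divide_distrib)
    thus ?thesis
      using R(1)[OF p] tc(4) pp by (simp add: con_set_def edge_average_config f_def S_def)
  qed
  have "Gd \<subseteq> (\<Union>q\<in>con_set n c. {p\<in>Gd. (R p, fst p) = q})" using inC by blast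
  hence "card Gd \<le> card (\<Union>q\<in>con_set n c. {p\<in>Gd. (R p, fst p) = q})"
    by (rule card_mono[rotated]) (use fincon finG in auto)
  also have "\<dots> \<le> (\<Sum>q\<in>con_set n c. card {p\<in>Gd. (R p, fst p) = q})" by (rule card_UN_le[OF fincon])
  \<comment> \<open>All preimages of a configuration under the repair differ from it in at most
    \<open>4 * J\<close> half-edges, so \<open>card_near_matchings\<close> bounds the
    fibres.\<close>
  also have "\<dots> \<le> (\<Sum>q\<in>con_set n c. (K * n * (K * n)) ^ (4 * J))"
  proof (rule sum_mono)
    fix q assume q: "q \<in> con_set n c"
    have fq: "fst q \<in> matchings S" using q by (auto simp: con_set_def simple_configs_def S_def)
    define MM where "MM = {M\<in>matchings S. card {e\<in>S. M e \<noteq> fst q e} \<le> 4 * J}"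
    have finM: "finite MM" unfolding MM_def using finite_matchings[OF finS(1)] by simp
    have "{p\<in>Gd. (R p, fst p) = q} \<subseteq> (\<lambda>M. (snd q, M)) ` MM"
    proof
      fix p assume p: "p \<in> {p\<in>Gd. (R p, fst p) = q}"
      hence "(fst p, snd p) \<in> type_space n na s" by (simp add: Gd_def)
      hence "snd p \<in> matchings S" unfolding S_def by (rule type_space_crs(3))
      moreover have "card {e\<in>S. snd p e \<noteq> fst q e} \<le> 4 * J" using R(2)[of p] p by auto
      ultimately have "snd p \<in> MM" by (simp add: MM_def)
      moreover have "p = (snd q, snd p)" using p by auto
      ultimately show "p \<in> (\<lambda>M. (snd q, M)) ` MM" by blast
    qed
    hence "card {p\<in>Gd. (R p, fst p) = q} \<le> card MM" by (rule surj_card_le[OF finM])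
    also have "\<dots> \<le> (card S * card S) ^ (4 * J)" unfolding MM_def by (rule card_near_matchings[OF finS fq])
    finally show "card {p\<in>Gd. (R p, fst p) = q} \<le> (K * n * (K * n)) ^ (4 * J)" unfolding cS .
  qed
  also have "\<dots> = card (con_set n c) * (K * n) ^ (8 * J)"
  proof -
    have "(K * n * (K * n)) ^ (4 * J) = (K * n) ^ (8 * J)" by (simp only: power2_eq_square[symmetric] power_mult[symmetric]) simp
    thus ?thesis by simp
  qed
  finally have "real (card Gd) \<le> real (card (con_set n c)) * real (K * n) ^ (8 * J)"
    by (metis of_nat_le_iff of_nat_mult of_nat_power)
  thus ?thesis using half by linarith
qed

lemma con_set_lower:
  assumes c: "c_mean < c" "c < c_max" and e: "0 < e"
  shows "eventually (\<lambda>n. even (n * K) \<longrightarrow> exp (rate_base K n + real n * (top_rate c - e)) \<le> real (card (con_set n c))) sequentially"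
proof -
  have "0 < e / 2" using e by simp
  from top_rate_approx[OF c this] obtain p q s where z: "0 < p" "0 < q" "0 < s" "p + q + 2 * s = 1"
    "c < real K * energy (p, q, s)" "top_rate c - e / 2 < entropy_of K (p, q, s)" by blast
  define na where "na n = nat \<lfloor>(p + s) * real n\<rfloor>" for n
  \<comment> \<open>Rounding must respect parity: \<open>sn\<close> is made congruent to
    \<open>K * na\<close> modulo 2. For even \<open>n * K\<close> it is then congruent to
    \<open>K * (n - na)\<close>, too.\<close>
  define sn where "sn n = 2 * nat \<lfloor>(real K * s / 2) * real n\<rfloor> + K * na n mod 2" for n
  have k0: "real K > 0" using K by simp
  have l1: "(\<lambda>n. real (na n) / real n) \<longlonglongrightarrow> p + s" unfolding na_def by (rule floor_ratio_tendsto) (use z in simp)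
  have lm: "(\<lambda>n. real (K * na n mod 2) / real n) \<longlonglongrightarrow> 0"
  proof (rule tendsto_sandwich[OF _ _ tendsto_const lim_1_over_n])
    show "eventually (\<lambda>n. real (K * na n mod 2) / real n \<le> 1 / real n) sequentially"
      by (rule always_eventually, rule allI, rule divide_right_mono) auto
  qed simp
  have "(\<lambda>n. 2 * (real (nat \<lfloor>(real K * s / 2) * real n\<rfloor>) / real n) + real (K * na n mod 2) / real n) \<longlonglongrightarrow> 2 * (real K * s / 2) + 0"
    by (intro tendsto_intros lm floor_ratio_tendsto) (use z k0 in simp)
  hence l2: "(\<lambda>n. real (sn n) / real n) \<longlonglongrightarrow> real K * s"
    by (simp add: sn_def add_divide_distrib)
  have nz: "eventually (\<lambda>n. real n \<noteq> 0) sequentially" using eventually_gt_at_top[of 0] by eventually_elim simp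
  have t3: "(\<lambda>n. real (sn n) / (real K * real n)) \<longlonglongrightarrow> s"
  proof -
    have "(\<lambda>n. real (sn n) / real n / real K) \<longlonglongrightarrow> real K * s / real K" by (intro tendsto_intros l2) (use k0 in simp)
    thus ?thesis using k0 by (simp add: mult.commute)
  qed
  have t1: "(\<lambda>n. (real K * real (na n) - real (sn n)) / (real K * real n)) \<longlonglongrightarrow> p"
  proof -
    have "(\<lambda>n. real (na n) / real n - real (sn n) / (real K * real n)) \<longlonglongrightarrow> (p + s) - s" by (intro tendsto_intros l1 t3)
    thus ?thesis using k0 by (simp add: diff_divide_distrib)
  qed
  have t2: "(\<lambda>n. (real K * (real n - real (na n)) - real (sn n)) / (real K * real n)) \<longlonglongrightarrow> q"
  proof -
    have "(\<lambda>n. 1 - real (na n) / real n - real (sn n) / (real K * real n)) \<longlonglongrightarrow> 1 - (p + s) - s" by (intro tendsto_intros l1 t3)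
    moreover have "1 - (p + s) - s = q" using z(4) by simp
    ultimately have "(\<lambda>n. 1 - real (na n) / real n - real (sn n) / (real K * real n)) \<longlonglongrightarrow> q" by simp
    moreover have "eventually (\<lambda>n. 1 - real (na n) / real n - real (sn n) / (real K * real n) =
       (real K * (real n - real (na n)) - real (sn n)) / (real K * real n)) sequentially"
      using nz by eventually_elim (use k0 in \<open>simp add: field_simps\<close>)
    ultimately show ?thesis by (rule Lim_transform_eventually)
  qed
  have et: "(\<lambda>n. edge_type n (na n) (sn n)) \<longlonglongrightarrow> (p, q, s)"
    unfolding edge_type_def by (intro tendsto_Pair t1 t2 t3)
  have pos1: "eventually (\<lambda>n. 0 < (real K * real (na n) - real (sn n)) / (real K * real n)) sequentially"
    by (rule order_tendstoD(1)[OF t1 z(1)])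
  have pos2: "eventually (\<lambda>n. 0 < (real K * (real n - real (na n)) - real (sn n)) / (real K * real n)) sequentially"
    by (rule order_tendstoD(1)[OF t2 z(2)])
  have valid: "eventually (\<lambda>n. even (n * K) \<longrightarrow> valid_type n (na n) (sn n)) sequentially"
    using pos1 pos2 eventually_gt_at_top[of 0]
  proof eventually_elim
    case (elim n)
    have kn: "real K * real n > 0" using k0 elim(3) by simp
    have 1: "real (sn n) < real K * real (na n)" using elim(1) kn by (simp add: zero_less_divide_iff)
    have 2: "real (sn n) < real K * (real n - real (na n))" using elim(2) kn by (simp add: zero_less_divide_iff)
    have nn: "na n \<le> n"
    proof -
      have "0 < real K * (real n - real (na n))" using 2 by linarith
      thus ?thesis by (simp add: zero_less_mult_iff)
    qed
    have s1: "sn n < K * na n" using 1 by (metis of_nat_less_iff of_nat_mult)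
    have s2: "sn n < K * (n - na n)" using 2 nn by (metis of_nat_less_iff of_nat_mult of_nat_diff)
    show ?case
    proof
      assume ev: "even (n * K)"
      have par1: "even (K * na n - sn n)"
      proof -
        have "sn n mod 2 = K * na n mod 2" by (simp add: sn_def)
        thus ?thesis by auto
      qed
      moreover have "K * (n - na n) = K * n - K * na n" by (simp add: diff_mult_distrib2)
      moreover have "K * na n \<le> K * n" using nn by simp
      ultimately have par2: "even (K * (n - na n) - sn n)" using ev s1 by auto
      show "valid_type n (na n) (sn n)"
        unfolding valid_type_def
      proof (intro conjI nn)
        obtain x where "K * na n - sn n = 2 * x" using par1 by blast
        moreover obtain y where "K * (n - na n) - sn n = 2 * y" using par2 by blast
        ultimately show "\<exists>ea eb. K * na n = sn n + 2 * ea \<and> K * (n - na n) = sn n + 2 * eb"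
          using s1 s2 by (intro exI[of _ x] exI[of _ y]) linarith
      qed
    qed
  qed
  \<comment> \<open>Half of the smaller mark frequency in the limit: a lower bound that leaves room
    for the summand 4 in \<open>simple_lower_bound\<close>.\<close>
  define d where "d = min (p + s) (q + s) / 2"
  have d: "0 < d" "d \<le> 1" using z by (auto simp: d_def)
  define K1 where "K1 = real K / d ^ 2 + real K ^ 2 / d ^ 4"
  \<comment> \<open>At twice the bound on the expected number of defects, Markov's inequality keeps
    at least half of the configurations.\<close>
  define J where "J = nat \<lceil>2 * K1\<rceil>"
  have J: "2 * K1 \<le> real J + 1" unfolding J_def by linarith
  define H where "H = Max (range (\<lambda>p. \<bar>h (fst p) (snd p)\<bar>))"
  have H: "\<bar>h x y\<bar> \<le> H" for x y
    unfolding H_def by (intro Max_ge finite_imageI finite image_eqI[of _ _ "(x, y)"]) auto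
  have l4: "eventually (\<lambda>n. d < real (na n) / real n - 4 / real K * (1 / real n)) sequentially"
  proof (rule order_tendstoD(1))
    have "(\<lambda>n. real (na n) / real n - 4 / real K * (1 / real n)) \<longlonglongrightarrow> (p + s) - 4 / real K * 0" by (intro tendsto_intros l1 lim_1_over_n)
    thus "(\<lambda>n. real (na n) / real n - 4 / real K * (1 / real n)) \<longlonglongrightarrow> p + s" by simp
    show "d < p + s" using z by (auto simp: d_def)
  qed
  have l5: "eventually (\<lambda>n. d < 1 - real (na n) / real n - 4 / real K * (1 / real n)) sequentially"
  proof (rule order_tendstoD(1))
    have "(\<lambda>n. 1 - real (na n) / real n - 4 / real K * (1 / real n)) \<longlonglongrightarrow> 1 - (p + s) - 4 / real K * 0" by (intro tendsto_intros l1 lim_1_over_n)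
    thus "(\<lambda>n. 1 - real (na n) / real n - 4 / real K * (1 / real n)) \<longlonglongrightarrow> 1 - (p + s)" by simp
    show "d < 1 - (p + s)" using z by (auto simp: d_def)
  qed
  have l6: "eventually (\<lambda>n. c < real K * energy (edge_type n (na n) (sn n)) - 8 * real J * H * (1 / real n)) sequentially"
  proof (rule order_tendstoD(1)[OF _ z(5)])
    have "(\<lambda>n. energy (edge_type n (na n) (sn n))) \<longlonglongrightarrow> energy (p, q, s)"
      unfolding energy_def edge_type_def prod.case by (intro tendsto_intros t1 t2 t3)
    hence "(\<lambda>n. real K * energy (edge_type n (na n) (sn n)) - 8 * real J * H * (1 / real n)) \<longlonglongrightarrow> real K * energy (p, q, s) - 8 * real J * H * 0"
      by (intro tendsto_intros lim_1_over_n)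
    thus "(\<lambda>n. real K * energy (edge_type n (na n) (sn n)) - 8 * real J * H * (1 / real n)) \<longlonglongrightarrow> real K * energy (p, q, s)" by simp
  qed
  have l7: "eventually (\<lambda>n. edge_type n (na n) (sn n) \<in> edge_laws \<longrightarrow> top_rate c - e / 2 < entropy_of K (edge_type n (na n) (sn n))) sequentially"
  proof -
    have zL: "(p, q, s) \<in> edge_laws" using z by (simp add: edge_laws_def)
    have "(entropy_of K \<longlongrightarrow> entropy_of K (p, q, s)) (at (p, q, s) within edge_laws)"
      using continuous_on_entropy_of zL by (simp add: continuous_on_def)
    hence "eventually (\<lambda>y. top_rate c - e / 2 < entropy_of K y) (at (p, q, s) within edge_laws)"
      by (rule order_tendstoD(1)) (rule z(6))
    hence "eventually (\<lambda>y. y \<noteq> (p, q, s) \<longrightarrow> y \<in> edge_laws \<longrightarrow> top_rate c - e / 2 < entropy_of K y) (nhds (p, q, s))"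
      by (simp add: eventually_at_filter)
    hence "eventually (\<lambda>y. y \<in> edge_laws \<longrightarrow> top_rate c - e / 2 < entropy_of K y) (nhds (p, q, s))"
      by eventually_elim (use z(6) in blast)
    thus ?thesis using et unfolding filterlim_iff by blast
  qed
  have l8: "eventually (\<lambda>n. K * n > 4 * K * (K + 1) + J) sequentially"
    using eventually_gt_at_top[of "4 * K * (K + 1) + J"]
  proof eventually_elim
    case (elim n)
    have "n \<le> K * n" using K by simp
    thus ?case using elim by linarith
  qed
  have "0 < e / 2" using e by simp
  note l9 = err_sublinear[OF this, of "8 * real J" "ln 2"]
  show ?thesis
    using valid l4 l5 l6 l7 l8 l9 eventually_ge_at_top[of 1]
  proof eventually_elim
    case (elim n)
    show ?case
    proof
      assume ev: "even (n * K)"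
      have v: "valid_type n (na n) (sn n)" using elim(1) ev by blast
      have n: "n \<ge> 1" by (rule elim(8))
      have n0: "real n > 0" using n by simp
      have nn: "na n \<le> n" using v by (simp add: valid_type_def)
      have eL: "edge_type n (na n) (sn n) \<in> edge_laws" by (rule edge_type_laws[OF v n])
      have lg: "d * real (K * n) + 4 \<le> real (K * na n)" "d * real (K * n) + 4 \<le> real (K * (n - na n))"
      proof -
        have kn: "real K * real n > 0" using k0 n0 by simp
        have "d * (real K * real n) \<le> (real (na n) / real n - 4 / real K * (1 / real n)) * (real K * real n)"
          by (rule mult_right_mono) (use elim(2) kn in auto)
        also have "\<dots> = real K * real (na n) - 4" using k0 n0 by (simp add: field_simps)
        finally show "d * real (K * n) + 4 \<le> real (K * na n)" by simp
        have "d * (real K * real n) \<le> (1 - real (na n) / real n - 4 / real K * (1 / real n)) * (real K * real n)"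
          by (rule mult_right_mono) (use elim(3) kn in auto)
        also have "\<dots> = real K * (real n - real (na n)) - 4" using k0 n0 by (simp add: field_simps)
        finally show "d * real (K * n) + 4 \<le> real (K * (n - na n))" using nn by simp
      qed
      have ce: "c + 8 * real J * H / real n \<le> real K * energy (edge_type n (na n) (sn n))" using elim(4) by simp
      have low: "real (card (type_space n (na n) (sn n))) \<le> 2 * real (card (con_set n c)) * real (K * n) ^ (8 * J)"
        by (rule simple_lower_bound[OF n v d lg J[unfolded K1_def] elim(6) H ce])
      have tc0: "real (card (type_space n (na n) (sn n))) > 0" using card_type_space(1)[OF v n] by simp
      have con0: "real (card (con_set n c)) > 0"
      proof (rule ccontr)
        assume "\<not> real (card (con_set n c)) > 0"
        hence "real (card (con_set n c)) = 0" by simp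
        thus False using low tc0 by simp
      qed
      have kn0: "real (K * n) > 0" using k0 n0 by simp
      have "ln (real (card (type_space n (na n) (sn n)))) \<le> ln (2 * real (card (con_set n c)) * real (K * n) ^ (8 * J))"
        using low tc0 by simp
      also have "\<dots> = ln 2 + ln (real (card (con_set n c))) + 8 * real J * ln (real (K * n))"
        using con0 kn0 by (simp add: ln_mult ln_realpow del: of_nat_mult)
      finally have lnl: "ln (real (card (type_space n (na n) (sn n)))) \<le> ln 2 + ln (real (card (con_set n c))) + 8 * real J * ln (real (K * n))" .
      have ent: "real n * (top_rate c - e / 2) \<le> real n * entropy_of K (edge_type n (na n) (sn n))"
        by (rule mult_left_mono) (use elim(5) eL in auto)
      have lnm: "8 * real J * ln (real (K * n)) \<le> 8 * real J * ln (real (K * n) + 1)"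
        by (rule mult_left_mono) (use kn0 in auto)
      have e0: "0 \<le> err n" "0 \<le> ln ((real n + 1) * (real (K * n) + 1))"
        by (auto simp: err_def intro!: ln_ge_zero mult_ge1_I)
      have "real n * (top_rate c - e) = real n * (top_rate c - e / 2) - e / 2 * real n" by (simp add: algebra_simps)
      hence "rate_base K n + real n * (top_rate c - e) \<le> ln (real (card (con_set n c)))"
        using card_type_space(2)[OF v n] lnl ent lnm e0 elim(7) by linarith
      hence "exp (rate_base K n + real n * (top_rate c - e)) \<le> exp (ln (real (card (con_set n c))))" by simp
      thus "exp (rate_base K n + real n * (top_rate c - e)) \<le> real (card (con_set n c))" using con0 by simp
    qed
  qed
qed

end

section \<open>Exponential rarity of bad configurations\<close>

context two_marks
begin

lemma sum_marks: "(\<Sum>x\<in>UNIV. f x) = f a + f b" for f :: "'x \<Rightarrow> 'y::comm_monoid_add"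
  unfolding ab(2) using ab(1) by simp

text \<open>
  At a maximiser the Lagrange conditions say that the edge law splits as a Gibbs weight, so the
  associated tree-indexed Markov chain is a translation-invariant splitting Gibbs measure.
\<close>

lemma maximiser_law:
  fixes p q s :: real
  assumes c: "c_mean < c" "c < c_max" and z: "(p, q, s) \<in> feas c" "entropy_of K (p, q, s) = top_rate c"
  defines "\<alpha> \<equiv> \<lambda>x. if x = a then p + s else q + s"
    and "\<pi> \<equiv> \<lambda>x y. if x = y then (if x = a then p else q) else s"
  shows "markov_law K \<alpha> \<pi>" "tree_law K (markov_law.tree_chain K \<alpha> \<pi>) \<in> G_nondeg K (pmf_of_set UNIV) h c"
proof -
  define g where "g = (real K - 1) / real K"
  have k2: "2 \<le> real K" using K by simp
  have max: "edge_entropy K p' q' s' \<le> edge_entropy K p q s"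
    if "(p', q', s') \<in> feasible (h a a) (h b b) (h a b) (c / real K)" for p' q' s'
    using top_rate_attained(2)[OF c, of "(p', q', s')"] that z(2) by (simp add: entropy_of_def feas_def)
  obtain \<beta> k where m: "0 < p" "0 < q" "0 < s" "p * h a a + q * h b b + 2 * s * h a b = c / real K"
    and lp: "ln p = 2 * g * ln (p + s) + \<beta> * h a a + k"
    and lq: "ln q = 2 * g * ln (q + s) + \<beta> * h b b + k"
    and ls: "ln s = g * ln (p + s) + g * ln (q + s) + \<beta> * h a b + k"
    using entropy_maximiser[OF k2 admissible[OF c] z(1)[unfolded feas_def] max, folded g_def] by blast
  have "p + q + 2 * s = 1" using z(1) by (simp add: feas_iff edge_laws_def)
  thus law: "markov_law K \<alpha> \<pi>"
    using m ab(1) K by unfold_locales (auto simp: \<alpha>_def \<pi>_def sum_marks not_a_iff)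
  interpret markov_law K \<alpha> \<pi> by (rule law)
  have split: "\<pi> x y = exp k * \<alpha> x powr g * \<alpha> y powr g * exp (\<beta> * h x y)" for x y
  proof -
    have pw: "(p + s) powr g = exp (g * ln (p + s))" "(q + s) powr g = exp (g * ln (q + s))"
      using m by (simp_all add: powr_def)
    have "p = exp (2 * g * ln (p + s) + \<beta> * h a a + k)" using m(1) by (simp flip: lp)
    also have "\<dots> = exp k * (p + s) powr g * (p + s) powr g * exp (\<beta> * h a a)"
      unfolding pw by (simp flip: exp_add add: algebra_simps)
    finally have ep: "p = exp k * (p + s) powr g * (p + s) powr g * exp (\<beta> * h a a)" .
    have "q = exp (2 * g * ln (q + s) + \<beta> * h b b + k)" using m(2) by (simp flip: lq)
    also have "\<dots> = exp k * (q + s) powr g * (q + s) powr g * exp (\<beta> * h b b)"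
      unfolding pw by (simp flip: exp_add add: algebra_simps)
    finally have eq: "q = exp k * (q + s) powr g * (q + s) powr g * exp (\<beta> * h b b)" .
    have "s = exp (g * ln (p + s) + g * ln (q + s) + \<beta> * h a b + k)" using m(3) by (simp flip: ls)
    also have "\<dots> = exp k * (p + s) powr g * (q + s) powr g * exp (\<beta> * h a b)"
      unfolding pw by (simp flip: exp_add add: algebra_simps)
    finally have es: "s = exp k * (p + s) powr g * (q + s) powr g * exp (\<beta> * h a b)" .
    consider "x = a" "y = a" | "x = a" "y = b" | "x = b" "y = a" | "x = b" "y = b"
      using not_a_iff by blast
    thus ?thesis
    proof cases
      case 1
      thus ?thesis using ep by (simp add: \<alpha>_def \<pi>_def)
    next
      case 2
      thus ?thesis using es ab(1) by (simp add: \<alpha>_def \<pi>_def)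
    next
      case 3
      thus ?thesis using es ab(1) h_sym[of b a] by (simp add: \<alpha>_def \<pi>_def mult_ac)
    next
      case 4
      thus ?thesis using eq ab(1) by (simp add: \<alpha>_def \<pi>_def)
    qed
  qed
  have T: "tree_chain \<in> TISGM K (\<lambda>x y. exp (\<beta> * h x y)) (pmf (pmf_of_set UNIV))"
    by (rule tree_chain_TISGM[OF g_def _ split]) simp_all
  have "real K * (\<integral>(x, y). h x y \<partial>edge_marginal (tree_law K tree_chain)) = real K * (p * h a a + q * h b b + 2 * s * h a b)"
    unfolding edge_marginal_expectation sum_marks using ab(1) h_sym[of b a] by (simp add: \<pi>_def)
  also have "\<dots> = c" unfolding m(4) using K by simp
  finally show "tree_law K tree_chain \<in> G_nondeg K (pmf_of_set UNIV) h c"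
    unfolding G_nondeg_def using T tree_law_tree by blast
qed

definition bad_type :: "'x gstar measure set \<Rightarrow> nat \<Rightarrow> nat \<Rightarrow> nat \<Rightarrow> nat" where
  "bad_type \<O> n na s = card {(X, M)\<in>type_space n na s. M \<in> simple_configs K n \<and> component_empirical n (graph_of K n M, X) \<notin> \<O>}"

text \<open>Either the entropy at \<open>z\<close> is below the maximum, and by continuity the types
  near \<open>z\<close> have too few configurations altogether; or \<open>z\<close> is a maximiser,
  the law of its chain lies in \<open>\<O>\<close>, and by concentration only an exponentially small
  proportion of the configurations near \<open>z\<close> is bad.\<close>

lemma bad_type_near:
  assumes c: "c_mean < c" "c < c_max" and \<O>: "openin weak_topology \<O>" "G_nondeg K (pmf_of_set UNIV) h c \<subseteq> \<O>"
    and z: "z \<in> feas c"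
  shows "\<exists>d>0. \<exists>\<eta>>0. \<exists>n0. \<forall>n\<ge>n0. \<forall>na s. valid_type n na s \<longrightarrow> edge_type n na s \<in> feas c \<longrightarrow> dist (edge_type n na s) z < d \<longrightarrow>
     real (bad_type \<O> n na s) \<le> exp (rate_base K n + real n * (top_rate c - \<eta>) + err n)"
proof (cases "entropy_of K z = top_rate c")
  case False
  define e where "e = (top_rate c - entropy_of K z) / 2"
  have e: "0 < e" using False top_rate_attained(2)[OF c z] by (simp add: e_def)
  have "continuous_on (feas c) (entropy_of K)"
    unfolding feas_def by (rule continuous_on_subset[OF continuous_on_entropy_of feasible_subset])
  then obtain d where d: "0 < d" "\<And>w. w \<in> feas c \<Longrightarrow> dist w z < d \<Longrightarrow> dist (entropy_of K w) (entropy_of K z) < e"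
    using z e unfolding continuous_on_iff by blast
  have "real (bad_type \<O> n na s) \<le> exp (rate_base K n + real n * (top_rate c - e) + err n)"
    if "1 \<le> n" "valid_type n na s" "edge_type n na s \<in> feas c" "dist (edge_type n na s) z < d" for n na s
  proof -
    have "entropy_of K (edge_type n na s) \<le> top_rate c - e"
      using d(2)[OF that(3,4)] abs_ge_self[of "entropy_of K (edge_type n na s) - entropy_of K z"]
      unfolding dist_real_def e_def by (simp add: field_simps)
    hence "real (card (type_space n na s)) \<le> exp (rate_base K n + real n * (top_rate c - e) + err n)"
      by (rule card_type_space_le[OF that(2,1)])
    moreover have "bad_type \<O> n na s \<le> card (type_space n na s)"
      unfolding bad_type_def by (rule card_mono[OF finite_type_space]) blast
    ultimately show ?thesis by linarith
  qed
  thus ?thesis using d(1) e by blast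
next
  case True
  obtain p q s where zz: "z = (p, q, s)" by (cases z)
  define \<alpha> where "\<alpha> = (\<lambda>x. if x = a then p + s else q + s)"
  define \<pi> where "\<pi> = (\<lambda>x y. if x = y then (if x = a then p else q) else s)"
  have law: "markov_law K \<alpha> \<pi>" and inG: "tree_law K (markov_law.tree_chain K \<alpha> \<pi>) \<in> G_nondeg K (pmf_of_set UNIV) h c"
    unfolding \<alpha>_def \<pi>_def using maximiser_law[OF c z[unfolded zz] True[unfolded zz]] by simp_all
  interpret markov_law K \<alpha> \<pi> by (rule law)
  obtain R \<epsilon> where \<epsilon>: "\<epsilon> > 0" and R: "\<And>n M X. n \<ge> 1 \<Longrightarrow> M \<in> matchings (half_edges K n) \<Longrightarrow>
     graph_of K n M \<in> regular_graphs K n \<Longrightarrow> \<forall>r\<le>R. profile_close K r \<alpha> \<pi> \<epsilon> n X M \<Longrightarrow> component_empirical n (graph_of K n M, X) \<in> \<O>"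
    using profile_close_imp_open[OF \<O>(1) subsetD[OF \<O>(2) inG]] by blast
  have "rare K \<alpha> \<pi> (\<lambda>n X M. \<exists>r\<in>{..R}. \<not> profile_close K r \<alpha> \<pi> \<epsilon> n X M)"
    by (rule rare_ex) (use K \<alpha>_pos \<pi>_nonneg \<epsilon> markov_weight_sum in \<open>auto intro!: profile_concentration\<close>)
  then obtain \<rho> \<eta> n0 where \<rho>: "\<rho> > 0" "\<eta> > 0" and n0: "\<And>n X E. n \<ge> n0 \<Longrightarrow> type_near K n X E \<alpha> \<pi> \<rho> \<Longrightarrow>
      real (card {M \<in> typed_matchings (half_edges K n) (\<lambda>e. X (fst e)) E. \<exists>r\<in>{..R}. \<not> profile_close K r \<alpha> \<pi> \<epsilon> n X M})
      \<le> exp (- \<eta> * real n) * real (card (typed_matchings (half_edges K n) (\<lambda>e. X (fst e)) E))"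
    unfolding rare_def by blast
  have "real (bad_type \<O> n na t) \<le> exp (rate_base K n + real n * (top_rate c - \<eta>) + err n)"
    if n: "max n0 1 \<le> n" and v: "valid_type n na t" and f: "edge_type n na t \<in> feas c" and d: "dist (edge_type n na t) z < \<rho> / 2" for n na t
  proof -
    obtain p' q' t' where et: "edge_type n na t = (p', q', t')" by (cases "edge_type n na t")
    have kn: "real K > 0" "real n > 0" using K n by auto
    have "dist p' p \<le> dist (edge_type n na t) z" "dist q' q \<le> dist (edge_type n na t) z" "dist t' s \<le> dist (edge_type n na t) z"
      unfolding et zz using dist_fst_le[of "(p', q', t')" "(p, q, s)"] dist_snd_le[of "(p', q', t')" "(p, q, s)"]
        dist_fst_le[of "(q', t')" "(q, s)"] dist_snd_le[of "(q', t')" "(q, s)"] by auto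
    hence near: "\<bar>p' - p\<bar> < \<rho> / 2" "\<bar>q' - q\<bar> < \<rho> / 2" "\<bar>t' - s\<bar> < \<rho> / 2" using d by (auto simp: dist_real_def)
    obtain ea eb where e: "K * na = t + 2 * ea" "K * (n - na) = t + 2 * eb" "na \<le> n" using v by (auto simp: valid_type_def)
    have ev: "p' = 2 * real ea / (real K * real n)" "q' = 2 * real eb / (real K * real n)" "t' = real t / (real K * real n)"
      using edge_type_eq[OF e] et by auto
    define E where "E = two_type a (K * na) (K * (n - na)) t"
    have "E x y = (if x = y then (if x = a then 2 * ea else 2 * eb) else t)" for x y
      using e by (simp add: E_def two_type_def)
    hence Er: "real (E x y) / (real K * real n) = (if x = y then (if x = a then p' else q') else t')" for x y
      by (simp add: ev)
    have "real K * real na = real t + 2 * real ea" using e(1) by (metis of_nat_add of_nat_mult of_nat_numeral)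
    hence ra: "real na / real n = p' + t'" unfolding ev using kn by (simp add: field_simps)
    have "real K * real (n - na) = real t + 2 * real eb" using e(2) by (metis of_nat_add of_nat_mult of_nat_numeral)
    hence rb: "real (n - na) / real n = q' + t'" unfolding ev using kn by (simp add: field_simps)
    \<comment> \<open>A mark frequency is the sum of two entries of the edge law, hence the radius
      \<open>\<rho> / 2\<close>.\<close>
    have tn: "type_near K n X E \<alpha> \<pi> \<rho>" if X: "cnt n X = na" for X
    proof -
      have "card {v\<in>{1..n}. X v = x} = (if x = a then na else n - na)" for x
        using card_b[of n X] X not_a_iff[of x] by (auto simp: cnt_def)
      hence "real (card {v\<in>{1..n}. X v = x}) / real n = (if x = a then p' + t' else q' + t')" for x
        using ra rb by simp
      moreover have "\<bar>p' + t' - (p + s)\<bar> < \<rho>" "\<bar>q' + t' - (q + s)\<bar> < \<rho>" using near by linarith+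
      ultimately show ?thesis unfolding type_near_def Er using near \<rho>(1) by (auto simp: \<alpha>_def \<pi>_def)
    qed
    define D where "D = {X\<in>mark_space n. cnt n X = na}"
    have finD: "finite D" unfolding D_def by (rule finite_subset[OF _ finite_mark_space]) blast
    have finC: "finite (configs_of_type n na t X)" for X unfolding configs_of_type_def by (rule finite_typed[OF finite_half_edges])
    define Bd where "Bd X = {M \<in> configs_of_type n na t X. \<exists>r\<in>{..R}. \<not> profile_close K r \<alpha> \<pi> \<epsilon> n X M}" for X
    have "{(X, M)\<in>type_space n na t. M \<in> simple_configs K n \<and> component_empirical n (graph_of K n M, X) \<notin> \<O>} \<subseteq> (SIGMA X:D. Bd X)"
    proof
      fix P assume "P \<in> {(X, M)\<in>type_space n na t. M \<in> simple_configs K n \<and> component_empirical n (graph_of K n M, X) \<notin> \<O>}"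
      then obtain X M where P: "P = (X, M)" "(X, M) \<in> type_space n na t" "M \<in> simple_configs K n" "component_empirical n (graph_of K n M, X) \<notin> \<O>"
        by blast
      have "M \<in> matchings (half_edges K n)" using P(3) by (simp add: simple_configs_def)
      hence "\<not> (\<forall>r\<le>R. profile_close K r \<alpha> \<pi> \<epsilon> n X M)" using R[OF _ _ graph_of_regular[OF P(3)], of X] n P(4) by auto
      thus "P \<in> (SIGMA X:D. Bd X)" using P(1,2) by (auto simp: type_space_def D_def Bd_def)
    qed
    hence "bad_type \<O> n na t \<le> card (SIGMA X:D. Bd X)"
      unfolding bad_type_def by (rule card_mono[rotated]) (intro finite_SigmaI finD, simp add: Bd_def finC)
    also have "\<dots> = (\<Sum>X\<in>D. card (Bd X))" by (rule card_SigmaI[OF finD]) (simp add: Bd_def finC)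
    finally have "real (bad_type \<O> n na t) \<le> (\<Sum>X\<in>D. real (card (Bd X)))" unfolding of_nat_sum[symmetric] of_nat_le_iff .
    also have "\<dots> \<le> (\<Sum>X\<in>D. exp (- \<eta> * real n) * real (card (configs_of_type n na t X)))"
    proof (rule sum_mono)
      fix X assume "X \<in> D"
      hence "type_near K n X E \<alpha> \<pi> \<rho>" using tn by (simp add: D_def)
      thus "real (card (Bd X)) \<le> exp (- \<eta> * real n) * real (card (configs_of_type n na t X))"
        using n0[of n X E] n unfolding Bd_def configs_of_type_def E_def by simp
    qed
    also have "\<dots> = exp (- \<eta> * real n) * real (card (type_space n na t))"
    proof -
      have "card (type_space n na t) = (\<Sum>X\<in>D. card (configs_of_type n na t X))"
        unfolding type_space_def D_def[symmetric] by (rule card_SigmaI[OF finD]) (simp add: finC)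
      thus ?thesis by (simp add: sum_distrib_left)
    qed
    also have "\<dots> \<le> exp (- \<eta> * real n) * exp (rate_base K n + real n * top_rate c + err n)"
      using card_type_space_le[OF v _ top_rate_attained(2)[OF c f]] n by simp
    also have "\<dots> = exp (rate_base K n + real n * (top_rate c - \<eta>) + err n)"
      by (simp flip: exp_add add: algebra_simps)
    finally show ?thesis .
  qed
  moreover have "0 < \<rho> / 2" using \<rho>(1) by simp
  ultimately show ?thesis using \<rho>(2) by blast
qed

text \<open>Compactness turns the local gains \<open>\<eta> z\<close> into a single
  \<open>\<eta>'\<close>; half of it pays for the number of types and the Stirling errors.\<close>

lemma bad_upper:
  assumes c: "c_mean < c" "c < c_max" and \<O>: "openin weak_topology \<O>" "G_nondeg K (pmf_of_set UNIV) h c \<subseteq> \<O>"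
  shows "\<exists>\<eta>>0. eventually (\<lambda>n. real (card {(M, X)\<in>con_set n c. component_empirical n (graph_of K n M, X) \<notin> \<O>})
    \<le> exp (rate_base K n + real n * (top_rate c - \<eta>))) sequentially"
proof -
  define Q where "Q z d \<eta> n0 \<longleftrightarrow> 0 < d \<and> 0 < \<eta> \<and> (\<forall>n\<ge>n0. \<forall>na s. valid_type n na s \<longrightarrow>
     edge_type n na s \<in> feas c \<longrightarrow> dist (edge_type n na s) z < d \<longrightarrow>
     real (bad_type \<O> n na s) \<le> exp (rate_base K n + real n * (top_rate c - \<eta>) + err n))" for z d \<eta> n0
  have "\<forall>z\<in>feas c. \<exists>d \<eta> n0. Q z d \<eta> n0" unfolding Q_def using bad_type_near[OF c \<O>] by blast
  then obtain d \<eta> n0 where w: "\<And>z. z \<in> feas c \<Longrightarrow> Q z (d z) (\<eta> z) (n0 z)" by metis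
  have loc: "d z > 0" "\<eta> z > 0" if "z \<in> feas c" for z using w[OF that] by (auto simp: Q_def)
  have bnd: "real (bad_type \<O> n na s) \<le> exp (rate_base K n + real n * (top_rate c - \<eta> z) + err n)"
    if "z \<in> feas c" "n0 z \<le> n" "valid_type n na s" "edge_type n na s \<in> feas c" "dist (edge_type n na s) z < d z" for z n na s
    using w[OF that(1)] that(2-) unfolding Q_def by blast
  have cf: "compact (feas c)" unfolding feas_def by (rule compact_feasible)
  have cov: "feas c \<subseteq> (\<Union>z\<in>feas c. ball z (d z))" using loc(1) by auto
  obtain D where D: "D \<subseteq> feas c" "finite D" "feas c \<subseteq> (\<Union>z\<in>D. ball z (d z))"
    by (rule compactE_image[OF cf, of "feas c" "\<lambda>z. ball z (d z)"]) (use cov in auto)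
  have neD: "D \<noteq> {}" using top_rate_attained(1)[OF c] D(3) by auto
  define \<eta>' where "\<eta>' = Min (\<eta> ` D)"
  have \<eta>': "0 < \<eta>'" "\<And>z. z \<in> D \<Longrightarrow> \<eta>' \<le> \<eta> z" unfolding \<eta>'_def using D neD loc(2) by auto
  define N where "N = Max (n0 ` D)"
  have N: "\<And>z. z \<in> D \<Longrightarrow> n0 z \<le> N" unfolding N_def using D(2) by simp
  have "0 < \<eta>' / 2" using \<eta>'(1) by simp
  from err_sublinear[OF this, of 0 0]
  have "eventually (\<lambda>n. real (card {(M, X)\<in>con_set n c. component_empirical n (graph_of K n M, X) \<notin> \<O>})
    \<le> exp (rate_base K n + real n * (top_rate c - \<eta>' / 2))) sequentially"
    using eventually_ge_at_top[of "max N 1"]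
  proof eventually_elim
    case (elim n)
    define B where "B = exp (rate_base K n + real n * (top_rate c - \<eta>') + err n)"
    have "real (card {(M, X)\<in>con_set n c. component_empirical n (graph_of K n M, X) \<notin> \<O>}) \<le> (real n + 1) * (real (K * n) + 1) * B"
    proof (rule con_set_bound)
      show "1 \<le> n" using elim(2) by simp
      show "0 \<le> B" by (simp add: B_def)
      fix na s assume v: "valid_type n na s" and f: "edge_type n na s \<in> feas c"
      obtain z where z: "z \<in> D" "dist (edge_type n na s) z < d z" using D(3) f by (auto simp: dist_commute)
      have "real (bad_type \<O> n na s) \<le> exp (rate_base K n + real n * (top_rate c - \<eta> z) + err n)"
        by (rule bnd[OF _ _ v f z(2)]) (use z(1) D(1) N[OF z(1)] elim(2) in auto)
      also have "\<dots> \<le> B" unfolding B_def using \<eta>'(2)[OF z(1)] by (simp add: mult_left_mono)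
      finally show "real (card {(X, M)\<in>type_space n na s. M \<in> simple_configs K n \<and> component_empirical n (graph_of K n M, X) \<notin> \<O>}) \<le> B"
        unfolding bad_type_def .
    qed
    also have "\<dots> = exp (ln ((real n + 1) * (real (K * n) + 1)) + (rate_base K n + real n * (top_rate c - \<eta>') + err n))"
    proof -
      have "0 < (real n + 1) * (real (K * n) + 1)" by (intro mult_pos_pos) (auto simp: add_nonneg_pos)
      thus ?thesis unfolding exp_add[of "ln _"] B_def by simp
    qed
    also have "\<dots> \<le> exp (rate_base K n + real n * (top_rate c - \<eta>' / 2))"
    proof -
      have "err n \<ge> 0" by (simp add: err_def)
      thus ?thesis using elim(1) by (simp add: algebra_simps)
    qed
    finally show ?case .
  qed
  thus ?thesis using \<open>0 < \<eta>' / 2\<close> by blast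
qed

end

section \<open>Conditional probabilities\<close>

text \<open>In a conditional probability the numerator has only a limsup while the denominator has a
  rate; this separates the two. \<open>A\<close> may take infinite values, so only \<open>b\<close>
  is compared with constants.\<close>

lemma Limsup_add_tendsto:
  fixes A :: "'a \<Rightarrow> ereal" and b :: "'a \<Rightarrow> real"
  assumes F: "F \<noteq> bot" and b: "(b \<longlongrightarrow> t) F"
  shows "Limsup F (\<lambda>n. A n + ereal (b n)) = Limsup F A + ereal t"
proof (rule antisym)
  have sh: "Limsup F (\<lambda>n. A n + ereal y) = Limsup F A + ereal y" for y
    by (rule Limsup_add_ereal_right[OF F]) simp
  show "Limsup F (\<lambda>n. A n + ereal (b n)) \<le> Limsup F A + ereal t"
  proof (rule ereal_le_epsilon2)
    fix e :: real assume "0 < e"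
    hence "eventually (\<lambda>n. b n < t + e) F" by (intro order_tendstoD(2)[OF b]) simp
    hence "Limsup F (\<lambda>n. A n + ereal (b n)) \<le> Limsup F (\<lambda>n. A n + ereal (t + e))"
      by (intro Limsup_mono) (auto elim!: eventually_mono intro!: add_left_mono)
    thus "Limsup F (\<lambda>n. A n + ereal (b n)) \<le> Limsup F A + ereal t + ereal e" unfolding sh by (simp add: add.assoc)
  qed
  show "Limsup F A + ereal t \<le> Limsup F (\<lambda>n. A n + ereal (b n))"
  proof (rule ereal_le_epsilon2)
    fix e :: real assume "0 < e"
    hence "eventually (\<lambda>n. t - e < b n) F" by (intro order_tendstoD(1)[OF b]) simp
    hence "Limsup F (\<lambda>n. A n + ereal (t - e)) \<le> Limsup F (\<lambda>n. A n + ereal (b n))"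
      by (intro Limsup_mono) (auto elim!: eventually_mono intro!: add_left_mono)
    hence "Limsup F A + ereal (t - e) + ereal e \<le> Limsup F (\<lambda>n. A n + ereal (b n)) + ereal e"
      unfolding sh by (rule add_right_mono)
    thus "Limsup F A + ereal t \<le> Limsup F (\<lambda>n. A n + ereal (b n)) + ereal e" by (simp add: add.assoc)
  qed
qed

text \<open>Source of the limit in the shift of \<open>c\<close>: a larger shift makes the
  constraint stronger, so the rate of the bad configurations is monotone and converges to its
  supremum, finite or not.\<close>

lemma antimono_tendsto_SUP:
  fixes N :: "real \<Rightarrow> ereal"
  assumes d: "0 < d" and anti: "\<And>x y. 0 < x \<Longrightarrow> x \<le> y \<Longrightarrow> y < d \<Longrightarrow> N y \<le> N x"
  shows "(N \<longlongrightarrow> (SUP x\<in>{0<..<d}. N x)) (at_right 0)"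
proof (rule increasing_tendsto)
  have "eventually (\<lambda>x. x \<in> {0<..<d}) (at_right 0)" by (rule eventually_at_right_real[OF d])
  thus "eventually (\<lambda>x. N x \<le> (SUP x\<in>{0<..<d}. N x)) (at_right 0)" by eventually_elim (rule SUP_upper)
  fix y assume "y < (SUP x\<in>{0<..<d}. N x)"
  then obtain x0 where x0: "x0 \<in> {0<..<d}" "y < N x0" by (auto simp: less_SUP_iff)
  have "eventually (\<lambda>x. x \<in> {0<..<x0}) (at_right 0)" by (rule eventually_at_right_real) (use x0(1) in simp)
  thus "eventually (\<lambda>x. y < N x) (at_right 0)"
    by eventually_elim (use anti[of _ x0] x0 in \<open>auto intro: less_le_trans\<close>)
qed

context two_marks
begin

text \<open>Restriction to even \<open>n * K\<close>, as in the graph model; for all other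
  \<open>n\<close> the conditioning event contains no configuration.\<close>

definition parity :: "nat filter" where "parity = inf sequentially (principal {n. even (n * K)})"

lemma parity_neq_bot: "parity \<noteq> bot"
proof
  assume "parity = bot"
  hence "eventually (\<lambda>n. False) parity" by simp
  hence "eventually (\<lambda>n. odd (n * K)) sequentially" by (simp add: parity_def eventually_inf_principal)
  then obtain N where "\<And>n. N \<le> n \<Longrightarrow> odd (n * K)" by (auto simp: eventually_sequentially)
  from this[of "2 * N"] show False by simp
qed

lemma eventually_parity: "eventually P sequentially \<Longrightarrow> eventually P parity"
  unfolding parity_def by (rule filter_leD[OF inf_le1])

lemma finite_con_set: "finite (con_set n c)"
  by (rule finite_subset[of _ "simple_configs K n \<times> mark_space n"])
    (auto simp: con_set_def intro: finite_SigmaI finite_simple_configs finite_mark_space)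

lemma eventually_con_lower:
  assumes "c_mean < c" "c < c_max" "0 < e"
  shows "eventually (\<lambda>n. exp (rate_base K n + real n * (top_rate c - e)) \<le> real (card (con_set n c))) parity"
  using con_set_lower[OF assms] by (simp add: parity_def eventually_inf_principal)

lemma con_rate_tendsto:
  assumes c: "c_mean < c" "c < c_max"
  shows "((\<lambda>n. (ln (real (card (con_set n c))) - rate_base K n) / real n) \<longlongrightarrow> top_rate c) parity"
proof (rule tendstoI)
  fix e :: real assume "0 < e"
  hence e: "0 < e / 2" by simp
  show "eventually (\<lambda>n. dist ((ln (real (card (con_set n c))) - rate_base K n) / real n) (top_rate c) < e) parity"
    using eventually_con_lower[OF c e] eventually_parity[OF con_set_upper[OF c e]] eventually_parity[OF eventually_gt_at_top[of 0]]
  proof eventually_elim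
    case (elim n)
    have pos: "0 < real (card (con_set n c))" using elim(1) exp_gt_zero by (rule less_le_trans[rotated])
    have "rate_base K n + real n * (top_rate c - e / 2) \<le> ln (real (card (con_set n c)))"
      using elim(1) pos by (simp add: ln_ge_iff)
    hence 1: "(top_rate c - e / 2) * real n \<le> ln (real (card (con_set n c))) - rate_base K n" by (simp add: algebra_simps)
    have "ln (real (card (con_set n c))) \<le> rate_base K n + real n * (top_rate c + e / 2)"
      using elim(2) pos by (metis ln_exp ln_le_cancel_iff exp_gt_zero)
    hence 2: "ln (real (card (con_set n c))) - rate_base K n \<le> (top_rate c + e / 2) * real n" by (simp add: algebra_simps)
    have "top_rate c - e / 2 \<le> (ln (real (card (con_set n c))) - rate_base K n) / real n"
      using 1 elim(3) by (simp add: pos_le_divide_eq)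
    moreover have "(ln (real (card (con_set n c))) - rate_base K n) / real n \<le> top_rate c + e / 2"
      using 2 elim(3) by (simp add: pos_divide_le_eq)
    ultimately show ?case using \<open>0 < e\<close> unfolding dist_real_def by simp
  qed
qed

definition bad_set :: "'x gstar measure set \<Rightarrow> nat \<Rightarrow> real \<Rightarrow> ((nat \<times> nat \<Rightarrow> nat \<times> nat) \<times> (nat \<Rightarrow> 'x)) set" where
  "bad_set \<O> n c = {(M, X)\<in>con_set n c. component_empirical n (graph_of K n M, X) \<notin> \<O>}"

text \<open>The value for an empty set agrees with \<open>log_prob 0\<close>. Subtracting
  \<open>rate_base\<close> leaves a quantity comparable with \<open>top_rate\<close>.\<close>

definition bad_rate :: "'x gstar measure set \<Rightarrow> nat \<Rightarrow> real \<Rightarrow> ereal" where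
  "bad_rate \<O> n c = (if bad_set \<O> n c = {} then -\<infinity> else ereal ((ln (real (card (bad_set \<O> n c))) - rate_base K n) / real n))"

lemma finite_bad_set: "finite (bad_set \<O> n c)"
  unfolding bad_set_def by (rule finite_subset[OF _ finite_con_set]) blast

lemma bad_rate_le:
  assumes "n \<ge> 1" "real (card (bad_set \<O> n c)) \<le> exp (rate_base K n + real n * y)"
  shows "bad_rate \<O> n c \<le> ereal y"
proof (cases "bad_set \<O> n c = {}")
  case False
  hence pos: "0 < real (card (bad_set \<O> n c))" using finite_bad_set by auto
  hence "ln (real (card (bad_set \<O> n c))) \<le> rate_base K n + real n * y"
    using assms(2) by (metis ln_exp ln_le_cancel_iff exp_gt_zero)
  hence "(ln (real (card (bad_set \<O> n c))) - rate_base K n) / real n \<le> y"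
    using assms(1) by (simp add: pos_divide_le_eq algebra_simps)
  thus ?thesis by (simp add: bad_rate_def)
qed (simp add: bad_rate_def)

lemma bad_rate_antimono:
  assumes "c \<le> c'" shows "bad_rate \<O> n c' \<le> bad_rate \<O> n c"
proof (cases "bad_set \<O> n c' = {}")
  case False
  have sub: "bad_set \<O> n c' \<subseteq> bad_set \<O> n c" using assms by (auto simp: bad_set_def con_set_def)
  hence ne: "bad_set \<O> n c \<noteq> {}" using False by blast
  have "card (bad_set \<O> n c') \<le> card (bad_set \<O> n c)" by (rule card_mono[OF finite_bad_set sub])
  moreover have "0 < card (bad_set \<O> n c')" using False finite_bad_set by auto
  ultimately have "ln (real (card (bad_set \<O> n c'))) \<le> ln (real (card (bad_set \<O> n c)))" by simp
  thus ?thesis using ne by (simp add: bad_rate_def divide_right_mono)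
qed (simp add: bad_rate_def)

abbreviation cond_bad :: "'x gstar measure set \<Rightarrow> nat \<Rightarrow> real \<Rightarrow> real" where
  "cond_bad \<O> n c \<equiv> \<P>(\<omega> in measure_pmf (graph_marks_law K (pmf_of_set UNIV) n).
     component_empirical n \<omega> \<notin> \<O> \<bar> c \<le> edge_average h n \<omega>)"

lemma log_cond_bad:
  assumes n: "n \<ge> 1" and ne: "con_set n c \<noteq> {}"
  shows "ereal (1 / real n) * log_prob (cond_bad \<O> n c) =
    bad_rate \<O> n c + ereal (- ((ln (real (card (con_set n c))) - rate_base K n) / real n))"
proof -
  obtain M X where "(M, X) \<in> con_set n c" using ne by auto
  hence "regular_graphs K n \<noteq> {}" using graph_of_regular by (auto simp: con_set_def)
  note r = cond_prob_ratio[OF refl this]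
  have "{(M, X). M \<in> simple_configs K n \<and> X \<in> mark_space n \<and> component_empirical n (graph_of K n M, X) \<notin> \<O> \<and>
      c \<le> edge_average h n (graph_of K n M, X)} = bad_set \<O> n c"
    by (auto simp: bad_set_def con_set_def)
  hence eq: "cond_bad \<O> n c = real (card (bad_set \<O> n c)) / real (card (con_set n c))"
    unfolding r by (simp add: con_set_def)
  have cp: "0 < real (card (con_set n c))" using ne finite_con_set by auto
  show ?thesis
  proof (cases "bad_set \<O> n c = {}")
    case True
    thus ?thesis using n unfolding eq by (simp add: log_prob_def bad_rate_def)
  next
    case False
    hence bp: "0 < real (card (bad_set \<O> n c))" using finite_bad_set by auto
    have "ln (real (card (bad_set \<O> n c)) / real (card (con_set n c))) = ln (real (card (bad_set \<O> n c))) - ln (real (card (con_set n c)))"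
      by (rule ln_divide_pos[OF bp cp])
    thus ?thesis
      using bp cp False unfolding eq by (simp add: log_prob_def bad_rate_def diff_divide_distrib)
  qed
qed

text \<open>For fixed \<open>\<delta>\<close> the limsup is that of the bad counts minus
  \<open>top_rate (c + \<delta>)\<close>. What is bad under the stronger constraint is bad for
  \<open>c\<close> itself, so the gain \<open>\<eta>\<close> of \<open>bad_upper\<close> at
  \<open>c\<close> is uniform in \<open>\<delta>\<close>, and right continuity of
  \<open>top_rate\<close> preserves it in the limit.\<close>

lemma conditional_decay:
  assumes c: "c_mean < c" "c < c_max" and \<O>: "openin weak_topology \<O>" "G_nondeg K (pmf_of_set UNIV) h c \<subseteq> \<O>"
  shows "\<exists>L::ereal. L < 0 \<and>
    ((\<lambda>\<delta>. Limsup parity (\<lambda>n. ereal (1 / real n) * log_prob (cond_bad \<O> n (c + \<delta>)))) \<longlongrightarrow> L) (at_right (0::real))"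
proof -
  define d where "d = c_max - c"
  have d: "0 < d" using c by (simp add: d_def)
  define N where "N \<delta> = Limsup parity (\<lambda>n. bad_rate \<O> n (c + \<delta>))" for \<delta>
  define M where "M = (SUP \<delta>\<in>{0<..<d}. N \<delta>)"
  have split: "Limsup parity (\<lambda>n. ereal (1 / real n) * log_prob (cond_bad \<O> n (c + \<delta>))) = N \<delta> + ereal (- top_rate (c + \<delta>))"
    if "\<delta> \<in> {0<..<d}" for \<delta>
  proof -
    have c': "c_mean < c + \<delta>" "c + \<delta> < c_max" using c that by (auto simp: d_def)
    have "eventually (\<lambda>n. ereal (1 / real n) * log_prob (cond_bad \<O> n (c + \<delta>)) =
       bad_rate \<O> n (c + \<delta>) + ereal (- ((ln (real (card (con_set n (c + \<delta>)))) - rate_base K n) / real n))) parity"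
      using eventually_con_lower[OF c' zero_less_one] eventually_parity[OF eventually_ge_at_top[of 1]]
    proof eventually_elim
      case (elim n)
      have "0 < real (card (con_set n (c + \<delta>)))" using elim(1) exp_gt_zero by (rule less_le_trans[rotated])
      hence "con_set n (c + \<delta>) \<noteq> {}" by auto
      thus ?case by (rule log_cond_bad[OF elim(2)])
    qed
    hence "Limsup parity (\<lambda>n. ereal (1 / real n) * log_prob (cond_bad \<O> n (c + \<delta>))) =
      Limsup parity (\<lambda>n. bad_rate \<O> n (c + \<delta>) + ereal (- ((ln (real (card (con_set n (c + \<delta>)))) - rate_base K n) / real n)))"
      by (rule Limsup_eq)
    also have "\<dots> = N \<delta> + ereal (- top_rate (c + \<delta>))"
      unfolding N_def by (rule Limsup_add_tendsto[OF parity_neq_bot]) (intro tendsto_minus con_rate_tendsto c')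
    finally show ?thesis .
  qed
  have Nt: "(N \<longlongrightarrow> M) (at_right 0)"
    unfolding M_def
  proof (rule antimono_tendsto_SUP[OF d])
    fix x y :: real assume "x \<le> y"
    thus "N y \<le> N x" unfolding N_def by (intro Limsup_mono always_eventually allI bad_rate_antimono) simp
  qed
  have Tt: "((\<lambda>\<delta>. top_rate (c + \<delta>)) \<longlongrightarrow> top_rate c) (at_right 0)"
  proof (rule increasing_tendsto)
    show "eventually (\<lambda>\<delta>. top_rate (c + \<delta>) \<le> top_rate c) (at_right 0)"
      using eventually_at_right_real[OF d] by eventually_elim (use c in \<open>auto simp: d_def intro!: top_rate_antimono\<close>)
    fix x assume "x < top_rate c"
    then obtain d' where d': "0 < d'" "\<And>\<delta>. 0 < \<delta> \<Longrightarrow> \<delta> < d' \<Longrightarrow> top_rate c - (top_rate c - x) < top_rate (c + \<delta>)"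
      using top_rate_right_continuous[OF c, of "top_rate c - x"] by auto
    show "eventually (\<lambda>\<delta>. x < top_rate (c + \<delta>)) (at_right 0)"
      using eventually_at_right_real[OF d'(1)] by eventually_elim (use d'(2) in simp)
  qed
  have "((\<lambda>\<delta>. N \<delta> + ereal (- top_rate (c + \<delta>))) \<longlongrightarrow> M + ereal (- top_rate c)) (at_right 0)"
    by (rule tendsto_add_ereal_general1[OF _ Nt]) (auto intro!: tendsto_intros Tt)
  moreover have "eventually (\<lambda>\<delta>. N \<delta> + ereal (- top_rate (c + \<delta>)) =
      Limsup parity (\<lambda>n. ereal (1 / real n) * log_prob (cond_bad \<O> n (c + \<delta>)))) (at_right 0)"
    using eventually_at_right_real[OF d] by eventually_elim (simp add: split)
  ultimately have lim: "((\<lambda>\<delta>. Limsup parity (\<lambda>n. ereal (1 / real n) * log_prob (cond_bad \<O> n (c + \<delta>)))) \<longlongrightarrow> M + ereal (- top_rate c)) (at_right 0)"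
    by (rule Lim_transform_eventually)
  obtain \<eta> where \<eta>: "0 < \<eta>" and up: "eventually (\<lambda>n. real (card (bad_set \<O> n c)) \<le> exp (rate_base K n + real n * (top_rate c - \<eta>))) sequentially"
    using bad_upper[OF c \<O>] unfolding bad_set_def by blast
  have "N \<delta> \<le> ereal (top_rate c - \<eta>)" if "\<delta> \<in> {0<..<d}" for \<delta>
    unfolding N_def
  proof (rule Limsup_bounded)
    show "eventually (\<lambda>n. bad_rate \<O> n (c + \<delta>) \<le> ereal (top_rate c - \<eta>)) parity"
      using eventually_parity[OF up] eventually_parity[OF eventually_ge_at_top[of 1]]
    proof eventually_elim
      case (elim n)
      have "bad_rate \<O> n (c + \<delta>) \<le> bad_rate \<O> n c" using that by (intro bad_rate_antimono) simp
      also have "\<dots> \<le> ereal (top_rate c - \<eta>)" by (rule bad_rate_le[OF elim(2,1)])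
      finally show ?case .
    qed
  qed
  hence "M \<le> ereal (top_rate c - \<eta>)" unfolding M_def by (rule SUP_least)
  hence "M + ereal (- top_rate c) \<le> ereal (top_rate c - \<eta>) + ereal (- top_rate c)" by (rule add_right_mono)
  also have "\<dots> < 0" using \<eta> by simp
  finally show ?thesis using lim by blast
qed

end

lemma conditional_decay_uniform:
  fixes K :: nat and h :: "'x::finite \<Rightarrow> 'x \<Rightarrow> real"
  assumes K: "K \<ge> 2" and X: "CARD('x) = 2" and h_sym: "\<And>x y. h x y = h y x"
    and c: "c_ref K (pmf_of_set UNIV) h < c" "c < real K * Max (range (\<lambda>(x, y). h x y))"
    and \<O>: "openin weak_topology \<O>" "G_nondeg K (pmf_of_set UNIV) h c \<subseteq> \<O>"
  shows "\<exists>L::ereal. L < 0 \<and>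
    ((\<lambda>\<delta>. Limsup (inf sequentially (principal {n. even (n * K)}))
        (\<lambda>n. ereal (1 / real n) * log_prob (\<P>(\<omega> in measure_pmf (graph_marks_law K (pmf_of_set UNIV) n).
             component_empirical n \<omega> \<notin> \<O> \<bar> c + \<delta> \<le> edge_average h n \<omega>)))) \<longlongrightarrow> L) (at_right (0::real))"
proof -
  obtain a b :: 'x where ab: "a \<noteq> b" "UNIV = {a, b}" using X by (auto simp: card_2_iff)
  interpret two_marks K a b h by unfold_locales (use K ab h_sym in auto)
  have "c_ref K (pmf_of_set UNIV) h = c_mean"
    unfolding c_ref_def c_mean_def sum_marks using h_sym[of b a] X by simp
  moreover have "Max (range (\<lambda>(x, y). h x y)) = max (h a a) (max (h b b) (h a b))"
  proof -
    have "range (\<lambda>(x, y). h x y) = (\<lambda>(x, y). h x y) ` ({a, b} \<times> {a, b})" using ab(2) by simp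
    also have "\<dots> = {h a a, h b b, h a b}" using h_sym[of b a] by auto
    finally show ?thesis by simp
  qed
  ultimately have "c_mean < c" "c < c_max" using c by (simp_all add: c_max_def)
  thus ?thesis using conditional_decay[OF _ _ \<O>] unfolding parity_def by blast
qed

text \<open>The inverse temperature ranges over all reals, so a change of sign of \<open>h\<close>
  is absorbed by that of \<open>\<beta>\<close>.\<close>

lemma G_nondeg_uminus: "G_nondeg K \<nu> (\<lambda>x y. - h x y) (- c) = G_nondeg K \<nu> h c"
proof -
  have "(\<Union>\<beta>::real. tree_law K ` TISGM K (\<lambda>x y. exp (\<beta> * - h x y)) (pmf \<nu>)) =
    (\<Union>\<beta>\<in>range uminus. tree_law K ` TISGM K (\<lambda>x y. exp (\<beta> * h x y)) (pmf \<nu>))"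
    unfolding image_image UN_simps by simp
  also have "range (uminus :: real \<Rightarrow> real) = UNIV" by simp
  finally have U: "(\<Union>\<beta>::real. tree_law K ` TISGM K (\<lambda>x y. exp (\<beta> * - h x y)) (pmf \<nu>)) =
    (\<Union>\<beta>::real. tree_law K ` TISGM K (\<lambda>x y. exp (\<beta> * h x y)) (pmf \<nu>))" .
  have "(\<integral>(x, y). - h x y \<partial>\<mu>) = - (\<integral>(x, y). h x y \<partial>\<mu>)" for \<mu>
    unfolding case_prod_beta by simp
  thus ?thesis unfolding G_nondeg_def U by simp
qed

theorem theorem2p27:
  fixes \<kappa> :: nat and \<nu> :: "'x::finite pmf" and h :: "'x \<Rightarrow> 'x \<Rightarrow> real" and c :: real
  assumes "\<kappa> \<ge> 2"
    and "CARD('x) = 2"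
    and "\<nu> = pmf_of_set UNIV"
    and "\<And>x y. h x y = h y x"
    and "real \<kappa> * Min (range (\<lambda>(x, y). h x y)) < c"
    and "c < real \<kappa> * Max (range (\<lambda>(x, y). h x y))"
    and "c \<noteq> c_ref \<kappa> \<nu> h"
  shows "\<forall>\<O>. openin weak_topology \<O> \<and> G_nondeg \<kappa> \<nu> h c \<subseteq> \<O> \<longrightarrow>
    (\<exists>L::ereal. L < 0 \<and>
      ((\<lambda>\<delta>. Limsup (inf sequentially (principal {n. even (n * \<kappa>)}))
          (\<lambda>n. ereal (1 / real n) *
             log_prob (\<P>(\<omega> in measure_pmf (graph_marks_law \<kappa> \<nu> n).
               component_empirical n \<omega> \<notin> \<O> \<bar> \<omega> \<in> Con \<kappa> \<nu> h n (c_shift \<kappa> \<nu> h c \<delta>)))))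
        \<longlongrightarrow> L) (at_right (0::real)))"
proof (intro allI impI, elim conjE)
  fix \<O> :: "'x gstar measure set"
  assume \<O>: "openin weak_topology \<O>" "G_nondeg \<kappa> \<nu> h c \<subseteq> \<O>"
  define P where "P Q = Limsup (inf sequentially (principal {n. even (n * \<kappa>)}))
     (\<lambda>n. ereal (1 / real n) * log_prob (\<P>(\<omega> in measure_pmf (graph_marks_law \<kappa> \<nu> n). component_empirical n \<omega> \<notin> \<O> \<bar> Q n \<omega>)))" for Q
  have "\<exists>L::ereal. L < 0 \<and> ((\<lambda>\<delta>. P (\<lambda>n \<omega>. \<omega> \<in> Con \<kappa> \<nu> h n (c_shift \<kappa> \<nu> h c \<delta>))) \<longlongrightarrow> L) (at_right (0::real))"
  proof (cases "c_ref \<kappa> \<nu> h < c")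
    case True
    have "\<exists>L::ereal. L < 0 \<and> ((\<lambda>\<delta>. P (\<lambda>n \<omega>. c + \<delta> \<le> edge_average h n \<omega>)) \<longlongrightarrow> L) (at_right (0::real))"
      using conditional_decay_uniform[OF assms(1,2,4) True[unfolded assms(3)] assms(6) \<O>(1) \<O>(2)[unfolded assms(3)]]
      unfolding P_def assms(3) .
    then obtain L :: ereal where L: "L < 0" "((\<lambda>\<delta>. P (\<lambda>n \<omega>. c + \<delta> \<le> edge_average h n \<omega>)) \<longlongrightarrow> L) (at_right (0::real))"
      by blast
    have "eventually (\<lambda>\<delta>. P (\<lambda>n \<omega>. c + \<delta> \<le> edge_average h n \<omega>) = P (\<lambda>n \<omega>. \<omega> \<in> Con \<kappa> \<nu> h n (c_shift \<kappa> \<nu> h c \<delta>))) (at_right 0)"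
      using eventually_at_right_less[of "0::real"]
    proof eventually_elim
      case (elim \<delta>)
      \<comment> \<open>\<open>Con\<close> chooses its direction by comparing the shifted constant
        with \<open>c_ref\<close>. The shift leads away from \<open>c_ref\<close>, so the direction
        is that of \<open>c\<close>.\<close>
      have "c_ref \<kappa> \<nu> h < c + \<delta>" using True elim by simp
      thus ?case using True by (simp add: Con_def c_shift_def)
    qed
    from Lim_transform_eventually[OF L(2) this] show ?thesis using L(1) by blast
  next
    case False
    \<comment> \<open>Reflection exchanges minimum and maximum, turns the constraint from above into
      one from below, and turns the shift \<open>c - \<delta>\<close> into
      \<open>- c + \<delta>\<close>.\<close>
    define h' where "h' x y = - h x y" for x y
    have lt: "c < c_ref \<kappa> \<nu> h" using False assms(7) by simp
    have ref: "c_ref \<kappa> \<nu> h' = - c_ref \<kappa> \<nu> h" by (simp add: c_ref_def h'_def sum_negf)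
    have "Max (range (\<lambda>(x, y). h' x y)) = - Min (range (\<lambda>(x, y). h x y))"
    proof -
      have "range (\<lambda>(x, y). h' x y) = uminus ` range (\<lambda>(x, y). h x y)" by (auto simp: h'_def case_prod_beta)
      thus ?thesis by simp
    qed
    hence up: "- c < real \<kappa> * Max (range (\<lambda>(x, y). h' x y))" using assms(5) by (simp del: minus_Min_eq_Max)
    have G: "G_nondeg \<kappa> (pmf_of_set UNIV) h' (- c) \<subseteq> \<O>"
      using \<O>(2) G_nondeg_uminus[of \<kappa> \<nu> h c] unfolding h'_def assms(3) by simp
    have avg: "edge_average h' n \<omega> = - edge_average h n \<omega>" for n \<omega>
      by (simp add: edge_average_def h'_def sum_negf case_prod_beta)
    have sym: "h' x y = h' y x" for x y using assms(4) by (simp add: h'_def)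
    have low: "c_ref \<kappa> (pmf_of_set UNIV) h' < - c" using lt ref unfolding assms(3) by simp
    have "\<exists>L::ereal. L < 0 \<and> ((\<lambda>\<delta>. P (\<lambda>n \<omega>. - c + \<delta> \<le> edge_average h' n \<omega>)) \<longlongrightarrow> L) (at_right (0::real))"
      using conditional_decay_uniform[OF assms(1,2) sym low up \<O>(1) G] unfolding P_def assms(3) .
    then obtain L :: ereal where L: "L < 0" "((\<lambda>\<delta>. P (\<lambda>n \<omega>. - c + \<delta> \<le> edge_average h' n \<omega>)) \<longlongrightarrow> L) (at_right (0::real))"
      by blast
    have "eventually (\<lambda>\<delta>. P (\<lambda>n \<omega>. - c + \<delta> \<le> edge_average h' n \<omega>) = P (\<lambda>n \<omega>. \<omega> \<in> Con \<kappa> \<nu> h n (c_shift \<kappa> \<nu> h c \<delta>))) (at_right 0)"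
      using eventually_at_right_less[of "0::real"]
    proof eventually_elim
      case (elim \<delta>)
      have "\<not> c_ref \<kappa> \<nu> h < c - \<delta>" "\<not> c_ref \<kappa> \<nu> h < c" using lt elim by simp_all
      moreover have "- c + \<delta> \<le> - x \<longleftrightarrow> x \<le> c - \<delta>" for x by linarith
      ultimately show ?case by (simp add: Con_def c_shift_def avg)
    qed
    from Lim_transform_eventually[OF L(2) this] show ?thesis using L(1) by blast
  qed
  thus "\<exists>L::ereal. L < 0 \<and>
      ((\<lambda>\<delta>. Limsup (inf sequentially (principal {n. even (n * \<kappa>)}))
          (\<lambda>n. ereal (1 / real n) *
             log_prob (\<P>(\<omega> in measure_pmf (graph_marks_law \<kappa> \<nu> n).
               component_empirical n \<omega> \<notin> \<O> \<bar> \<omega> \<in> Con \<kappa> \<nu> h n (c_shift \<kappa> \<nu> h c \<delta>)))))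
        \<longlongrightarrow> L) (at_right (0::real))"
    unfolding P_def .
qed

end
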